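(* Let $(S,\psi)$ be an (embedded) symplectic leaf of a Poisson manifold $(M,\pi)$, with infinitesimal Poisson algebra $\mathcal P$. Then the natural map $\zeta:\mathrm H^1(\mathcal P)\to\mathrm H^1(S,\psi)$ is surjective. Moreover, there is an isomorphism of real vector spaces $$\mathrm H^1(\mathcal P)\simeq\mathrm H^1_{\mathrm{dR}}(S)\oplus\mathrm H^1_{\partial_{\mathcal D}}\oplus\frac{\mathfrak M_0(\mathcal P)}{\operatorname{Inn}\mathcal G},$$ where $\mathrm H^1_{\mathrm{dR}}(S)$ is the first de Rham cohomology of $S$.
   Context: Infinitesimal Poisson algebra. Everything is smooth; $C^\infty_S$ is the algebra of smooth functions on $S$. On a Poisson manifold $(M,\pi)$ put $\pi^\sharp\alpha=\pi(\alpha,\cdot)$, $\{f,g\}_\pi=\pi(df,dg)$, $[\alpha,\beta]_\pi=L_{\pi^\sharp\alpha}\beta-L_{\pi^\sharp\beta}\alpha-d(\pi(\alpha,\beta))$. Let $(S,\psi)\hookrightarrow(M,\pi)$ be an embedded Poisson submanifold (here a symplectic leaf), $E=T_SM/TS$ its normal bundle, $E^*\simeq TS^\circ\subset T^*_SM$ the conormal bundle. The cotangent Lie algebroid of $M$ restricts to a Lie algebroid $T^*_SM$ over $S$ with anchor $\pi^\sharp|_S$ and bracket $[\alpha|_S,\beta|_S]_S=[\alpha,\beta]_\pi|_S$; the restriction map $r:T^*_SM\to T^*S$ has kernel $E^*$. The induced bracket $[\cdot,\cdot]_1$ on $\Gamma E^*$ is $C^\infty_S$-bilinear, giving a $C^\infty_S$-Lie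 algebra $\mathcal G=(\Gamma E^*,[\cdot,\cdot]_1)$. Fix an exponential map (tubular neighborhood map) $\mathbf e:E\to M$ of $S$; it induces a splitting $T_SM=TS\oplus E$ and hence a vector bundle map $h:T^*S\to T^*_SM$ with $r\circ h=\mathrm{Id}$. Put $\mathcal D_\alpha\xi=[h(\alpha),\xi]_S$ and $\mathcal K(\alpha,\beta)=[h(\alpha),h(\beta)]_S-h[\alpha,\beta]_\psi\in\Gamma E^*$ for $\alpha,\beta\in\Gamma T^*S$, $\xi\in\Gamma E^*$. The commutative algebra of fiberwise affine functions on $E$ is $C^\infty_{\mathrm{aff}}(E)=C^\infty_S\oplus\Gamma E^*$ with product $(f\oplus\eta)(g\oplus\xi)=fg\oplus(f\xi+g\eta)$. The infinitesimal Poisson algebra of $S$ is $\mathcal P=(C^\infty_{\mathrm{aff}}(E),\{\cdot,\cdot\}^{\mathrm{aff}})$ with $$\{f\oplus\eta,g\oplus\xi\}^{\mathrm{aff}}=\psi(df,dg)\oplus\big(\mathcal D_{df}\xi-\mathcal D_{dg}\eta+[\eta,\xi]_1+\mathcal K(df,dg)\big).$$ It is a Poisson algebra; different choices of $\mathbf e$ give isomorphic Poisson algebras. Cohomologies. $\mathrm H^1(\mathcal P)=\mathrm{Poiss}(\mathcal P)/\mathrm{Ham}(\mathcal P)$: $\mathbb R$-linear derivations of the commutative algebra that are also derivations of the bracket, modulo the derivations $\{p,\cdot\}^{\mathrm{aff}}$. $\mathrm H^1(S,\psi)$ is the space of vector fields $v$ on $S$ with $L_v\psi=0$ modulo the Hamiltonian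 vector fields $\psi^\sharp dh$, $h\in C^\infty_S$. For $Q\in\Gamma(\wedge^kTS\otimes E^* )$ put $$(d_{\mathcal D}Q)(df_0,\dots,df_k)=\sum_i(-1)^i\mathcal D_{df_i}\big(Q(df_0,\dots,\widehat{df_i},\dots,df_k)\big)+\sum_{i<j}(-1)^{i+j}Q\big(d\psi(df_i,df_j),df_0,\dots,\widehat{df_i},\dots,\widehat{df_j},\dots,df_k\big).$$ Let $Z_{\mathcal G}$ be the center of $\mathcal G$ and $\mathfrak Z^k=\Gamma(\wedge^kTS\otimes Z_{\mathcal G})$ the $k$-vector fields on $S$ with values in $Z_{\mathcal G}$. $d_{\mathcal D}$ restricts to $\partial_{\mathcal D}$ on $\mathfrak Z^\bullet$ with $\partial_{\mathcal D}^2=0$; $\mathrm H^1_{\partial_{\mathcal D}}$ is the first cohomology of $(\mathfrak Z^\bullet,\partial_{\mathcal D})$. The map $\zeta$. Every Poisson derivation $X$ of $\mathcal P$ maps $\{0\}\oplus\Gamma E^*$ into itself, and hence induces a derivation of $C^\infty_S=C^\infty_{\mathrm{aff}}(E)/\Gamma E^*$, i.e. a vector field $u$ on $S$, which is a Poisson vector field; $\zeta$ is the well-defined linear map $[X]\mapsto[u]$. $\mathfrak M_0(\mathcal P)$ is the space of $C^\infty_S$-linear derivations $\delta$ of the Lie algebra $\mathcal G$ for which there is $\widetilde Q\in\Gamma(TS\otimes E^* )$ with, for all $f,g\in C^\infty_S$, $[\delta,\mathcal D_{df}]=[\widetilde Q(df),\cdot]_1$ and $(d_{\mathcal D}\widetilde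 Q)(df,dg)=\delta(\mathcal K(df,dg))$. $\operatorname{Inn}\mathcal G=\{[\xi,\cdot]_1\mid\xi\in\Gamma E^*\}\subseteq\mathfrak M_0(\mathcal P)$. *)

theory Defs
  imports "HOL-Analysis.Analysis" "HOL-Library.Function_Algebras"
begin

section \<open>Linear algebra\<close>

text \<open>Functions with values in a real vector space form a real vector space, pointwise. Functions,
  vector fields, sections and operators below are all functions, and they are made zero outside
  their domain, so that the spaces they form are linear subspaces of the ambient type.\<close>

instantiation "fun" :: (type, real_vector) real_vector
begin

definition scaleR_fun :: "real \<Rightarrow> ('a \<Rightarrow> 'b) \<Rightarrow> 'a \<Rightarrow> 'b" where
  "scaleR_fun c f = (\<lambda>x. c *\<^sub>R f x)"

instance
  by standard (simp_all add: scaleR_fun_def fun_eq_iff scaleR_add_right scaleR_add_left)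

end

record 'a rspace =
  rcarrier :: "'a set"
  radd :: "'a \<Rightarrow> 'a \<Rightarrow> 'a"
  rscale :: "real \<Rightarrow> 'a \<Rightarrow> 'a"

definition coset :: "'a::real_vector set \<Rightarrow> 'a \<Rightarrow> 'a set" where
  "coset W v = (\<lambda>w. v + w) ` W"

text \<open>In the scalar multiplication the summand \<open>w\<close> is needed only for the scalar \<open>0\<close>.\<close>

definition quotient_rspace :: "'a::real_vector set \<Rightarrow> 'a set \<Rightarrow> 'a set rspace" where
  "quotient_rspace V W =
    \<lparr> rcarrier = coset W ` V,
      radd = (\<lambda>A B. {a + b | a b. a \<in> A \<and> b \<in> B}),
      rscale = (\<lambda>c A. {c *\<^sub>R a + w | a w. a \<in> A \<and> w \<in> W}) \<rparr>"

definition direct_sum :: "'a rspace \<Rightarrow> 'b rspace \<Rightarrow> ('a \<times> 'b) rspace" where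
  "direct_sum A B =
    \<lparr> rcarrier = rcarrier A \<times> rcarrier B,
      radd = (\<lambda>x y. (radd A (fst x) (fst y), radd B (snd x) (snd y))),
      rscale = (\<lambda>c x. (rscale A c (fst x), rscale B c (snd x))) \<rparr>"

definition rspace_isomorphic :: "'a rspace \<Rightarrow> 'b rspace \<Rightarrow> bool" where
  "rspace_isomorphic A B \<longleftrightarrow>
    (\<exists>F. bij_betw F (rcarrier A) (rcarrier B) \<and>
         (\<forall>x\<in>rcarrier A. \<forall>y\<in>rcarrier A. F (radd A x y) = radd B (F x) (F y)) \<and>
         (\<forall>c. \<forall>x\<in>rcarrier A. F (rscale A c x) = rscale B c (F x)))"


section \<open>Smooth manifolds\<close>

primrec Ck_on :: "nat \<Rightarrow> 'e::real_normed_vector set \<Rightarrow> ('e \<Rightarrow> 'b::real_normed_vector) \<Rightarrow> bool" where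
  "Ck_on 0 U f \<longleftrightarrow> continuous_on U f"
| "Ck_on (Suc k) U f \<longleftrightarrow>
    (\<forall>x\<in>U. f differentiable (at x)) \<and> (\<forall>v. Ck_on k U (\<lambda>x. frechet_derivative f (at x) v))"

definition smooth_on :: "'e::real_normed_vector set \<Rightarrow> ('e \<Rightarrow> 'b::real_normed_vector) \<Rightarrow> bool" where
  "smooth_on U f \<longleftrightarrow> (\<forall>k. Ck_on k U f)"

text \<open>A chart is a pair of a domain and a coordinate map into the model space. The underlying set
  and the topology of a manifold are determined by its atlas. The model space is a finite-dimensional
  real inner product space; the class \<open>euclidean_space\<close> is not used because it excludes
  dimension \<open>0\<close> (a point at which the Poisson tensor vanishes is a leaf of dimension \<open>0\<close>, and an open
  leaf has a normal bundle of rank \<open>0\<close>).\<close>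

type_synonym ('a, 'e) atlas = "('a set \<times> ('a \<Rightarrow> 'e)) set"

definition carrier :: "('a, 'e) atlas \<Rightarrow> 'a set" where
  "carrier A = \<Union> (fst ` A)"

definition atlas_topology :: "('a, 'e::real_inner) atlas \<Rightarrow> 'a topology" where
  "atlas_topology A =
    topology (\<lambda>W. W \<subseteq> carrier A \<and> (\<forall>(U, \<phi>)\<in>A. open (\<phi> ` (U \<inter> W))))"

definition manifold :: "('a, 'e::real_inner) atlas \<Rightarrow> bool" where
  "manifold A \<longleftrightarrow>
    (\<exists>B::'e set. finite B \<and> span B = UNIV) \<and>
    (\<forall>(U, \<phi>)\<in>A. inj_on \<phi> U \<and> open (\<phi> ` U)) \<and>
    (\<forall>(U, \<phi>)\<in>A. \<forall>(V, \<theta>)\<in>A.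
       open (\<phi> ` (U \<inter> V)) \<and> smooth_on (\<phi> ` (U \<inter> V)) (\<theta> \<circ> inv_into U \<phi>)) \<and>
    Hausdorff_space (atlas_topology A) \<and> second_countable (atlas_topology A)"

definition smooth_fun_on :: "('a, 'e::real_inner) atlas \<Rightarrow> 'a set \<Rightarrow> ('a \<Rightarrow> real) \<Rightarrow> bool" where
  "smooth_fun_on A W f \<longleftrightarrow> (\<forall>(U, \<phi>)\<in>A. smooth_on (\<phi> ` (U \<inter> W)) (f \<circ> inv_into U \<phi>))"

definition smooth_map ::
    "('a, 'e::real_inner) atlas \<Rightarrow> ('b, 'f::real_inner) atlas \<Rightarrow> ('a \<Rightarrow> 'b) \<Rightarrow> bool" where
  "smooth_map A B F \<longleftrightarrow>
    F ` carrier A \<subseteq> carrier B \<and>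
    (\<forall>(U, \<phi>)\<in>A. \<forall>(V, \<theta>)\<in>B.
       open (\<phi> ` (U \<inter> F -` V)) \<and> smooth_on (\<phi> ` (U \<inter> F -` V)) (\<theta> \<circ> F \<circ> inv_into U \<phi>))"

definition open_submanifold :: "('a, 'e) atlas \<Rightarrow> 'a set \<Rightarrow> ('a, 'e) atlas" where
  "open_submanifold A W = (\<lambda>(U, \<phi>). (U \<inter> W, \<phi>)) ` A"

definition Cinf :: "('a, 'e::real_inner) atlas \<Rightarrow> ('a \<Rightarrow> real) set" where
  "Cinf A = {f. smooth_fun_on A (carrier A) f \<and> (\<forall>x. x \<notin> carrier A \<longrightarrow> f x = 0)}"

text \<open>Tangent vectors at \<open>p\<close> are derivations at \<open>p\<close> of the algebra of smooth functions.\<close>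

type_synonym 'a tvec = "('a \<Rightarrow> real) \<Rightarrow> real"
type_synonym 'a cvec = "'a tvec \<Rightarrow> real"

definition tangent :: "('a, 'e::real_inner) atlas \<Rightarrow> 'a \<Rightarrow> 'a tvec set" where
  "tangent A p = {v.
    (\<forall>f\<in>Cinf A. \<forall>g\<in>Cinf A. v (f + g) = v f + v g) \<and>
    (\<forall>c. \<forall>f\<in>Cinf A. v (c *\<^sub>R f) = c * v f) \<and>
    (\<forall>f\<in>Cinf A. \<forall>g\<in>Cinf A. v (f * g) = f p * v g + g p * v f) \<and>
    (\<forall>f. f \<notin> Cinf A \<longrightarrow> v f = 0)}"

definition cotangent :: "('a, 'e::real_inner) atlas \<Rightarrow> 'a \<Rightarrow> 'a cvec set" where
  "cotangent A p = {a.
    (\<forall>v\<in>tangent A p. \<forall>w\<in>tangent A p. a (v + w) = a v + a w) \<and>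
    (\<forall>c. \<forall>v\<in>tangent A p. a (c *\<^sub>R v) = c * a v) \<and>
    (\<forall>v. v \<notin> tangent A p \<longrightarrow> a v = 0)}"

definition vector_fields :: "('a, 'e::real_inner) atlas \<Rightarrow> ('a \<Rightarrow> 'a tvec) set" where
  "vector_fields A = {X.
    (\<forall>p\<in>carrier A. X p \<in> tangent A p) \<and> (\<forall>p. p \<notin> carrier A \<longrightarrow> X p = 0) \<and>
    (\<forall>f\<in>Cinf A. (\<lambda>p. X p f) \<in> Cinf A)}"

definition one_forms :: "('a, 'e::real_inner) atlas \<Rightarrow> ('a \<Rightarrow> 'a cvec) set" where
  "one_forms A = {\<alpha>.
    (\<forall>p\<in>carrier A. \<alpha> p \<in> cotangent A p) \<and> (\<forall>p. p \<notin> carrier A \<longrightarrow> \<alpha> p = 0) \<and>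
    (\<forall>X\<in>vector_fields A. (\<lambda>p. \<alpha> p (X p)) \<in> Cinf A)}"

definition dif :: "('a, 'e::real_inner) atlas \<Rightarrow> ('a \<Rightarrow> real) \<Rightarrow> 'a \<Rightarrow> 'a cvec" where
  "dif A f p v = (if p \<in> carrier A \<and> v \<in> tangent A p then v f else 0)"

definition lie_bracket :: "('a \<Rightarrow> 'a tvec) \<Rightarrow> ('a \<Rightarrow> 'a tvec) \<Rightarrow> 'a \<Rightarrow> 'a tvec" where
  "lie_bracket X Y p f = X p (\<lambda>q. Y q f) - Y p (\<lambda>q. X q f)"

text \<open>\<open>(L\<^sub>X \<beta>)(Y) = X(\<beta>(Y)) - \<beta>([X, Y])\<close>, evaluated at a tangent vector by means of any vector field
  \<open>Y\<close> that extends it.\<close>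

definition lie_form ::
    "('a, 'e::real_inner) atlas \<Rightarrow> ('a \<Rightarrow> 'a tvec) \<Rightarrow> ('a \<Rightarrow> 'a cvec) \<Rightarrow> 'a \<Rightarrow> 'a cvec" where
  "lie_form A X \<beta> p v =
    (if p \<in> carrier A \<and> v \<in> tangent A p
     then let Y = (SOME Y. Y \<in> vector_fields A \<and> Y p = v)
          in X p (\<lambda>q. \<beta> q (Y q)) - \<beta> p (lie_bracket X Y p)
     else 0)"

definition closed_forms :: "('a, 'e::real_inner) atlas \<Rightarrow> ('a \<Rightarrow> 'a cvec) set" where
  "closed_forms A = {\<alpha>\<in>one_forms A. \<forall>X\<in>vector_fields A. \<forall>Y\<in>vector_fields A. \<forall>p\<in>carrier A.
    X p (\<lambda>q. \<alpha> q (Y q)) - Y p (\<lambda>q. \<alpha> q (X q)) - \<alpha> p (lie_bracket X Y p) = 0}"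

definition H1_dR :: "('a, 'e::real_inner) atlas \<Rightarrow> ('a \<Rightarrow> 'a cvec) set rspace" where
  "H1_dR A = quotient_rspace (closed_forms A) (dif A ` Cinf A)"


section \<open>Poisson manifolds\<close>

type_synonym 'a bivector = "'a \<Rightarrow> 'a cvec \<Rightarrow> 'a cvec \<Rightarrow> real"

definition bivector_pair :: "('a, 'e::real_inner) atlas \<Rightarrow> 'a bivector \<Rightarrow>
    ('a \<Rightarrow> 'a cvec) \<Rightarrow> ('a \<Rightarrow> 'a cvec) \<Rightarrow> 'a \<Rightarrow> real" where
  "bivector_pair A \<pi> \<alpha> \<beta> p = (if p \<in> carrier A then \<pi> p (\<alpha> p) (\<beta> p) else 0)"

definition poisson_bracket :: "('a, 'e::real_inner) atlas \<Rightarrow> 'a bivector \<Rightarrow>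
    ('a \<Rightarrow> real) \<Rightarrow> ('a \<Rightarrow> real) \<Rightarrow> 'a \<Rightarrow> real" where
  "poisson_bracket A \<pi> f g = bivector_pair A \<pi> (dif A f) (dif A g)"

definition poisson :: "('a, 'e::real_inner) atlas \<Rightarrow> 'a bivector \<Rightarrow> bool" where
  "poisson A \<pi> \<longleftrightarrow>
    (\<forall>p\<in>carrier A. \<forall>a\<in>cotangent A p. \<forall>b\<in>cotangent A p. \<forall>c\<in>cotangent A p. \<forall>r.
       \<pi> p (a + b) c = \<pi> p a c + \<pi> p b c \<and> \<pi> p (r *\<^sub>R a) c = r * \<pi> p a c \<and>
       \<pi> p a b = - \<pi> p b a) \<and>
    (\<forall>\<alpha>\<in>one_forms A. \<forall>\<beta>\<in>one_forms A. bivector_pair A \<pi> \<alpha> \<beta> \<in> Cinf A) \<and>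
    (\<forall>f\<in>Cinf A. \<forall>g\<in>Cinf A. \<forall>h\<in>Cinf A.
       poisson_bracket A \<pi> f (poisson_bracket A \<pi> g h) +
       poisson_bracket A \<pi> g (poisson_bracket A \<pi> h f) +
       poisson_bracket A \<pi> h (poisson_bracket A \<pi> f g) = 0)"

definition sharp_at ::
    "('a, 'e::real_inner) atlas \<Rightarrow> 'a bivector \<Rightarrow> 'a \<Rightarrow> 'a cvec \<Rightarrow> 'a tvec" where
  "sharp_at A \<pi> p a f = (if p \<in> carrier A \<and> f \<in> Cinf A then \<pi> p a (dif A f p) else 0)"

definition sharp :: "('a, 'e::real_inner) atlas \<Rightarrow> 'a bivector \<Rightarrow>
    ('a \<Rightarrow> 'a cvec) \<Rightarrow> 'a \<Rightarrow> 'a tvec" where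
  "sharp A \<pi> \<alpha> p = sharp_at A \<pi> p (\<alpha> p)"

definition form_bracket :: "('a, 'e::real_inner) atlas \<Rightarrow> 'a bivector \<Rightarrow>
    ('a \<Rightarrow> 'a cvec) \<Rightarrow> ('a \<Rightarrow> 'a cvec) \<Rightarrow> 'a \<Rightarrow> 'a cvec" where
  "form_bracket A \<pi> \<alpha> \<beta> =
    lie_form A (sharp A \<pi> \<alpha>) \<beta> - lie_form A (sharp A \<pi> \<beta>) \<alpha> - dif A (bivector_pair A \<pi> \<alpha> \<beta>)"

text \<open>The condition is \<open>L\<^sub>v \<psi> = 0\<close>, evaluated on pairs of 1-forms.\<close>

definition poisson_fields ::
    "('a, 'e::real_inner) atlas \<Rightarrow> 'a bivector \<Rightarrow> ('a \<Rightarrow> 'a tvec) set" where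
  "poisson_fields A \<psi> = {v\<in>vector_fields A.
    \<forall>\<alpha>\<in>one_forms A. \<forall>\<beta>\<in>one_forms A. \<forall>p\<in>carrier A.
      v p (bivector_pair A \<psi> \<alpha> \<beta>)
      - bivector_pair A \<psi> (lie_form A v \<alpha>) \<beta> p - bivector_pair A \<psi> \<alpha> (lie_form A v \<beta>) p = 0}"

definition hamiltonian_fields ::
    "('a, 'e::real_inner) atlas \<Rightarrow> 'a bivector \<Rightarrow> ('a \<Rightarrow> 'a tvec) set" where
  "hamiltonian_fields A \<psi> = (\<lambda>h. sharp A \<psi> (dif A h)) ` Cinf A"

definition H1_poisson ::
    "('a, 'e::real_inner) atlas \<Rightarrow> 'a bivector \<Rightarrow> ('a \<Rightarrow> 'a tvec) set rspace" where
  "H1_poisson A \<psi> = quotient_rspace (poisson_fields A \<psi>) (hamiltonian_fields A \<psi>)"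


section \<open>Submanifolds and symplectic leaves\<close>

definition restr :: "('a, 'd) atlas \<Rightarrow> ('a \<Rightarrow> 'b::zero) \<Rightarrow> 'a \<Rightarrow> 'b" where
  "restr S f x = (if x \<in> carrier S then f x else 0)"

text \<open>The differential of the inclusion of \<open>S\<close> into \<open>M\<close>, and its transpose.\<close>

definition push :: "('a, 'e::real_inner) atlas \<Rightarrow> ('a, 'd::real_inner) atlas \<Rightarrow>
    'a tvec \<Rightarrow> 'a tvec" where
  "push M S v f = (if f \<in> Cinf M then v (restr S f) else 0)"

definition pull :: "('a, 'e::real_inner) atlas \<Rightarrow> ('a, 'd::real_inner) atlas \<Rightarrow>
    'a \<Rightarrow> 'a cvec \<Rightarrow> 'a cvec" where
  "pull M S s a v = (if v \<in> tangent S s then a (push M S v) else 0)"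

definition immersed_submanifold ::
    "('a, 'e::real_inner) atlas \<Rightarrow> ('a, 'd::real_inner) atlas \<Rightarrow> bool" where
  "immersed_submanifold M S \<longleftrightarrow>
    manifold S \<and> smooth_map S M (\<lambda>x. x) \<and> (\<forall>s\<in>carrier S. inj_on (push M S) (tangent S s))"

definition embedded_submanifold ::
    "('a, 'e::real_inner) atlas \<Rightarrow> ('a, 'd::real_inner) atlas \<Rightarrow> bool" where
  "embedded_submanifold M S \<longleftrightarrow>
    immersed_submanifold M S \<and>
    atlas_topology S = subtopology (atlas_topology M) (carrier S)"

definition embedded_poisson_submanifold :: "('a, 'e::real_inner) atlas \<Rightarrow> 'a bivector \<Rightarrow>
    ('a, 'd::real_inner) atlas \<Rightarrow> 'a bivector \<Rightarrow> bool" where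
  "embedded_poisson_submanifold M \<pi> S \<psi> \<longleftrightarrow>
    embedded_submanifold M S \<and> poisson S \<psi> \<and>
    (\<forall>s\<in>carrier S. \<forall>a\<in>cotangent M s. \<forall>b\<in>cotangent M s.
       \<psi> s (pull M S s a) (pull M S s b) = \<pi> s a b)"

text \<open>Symplectic leaves are the leaves of the characteristic distribution \<open>\<pi>\<^sup>\<sharp>(T\<^sup>*M)\<close>: its maximal
  connected integral submanifolds. An integral submanifold that meets \<open>S\<close> in a point has the
  dimension of \<open>S\<close> if it is connected, so maximality may be tested with the model space of \<open>S\<close>.\<close>

definition connected_integral_submanifold :: "('a, 'e::real_inner) atlas \<Rightarrow> 'a bivector \<Rightarrow>
    ('a, 'd::real_inner) atlas \<Rightarrow> bool" where
  "connected_integral_submanifold M \<pi> S \<longleftrightarrow>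
    immersed_submanifold M S \<and> carrier S \<noteq> {} \<and> connected_space (atlas_topology S) \<and>
    (\<forall>s\<in>carrier S. push M S ` tangent S s = sharp_at M \<pi> s ` cotangent M s)"

definition symplectic_leaf :: "('a, 'e::real_inner) atlas \<Rightarrow> 'a bivector \<Rightarrow>
    ('a, 'd::real_inner) atlas \<Rightarrow> bool" where
  "symplectic_leaf M \<pi> S \<longleftrightarrow>
    connected_integral_submanifold M \<pi> S \<and>
    (\<forall>N :: ('a, 'd) atlas. connected_integral_submanifold M \<pi> N \<and> carrier N \<inter> carrier S \<noteq> {}
       \<longrightarrow> carrier N \<subseteq> carrier S)"


section \<open>The normal and conormal bundles\<close>

text \<open>Sections of \<open>T\<^sup>*\<^sub>SM\<close>, the restriction of the cotangent bundle of \<open>M\<close> to \<open>S\<close>.\<close>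

definition cotangent_sections :: "('a, 'e::real_inner) atlas \<Rightarrow> ('a, 'd::real_inner) atlas \<Rightarrow>
    ('a \<Rightarrow> 'a cvec) set" where
  "cotangent_sections M S = {a.
    (\<forall>s\<in>carrier S. a s \<in> cotangent M s) \<and> (\<forall>s. s \<notin> carrier S \<longrightarrow> a s = 0) \<and>
    (\<forall>X\<in>vector_fields M. (\<lambda>s. a s (X s)) \<in> Cinf S)}"

definition conormal_space :: "('a, 'e::real_inner) atlas \<Rightarrow> ('a, 'd::real_inner) atlas \<Rightarrow>
    'a \<Rightarrow> 'a cvec set" where
  "conormal_space M S s = {a\<in>cotangent M s. \<forall>v\<in>tangent S s. a (push M S v) = 0}"

definition conormal_sections :: "('a, 'e::real_inner) atlas \<Rightarrow> ('a, 'd::real_inner) atlas \<Rightarrow>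
    ('a \<Rightarrow> 'a cvec) set" where
  "conormal_sections M S =
    {\<eta>\<in>cotangent_sections M S. \<forall>s\<in>carrier S. \<eta> s \<in> conormal_space M S s}"

definition normal_space :: "('a, 'e::real_inner) atlas \<Rightarrow> ('a, 'd::real_inner) atlas \<Rightarrow>
    'a \<Rightarrow> 'a tvec set rspace" where
  "normal_space M S s = quotient_rspace (tangent M s) (push M S ` tangent S s)"

definition normal_pairing :: "'a cvec \<Rightarrow> 'a tvec set \<Rightarrow> real" where
  "normal_pairing a w = a (SOME v. v \<in> w)"

text \<open>A smooth local trivialization \<open>W \<times> 'f \<rightarrow> E|\<^sub>W\<close> of the normal bundle with typical fibre \<open>'f\<close>.
  Smoothness of sections of \<open>E\<close> is tested by pairing with the sections of the dual bundle.\<close>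

definition normal_trivialization :: "('a, 'e::real_inner) atlas \<Rightarrow> ('a, 'd::real_inner) atlas \<Rightarrow>
    'a set \<Rightarrow> ('a \<Rightarrow> 'f::real_inner \<Rightarrow> 'a tvec set) \<Rightarrow> bool" where
  "normal_trivialization M S W T \<longleftrightarrow>
    openin (atlas_topology S) W \<and>
    (\<forall>s\<in>W. bij_betw (T s) UNIV (rcarrier (normal_space M S s)) \<and>
       (\<forall>x y. T s (x + y) = radd (normal_space M S s) (T s x) (T s y)) \<and>
       (\<forall>c x. T s (c *\<^sub>R x) = rscale (normal_space M S s) c (T s x))) \<and>
    (\<forall>x. \<forall>\<eta>\<in>conormal_sections M S. smooth_fun_on S W (\<lambda>s. normal_pairing (\<eta> s) (T s x)))"

text \<open>The total space of the normal bundle, as a set and as a manifold modelled on the product with the fibre.\<close>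

definition normal_total :: "('a, 'e::real_inner) atlas \<Rightarrow> ('a, 'd::real_inner) atlas \<Rightarrow>
    ('a \<times> 'a tvec set) set" where
  "normal_total M S = {(s, w). s \<in> carrier S \<and> w \<in> rcarrier (normal_space M S s)}"

definition normal_atlas :: "('a, 'e::real_inner) atlas \<Rightarrow> ('a, 'd::real_inner) atlas \<Rightarrow>
    ('a \<times> 'a tvec set, 'd \<times> 'f::real_inner) atlas" where
  "normal_atlas M S =
    {({(s, w). s \<in> W \<and> w \<in> rcarrier (normal_space M S s)}, \<lambda>(s, w). (\<phi> s, inv (T s) w)) | U \<phi> W T.
       (U, \<phi>) \<in> S \<and> W \<subseteq> U \<and> normal_trivialization M S W T}"

text \<open>The differential of \<open>e\<close> at the zero vector over \<open>s\<close>, along the fibre of \<open>E\<close>.\<close>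

definition vertical_differential ::
    "('a, 'e::real_inner) atlas \<Rightarrow> ('a, 'd::real_inner) atlas \<Rightarrow>
     ('a \<times> 'a tvec set \<Rightarrow> 'a) \<Rightarrow> 'a \<Rightarrow> 'a tvec set \<Rightarrow> 'a tvec" where
  "vertical_differential M S e s w f =
    (if f \<in> Cinf M then deriv (\<lambda>t. f (e (s, rscale (normal_space M S s) t w))) 0 else 0)"

text \<open>An exponential map is a diffeomorphism from the total space of \<open>E\<close> onto an open neighbourhood
  of \<open>S\<close> in \<open>M\<close> that is the identity on \<open>S\<close> and whose vertical differential along \<open>S\<close>, followed by the
  projection \<open>T\<^sub>SM \<rightarrow> E\<close>, is the identity of \<open>E\<close>. The zero vector of the fibre over \<open>s\<close> is the coset
  \<open>push M S ` tangent S s\<close>. The first two conditions say that \<open>'f\<close> is a typical fibre of \<open>E\<close>.\<close>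

definition exponential_map :: "'f::real_inner itself \<Rightarrow>
    ('a, 'e::real_inner) atlas \<Rightarrow> ('a, 'd::real_inner) atlas \<Rightarrow>
    ('a \<times> 'a tvec set \<Rightarrow> 'a) \<Rightarrow> bool" where
  "exponential_map (_ :: 'f itself) M S e \<longleftrightarrow>
    (let E = (normal_atlas M S :: ('a \<times> 'a tvec set, 'd \<times> 'f) atlas) in
      manifold E \<and> carrier E = normal_total M S \<and>
      smooth_map E M e \<and> inj_on e (carrier E) \<and> openin (atlas_topology M) (e ` carrier E) \<and>
      smooth_map (open_submanifold M (e ` carrier E)) E (inv_into (carrier E) e) \<and>
      (\<forall>s\<in>carrier S. e (s, push M S ` tangent S s) = s) \<and>
      (\<forall>(s, w)\<in>carrier E. vertical_differential M S e s w \<in> w))"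


section \<open>The infinitesimal Poisson algebra of a leaf\<close>

locale leaf_data =
  fixes M :: "('a, 'e::real_inner) atlas" and \<pi> :: "'a bivector"
    and S :: "('a, 'd::real_inner) atlas" and \<psi> :: "'a bivector"
    and e :: "'a \<times> 'a tvec set \<Rightarrow> 'a"
begin

text \<open>The bracket of sections of \<open>T\<^sup>*\<^sub>SM\<close> is computed at \<open>s\<close> from 1-forms on \<open>M\<close> that extend the
  sections near \<open>s\<close>; sections over a leaf that is not closed need not extend globally.\<close>

definition br :: "('a \<Rightarrow> 'a cvec) \<Rightarrow> ('a \<Rightarrow> 'a cvec) \<Rightarrow> 'a \<Rightarrow> 'a cvec" where
  "br a b s =
    (if s \<in> carrier S
     then SOME c. \<exists>\<alpha>\<in>one_forms M. \<exists>\<beta>\<in>one_forms M. \<exists>W. openin (atlas_topology S) W \<and> s \<in> W \<and>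
       (\<forall>x\<in>W. \<alpha> x = a x \<and> \<beta> x = b x) \<and> c = form_bracket M \<pi> \<alpha> \<beta> s
     else 0)"

abbreviation "C \<equiv> Cinf S"
abbreviation "\<Gamma>E \<equiv> conormal_sections M S"
abbreviation "d \<equiv> dif S"

text \<open>The splitting of \<open>r : T\<^sup>*\<^sub>SM \<rightarrow> T\<^sup>*S\<close> dual to \<open>T\<^sub>SM = TS \<oplus> E\<close>: \<open>h \<alpha>\<close> evaluates \<open>\<alpha>\<close> on the
  \<open>TS\<close>-component.\<close>

definition h :: "('a \<Rightarrow> 'a cvec) \<Rightarrow> 'a \<Rightarrow> 'a cvec" where
  "h \<alpha> s v =
    (if s \<in> carrier S \<and> v \<in> tangent M s
     then \<alpha> s (THE u. u \<in> tangent S s \<and>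
            (\<exists>w\<in>rcarrier (normal_space M S s). v = push M S u + vertical_differential M S e s w))
     else 0)"

definition \<D> :: "('a \<Rightarrow> 'a cvec) \<Rightarrow> ('a \<Rightarrow> 'a cvec) \<Rightarrow> 'a \<Rightarrow> 'a cvec" where
  "\<D> \<alpha> \<xi> = br (h \<alpha>) \<xi>"

definition \<K> :: "('a \<Rightarrow> 'a cvec) \<Rightarrow> ('a \<Rightarrow> 'a cvec) \<Rightarrow> 'a \<Rightarrow> 'a cvec" where
  "\<K> \<alpha> \<beta> = br (h \<alpha>) (h \<beta>) - h (form_bracket S \<psi> \<alpha> \<beta>)"

definition fmult :: "('a \<Rightarrow> real) \<Rightarrow> ('a \<Rightarrow> 'a cvec) \<Rightarrow> 'a \<Rightarrow> 'a cvec" where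
  "fmult f \<xi> s = f s *\<^sub>R \<xi> s"

definition aff :: "(('a \<Rightarrow> real) \<times> ('a \<Rightarrow> 'a cvec)) set" where
  "aff = C \<times> \<Gamma>E"

fun aff_mult :: "('a \<Rightarrow> real) \<times> ('a \<Rightarrow> 'a cvec) \<Rightarrow> ('a \<Rightarrow> real) \<times> ('a \<Rightarrow> 'a cvec) \<Rightarrow>
    ('a \<Rightarrow> real) \<times> ('a \<Rightarrow> 'a cvec)" where
  "aff_mult (f, \<eta>) (g, \<xi>) = (f * g, fmult f \<xi> + fmult g \<eta>)"

fun aff_bracket :: "('a \<Rightarrow> real) \<times> ('a \<Rightarrow> 'a cvec) \<Rightarrow> ('a \<Rightarrow> real) \<times> ('a \<Rightarrow> 'a cvec) \<Rightarrow>
    ('a \<Rightarrow> real) \<times> ('a \<Rightarrow> 'a cvec)" where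
  "aff_bracket (f, \<eta>) (g, \<xi>) =
    (poisson_bracket S \<psi> f g, \<D> (d f) \<xi> - \<D> (d g) \<eta> + br \<eta> \<xi> + \<K> (d f) (d g))"

definition Poiss ::
    "(('a \<Rightarrow> real) \<times> ('a \<Rightarrow> 'a cvec) \<Rightarrow> ('a \<Rightarrow> real) \<times> ('a \<Rightarrow> 'a cvec)) set" where
  "Poiss = {X.
    X ` aff \<subseteq> aff \<and> (\<forall>p. p \<notin> aff \<longrightarrow> X p = 0) \<and>
    (\<forall>p\<in>aff. \<forall>q\<in>aff. X (p + q) = X p + X q) \<and>
    (\<forall>c. \<forall>p\<in>aff. X (c *\<^sub>R p) = c *\<^sub>R X p) \<and>
    (\<forall>p\<in>aff. \<forall>q\<in>aff. X (aff_mult p q) = aff_mult (X p) q + aff_mult p (X q)) \<and>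
    (\<forall>p\<in>aff. \<forall>q\<in>aff. X (aff_bracket p q) = aff_bracket (X p) q + aff_bracket p (X q))}"

definition Ham ::
    "(('a \<Rightarrow> real) \<times> ('a \<Rightarrow> 'a cvec) \<Rightarrow> ('a \<Rightarrow> real) \<times> ('a \<Rightarrow> 'a cvec)) set" where
  "Ham = (\<lambda>p q. if q \<in> aff then aff_bracket p q else 0) ` aff"

definition "H1_P = quotient_rspace Poiss Ham"

definition induced_field ::
    "(('a \<Rightarrow> real) \<times> ('a \<Rightarrow> 'a cvec) \<Rightarrow> ('a \<Rightarrow> real) \<times> ('a \<Rightarrow> 'a cvec)) \<Rightarrow> 'a \<Rightarrow> 'a tvec" where
  "induced_field X s f = fst (X (f, 0)) s"

text \<open>The union over the representatives is a single coset exactly because the class of the induced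
  field does not depend on the representative.\<close>

definition \<zeta> ::
    "(('a \<Rightarrow> real) \<times> ('a \<Rightarrow> 'a cvec) \<Rightarrow> ('a \<Rightarrow> real) \<times> ('a \<Rightarrow> 'a cvec)) set \<Rightarrow>
     ('a \<Rightarrow> 'a tvec) set" where
  "\<zeta> c = (\<Union>X\<in>c. coset (hamiltonian_fields S \<psi>) (induced_field X))"


subsection \<open>Multivector fields with values in the conormal bundle\<close>

text \<open>\<open>\<Gamma>(\<Lambda>\<^sup>kTS \<otimes> E\<^sup>*)\<close>: at each point an alternating \<open>k\<close>-linear map from \<open>T\<^sup>*S\<close> to \<open>E\<^sup>*\<close>, the \<open>k\<close> arguments
  being given as a list.\<close>

definition apply_forms :: "('a \<Rightarrow> 'a cvec list \<Rightarrow> 'a cvec) \<Rightarrow> ('a \<Rightarrow> 'a cvec) list \<Rightarrow> 'a \<Rightarrow> 'a cvec" where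
  "apply_forms Q \<alpha>s s = Q s (map (\<lambda>\<alpha>. \<alpha> s) \<alpha>s)"

definition multivectors :: "nat \<Rightarrow> ('a \<Rightarrow> 'a cvec list \<Rightarrow> 'a cvec) set" where
  "multivectors k = {Q.
    (\<forall>s as. \<not> (s \<in> carrier S \<and> length as = k \<and> set as \<subseteq> cotangent S s) \<longrightarrow> Q s as = 0) \<and>
    (\<forall>s\<in>carrier S. \<forall>as. length as = k \<and> set as \<subseteq> cotangent S s \<longrightarrow>
       Q s as \<in> conormal_space M S s \<and>
       (\<forall>i<k. \<forall>a\<in>cotangent S s. \<forall>b\<in>cotangent S s. \<forall>c.
          Q s (as[i := a + b]) = Q s (as[i := a]) + Q s (as[i := b]) \<and>
          Q s (as[i := c *\<^sub>R a]) = c *\<^sub>R Q s (as[i := a])) \<and>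
       (\<forall>i<k. \<forall>j<k. i \<noteq> j \<and> as ! i = as ! j \<longrightarrow> Q s as = 0)) \<and>
    (\<forall>\<alpha>s. length \<alpha>s = k \<and> set \<alpha>s \<subseteq> one_forms S \<longrightarrow> apply_forms Q \<alpha>s \<in> \<Gamma>E)}"

definition omit :: "nat \<Rightarrow> 'b list \<Rightarrow> 'b list" where
  "omit i xs = take i xs @ drop (Suc i) xs"

text \<open>The value of \<open>d\<^sub>\<D> Q\<close> on the differentials of a list of functions \<open>f\<^sub>0, \<dots>, f\<^sub>k\<close>.\<close>

definition d\<D> :: "('a \<Rightarrow> 'a cvec list \<Rightarrow> 'a cvec) \<Rightarrow> ('a \<Rightarrow> real) list \<Rightarrow> 'a \<Rightarrow> 'a cvec" where
  "d\<D> Q fs =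
    (\<Sum>i<length fs. (-1) ^ i *\<^sub>R \<D> (d (fs ! i)) (apply_forms Q (map d (omit i fs)))) +
    (\<Sum>j<length fs. \<Sum>i<j. (-1) ^ (i + j) *\<^sub>R
       apply_forms Q (d (poisson_bracket S \<psi> (fs ! i) (fs ! j)) # map d (omit i (omit j fs))))"

definition center :: "('a \<Rightarrow> 'a cvec) set" where
  "center = {\<xi>\<in>\<Gamma>E. \<forall>\<eta>\<in>\<Gamma>E. br \<xi> \<eta> = 0}"

definition \<ZZ> :: "nat \<Rightarrow> ('a \<Rightarrow> 'a cvec list \<Rightarrow> 'a cvec) set" where
  "\<ZZ> k = {Q\<in>multivectors k.
    \<forall>\<alpha>s. length \<alpha>s = k \<and> set \<alpha>s \<subseteq> one_forms S \<longrightarrow> apply_forms Q \<alpha>s \<in> center}"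

text \<open>A multivector field is determined by its values on differentials, so \<open>d\<^sub>\<D> Q = R\<close> is tested there.\<close>

definition H1_del :: "('a \<Rightarrow> 'a cvec list \<Rightarrow> 'a cvec) set rspace" where
  "H1_del = quotient_rspace
    {Q\<in>\<ZZ> 1. \<forall>f\<in>C. \<forall>g\<in>C. d\<D> Q [f, g] = 0}
    {Q\<in>\<ZZ> 1. \<exists>R\<in>\<ZZ> 0. \<forall>f\<in>C. apply_forms Q [d f] = d\<D> R [f]}"

definition \<MM>0 :: "(('a \<Rightarrow> 'a cvec) \<Rightarrow> 'a \<Rightarrow> 'a cvec) set" where
  "\<MM>0 = {\<delta>.
    \<delta> ` \<Gamma>E \<subseteq> \<Gamma>E \<and> (\<forall>\<eta>. \<eta> \<notin> \<Gamma>E \<longrightarrow> \<delta> \<eta> = 0) \<and>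
    (\<forall>\<eta>\<in>\<Gamma>E. \<forall>\<xi>\<in>\<Gamma>E. \<delta> (\<eta> + \<xi>) = \<delta> \<eta> + \<delta> \<xi>) \<and>
    (\<forall>f\<in>C. \<forall>\<eta>\<in>\<Gamma>E. \<delta> (fmult f \<eta>) = fmult f (\<delta> \<eta>)) \<and>
    (\<forall>\<eta>\<in>\<Gamma>E. \<forall>\<xi>\<in>\<Gamma>E. \<delta> (br \<eta> \<xi>) = br (\<delta> \<eta>) \<xi> + br \<eta> (\<delta> \<xi>)) \<and>
    (\<exists>Q\<in>multivectors 1. \<forall>f\<in>C. \<forall>g\<in>C.
       (\<forall>\<xi>\<in>\<Gamma>E. \<delta> (\<D> (d f) \<xi>) - \<D> (d f) (\<delta> \<xi>) = br (apply_forms Q [d f]) \<xi>) \<and>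
       d\<D> Q [f, g] = \<delta> (\<K> (d f) (d g)))}"

definition Inn :: "(('a \<Rightarrow> 'a cvec) \<Rightarrow> 'a \<Rightarrow> 'a cvec) set" where
  "Inn = (\<lambda>\<xi> \<eta>. if \<eta> \<in> \<Gamma>E then br \<xi> \<eta> else 0) ` \<Gamma>E"

end

end

theory Submission
  imports Defs
begin

text \<open>The map \<open>lift (f \<oplus> \<eta>) = h(df) + \<eta>\<close> turns the bracket of \<open>\<P>\<close> into the bracket of the Lie
  algebroid \<open>T\<^sup>*\<^sub>SM\<close>, so every section \<open>a\<close> of \<open>T\<^sup>*\<^sub>SM\<close> that restricts to a closed 1-form on \<open>S\<close> acts on \<open>\<P>\<close>
  by a Poisson derivation \<open>ad a\<close>, which is Hamiltonian if the 1-form is exact. Since \<open>\<psi>\<close> is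
  nondegenerate, every Poisson vector field on \<open>S\<close> is \<open>\<psi>\<^sup>\<sharp>\<alpha>\<close> with \<open>\<alpha>\<close> closed; it is induced by
  \<open>ad (h \<alpha>)\<close>, and hence \<open>\<zeta>\<close> is surjective.

  Subtracting \<open>ad (h \<alpha>)\<close> from a Poisson derivation leaves one that induces the zero field. It has the
  form \<open>f \<oplus> \<eta> \<mapsto> 0 \<oplus> (Q f + \<delta> \<eta>)\<close>; the \<open>\<delta>\<close> that occur are the elements of \<open>\<MM>\<^sub>0\<close>, and those with
  \<open>\<delta> = 0\<close> are the cocycles \<open>Q\<close> of \<open>\<partial>\<^sub>\<D>\<close>. Choosing a linear section of \<open>(Q, \<delta>) \<mapsto> \<delta>\<close> that maps inner
  derivations to Hamiltonian ones gives the decomposition.\<close>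

section \<open>Calculus of smooth functions\<close>

text \<open>Three obstacles shape the proof. A leaf need not be closed, so functions and sections on
  \<open>S\<close> extend to \<open>M\<close> only near each point; identities between sections are
  therefore reduced, by additivity and locality, to sections \<open>a \<odot> dif M F\<close>, where
  they become identities between Poisson brackets. The tubular neighbourhood supplies local
  extensions constant along the fibres, and these also compute the splitting \<open>h\<close>.
  Closedness of the 1-form is what keeps \<open>ad a\<close> inside the algebra: the bracket of a
  closed form \<alpha> with df is the differential of \<psi>(\<alpha>, df), so the bracket of
  \<open>a\<close> with a lift is again a lift. Finally, the 1-form belonging to a smooth vector
  field must be shown smooth, on which pointwise inversion of \<psi> says nothing. A Nakayama
  argument for germs writes every vector field locally as a smooth combination of Hamiltonian
  fields, and on those the form is computed by the given field itself. The linear section at the end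
  comes from Hamel bases, so the isomorphism depends on choices.\<close>

lemma Ck_on_subset: "Ck_on k U f \<Longrightarrow> V \<subseteq> U \<Longrightarrow> Ck_on k V f"
  by (induction k arbitrary: f) (auto intro: continuous_on_subset)

lemma Ck_on_SucD:
  assumes "Ck_on (Suc k) U f"
  shows "x \<in> U \<Longrightarrow> (f has_derivative frechet_derivative f (at x)) (at x)"
    and "Ck_on k U (\<lambda>x. frechet_derivative f (at x) v)"
  using assms by (auto simp: frechet_derivative_works[symmetric])

lemma Ck_on_continuous: "Ck_on k U f \<Longrightarrow> continuous_on U f"
proof (cases k)
  case (Suc n)
  assume "Ck_on k U f"
  then show ?thesis
    unfolding Suc by (auto intro!: continuous_at_imp_continuous_on differentiable_imp_continuous_within)
qed auto

lemma Ck_on_less: "Ck_on (Suc k) U f \<Longrightarrow> Ck_on k U f"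
proof (induction k arbitrary: f)
  case 0
  then show ?case by (simp add: Ck_on_continuous[of "Suc 0", simplified])
next
  case (Suc k)
  show ?case
    unfolding Ck_on.simps(2)[of k] using Suc.prems Suc.IH unfolding Ck_on.simps(2)[of "Suc k"]
    by blast
qed

text \<open>The derivatives are taken at x in the whole space, so agreement on \<open>U\<close>
  determines them only because \<open>U\<close> is open.\<close>

lemma Ck_on_cong:
  assumes "open U" "\<And>x. x \<in> U \<Longrightarrow> f x = g x"
  shows "Ck_on k U f \<longleftrightarrow> Ck_on k U g"
proof -
  have "Ck_on k U f \<Longrightarrow> Ck_on k U g" if "\<And>x. x \<in> U \<Longrightarrow> f x = g x"
    for f g :: "'a \<Rightarrow> 'b"
    using that
  proof (induction k arbitrary: f g)
    case 0
    then show ?case by (metis Ck_on.simps(1) continuous_on_cong)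
  next
    case (Suc k)
    have d: "(g has_derivative frechet_derivative f (at x)) (at x)" if "x \<in> U" for x
      using has_derivative_transform_within_open[OF Ck_on_SucD(1)[OF Suc.prems(1) that] assms(1) that]
        Suc.prems(2) by auto
    have "frechet_derivative g (at x) = frechet_derivative f (at x)" if "x \<in> U" for x
      using frechet_derivative_at[OF d[OF that]] by simp
    then have "Ck_on k U (\<lambda>x. frechet_derivative g (at x) v)" for v
      by (intro Suc.IH[OF Ck_on_SucD(2)[OF Suc.prems(1), of v]]) simp
    then show ?case using d by (auto simp: differentiable_def)
  qed
  from this[of f g] this[of g f] assms(2) show ?thesis by auto
qed

text \<open>By uniqueness of derivatives any explicit formula may replace
  \<open>frechet_derivative\<close>; the closure properties below are obtained from such
  formulas.\<close>

lemma Ck_on_SucI: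
  assumes "open U" and d: "\<And>x. x \<in> U \<Longrightarrow> (f has_derivative f' x) (at x)"
    and "\<And>v. Ck_on k U (\<lambda>x. f' x v)"
  shows "Ck_on (Suc k) U f"
proof -
  have "Ck_on k U (\<lambda>x. frechet_derivative f (at x) v)" for v
    using Ck_on_cong[OF assms(1), of "\<lambda>x. f' x v" "\<lambda>x. frechet_derivative f (at x) v" k]
      frechet_derivative_at[OF d] assms(3) by metis
  then show ?thesis using d by (auto simp: differentiable_def)
qed

lemma Ck_on_local:
  assumes "\<And>x. x \<in> U \<Longrightarrow> \<exists>V. open V \<and> x \<in> V \<and> Ck_on k V f"
  shows "Ck_on k U f"
  using assms
proof (induction k arbitrary: f)
  case 0
  then show ?case
    by (metis Ck_on.simps(1) continuous_at_imp_continuous_on continuous_on_eq_continuous_at)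
next
  case (Suc k)
  show ?case unfolding Ck_on.simps
  proof (intro conjI ballI allI)
    show "f differentiable at x" if "x \<in> U" for x using Suc.prems[OF that] by auto
    show "Ck_on k U (\<lambda>x. frechet_derivative f (at x) v)" for v
      by (rule Suc.IH) (use Suc.prems in fastforce)
  qed
qed

lemma Ck_on_const [simp]: "Ck_on k U (\<lambda>x. c)"
  by (induction k arbitrary: c) auto

lemma Ck_on_bounded_linear:
  assumes "bounded_linear L" shows "Ck_on k U L"
proof (cases k)
  case 0
  then show ?thesis using linear_continuous_on[OF assms] by simp
next
  case (Suc n)
  have d: "(L has_derivative L) (at x)" for x
    by (rule bounded_linear_imp_has_derivative[OF assms])
  show ?thesis
    using frechet_derivative_at[OF d, symmetric] d unfolding Suc
    by (auto simp: differentiable_def)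
qed

lemma Ck_on_add:
  assumes "open U" "Ck_on k U f" "Ck_on k U g" shows "Ck_on k U (\<lambda>x. f x + g x)"
  using assms(2,3)
proof (induction k arbitrary: f g)
  case 0 then show ?case by (auto intro: continuous_intros)
next
  case (Suc k)
  show ?case
    by (rule Ck_on_SucI[OF assms(1) has_derivative_add])
      (use Ck_on_SucD[OF Suc.prems(1)] Ck_on_SucD[OF Suc.prems(2)] Suc.IH in auto)
qed

lemma Ck_on_sum:
  assumes "open U" "\<And>i. i \<in> I \<Longrightarrow> Ck_on k U (f i)"
  shows "Ck_on k U (\<lambda>x. \<Sum>i\<in>I. f i x)"
  using assms(2) by (induction I rule: infinite_finite_induct) (auto intro: Ck_on_add[OF assms(1)])

text \<open>Induction by the product rule. The bilinear form of the statement serves products,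
  scalar multiples and inner products alike.\<close>

lemma Ck_on_bilinear:
  assumes B: "bounded_bilinear B" and "open U" "Ck_on k U f" "Ck_on k U g"
  shows "Ck_on k U (\<lambda>x. B (f x) (g x))"
  using assms(3,4)
proof (induction k arbitrary: f g)
  case 0 then show ?case by (auto intro: bounded_bilinear.continuous_on[OF B])
next
  case (Suc k)
  show ?case
    by (rule Ck_on_SucI[OF assms(2) bounded_bilinear.FDERIV[OF B]])
      (use Ck_on_SucD[OF Suc.prems(1)] Ck_on_SucD[OF Suc.prems(2)] in
        \<open>auto intro!: Ck_on_add[OF assms(2)] Suc.IH Ck_on_less[OF Suc.prems(1)] Ck_on_less[OF Suc.prems(2)]\<close>)
qed

lemmas Ck_on_mult = Ck_on_bilinear[OF bounded_bilinear_mult]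

text \<open>Normalization is unnecessary: a zero vector in \<open>C\<close> contributes \<open>0 / 0 = 0\<close>.\<close>

lemma orthogonal_expansion:
  assumes "finite (B :: 'e::real_inner set)" "span B = UNIV"
  shows "\<exists>C :: 'e set. finite C \<and> (\<forall>x. x = (\<Sum>c\<in>C. (inner x c / inner c c) *\<^sub>R c))"
proof -
  obtain C :: "'e set" where C: "finite C" "span C = UNIV" "pairwise orthogonal C"
    using basis_orthogonal[OF assms(1)] unfolding assms(2) by blast
  have "x = (\<Sum>c\<in>C. (inner x c / inner c c) *\<^sub>R c)" for x
  proof -
    let ?z = "x - (\<Sum>c\<in>C. (inner x c / inner c c) *\<^sub>R c)"
    have "orthogonal ?z c" if "c \<in> C" for c
    proof -
      have "inner (\<Sum>b\<in>C. (inner x b / inner b b) *\<^sub>R b) c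
          = (\<Sum>b\<in>C. inner x b / inner b b * inner b c)"
        by (simp add: inner_sum_left)
      also have "\<dots> = (\<Sum>b\<in>C. if b = c then inner x c else 0)"
        using C(3) that by (intro sum.cong) (auto simp: pairwise_def orthogonal_def)
      finally show ?thesis using that C(1) by (simp add: orthogonal_def inner_diff_left)
    qed
    then have "orthogonal ?z ?z" using orthogonal_to_span[of ?z C ?z] C(2) by auto
    then show ?thesis by (simp add: orthogonal_def)
  qed
  then show ?thesis using C(1) by blast
qed

definition finite_dim :: "'e::real_inner itself \<Rightarrow> bool" where
  "finite_dim _ \<longleftrightarrow> (\<exists>B :: 'e set. finite B \<and> span B = UNIV)"

definition obasis :: "'e::real_inner set" where
  "obasis = (SOME C. finite C \<and> (\<forall>x. x = (\<Sum>c\<in>C. (inner x c / inner c c) *\<^sub>R c)))"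

definition coord :: "'e::real_inner \<Rightarrow> 'e \<Rightarrow> real" where
  "coord c x = inner x c / inner c c"

lemma obasis:
  assumes "finite_dim TYPE('e::real_inner)"
  shows "finite (obasis :: 'e set)" "(\<Sum>c\<in>obasis. coord c x *\<^sub>R c) = (x :: 'e)"
proof -
  have "\<exists>C :: 'e set. finite C \<and> (\<forall>x. x = (\<Sum>c\<in>C. (inner x c / inner c c) *\<^sub>R c))"
    using orthogonal_expansion assms unfolding finite_dim_def by metis
  from someI_ex[OF this, folded obasis_def coord_def]
  show "finite (obasis :: 'e set)" "(\<Sum>c\<in>obasis. coord c x *\<^sub>R c) = (x :: 'e)"
    by (blast, metis)
qed

lemma bounded_linear_coord: "bounded_linear (coord c)"
  unfolding coord_def divide_inverse
  by (rule bounded_linear_mult_const, rule bounded_linear_inner_left)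

text \<open>\<open>Ck_on\<close> differentiates in fixed directions, whereas the chain rule applies
  the derivative of \<open>g\<close> to a vector that varies with x. Expanding this vector in
  coordinates leaves only fixed directions \<open>c\<close>, to which the induction hypothesis
  applies; this is where finite dimension enters.\<close>

lemma Ck_on_compose:
  fixes f :: "'a::real_normed_vector \<Rightarrow> 'b::real_inner" and g :: "'b \<Rightarrow> 'c::real_normed_vector"
  assumes fd: "finite_dim TYPE('b)" and "open U" "open V"
    and "Ck_on k U f" "Ck_on k V g" and sub: "f ` U \<subseteq> V"
  shows "Ck_on k U (\<lambda>x. g (f x))"
  using assms(4,5)
proof (induction k arbitrary: g)
  case 0 then show ?case
    using sub continuous_on_compose2[of V g U f] by auto
next
  case (Suc k)
  let ?f' = "\<lambda>x. frechet_derivative f (at x)" and ?g' = "\<lambda>x. frechet_derivative g (at x)"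
  have d: "((\<lambda>x. g (f x)) has_derivative (\<lambda>v. ?g' (f x) (?f' x v))) (at x)" if "x \<in> U" for x
    using has_derivative_compose[OF Ck_on_SucD(1)[OF Suc.prems(1) that]]
      Ck_on_SucD(1)[OF Suc.prems(2), of "f x"] that sub by auto
  have e: "?g' (f x) (?f' x v) = (\<Sum>c\<in>obasis. coord c (?f' x v) *\<^sub>R ?g' (f x) c)" if "x \<in> U" for x v
  proof -
    have "f x \<in> V" using that sub by auto
    then interpret g: bounded_linear "?g' (f x)"
      using Ck_on_SucD(1)[OF Suc.prems(2)] has_derivative_bounded_linear by blast
    have "?g' (f x) (?f' x v) = ?g' (f x) (\<Sum>c\<in>obasis. coord c (?f' x v) *\<^sub>R c)"
      using obasis(2)[OF fd] by simp
    then show ?thesis by (simp add: g.sum g.scaleR)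
  qed
  show ?case
  proof (rule Ck_on_SucI[OF assms(2)])
    show "((\<lambda>x. g (f x)) has_derivative (\<lambda>v. (\<Sum>c\<in>obasis. coord c (?f' x v) *\<^sub>R ?g' (f x) c))) (at x)"
      if "x \<in> U" for x using d[OF that] e[OF that] by simp
    show "Ck_on k U (\<lambda>x. \<Sum>c\<in>obasis. coord c (?f' x v) *\<^sub>R ?g' (f x) c)" for v
    proof (intro Ck_on_sum[OF assms(2)] Ck_on_bilinear[OF bounded_bilinear_scaleR assms(2)])
      show "Ck_on k U (\<lambda>x. coord c (?f' x v))" for c
        unfolding coord_def divide_inverse
        by (intro Ck_on_mult[OF assms(2)] Ck_on_bilinear[OF bounded_bilinear_inner assms(2)])
          (auto intro: Ck_on_SucD(2)[OF Suc.prems(1)])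
      show "Ck_on k U (\<lambda>x. ?g' (f x) c)" for c
        by (rule Suc.IH[OF Ck_on_less[OF Suc.prems(1)] Ck_on_SucD(2)[OF Suc.prems(2)]])
    qed
  qed
qed

lemma Ck_on_inverse:
  fixes f :: "'a::real_normed_vector \<Rightarrow> real"
  assumes "open U" "Ck_on k U f" "\<And>x. x \<in> U \<Longrightarrow> f x \<noteq> 0"
  shows "Ck_on k U (\<lambda>x. inverse (f x))"
  using assms(2)
proof (induction k)
  case 0 then show ?case using assms(3) by (auto intro: continuous_intros)
next
  case (Suc k)
  show ?case
    by (rule Ck_on_SucI[OF assms(1) Deriv.has_derivative_inverse[OF assms(3) Ck_on_SucD(1)[OF Suc.prems]]])
      (auto intro!: Ck_on_mult[OF assms(1)] Suc.IH Ck_on_less[OF Suc.prems] Ck_on_SucD(2)[OF Suc.prems]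
        Ck_on_bilinear[OF bounded_bilinear_mult assms(1) Ck_on_const[of _ _ "-1 :: real"], simplified])
qed

section \<open>Smooth bump functions on the model space\<close>

definition flat_exp :: "nat \<Rightarrow> real \<Rightarrow> real" where
  "flat_exp n t = (if t > 0 then inverse t ^ n * exp (- inverse t) else 0)"

lemma flat_exp_tendsto: "(flat_exp n \<longlongrightarrow> 0) (at 0)"
proof -
  have "((\<lambda>t. inverse t ^ n * exp (- inverse t)) \<longlongrightarrow> 0) (at_right (0::real))"
    using filterlim_compose[OF tendsto_power_div_exp_0[of n] filterlim_inverse_at_top_right]
    by (simp add: exp_minus divide_inverse)
  then have r: "(flat_exp n \<longlongrightarrow> 0) (at_right 0)"
    by (rule Lim_transform_eventually) (auto simp: eventually_at_filter flat_exp_def)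
  have "((\<lambda>t. 0) \<longlongrightarrow> 0) (at_left (0::real))" by simp
  then have "(flat_exp n \<longlongrightarrow> 0) (at_left 0)"
    by (rule Lim_transform_eventually) (auto simp: eventually_at_filter flat_exp_def)
  with r show ?thesis by (simp add: filterlim_split_at)
qed

text \<open>The functions t^(-n) exp(-1/t), extended by 0, form a family closed under
  differentiation up to linear combinations; this is why \<open>n\<close> is carried along, and
  smoothness follows by induction.\<close>

lemma flat_exp_deriv:
  "(flat_exp n has_real_derivative (flat_exp (n + 2) t - n * flat_exp (n + 1) t)) (at t)"
proof -
  consider "t > 0" | "t < 0" | "t = 0" by linarith
  then show ?thesis
  proof cases
    case 1
    have "((\<lambda>t. inverse t ^ n * exp (- inverse t)) has_real_derivative
        (flat_exp (n + 2) t - n * flat_exp (n + 1) t)) (at t)"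
      using 1 by (auto intro!: derivative_eq_intros simp: flat_exp_def)
        (cases n; simp add: field_simps power2_eq_square)
    then show ?thesis
      by (rule has_field_derivative_transform_within_open[of _ _ _ "{0<..}"])
        (use 1 in \<open>auto simp: flat_exp_def\<close>)
  next
    case 2
    have "((\<lambda>t. 0) has_real_derivative 0) (at t)" by simp
    then have "(flat_exp n has_real_derivative 0) (at t)"
      by (rule has_field_derivative_transform_within_open[of _ _ _ "{..<0}"])
        (use 2 in \<open>auto simp: flat_exp_def\<close>)
    then show ?thesis using 2 by (simp add: flat_exp_def)
  next
    case 3
    \<comment> \<open>The difference quotient at 0 is the next member of the family, so its limit is
      0.\<close>
    have "((\<lambda>h. flat_exp n h / h) \<longlongrightarrow> 0) (at 0)"
      by (rule Lim_transform_eventually[OF flat_exp_tendsto[of "Suc n"]])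
        (auto simp: eventually_at_filter flat_exp_def field_simps)
    then show ?thesis using 3 by (simp add: DERIV_def flat_exp_def)
  qed
qed

lemma Ck_on_flat_exp: "Ck_on k UNIV (flat_exp n)"
proof (induction k arbitrary: n)
  case 0
  then show ?case
    using DERIV_isCont[OF flat_exp_deriv] by (auto intro: continuous_at_imp_continuous_on)
next
  case (Suc k)
  show ?case
  proof (rule Ck_on_SucI[OF open_UNIV])
    show "(flat_exp n has_derivative
        (\<lambda>v. v * flat_exp (n + 2) t + (- real n * v) * flat_exp (n + 1) t)) (at t)" for t
      by (rule has_derivative_eq_rhs[OF flat_exp_deriv[unfolded has_field_derivative_def]])
        (auto simp: fun_eq_iff left_diff_distrib)
    show "Ck_on k UNIV (\<lambda>t. v * flat_exp (n + 2) t + (- real n * v) * flat_exp (n + 1) t)" for v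
      by (intro Ck_on_add Ck_on_mult Suc.IH Ck_on_const open_UNIV)
  qed
qed

lemma finite_dim_real: "finite_dim TYPE(real)"
proof -
  have "span {1 :: real} = UNIV" unfolding span_singleton
    by (auto intro: rangeI[of "\<lambda>k. k *\<^sub>R (1::real)", simplified])
  then show ?thesis unfolding finite_dim_def by (intro exI[of _ "{1}"]) auto
qed

text \<open>A quotient a / (a + b) with a > 0 exactly for |y| < r and b > 0 exactly for |y|^2 > r^2
  / 2 (for positive r), so that the denominator never vanishes. The squared norm is used because it
  is smooth at 0.\<close>

definition bump :: "real \<Rightarrow> 'e::real_inner \<Rightarrow> real" where
  "bump r y = flat_exp 0 (r\<^sup>2 - inner y y) *
    inverse (flat_exp 0 (r\<^sup>2 - inner y y) + flat_exp 0 (inner y y - r\<^sup>2 / 2))"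

lemma flat_exp_pos: "t > 0 \<Longrightarrow> flat_exp n t > 0" and flat_exp_nonneg: "flat_exp n t \<ge> 0"
  and flat_exp_eq_0: "t \<le> 0 \<Longrightarrow> flat_exp n t = 0"
  by (auto simp: flat_exp_def)

lemma Ck_on_bump:
  assumes "r > 0" shows "Ck_on k UNIV (\<lambda>y. bump r (y - z))"
proof -
  have i: "Ck_on k UNIV (\<lambda>y. inner (y - z) (y - z))"
    using Ck_on_add[OF open_UNIV Ck_on_bounded_linear[OF bounded_linear_ident] Ck_on_const[of _ _ "- z"]]
    by (intro Ck_on_bilinear[OF bounded_bilinear_inner open_UNIV]) auto
  have j: "Ck_on k UNIV (\<lambda>y. a + b * inner (y - z) (y - z))" for a b
    by (intro Ck_on_add Ck_on_mult i open_UNIV Ck_on_const)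
  have f: "Ck_on k UNIV (\<lambda>y. flat_exp 0 (a + b * inner (y - z) (y - z)))" for a b
    by (rule Ck_on_compose[OF finite_dim_real open_UNIV open_UNIV j Ck_on_flat_exp]) simp
  have "flat_exp 0 (r\<^sup>2 - inner y y) + flat_exp 0 (inner y y - r\<^sup>2 / 2) > 0" for y :: 'a
  proof (cases "r\<^sup>2 - inner y y > 0")
    case True then show ?thesis using flat_exp_pos flat_exp_nonneg by (metis add_pos_nonneg)
  next
    case False
    then have "inner y y - r\<^sup>2 / 2 > 0" using assms zero_less_power[of r 2] by linarith
    then show ?thesis using flat_exp_pos flat_exp_nonneg by (metis add_nonneg_pos)
  qed
  then have nz: "flat_exp 0 (r\<^sup>2 - inner y y) + flat_exp 0 (inner y y - r\<^sup>2 / 2) \<noteq> 0" for y :: 'a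
    by (metis less_irrefl)
  show ?thesis unfolding bump_def
    by (intro Ck_on_mult Ck_on_inverse open_UNIV Ck_on_add nz)
      (use f[of "r\<^sup>2" "-1"] f[of "- (r\<^sup>2 / 2)" 1] in auto)
qed

lemma bump_eq_1: "r > 0 \<Longrightarrow> norm y < r / 2 \<Longrightarrow> bump r y = 1"
proof -
  assume r: "r > 0" and y: "norm y < r / 2"
  have "inner y y < (r/2)\<^sup>2"
    using y r by (metis norm_ge_zero power2_norm_eq_inner power_strict_mono zero_less_numeral)
  then have *: "inner y y < r\<^sup>2 / 4" by (simp add: power2_eq_square)
  have "r\<^sup>2 > 0" using r by simp
  with * have "inner y y - r\<^sup>2 / 2 \<le> 0" "r\<^sup>2 - inner y y > 0" by linarith+
  then show ?thesis using flat_exp_pos[of "r\<^sup>2 - inner y y" 0] by (simp add: bump_def flat_exp_eq_0)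
qed

lemma bump_eq_0: "r > 0 \<Longrightarrow> norm y \<ge> r \<Longrightarrow> bump r y = 0"
  using power_mono[of r "norm y" 2] by (simp add: bump_def power2_norm_eq_inner flat_exp_eq_0)

section \<open>Integrals along rays and Hadamard's lemma\<close>

lemma uniform_near_compact:
  fixes g :: "'i \<Rightarrow> 'e::metric_space \<Rightarrow> real"
  assumes "compact K" "open U" "K \<subseteq> U" "finite C" "\<And>c. c \<in> C \<Longrightarrow> continuous_on U (g c)" "\<epsilon> > 0"
  shows "\<exists>\<delta>>0. \<forall>x\<in>K. ball x \<delta> \<subseteq> U \<and> (\<forall>z\<in>ball x \<delta>. \<forall>c\<in>C. \<bar>g c z - g c x\<bar> < \<epsilon>)"
proof -
  \<comment> \<open>These open sets, on which every \<open>g c\<close> oscillates by less than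
    \<epsilon>, cover \<open>K\<close>; a Lebesgue number of the cover is the required \<delta>.
    Uniform continuity on \<open>K\<close> alone would not compare with points off
    \<open>K\<close>.\<close>
  define \<G> where "\<G> = {G. open G \<and> G \<subseteq> U \<and> (\<forall>x\<in>G. \<forall>y\<in>G. \<forall>c\<in>C. \<bar>g c y - g c x\<bar> < \<epsilon>)}"
  have cover: "\<exists>G\<in>\<G>. x \<in> G" if "x \<in> K" for x
  proof -
    have "\<forall>\<^sub>F y in nhds x. dist (g c y) (g c x) < \<epsilon> / 2" if "c \<in> C" for c
    proof -
      have "isCont (g c) x"
        using assms(5)[OF that] \<open>x \<in> K\<close> assms(2,3) by (auto simp: continuous_on_eq_continuous_at)
      then have "(g c \<longlongrightarrow> g c x) (nhds x)" by (simp add: continuous_at tendsto_nhds_iff)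
      then show ?thesis using assms(6) by (intro tendstoD) simp_all
    qed
    then have "\<forall>\<^sub>F y in nhds x. \<forall>c\<in>C. dist (g c y) (g c x) < \<epsilon> / 2"
      by (simp add: eventually_ball_finite_distrib assms(4))
    then obtain O' where O: "open O'" "x \<in> O'" "\<And>y c. y \<in> O' \<Longrightarrow> c \<in> C \<Longrightarrow> dist (g c y) (g c x) < \<epsilon> / 2"
      unfolding eventually_nhds by auto
    have "\<bar>g c z - g c y\<bar> < \<epsilon>" if "y \<in> O'" "z \<in> O'" "c \<in> C" for y z c
      using O(3)[OF that(1,3)] O(3)[OF that(2,3)] unfolding dist_real_def by linarith
    then have "O' \<inter> U \<in> \<G>" unfolding \<G>_def using open_Int[OF O(1) assms(2)] by simp
    moreover have "x \<in> O' \<inter> U" using O(2) \<open>x \<in> K\<close> assms(3) by (simp add: subset_iff)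
    ultimately show ?thesis by (rule bexI[rotated])
  qed
  have "K \<subseteq> \<Union>\<G>" using cover by auto
  moreover have "open G" if "G \<in> \<G>" for G using that by (simp add: \<G>_def)
  ultimately obtain \<delta> where "0 < \<delta>" and \<delta>: "\<And>x. x \<in> K \<Longrightarrow> \<exists>G\<in>\<G>. ball x \<delta> \<subseteq> G"
    using Heine_Borel_lemma[OF assms(1), of \<G>] by metis
  have "ball x \<delta> \<subseteq> U \<and> (\<forall>z\<in>ball x \<delta>. \<forall>c\<in>C. \<bar>g c z - g c x\<bar> < \<epsilon>)" if "x \<in> K" for x
  proof -
    obtain G where "G \<in> \<G>" "ball x \<delta> \<subseteq> G" using \<delta>[OF \<open>x \<in> K\<close>] by auto
    moreover have "x \<in> G" using \<open>0 < \<delta>\<close> \<open>ball x \<delta> \<subseteq> G\<close> by (simp add: subset_iff)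
    ultimately have "G \<subseteq> U" "\<forall>y\<in>G. \<forall>c\<in>C. \<bar>g c y - g c x\<bar> < \<epsilon>" by (simp_all add: \<G>_def)
    then show ?thesis using \<open>ball x \<delta> \<subseteq> G\<close> by (simp add: subset_iff)
  qed
  then show ?thesis using \<open>0 < \<delta>\<close> by blast
qed

lemma in_ball_segment:
  fixes z y :: "'e::real_normed_vector"
  assumes "y \<in> ball z r" "t \<in> {0..1}"
  shows "z + t *\<^sub>R (y - z) \<in> ball z r"
proof -
  have "t * norm (y - z) \<le> 1 * norm (y - z)" using assms(2) by (intro mult_right_mono) auto
  then show ?thesis using assms by (auto simp: dist_norm norm_minus_commute)
qed

text \<open>Differentiation under the integral sign. Each derivative in y produces a factor t, which
  the weight t^m absorbs: the derivative consists of integrals of the same form, with m + 1 and a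
  partial derivative of \<open>h\<close>.\<close>

lemma has_derivative_ray_integral:
  fixes h :: "'e::real_inner \<Rightarrow> real"
  assumes fd: "finite_dim TYPE('e)" and h: "smooth_on (ball z r) h" and y: "y \<in> ball z r"
  shows "((\<lambda>y. integral {0..1} (\<lambda>t. t ^ m * h (z + t *\<^sub>R (y - z)))) has_derivative
    (\<lambda>v. \<Sum>c\<in>obasis. coord c v *
       integral {0..1} (\<lambda>t. t ^ Suc m * frechet_derivative h (at (z + t *\<^sub>R (y - z))) c))) (at y)"
    (is "(?H has_derivative ?D) _")
proof -
  define h' where "h' c x = frechet_derivative h (at x) c" for c x
  define p where "p t = z + t *\<^sub>R (y - z)" for t
  have hd: "(h has_derivative (\<lambda>v. h' v x)) (at x)" if "x \<in> ball z r" for x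
    using Ck_on_SucD(1)[of 0 "ball z r" h x] h that unfolding smooth_on_def h'_def by blast
  have h'c: "continuous_on (ball z r) (h' c)" for c
    using Ck_on_SucD(2)[of 0 "ball z r" h c] h unfolding smooth_on_def h'_def[abs_def] by auto
  have hc: "continuous_on (ball z r) h" using h unfolding smooth_on_def by (metis Ck_on_continuous)
  have pb: "p t \<in> ball z r" if "t \<in> {0..1}" for t
    unfolding p_def by (rule in_ball_segment[OF y that])
  have pc: "continuous_on {0..1} p" unfolding p_def by (intro continuous_intros)
  have h'lin: "h' v x = (\<Sum>c\<in>obasis. coord c v * h' c x)" if "x \<in> ball z r" for x v
  proof -
    interpret bounded_linear "\<lambda>v. h' v x" using hd[OF that] by (rule has_derivative_bounded_linear)
    have "h' v x = h' (\<Sum>c\<in>obasis. coord c v *\<^sub>R c) x" using obasis(2)[OF fd, of v] by simp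
    then show ?thesis by (simp add: sum scaleR)
  qed
  have ray: "continuous_on {0..1} (\<lambda>t. t ^ n * f (z + t *\<^sub>R (x - z)))"
    if "x \<in> ball z r" "continuous_on (ball z r) f" for f :: "'e \<Rightarrow> real" and n x
    by (intro continuous_intros continuous_on_compose2[OF that(2)]) (use in_ball_segment[OF that(1)] in auto)
  \<comment> \<open>The summand 1 keeps \<open>B\<close> positive even in dimension 0. An error of
    \<epsilon> / B in each partial derivative then adds up to at most \<epsilon> in operator
    norm.\<close>
  define B where "B = (\<Sum>c\<in>(obasis::'e set). onorm (coord c)) + 1"
  have B: "B > 0"
    unfolding B_def by (intro add_nonneg_pos sum_nonneg onorm_pos_le bounded_linear_coord) auto
  have bl: "bounded_linear ?D"
    by (intro bounded_linear_sum bounded_linear_mult_const bounded_linear_coord)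
  have main: "\<exists>d>0. \<forall>w. norm w < d \<longrightarrow> norm (?H (y + w) - ?H y - ?D w) \<le> \<epsilon> * norm w"
    if "\<epsilon> > 0" for \<epsilon>
  proof -
    have "\<epsilon> / B > 0" using that B by simp
    from uniform_near_compact[where g = h', OF compact_continuous_image[OF pc compact_Icc] open_ball[of z r] _
        obasis(1)[OF fd] h'c this]
    obtain \<delta> where "\<delta> > 0" and \<delta>: "\<And>t. t \<in> {0..1} \<Longrightarrow> ball (p t) \<delta> \<subseteq> ball z r"
      "\<And>t x c. t \<in> {0..1} \<Longrightarrow> x \<in> ball (p t) \<delta> \<Longrightarrow> c \<in> obasis \<Longrightarrow> \<bar>h' c x - h' c (p t)\<bar> < \<epsilon> / B"
      using pb by (auto simp: image_subset_iff)
    \<comment> \<open>A bound, uniform in t, for the remainder of the linearization of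
      \<open>h\<close> along the segment; integrating it over t bounds the remainder of the
      integral.\<close>
    have pt: "norm (h (p t + t *\<^sub>R w) - h (p t) - h' (t *\<^sub>R w) (p t)) \<le> \<epsilon> * norm w"
      if t: "t \<in> {0..1}" and w: "norm w < \<delta>" for t w
    proof -
      have tw: "norm (t *\<^sub>R w) \<le> norm w" using t by (auto intro: mult_left_le_one_le)
      have on: "onorm ((\<lambda>v. h' v x) - (\<lambda>v. h' v (p t))) \<le> \<epsilon>" if x: "x \<in> ball (p t) \<delta>" for x
      proof (rule onorm_bound)
        fix v
        have "norm (((\<lambda>v. h' v x) - (\<lambda>v. h' v (p t))) v)
            = \<bar>\<Sum>c\<in>obasis. coord c v * (h' c x - h' c (p t))\<bar>"
          using h'lin[of x v] h'lin[of "p t" v] \<delta>(1)[OF t] x pb[OF t]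
          by (auto simp: sum_subtractf algebra_simps)
        also have "\<dots> \<le> (\<Sum>c\<in>(obasis::'e set). onorm (coord c) * norm v * (\<epsilon> / B))"
        proof (rule order_trans[OF sum_abs sum_mono])
          fix c :: 'e assume "c \<in> obasis"
          then have "\<bar>h' c x - h' c (p t)\<bar> \<le> \<epsilon> / B" using \<delta>(2)[OF t x] by (simp add: less_imp_le)
          then show "\<bar>coord c v * (h' c x - h' c (p t))\<bar> \<le> onorm (coord c) * norm v * (\<epsilon> / B)"
            using onorm[OF bounded_linear_coord, of c v] unfolding abs_mult
            by (intro mult_mono) (auto intro!: onorm_pos_le bounded_linear_coord mult_nonneg_nonneg)
        qed
        also have "\<dots> = (\<Sum>c\<in>(obasis::'e set). onorm (coord c)) * (norm v * (\<epsilon> / B))"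
          by (simp only: sum_distrib_right mult.assoc)
        also have "\<dots> \<le> B * (norm v * (\<epsilon> / B))"
          using \<open>\<epsilon> > 0\<close> B by (intro mult_right_mono) (auto simp: B_def)
        also have "\<dots> = \<epsilon> * norm v" using B by simp
        finally show "norm (((\<lambda>v. h' v x) - (\<lambda>v. h' v (p t))) v) \<le> \<epsilon> * norm v" .
      qed (use \<open>\<epsilon> > 0\<close> in simp)
      have "norm (h (p t + t *\<^sub>R w) - h (p t) - h' ((p t + t *\<^sub>R w) - p t) (p t))
          \<le> norm ((p t + t *\<^sub>R w) - p t) * \<epsilon>"
      proof (rule differentiable_bound_linearization[of _ _ "ball (p t) \<delta>" h "\<lambda>x v. h' v x", rotated])
        show "(h has_derivative (\<lambda>v. h' v x)) (at x within ball (p t) \<delta>)" if "x \<in> ball (p t) \<delta>" for x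
          by (rule has_derivative_at_withinI[OF hd]) (use \<delta>(1)[OF t] that in auto)
        show "onorm ((\<lambda>v. h' v x) - (\<lambda>v. h' v (p t))) \<le> \<epsilon>" if "x \<in> ball (p t) \<delta>" for x by (rule on[OF that])
        show "p t \<in> ball (p t) \<delta>" using \<open>\<delta> > 0\<close> by simp
        show "p t + s *\<^sub>R (p t + t *\<^sub>R w - p t) \<in> ball (p t) \<delta>" if "s \<in> {0..1}" for s
        proof -
          have "\<bar>s * t\<bar> * norm w \<le> 1 * norm w"
            using that t by (intro mult_right_mono) (auto simp: abs_mult mult_le_one)
          then show ?thesis using w by (simp add: dist_norm)
        qed
      qed
      also have "\<dots> \<le> norm w * \<epsilon>" using tw \<open>\<epsilon> > 0\<close> by (simp add: mult_right_mono)
      finally show ?thesis by (simp add: mult.commute)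
    qed
    obtain \<rho> where \<rho>: "\<rho> > 0" "ball y \<rho> \<subseteq> ball z r" using y open_contains_ball[of "ball z r"] by blast
    have "norm (?H (y + w) - ?H y - ?D w) \<le> \<epsilon> * norm w" if w: "norm w < min \<delta> \<rho>" for w
    proof -
      have yw: "y + w \<in> ball z r" using \<rho>(2) w by (auto simp: dist_norm subset_iff)
      let ?I = "\<lambda>t. t ^ m * h (z + t *\<^sub>R (y + w - z)) - t ^ m * h (z + t *\<^sub>R (y - z))
          - (\<Sum>c\<in>obasis. coord c w * (t ^ Suc m * h' c (z + t *\<^sub>R (y - z))))"
      note c = ray[OF yw hc, of m] ray[OF y hc, of m] ray[OF y h'c, of "Suc m"]
      have cs: "continuous_on {0..1} (\<lambda>t. \<Sum>c\<in>obasis. coord c w * (t ^ Suc m * h' c (z + t *\<^sub>R (y - z))))"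
        by (intro continuous_on_sum continuous_on_mult_left c)
      note i = integrable_integral[OF integrable_continuous_real]
      have "(?I has_integral ?H (y + w) - ?H y - ?D w) {0..1}"
        unfolding h'_def[symmetric]
        by (intro has_integral_diff has_integral_sum has_integral_mult_right i c obasis(1)[OF fd])
      then have e: "?H (y + w) - ?H y - ?D w = integral {0..1} ?I" by (rule integral_unique[symmetric])
      have "norm (integral {0..1} ?I) \<le> \<epsilon> * norm w * (1 - 0)"
      proof (rule integral_bound)
        show "continuous_on {0..1} ?I" by (intro continuous_on_diff c(1,2) cs)
        fix t :: real assume t: "t \<in> {0..1}"
        have "h' (t *\<^sub>R w) (p t) = t * h' w (p t)"
          using linear_scale[OF has_derivative_linear[OF hd[OF pb[OF t]]], of t w] by simp
        then have "?I t = t ^ m * (h (p t + t *\<^sub>R w) - h (p t) - h' (t *\<^sub>R w) (p t))"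
          unfolding p_def[symmetric] h'lin[OF pb[OF t], of w]
          by (simp add: p_def algebra_simps sum_distrib_left)
        then have "norm (?I t) = \<bar>t ^ m\<bar> * norm (h (p t + t *\<^sub>R w) - h (p t) - h' (t *\<^sub>R w) (p t))"
          by (simp add: abs_mult)
        also have "\<dots> \<le> 1 * (\<epsilon> * norm w)"
          using t w pt[OF t, of w] by (intro mult_mono) (auto simp: power_le_one)
        finally show "norm (?I t) \<le> \<epsilon> * norm w" by simp
      qed simp
      then show ?thesis using e by simp
    qed
    then show ?thesis using \<rho>(1) \<open>\<delta> > 0\<close> by (intro exI[of _ "min \<delta> \<rho>"]) auto
  qed
  show ?thesis
    unfolding has_derivative_at_alt
  proof (intro conjI bl allI impI)
    fix \<epsilon> :: real assume "\<epsilon> > 0"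
    from main[OF this] obtain d where d: "d > 0" "\<And>w. norm w < d \<Longrightarrow> norm (?H (y + w) - ?H y - ?D w) \<le> \<epsilon> * norm w"
      by blast
    show "\<exists>d>0. \<forall>x. norm (x - y) < d \<longrightarrow> norm (?H x - ?H y - ?D (x - y)) \<le> \<epsilon> * norm (x - y)"
      using d(1) d(2)[of "x - y" for x] by (intro exI[of _ d]) auto
  qed
qed

lemma smooth_on_frechet: "smooth_on U h \<Longrightarrow> smooth_on U (\<lambda>x. frechet_derivative h (at x) c)"
  unfolding smooth_on_def using Ck_on_SucD(2) by blast

text \<open>Induction on the order with \<open>h\<close> and \<open>m\<close> arbitrary, since
  differentiation changes both.\<close>

lemma smooth_on_ray_integral:
  fixes h :: "'e::real_inner \<Rightarrow> real"
  assumes fd: "finite_dim TYPE('e)" and h: "smooth_on (ball z r) h"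
  shows "smooth_on (ball z r) (\<lambda>y. integral {0..1} (\<lambda>t. t ^ m * h (z + t *\<^sub>R (y - z))))"
proof -
  have "Ck_on k (ball z r) (\<lambda>y. integral {0..1} (\<lambda>t. t ^ m * h (z + t *\<^sub>R (y - z))))" for k
    using h
  proof (induction k arbitrary: h m)
    case 0
    show ?case unfolding Ck_on.simps
      by (intro continuous_at_imp_continuous_on ballI has_derivative_continuous[OF has_derivative_ray_integral[OF fd 0]])
  next
    case (Suc k)
    show ?case
      by (rule Ck_on_SucI[OF open_ball has_derivative_ray_integral[OF fd Suc.prems]], assumption)
        (intro Ck_on_sum Ck_on_mult Ck_on_const open_ball Suc.IH smooth_on_frechet Suc.prems)
  qed
  then show ?thesis by (simp add: smooth_on_def)
qed

text \<open>The coefficient \<open>G c\<close> is the mean of the partial derivative of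
  \<open>h\<close> in direction c over the segment from z to y; the fundamental theorem of calculus
  along the segment gives the expansion.\<close>

lemma hadamard:
  fixes h :: "'e::real_inner \<Rightarrow> real"
  assumes fd: "finite_dim TYPE('e)" and h: "smooth_on (ball z r) h" and "r > 0"
  shows "\<exists>G. (\<forall>c. smooth_on (ball z r) (G c)) \<and> (\<forall>c. G c z = frechet_derivative h (at z) c) \<and>
    (\<forall>y\<in>ball z r. h y = h z + (\<Sum>c\<in>obasis. coord c (y - z) * G c y))"
proof -
  define G where "G c y = integral {0..1} (\<lambda>t. frechet_derivative h (at (z + t *\<^sub>R (y - z))) c)" for c y
  have "smooth_on (ball z r) (G c)" for c
    using smooth_on_ray_integral[OF fd smooth_on_frechet[OF h], of 0] unfolding G_def by simp
  moreover have "G c z = frechet_derivative h (at z) c" for c by (simp add: G_def)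
  moreover have "h y = h z + (\<Sum>c\<in>obasis. coord c (y - z) * G c y)" if y: "y \<in> ball z r" for y
  proof -
    let ?h' = "\<lambda>x. frechet_derivative h (at x)"
    have hd: "(h has_derivative ?h' x) (at x)" if "x \<in> ball z r" for x
      using Ck_on_SucD(1)[of 0 "ball z r" h x] h that unfolding smooth_on_def by blast
    have "((\<lambda>t. ?h' (z + t *\<^sub>R (y - z)) (y - z)) has_integral h (z + 1 *\<^sub>R (y - z)) - h (z + 0 *\<^sub>R (y - z))) {0..1}"
    proof (rule fundamental_theorem_of_calculus)
      fix t :: real assume t: "t \<in> {0..1}"
      have "((\<lambda>t. z + t *\<^sub>R (y - z)) has_derivative (\<lambda>s. s *\<^sub>R (y - z))) (at t)"
        by (auto intro!: derivative_eq_intros)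
      from has_derivative_compose[OF this hd[OF in_ball_segment[OF y t]]]
      have "((\<lambda>t. h (z + t *\<^sub>R (y - z))) has_derivative (\<lambda>s. s *\<^sub>R ?h' (z + t *\<^sub>R (y - z)) (y - z))) (at t)"
        using linear_scale[OF has_derivative_linear[OF hd[OF in_ball_segment[OF y t]]]] by simp
      then show "((\<lambda>t. h (z + t *\<^sub>R (y - z))) has_vector_derivative ?h' (z + t *\<^sub>R (y - z)) (y - z)) (at t within {0..1})"
        unfolding has_vector_derivative_def by (rule has_derivative_at_withinI)
    qed simp
    then have "h y - h z = integral {0..1} (\<lambda>t. ?h' (z + t *\<^sub>R (y - z)) (y - z))"
      by (simp add: integral_unique)
    also have "\<dots> = integral {0..1} (\<lambda>t. \<Sum>c\<in>obasis. coord c (y - z) * ?h' (z + t *\<^sub>R (y - z)) c)"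
    proof (rule integral_cong)
      fix t :: real assume t: "t \<in> {0..1}"
      note l = has_derivative_linear[OF hd[OF in_ball_segment[OF y t]]]
      have "?h' (z + t *\<^sub>R (y - z)) (y - z) = ?h' (z + t *\<^sub>R (y - z)) (\<Sum>c\<in>obasis. coord c (y - z) *\<^sub>R c)"
        by (simp only: obasis(2)[OF fd])
      then show "?h' (z + t *\<^sub>R (y - z)) (y - z) = (\<Sum>c\<in>obasis. coord c (y - z) * ?h' (z + t *\<^sub>R (y - z)) c)"
        by (simp add: linear_sum[OF l] linear_scale[OF l])
    qed
    also have "\<dots> = (\<Sum>c\<in>obasis. coord c (y - z) * G c y)"
    proof -
      have "continuous_on (ball z r) (\<lambda>x. ?h' x c)" for c
        using smooth_on_frechet[OF h, of c] unfolding smooth_on_def by (metis Ck_on_continuous)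
      then have "continuous_on {0..1} (\<lambda>t. ?h' (z + t *\<^sub>R (y - z)) c)" for c
        by (rule continuous_on_compose2) (use in_ball_segment[OF y] in \<open>auto intro!: continuous_intros\<close>)
      note i = integrable_integral[OF integrable_continuous_real[OF this]]
      have "((\<lambda>t. \<Sum>c\<in>obasis. coord c (y - z) * ?h' (z + t *\<^sub>R (y - z)) c) has_integral
          (\<Sum>c\<in>obasis. coord c (y - z) * G c y)) {0..1}"
        unfolding G_def by (intro has_integral_sum has_integral_mult_right i obasis(1)[OF fd])
      then show ?thesis by (rule integral_unique)
    qed
    finally show ?thesis by simp
  qed
  ultimately show ?thesis by blast
qed

text \<open>The ball about 0 is a closed subset of a coordinate box over \<open>obasis\<close>, and
  the box is compact as a finite sum of compact segments.\<close>

lemma compact_cball_finite_dim: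
  fixes z :: "'e::real_inner"
  assumes fd: "finite_dim TYPE('e)" shows "compact (cball z r)"
proof -
  have cube: "compact {\<Sum>c\<in>C. t c *\<^sub>R c | t. \<forall>c\<in>C. \<bar>t c\<bar> \<le> M}" (is "compact (?Q C)")
    if "finite C" for C :: "'e set" and M :: real
    using that
  proof (induction C)
    case empty then show ?case by simp
  next
    case (insert a C)
    have "?Q (insert a C) = {x + y | x y. x \<in> (\<lambda>t. t *\<^sub>R a) ` {-M..M} \<and> y \<in> ?Q C}" (is "_ = ?R")
    proof safe
      fix t :: "'e \<Rightarrow> real" assume "\<forall>c\<in>insert a C. \<bar>t c\<bar> \<le> M"
      then show "\<exists>x y. (\<Sum>c\<in>insert a C. t c *\<^sub>R c) = x + y \<and> x \<in> (\<lambda>t. t *\<^sub>R a) ` {-M..M} \<and> y \<in> ?Q C"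
        using insert by (intro exI[of _ "t a *\<^sub>R a"] exI[of _ "\<Sum>c\<in>C. t c *\<^sub>R c"]) (auto simp: abs_le_iff)
    next
      fix u and t :: "'e \<Rightarrow> real" assume *: "u \<in> {-M..M}" "\<forall>c\<in>C. \<bar>t c\<bar> \<le> M"
      have "(\<Sum>c\<in>C. (t(a := u)) c *\<^sub>R c) = (\<Sum>c\<in>C. t c *\<^sub>R c)"
        using insert by (intro sum.cong) auto
      then have "u *\<^sub>R a + (\<Sum>c\<in>C. t c *\<^sub>R c) = (\<Sum>c\<in>insert a C. (t(a := u)) c *\<^sub>R c)"
        using insert by simp
      moreover have "\<forall>c\<in>insert a C. \<bar>(t(a := u)) c\<bar> \<le> M" using * by (auto simp: abs_le_iff)
      ultimately show "\<exists>t'. u *\<^sub>R a + (\<Sum>c\<in>C. t c *\<^sub>R c) = (\<Sum>c\<in>insert a C. t' c *\<^sub>R c) \<and> (\<forall>c\<in>insert a C. \<bar>t' c\<bar> \<le> M)"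
        by blast
    qed
    moreover have "compact ((\<lambda>t. t *\<^sub>R a) ` {-M..M})"
      by (intro compact_continuous_image continuous_intros compact_Icc)
    ultimately show ?case using compact_sums[OF _ insert.IH] by simp
  qed
  \<comment> \<open>The inserted 0 makes the maximum meaningful for an empty \<open>obasis\<close>;
    the absolute value covers a negative radius.\<close>
  define M where "M = Max (insert 0 ((\<lambda>c::'e. onorm (coord c)) ` obasis)) * \<bar>r\<bar>"
  have "cball 0 r \<subseteq> {\<Sum>c\<in>obasis. t c *\<^sub>R c | t. \<forall>c\<in>(obasis::'e set). \<bar>t c\<bar> \<le> M}"
  proof
    fix x :: 'e assume x: "x \<in> cball 0 r"
    have "\<bar>coord c x\<bar> \<le> M" if "c \<in> obasis" for c
    proof -
      have "\<bar>coord c x\<bar> \<le> onorm (coord c) * norm x" using onorm[OF bounded_linear_coord, of c x] by simp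
      also have "\<dots> \<le> M" unfolding M_def
        using x that obasis(1)[OF fd] by (intro mult_mono Max_ge) (auto intro: Max_ge)
      finally show ?thesis .
    qed
    then show "x \<in> {\<Sum>c\<in>obasis. t c *\<^sub>R c | t. \<forall>c\<in>(obasis::'e set). \<bar>t c\<bar> \<le> M}"
      using obasis(2)[OF fd, of x] by (auto intro!: exI[of _ "\<lambda>c. coord c x"])
  qed
  then have "compact (cball (0::'e) r)"
    using compact_Int_closed[OF cube[OF obasis(1)[OF fd], of M] closed_cball[of 0 r]] by (simp add: Int_absorb1)
  then have "compact ((+) z ` cball 0 r)" by (rule compact_translation)
  then show ?thesis by (simp add: image_add_cball)
qed

section \<open>Smooth functions on a manifold\<close>

lemma sum_apply: "(\<Sum>i\<in>I. f i) x = (\<Sum>i\<in>I. f i x :: 'b::comm_monoid_add)"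
  by (induction I rule: infinite_finite_induct) auto

lemma scaleR_apply [simp]: "(c *\<^sub>R f) x = c *\<^sub>R f x"
  by (simp add: scaleR_fun_def)

lemma smooth_on_subset: "smooth_on U f \<Longrightarrow> V \<subseteq> U \<Longrightarrow> smooth_on V f"
  unfolding smooth_on_def using Ck_on_subset by metis

lemma smooth_on_cong: "open U \<Longrightarrow> (\<And>x. x \<in> U \<Longrightarrow> f x = g x) \<Longrightarrow> smooth_on U f \<longleftrightarrow> smooth_on U g"
  unfolding smooth_on_def using Ck_on_cong by blast

lemma smooth_on_eq:
  assumes "smooth_on U f" "open U" "\<And>x. x \<in> U \<Longrightarrow> f x = g x" shows "smooth_on U g"
  using smooth_on_cong[of U f g] assms by simp

lemma smooth_on_local:
  assumes "\<And>x. x \<in> U \<Longrightarrow> \<exists>V. open V \<and> x \<in> V \<and> smooth_on V f"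
  shows "smooth_on U f"
  unfolding smooth_on_def
proof (intro allI Ck_on_local)
  show "\<exists>V. open V \<and> x \<in> V \<and> Ck_on k V f" if "x \<in> U" for k x
    using assms[OF that] by (auto simp: smooth_on_def)
qed

lemma smooth_on_continuous: "smooth_on U f \<Longrightarrow> continuous_on U f"
  unfolding smooth_on_def using Ck_on_continuous by blast

lemma smooth_on_compose:
  fixes f :: "'a::real_normed_vector \<Rightarrow> 'b::real_inner" and g :: "'b \<Rightarrow> 'c::real_normed_vector"
  assumes "finite_dim TYPE('b)" "open U" "open V" "smooth_on U f" "smooth_on V g" "f ` U \<subseteq> V"
  shows "smooth_on U (\<lambda>x. g (f x))"
  unfolding smooth_on_def
  by (rule allI, rule Ck_on_compose[OF assms(1-3) _ _ assms(6)]) (use assms(4,5) in \<open>simp_all add: smooth_on_def\<close>)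

lemma open_preimage_smooth:
  assumes "smooth_on U f" "open U" "open N" shows "open {x \<in> U. f x \<in> N}"
  using continuous_open_preimage[OF smooth_on_continuous[OF assms(1)] assms(2,3)]
  by (simp add: Int_def vimage_def)

locale manifold_on =
  fixes A :: "('a, 'e::real_inner) atlas"
  assumes manifold: "manifold A"
begin

abbreviation "is_open \<equiv> openin (atlas_topology A)"

lemma finite_dim: "finite_dim TYPE('e)"
  using manifold by (simp add: manifold_def finite_dim_def)

lemma chart:
  assumes "(U, \<phi>) \<in> A"
  shows "inj_on \<phi> U" "open (\<phi> ` U)" "U \<subseteq> carrier A"
proof -
  have "\<forall>(U, \<phi>)\<in>A. inj_on \<phi> U \<and> open (\<phi> ` U)" using manifold by (simp add: manifold_def)
  then show "inj_on \<phi> U" "open (\<phi> ` U)" using assms by auto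
  show "U \<subseteq> carrier A" using assms by (force simp: carrier_def)
qed

lemma transition:
  assumes "(U, \<phi>) \<in> A" "(V, \<theta>) \<in> A"
  shows "open (\<phi> ` (U \<inter> V))" "smooth_on (\<phi> ` (U \<inter> V)) (\<theta> \<circ> inv_into U \<phi>)"
proof -
  have "\<forall>(U, \<phi>)\<in>A. \<forall>(V, \<theta>)\<in>A.
      open (\<phi> ` (U \<inter> V)) \<and> smooth_on (\<phi> ` (U \<inter> V)) (\<theta> \<circ> inv_into U \<phi>)"
    using manifold by (simp add: manifold_def)
  then show "open (\<phi> ` (U \<inter> V))" "smooth_on (\<phi> ` (U \<inter> V)) (\<theta> \<circ> inv_into U \<phi>)"
    using assms by auto
qed

lemma chart_at: "p \<in> carrier A \<Longrightarrow> \<exists>U \<phi>. (U, \<phi>) \<in> A \<and> p \<in> U"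
  by (auto simp: carrier_def)

text \<open>Injectivity of the charts makes images commute with intersections, so these sets do form
  a topology and \<open>topology\<close> can be inverted.\<close>

lemma is_open_iff: "is_open W \<longleftrightarrow> W \<subseteq> carrier A \<and> (\<forall>(U, \<phi>)\<in>A. open (\<phi> ` (U \<inter> W)))"
proof -
  let ?P = "\<lambda>W. W \<subseteq> carrier A \<and> (\<forall>(U, \<phi>)\<in>A. open (\<phi> ` (U \<inter> W)))"
  have "istopology ?P"
    unfolding istopology_def
  proof (intro conjI allI impI)
    fix W W' assume W: "?P W" "?P W'"
    have "open (\<phi> ` (U \<inter> (W \<inter> W')))" if "(U, \<phi>) \<in> A" for U \<phi>
    proof -
      have "\<phi> ` (U \<inter> (W \<inter> W')) = \<phi> ` (U \<inter> W) \<inter> \<phi> ` (U \<inter> W')"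
        using inj_on_image_Int[OF chart(1)[OF that], of "U \<inter> W" "U \<inter> W'"] by (simp add: Int_ac)
      then show ?thesis using W that by (auto intro!: open_Int)
    qed
    then show "W \<inter> W' \<subseteq> carrier A" "\<forall>(U, \<phi>)\<in>A. open (\<phi> ` (U \<inter> (W \<inter> W')))" using W by auto
  next
    fix \<K> assume K: "\<forall>W\<in>\<K>. ?P W"
    have "open (\<phi> ` (U \<inter> \<Union>\<K>))" if "(U, \<phi>) \<in> A" for U \<phi>
    proof -
      have "\<phi> ` (U \<inter> \<Union>\<K>) = (\<Union>W\<in>\<K>. \<phi> ` (U \<inter> W))" by auto
      moreover have "open (\<phi> ` (U \<inter> W))" if "W \<in> \<K>" for W using K that \<open>(U, \<phi>) \<in> A\<close> by blast
      ultimately show ?thesis by auto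
    qed
    then show "\<Union>\<K> \<subseteq> carrier A" "\<forall>(U, \<phi>)\<in>A. open (\<phi> ` (U \<inter> \<Union>\<K>))" using K by auto
  qed
  then show ?thesis unfolding atlas_topology_def by (simp add: topology_inverse')
qed

lemma is_open_subset: "is_open W \<Longrightarrow> W \<subseteq> carrier A"
  by (simp add: is_open_iff)

lemma is_open_chart: "(U, \<phi>) \<in> A \<Longrightarrow> is_open U"
  using transition(1) chart(3) by (auto simp: is_open_iff Int_commute)

lemma is_open_carrier: "is_open (carrier A)"
  using chart(2,3) by (auto simp: is_open_iff) (metis inf.absorb1)

lemma is_open_image: "is_open W \<Longrightarrow> (U, \<phi>) \<in> A \<Longrightarrow> open (\<phi> ` (U \<inter> W))"
  by (auto simp: is_open_iff)

lemma topspace: "topspace (atlas_topology A) = carrier A"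
  using is_open_carrier is_open_subset by (meson openin_subset openin_topspace subset_antisym)

lemma is_open_preimage:
  assumes U: "(U, \<phi>) \<in> A" and N: "open N"
  shows "is_open {x\<in>U. \<phi> x \<in> N}"
proof -
  have "open (\<theta> ` (V \<inter> {x\<in>U. \<phi> x \<in> N}))" if V: "(V, \<theta>) \<in> A" for V \<theta>
  proof -
    have "\<theta> ` (V \<inter> {x\<in>U. \<phi> x \<in> N}) = {y \<in> \<theta> ` (V \<inter> U). (\<phi> \<circ> inv_into V \<theta>) y \<in> N}"
      using chart(1)[OF V] by auto
    then show ?thesis using open_preimage_smooth[OF transition(2)[OF V U] transition(1)[OF V U] N] by simp
  qed
  then show ?thesis using chart(3)[OF U] by (auto simp: is_open_iff)
qed

text \<open>Asks for one chart only, which makes it easy to establish and to glue;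
  \<open>smooth_atD\<close> passes to any other chart, and \<open>Cinf_iff\<close> recovers the
  smooth functions.\<close>

definition smooth_at :: "('a \<Rightarrow> real) \<Rightarrow> 'a \<Rightarrow> bool" where
  "smooth_at f p \<longleftrightarrow> (\<exists>U \<phi> N. (U, \<phi>) \<in> A \<and> p \<in> U \<and> open N \<and> \<phi> p \<in> N \<and> N \<subseteq> \<phi> ` U \<and>
     smooth_on N (f \<circ> inv_into U \<phi>))"

lemma smooth_atI:
  "(U, \<phi>) \<in> A \<Longrightarrow> p \<in> U \<Longrightarrow> open N \<Longrightarrow> \<phi> p \<in> N \<Longrightarrow> N \<subseteq> \<phi> ` U \<Longrightarrow>
   smooth_on N (f \<circ> inv_into U \<phi>) \<Longrightarrow> smooth_at f p"
  unfolding smooth_at_def by metis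

lemma smooth_atI':
  assumes "(U, \<phi>) \<in> A" "p \<in> U" "smooth_on (\<phi> ` U) (f \<circ> inv_into U \<phi>)" shows "smooth_at f p"
  using assms chart(2)[OF assms(1)] by (intro smooth_atI[of U \<phi> p "\<phi> ` U"]) auto

lemma smooth_atD:
  assumes f: "smooth_at f p" and V: "(V, \<theta>) \<in> A" "p \<in> V"
  shows "\<exists>N. open N \<and> \<theta> p \<in> N \<and> N \<subseteq> \<theta> ` V \<and> smooth_on N (f \<circ> inv_into V \<theta>)"
proof -
  obtain U \<phi> N where U: "(U, \<phi>) \<in> A" "p \<in> U" and N: "open N" "\<phi> p \<in> N" "N \<subseteq> \<phi> ` U"
    "smooth_on N (f \<circ> inv_into U \<phi>)" using f by (auto simp: smooth_at_def)
  define N' where "N' = {y \<in> \<theta> ` (V \<inter> U). (\<phi> \<circ> inv_into V \<theta>) y \<in> N}"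
  have o: "open N'"
    unfolding N'_def by (rule open_preimage_smooth[OF transition(2)[OF V(1) U(1)] transition(1)[OF V(1) U(1)] N(1)])
  have "smooth_on N' (\<lambda>y. (f \<circ> inv_into U \<phi>) ((\<phi> \<circ> inv_into V \<theta>) y))"
    by (rule smooth_on_compose[OF finite_dim o N(1) _ N(4)])
      (use smooth_on_subset[OF transition(2)[OF V(1) U(1)], of N'] in \<open>auto simp: N'_def comp_def\<close>)
  then have "smooth_on N' (f \<circ> inv_into V \<theta>)"
    by (rule smooth_on_eq[OF _ o]) (use chart(1)[OF V(1)] chart(1)[OF U(1)] in \<open>auto simp: N'_def\<close>)
  moreover have "\<theta> p \<in> N'" using U V N chart(1)[OF V(1)] by (auto simp: N'_def)
  ultimately show ?thesis using o by (intro exI[of _ N']) (auto simp: N'_def)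
qed

lemma Cinf_iff: "f \<in> Cinf A \<longleftrightarrow> (\<forall>p\<in>carrier A. smooth_at f p) \<and> (\<forall>p. p \<notin> carrier A \<longrightarrow> f p = 0)"
proof -
  have "smooth_fun_on A (carrier A) f \<longleftrightarrow> (\<forall>p\<in>carrier A. smooth_at f p)"
  proof
    assume f: "smooth_fun_on A (carrier A) f"
    have "smooth_at f p" if "(U, \<phi>) \<in> A" "p \<in> U" for U \<phi> p
    proof -
      have "smooth_on (\<phi> ` (U \<inter> carrier A)) (f \<circ> inv_into U \<phi>)"
        using f that(1) by (auto simp: smooth_fun_on_def)
      then have "smooth_on (\<phi> ` U) (f \<circ> inv_into U \<phi>)" using chart(3)[OF that(1)] by (simp add: Int_absorb2)
      then show ?thesis by (rule smooth_atI'[OF that])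
    qed
    then show "\<forall>p\<in>carrier A. smooth_at f p" using chart_at by metis
  next
    assume f: "\<forall>p\<in>carrier A. smooth_at f p"
    have "smooth_on (\<phi> ` U) (f \<circ> inv_into U \<phi>)" if U: "(U, \<phi>) \<in> A" for U \<phi>
    proof (rule smooth_on_local)
      fix x assume "x \<in> \<phi> ` U"
      then obtain p where p: "p \<in> U" "x = \<phi> p" by auto
      then have "smooth_at f p" using f chart(3)[OF U] by (simp add: subset_iff)
      from smooth_atD[OF this U p(1)]
      show "\<exists>V. open V \<and> x \<in> V \<and> smooth_on V (f \<circ> inv_into U \<phi>)" unfolding p(2) by metis
    qed
    then show "smooth_fun_on A (carrier A) f"
      using chart(3) by (auto simp: smooth_fun_on_def Int_absorb2)
  qed
  then show ?thesis by (simp add: Cinf_def)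
qed

lemma Cinf_outside: "f \<in> Cinf A \<Longrightarrow> p \<notin> carrier A \<Longrightarrow> f p = 0"
  by (simp add: Cinf_iff)

lemma smooth_at_cong:
  assumes "smooth_at f p" "is_open W" "p \<in> W" "\<And>q. q \<in> W \<Longrightarrow> f q = g q"
  shows "smooth_at g p"
proof -
  obtain U \<phi> N where U: "(U, \<phi>) \<in> A" "p \<in> U" and N: "open N" "\<phi> p \<in> N" "N \<subseteq> \<phi> ` U"
    "smooth_on N (f \<circ> inv_into U \<phi>)" using assms(1) by (auto simp: smooth_at_def)
  let ?N = "N \<inter> \<phi> ` (U \<inter> W)"
  have o: "open ?N" using N(1) is_open_image[OF assms(2) U(1)] by auto
  have "smooth_on ?N (f \<circ> inv_into U \<phi>)" by (rule smooth_on_subset[OF N(4)]) auto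
  then have "smooth_on ?N (g \<circ> inv_into U \<phi>)"
    by (rule smooth_on_eq[OF _ o]) (use assms(4) chart(1)[OF U(1)] in auto)
  then show ?thesis by (rule smooth_atI[OF U o, rotated -1]) (use U N assms(3) in auto)
qed

lemma smooth_at_pair:
  assumes "smooth_at f p" "smooth_at g p"
  shows "\<exists>U \<phi> N. (U, \<phi>) \<in> A \<and> p \<in> U \<and> open N \<and> \<phi> p \<in> N \<and> N \<subseteq> \<phi> ` U \<and>
     smooth_on N (f \<circ> inv_into U \<phi>) \<and> smooth_on N (g \<circ> inv_into U \<phi>)"
proof -
  obtain U \<phi> N where U: "(U, \<phi>) \<in> A" "p \<in> U" and N: "open N" "\<phi> p \<in> N" "N \<subseteq> \<phi> ` U"
    "smooth_on N (f \<circ> inv_into U \<phi>)" using assms(1) by (auto simp: smooth_at_def)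
  obtain N' where N': "open N'" "\<phi> p \<in> N'" "N' \<subseteq> \<phi> ` U" "smooth_on N' (g \<circ> inv_into U \<phi>)"
    using smooth_atD[OF assms(2) U] by auto
  show ?thesis
    using U N N' by (intro exI[of _ U] exI[of _ \<phi>] exI[of _ "N \<inter> N'"]) (auto intro: smooth_on_subset)
qed

lemma smooth_at_add:
  assumes "smooth_at f p" "smooth_at g p" shows "smooth_at (\<lambda>x. f x + g x) p"
proof -
  obtain U \<phi> N where *: "(U, \<phi>) \<in> A" "p \<in> U" "open N" "\<phi> p \<in> N" "N \<subseteq> \<phi> ` U"
    "smooth_on N (f \<circ> inv_into U \<phi>)" "smooth_on N (g \<circ> inv_into U \<phi>)"
    using smooth_at_pair[OF assms] by auto
  then have "smooth_on N ((\<lambda>x. f x + g x) \<circ> inv_into U \<phi>)"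
    by (simp add: smooth_on_def comp_def Ck_on_add)
  then show ?thesis by (rule smooth_atI[OF *(1-5)])
qed

lemma smooth_at_mult:
  assumes "smooth_at f p" "smooth_at g p" shows "smooth_at (\<lambda>x. f x * g x) p"
proof -
  obtain U \<phi> N where *: "(U, \<phi>) \<in> A" "p \<in> U" "open N" "\<phi> p \<in> N" "N \<subseteq> \<phi> ` U"
    "smooth_on N (f \<circ> inv_into U \<phi>)" "smooth_on N (g \<circ> inv_into U \<phi>)"
    using smooth_at_pair[OF assms] by auto
  then have "smooth_on N ((\<lambda>x. f x * g x) \<circ> inv_into U \<phi>)"
    by (simp add: smooth_on_def comp_def Ck_on_mult)
  then show ?thesis by (rule smooth_atI[OF *(1-5)])
qed

lemma smooth_at_const: "p \<in> carrier A \<Longrightarrow> smooth_at (\<lambda>x. c) p"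
  using chart_at[of p] by (auto simp: smooth_on_def comp_def intro: smooth_atI')

lemma is_open_value:
  assumes "smooth_at f p" "f p \<noteq> 0" shows "\<exists>W. is_open W \<and> p \<in> W \<and> (\<forall>q\<in>W. f q \<noteq> 0)"
proof -
  obtain U \<phi> N where U: "(U, \<phi>) \<in> A" "p \<in> U" and N: "open N" "\<phi> p \<in> N" "N \<subseteq> \<phi> ` U"
    "smooth_on N (f \<circ> inv_into U \<phi>)" using assms(1) by (auto simp: smooth_at_def)
  let ?N = "{x \<in> N. (f \<circ> inv_into U \<phi>) x \<in> - {0}}"
  have "open ?N" by (rule open_preimage_smooth[OF N(4,1)]) auto
  then show ?thesis using is_open_preimage[OF U(1), of ?N] U N assms(2) chart(1)[OF U(1)]
    by (intro exI[of _ "{x\<in>U. \<phi> x \<in> ?N}"]) auto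
qed

lemma smooth_at_inverse:
  assumes "smooth_at f p" "f p \<noteq> 0" shows "smooth_at (\<lambda>x. inverse (f x)) p"
proof -
  obtain U \<phi> N where U: "(U, \<phi>) \<in> A" "p \<in> U" and N: "open N" "\<phi> p \<in> N" "N \<subseteq> \<phi> ` U"
    "smooth_on N (f \<circ> inv_into U \<phi>)" using assms(1) by (auto simp: smooth_at_def)
  let ?N = "{x \<in> N. (f \<circ> inv_into U \<phi>) x \<in> - {0}}"
  have o: "open ?N" by (rule open_preimage_smooth[OF N(4,1)]) auto
  have "smooth_on ?N (f \<circ> inv_into U \<phi>)" by (rule smooth_on_subset[OF N(4)]) auto
  then have "smooth_on ?N ((\<lambda>x. inverse (f x)) \<circ> inv_into U \<phi>)"
    using o by (auto simp: smooth_on_def comp_def intro!: Ck_on_inverse)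
  moreover have "\<phi> p \<in> ?N" using U N assms(2) chart(1)[OF U(1)] by auto
  ultimately show ?thesis by (intro smooth_atI[OF U o]) (use N(3) in auto)
qed

lemma Cinf_local:
  assumes "\<And>p. p \<in> carrier A \<Longrightarrow> \<exists>W g. is_open W \<and> p \<in> W \<and> g \<in> Cinf A \<and> (\<forall>q\<in>W. f q = g q)"
    and "\<And>p. p \<notin> carrier A \<Longrightarrow> f p = 0"
  shows "f \<in> Cinf A"
proof -
  have "smooth_at f p" if p: "p \<in> carrier A" for p
  proof -
    obtain W g where "is_open W" "p \<in> W" "g \<in> Cinf A" "\<forall>q\<in>W. f q = g q" using assms(1)[OF p] by auto
    then show ?thesis using smooth_at_cong[of g p W f] p by (auto simp: Cinf_iff)
  qed
  then show ?thesis using assms(2) by (auto simp: Cinf_iff)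
qed

lemma Cinf_add: "f \<in> Cinf A \<Longrightarrow> g \<in> Cinf A \<Longrightarrow> f + g \<in> Cinf A"
  by (auto simp: Cinf_iff plus_fun_def intro: smooth_at_add)

lemma Cinf_mult: "f \<in> Cinf A \<Longrightarrow> g \<in> Cinf A \<Longrightarrow> f * g \<in> Cinf A"
  by (auto simp: Cinf_iff times_fun_def intro: smooth_at_mult)

lemma Cinf_scale: "f \<in> Cinf A \<Longrightarrow> c *\<^sub>R f \<in> Cinf A"
  using smooth_at_mult[OF smooth_at_const] by (auto simp: Cinf_iff scaleR_fun_def)

lemma Cinf_0: "0 \<in> Cinf A"
  by (auto simp: Cinf_iff zero_fun_def intro: smooth_at_const)

lemma Cinf_minus: "f \<in> Cinf A \<Longrightarrow> - f \<in> Cinf A"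
  using Cinf_scale[of f "-1"] by simp

lemma Cinf_diff: "f \<in> Cinf A \<Longrightarrow> g \<in> Cinf A \<Longrightarrow> f - g \<in> Cinf A"
  using Cinf_add[of f "- g"] Cinf_minus by simp

lemma Cinf_sum: "(\<And>i. i \<in> I \<Longrightarrow> f i \<in> Cinf A) \<Longrightarrow> sum f I \<in> Cinf A"
  by (induction I rule: infinite_finite_induct) (auto intro: Cinf_add Cinf_0)

section \<open>Cutoff functions, local extension and local inverses\<close>

definition unit :: "'a \<Rightarrow> real" where
  "unit p = (if p \<in> carrier A then 1 else 0)"

lemma Cinf_unit: "unit \<in> Cinf A"
proof -
  have "smooth_at unit p" if "p \<in> carrier A" for p
    by (rule smooth_at_cong[OF smooth_at_const[OF that, of 1] is_open_carrier that]) (simp add: unit_def)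
  then show ?thesis by (simp add: Cinf_iff unit_def)
qed

text \<open>The closed set \<open>K\<close> is carried along because extending \<omega> f by 0
  needs, at each point off \<open>W\<close>, a neighbourhood on which \<omega> vanishes.
  \<open>K\<close> is the image of a compact ball of a chart, hence closed because the manifold is
  Hausdorff.\<close>

lemma bump_function:
  assumes W: "is_open W" "p \<in> W"
  shows "\<exists>\<omega> W' K. \<omega> \<in> Cinf A \<and> is_open W' \<and> p \<in> W' \<and> W' \<subseteq> W \<and> (\<forall>q\<in>W'. \<omega> q = 1) \<and>
    closedin (atlas_topology A) K \<and> K \<subseteq> W \<and> (\<forall>q. q \<notin> K \<longrightarrow> \<omega> q = 0)"
proof -
  obtain U \<phi> where U: "(U, \<phi>) \<in> A" "p \<in> U" using chart_at is_open_subset W by blast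
  note inj = chart(1)[OF U(1)]
  obtain r where r: "r > 0" "cball (\<phi> p) r \<subseteq> \<phi> ` (U \<inter> W)"
    using open_contains_cball[of "\<phi> ` (U \<inter> W)"] is_open_image[OF W(1) U(1)] U W by blast
  define K where "K = inv_into U \<phi> ` cball (\<phi> p) r"
  have "compactin (top_of_set (\<phi> ` U)) (cball (\<phi> p) r)"
    using compact_cball_finite_dim[OF finite_dim] r by (auto simp: compactin_subtopology)
  moreover have "continuous_map (top_of_set (\<phi> ` U)) (atlas_topology A) (inv_into U \<phi>)"
  proof (rule continuous_map[THEN iffD2], intro conjI allI impI)
    show "inv_into U \<phi> ` topspace (top_of_set (\<phi> ` U)) \<subseteq> topspace (atlas_topology A)"
      using inj chart(3)[OF U(1)] by (auto simp: topspace)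
    fix O' assume O: "is_open O'"
    have "{x \<in> topspace (top_of_set (\<phi> ` U)). inv_into U \<phi> x \<in> O'} = \<phi> ` (U \<inter> O')"
      using inj by auto
    then show "openin (top_of_set (\<phi> ` U)) {x \<in> topspace (top_of_set (\<phi> ` U)). inv_into U \<phi> x \<in> O'}"
      using is_open_image[OF O U(1)] by (auto simp: openin_open intro!: exI[of _ "\<phi> ` (U \<inter> O')"])
  qed
  ultimately have "compactin (atlas_topology A) K" unfolding K_def by (rule image_compactin)
  then have K: "closedin (atlas_topology A) K"
    using manifold compactin_imp_closedin by (auto simp: manifold_def)
  have KW: "K \<subseteq> U \<inter> W" unfolding K_def using r(2) inj by auto
  define \<omega> where "\<omega> q = (if q \<in> U then bump r (\<phi> q - \<phi> p) else 0)" for q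
  have z: "\<omega> q = 0" if "q \<notin> K" for q
  proof (cases "q \<in> U")
    case True
    have "\<phi> q \<notin> cball (\<phi> p) r" using that inj True unfolding K_def by (metis image_eqI inv_into_f_f)
    then show ?thesis using bump_eq_0[of r "\<phi> q - \<phi> p"] r(1) by (simp add: \<omega>_def dist_norm norm_minus_commute)
  qed (simp add: \<omega>_def)
  have "smooth_at \<omega> q" if "q \<in> carrier A" for q
  proof (cases "q \<in> U")
    case True
    have "smooth_on (\<phi> ` U) (\<lambda>y. bump r (y - \<phi> p))"
      by (rule smooth_on_subset[of UNIV]) (simp_all add: smooth_on_def Ck_on_bump[OF r(1)])
    then have "smooth_on (\<phi> ` U) (\<omega> \<circ> inv_into U \<phi>)"
      by (rule smooth_on_eq[OF _ chart(2)[OF U(1)]]) (use inj in \<open>auto simp: \<omega>_def\<close>)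
    then show ?thesis by (rule smooth_atI'[OF U(1) True])
  next
    case False
    have "is_open (carrier A - K)" using K topspace by (auto simp: closedin_def)
    then show ?thesis
      by (rule smooth_at_cong[OF smooth_at_const[OF that, of 0]]) (use that False KW z in auto)
  qed
  then have "\<omega> \<in> Cinf A" using chart(3)[OF U(1)] by (auto simp: Cinf_iff \<omega>_def)
  moreover have "is_open {x\<in>U. \<phi> x \<in> ball (\<phi> p) (r / 2)}" by (rule is_open_preimage[OF U(1) open_ball])
  moreover have "{x\<in>U. \<phi> x \<in> ball (\<phi> p) (r / 2)} \<subseteq> W"
  proof
    fix x assume x: "x \<in> {x\<in>U. \<phi> x \<in> ball (\<phi> p) (r / 2)}"
    then have "\<phi> x \<in> cball (\<phi> p) r" using r(1) by auto
    then show "x \<in> W" using r(2) x inj by (auto dest!: subsetD simp: inj_on_eq_iff)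
  qed
  moreover have "\<forall>q\<in>{x\<in>U. \<phi> x \<in> ball (\<phi> p) (r / 2)}. \<omega> q = 1"
    using bump_eq_1[OF r(1)] by (auto simp: \<omega>_def dist_norm norm_minus_commute)
  moreover have "p \<in> {x\<in>U. \<phi> x \<in> ball (\<phi> p) (r / 2)}" using U r by auto
  ultimately show ?thesis using K KW z by blast
qed

lemma Cinf_cutoff:
  assumes "\<omega> \<in> Cinf A" "closedin (atlas_topology A) K" "K \<subseteq> W" "\<And>q. q \<notin> K \<Longrightarrow> \<omega> q = 0"
    and "is_open W" "\<And>q. q \<in> W \<Longrightarrow> smooth_at f q"
  shows "(\<lambda>q. \<omega> q * f q) \<in> Cinf A"
proof -
  have "smooth_at (\<lambda>q. \<omega> q * f q) q" if "q \<in> carrier A" for q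
  proof (cases "q \<in> W")
    case True then show ?thesis using assms(1,6) that by (auto simp: Cinf_iff intro: smooth_at_mult)
  next
    case False
    have "is_open (carrier A - K)" using assms(2) topspace by (auto simp: closedin_def)
    then show ?thesis
      by (rule smooth_at_cong[OF smooth_at_const[OF that, of 0]]) (use that False assms in auto)
  qed
  then show ?thesis using assms(1) by (auto simp: Cinf_iff)
qed

lemma Cinf_extension:
  assumes "is_open W" "p \<in> W" "\<And>q. q \<in> W \<Longrightarrow> smooth_at f q"
  shows "\<exists>g W'. g \<in> Cinf A \<and> is_open W' \<and> p \<in> W' \<and> W' \<subseteq> W \<and> (\<forall>q\<in>W'. g q = f q)"
proof -
  obtain \<omega> W' K where *: "\<omega> \<in> Cinf A" "is_open W'" "p \<in> W'" "W' \<subseteq> W" "\<forall>q\<in>W'. \<omega> q = 1"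
    "closedin (atlas_topology A) K" "K \<subseteq> W" "\<forall>q. q \<notin> K \<longrightarrow> \<omega> q = 0"
    using bump_function[OF assms(1,2)] by blast
  then have "(\<lambda>q. \<omega> q * f q) \<in> Cinf A" using assms by (intro Cinf_cutoff[of \<omega> K W]) auto
  then show ?thesis using * by (intro exI[of _ "\<lambda>q. \<omega> q * f q"] exI[of _ W']) auto
qed

lemma Cinf_local_inverse:
  assumes "f \<in> Cinf A" "p \<in> carrier A" "f p \<noteq> 0"
  shows "\<exists>g W. g \<in> Cinf A \<and> is_open W \<and> p \<in> W \<and> (\<forall>q\<in>W. g q * f q = 1)"
proof -
  obtain W where W: "is_open W" "p \<in> W" "\<forall>q\<in>W. f q \<noteq> 0"
    using is_open_value[of f p] assms by (auto simp: Cinf_iff)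
  have "smooth_at (\<lambda>x. inverse (f x)) q" if "q \<in> W" for q
    by (rule smooth_at_inverse) (use assms(1) W is_open_subset[OF W(1)] that in \<open>auto simp: Cinf_iff\<close>)
  from Cinf_extension[OF W(1,2) this] obtain g W' where *: "g \<in> Cinf A" "is_open W'" "p \<in> W'" "W' \<subseteq> W"
    "\<forall>q\<in>W'. g q = inverse (f q)" by blast
  then have "\<forall>q\<in>W'. g q * f q = 1" using W(3) by auto
  then show ?thesis using * by blast
qed

section \<open>Tangent vectors and local frames\<close>

lemma tangentD:
  assumes "v \<in> tangent A p" "f \<in> Cinf A" "g \<in> Cinf A"
  shows "v (f + g) = v f + v g" "v (c *\<^sub>R f) = c * v f" "v (f * g) = f p * v g + g p * v f"
    "v (- f) = - v f" "v (f - g) = v f - v g" "v 0 = 0"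
proof -
  show a: "v (f + g) = v f + v g" and "v (f * g) = f p * v g + g p * v f"
    using assms by (auto simp: tangent_def)
  have s: "v (c *\<^sub>R f) = c * v f" if "f \<in> Cinf A" for f c using assms that by (auto simp: tangent_def)
  show "v (c *\<^sub>R f) = c * v f" by (rule s[OF assms(2)])
  show m: "v (- f) = - v f" using s[OF assms(2), of "-1"] by simp
  have "v (f + - g) = v f + v (- g)" using assms Cinf_minus[OF assms(3)] by (auto simp: tangent_def)
  then show "v (f - g) = v f - v g" using s[OF assms(3), of "-1"] by simp
  show "v 0 = 0" using s[OF Cinf_0, of 0] by simp
qed

lemma tangent_outside: "v \<in> tangent A p \<Longrightarrow> f \<notin> Cinf A \<Longrightarrow> v f = 0"
  by (simp add: tangent_def)

lemma tangent_sum: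
  assumes "v \<in> tangent A p" "\<And>i. i \<in> I \<Longrightarrow> f i \<in> Cinf A"
  shows "v (sum f I) = (\<Sum>i\<in>I. v (f i))"
  using assms(2)
  by (induction I rule: infinite_finite_induct)
    (auto simp: tangentD(6)[OF assms(1) Cinf_0 Cinf_0] tangentD(1)[OF assms(1)] Cinf_sum)

lemma tangent_subspace:
  "v \<in> tangent A p \<Longrightarrow> w \<in> tangent A p \<Longrightarrow> v + w \<in> tangent A p"
  "v \<in> tangent A p \<Longrightarrow> c *\<^sub>R v \<in> tangent A p" "0 \<in> tangent A p"
  by (auto simp: tangent_def algebra_simps scaleR_fun_def[of c v])

text \<open>For a cutoff \<omega> supported in \<open>W\<close> the product \<omega> (f - g) is 0.
  The product rule at p, where \<omega> is 1 and f - g is 0, then leaves v (f - g) = 0.\<close>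

lemma tangent_local:
  assumes v: "v \<in> tangent A p" and f: "f \<in> Cinf A" and g: "g \<in> Cinf A"
    and W: "is_open W" "p \<in> W" "\<And>q. q \<in> W \<Longrightarrow> f q = g q"
  shows "v f = v g"
proof -
  obtain \<omega> W' K where *: "\<omega> \<in> Cinf A" "p \<in> W'" "\<forall>q\<in>W'. \<omega> q = 1" "K \<subseteq> W" "\<forall>q. q \<notin> K \<longrightarrow> \<omega> q = 0"
    using bump_function[OF W(1,2)] by blast
  have "\<omega> * (f - g) = 0" using * W(3) by (fastforce simp: fun_eq_iff)
  then have "\<omega> p * v (f - g) + (f - g) p * v \<omega> = 0"
    using tangentD(3)[OF v *(1) Cinf_diff[OF f g]] tangentD(6)[OF v f g] by simp
  then show ?thesis using * W tangentD(5)[OF v f g] by simp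
qed

text \<open>The unit is idempotent, so the product rule gives v(unit) = 2 v(unit).\<close>

lemma tangent_const:
  assumes v: "v \<in> tangent A p" and "p \<in> carrier A" shows "v unit = 0"
proof -
  have "unit * unit = unit" by (simp add: unit_def fun_eq_iff)
  then show ?thesis using tangentD(3)[OF v Cinf_unit Cinf_unit] assms(2) by (simp add: unit_def)
qed

lemma vector_field_zero: "X \<in> vector_fields A \<Longrightarrow> p \<notin> carrier A \<Longrightarrow> X p = 0"
  by (simp add: vector_fields_def)

lemma vector_field_tangent: "X \<in> vector_fields A \<Longrightarrow> p \<in> carrier A \<Longrightarrow> X p \<in> tangent A p"
  by (simp add: vector_fields_def)

lemma vector_field_Cinf: "X \<in> vector_fields A \<Longrightarrow> f \<in> Cinf A \<Longrightarrow> (\<lambda>p. X p f) \<in> Cinf A"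
  by (simp add: vector_fields_def)

text \<open>The coordinate field in direction \<open>c\<close>, made global by the cutoff
  \<omega>.\<close>

lemma chart_field:
  fixes c :: 'e
  assumes U: "(U, \<phi>) \<in> A" and K: "\<omega> \<in> Cinf A" "closedin (atlas_topology A) K" "K \<subseteq> U"
    "\<And>q. q \<notin> K \<Longrightarrow> \<omega> q = 0"
  defines "X \<equiv> (\<lambda>q f. if f \<in> Cinf A then \<omega> q * frechet_derivative (f \<circ> inv_into U \<phi>) (at (\<phi> q)) c else 0)"
  shows "X \<in> vector_fields A"
proof -
  note inj = chart(1)[OF U]
  have sm: "smooth_on (\<phi> ` U) (f \<circ> inv_into U \<phi>)" if "f \<in> Cinf A" for f
    using that U chart(3)[OF U] by (fastforce simp: Cinf_def smooth_fun_on_def Int_absorb2)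
  have hd: "(f \<circ> inv_into U \<phi> has_derivative frechet_derivative (f \<circ> inv_into U \<phi>) (at (\<phi> q))) (at (\<phi> q))"
    if "f \<in> Cinf A" "q \<in> U" for f q
    using sm[OF that(1)] that(2) Ck_on_SucD(1)[of 0 "\<phi> ` U"] unfolding smooth_on_def by blast
  have eq: "frechet_derivative (f \<circ> inv_into U \<phi>) (at (\<phi> q)) c = D c"
    if "(f \<circ> inv_into U \<phi> has_derivative D) (at (\<phi> q))" for f q D
    using frechet_derivative_at[OF that] by simp
  have z: "X q = 0" if "q \<notin> U" for q using that K by (auto simp: X_def fun_eq_iff)
  have "X q \<in> tangent A q" for q
  proof (cases "q \<in> U")
    case False then show ?thesis using z tangent_subspace(3) by simp
  next
    case q: True
    have "X q (f + g) = X q f + X q g" if f: "f \<in> Cinf A" and g: "g \<in> Cinf A" for f g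
    proof -
      have e: "(f + g) \<circ> inv_into U \<phi> = (\<lambda>x. (f \<circ> inv_into U \<phi>) x + (g \<circ> inv_into U \<phi>) x)" by auto
      show ?thesis
        using eq[of "f + g", unfolded e, OF has_derivative_add[OF hd[OF f q] hd[OF g q]]] f g
        by (simp add: X_def e Cinf_add algebra_simps)
    qed
    moreover have "X q (r *\<^sub>R f) = r * X q f" if f: "f \<in> Cinf A" for f r
    proof -
      have e: "(r *\<^sub>R f) \<circ> inv_into U \<phi> = (\<lambda>x. r *\<^sub>R (f \<circ> inv_into U \<phi>) x)" by (auto simp: scaleR_fun_def)
      show ?thesis
        using eq[of "r *\<^sub>R f", unfolded e, OF has_derivative_scaleR_right[OF hd[OF f q]]] f
        by (simp add: X_def e Cinf_scale)
    qed
    moreover have "X q (f * g) = f q * X q g + g q * X q f" if f: "f \<in> Cinf A" and g: "g \<in> Cinf A" for f g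
    proof -
      have e: "(f * g) \<circ> inv_into U \<phi> = (\<lambda>x. (f \<circ> inv_into U \<phi>) x * (g \<circ> inv_into U \<phi>) x)" by auto
      show ?thesis
        using eq[of "f * g", unfolded e, OF has_derivative_mult[OF hd[OF f q] hd[OF g q]]] f g inj q
        by (simp add: X_def e Cinf_mult algebra_simps)
    qed
    ultimately show ?thesis unfolding tangent_def by (auto simp: X_def)
  qed
  moreover have "X q = 0" if "q \<notin> carrier A" for q using that chart(3)[OF U] z by auto
  moreover have "(\<lambda>q. X q f) \<in> Cinf A" if f: "f \<in> Cinf A" for f
  proof -
    have "smooth_at (\<lambda>q. frechet_derivative (f \<circ> inv_into U \<phi>) (at (\<phi> q)) c) q" if q: "q \<in> U" for q
    proof -
      have "smooth_on (\<phi> ` U) ((\<lambda>q. frechet_derivative (f \<circ> inv_into U \<phi>) (at (\<phi> q)) c) \<circ> inv_into U \<phi>)"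
        by (rule smooth_on_eq[OF smooth_on_frechet[OF sm[OF f], of c] chart(2)[OF U]]) (simp add: f_inv_into_f)
      then show ?thesis by (rule smooth_atI'[OF U q])
    qed
    from Cinf_cutoff[OF K(1-4) is_open_chart[OF U] this] show ?thesis using f by (simp add: X_def)
  qed
  ultimately show ?thesis by (auto simp: vector_fields_def)
qed

text \<open>Coordinate functions and coordinate fields, by Hadamard's lemma in a chart.\<close>

lemma local_frame:
  assumes p: "p \<in> carrier A"
  shows "\<exists>W I F D. is_open W \<and> p \<in> W \<and> finite (I :: 'e set) \<and> (\<forall>c\<in>I. F c \<in> Cinf A) \<and> (\<forall>c\<in>I. D c \<in> vector_fields A) \<and>
    (\<forall>q\<in>W. \<forall>v\<in>tangent A q. \<forall>f\<in>Cinf A. v f = (\<Sum>c\<in>I. v (F c) * D c q f))"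
proof -
  obtain U \<phi> where U: "(U, \<phi>) \<in> A" "p \<in> U" using chart_at[OF p] by auto
  note inj = chart(1)[OF U(1)]
  obtain \<omega> W K where *: "\<omega> \<in> Cinf A" "is_open W" "p \<in> W" "W \<subseteq> U" "\<forall>q\<in>W. \<omega> q = 1"
    "closedin (atlas_topology A) K" "K \<subseteq> U" "\<forall>q. q \<notin> K \<longrightarrow> \<omega> q = 0"
    using bump_function[OF is_open_chart[OF U(1)] U(2)] by blast
  define F where "F c q = \<omega> q * coord c (\<phi> q)" for c q
  define D where "D c q f = (if f \<in> Cinf A then \<omega> q * frechet_derivative (f \<circ> inv_into U \<phi>) (at (\<phi> q)) c else 0)"
    for c q f
  have D: "D c \<in> vector_fields A" for c
    unfolding D_def[abs_def] by (rule chart_field[OF U(1) *(1,6,7)]) (use * in auto)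
  have F: "F c \<in> Cinf A" for c
  proof -
    have "smooth_at (\<lambda>q. coord c (\<phi> q)) q" if q: "q \<in> U" for q
    proof -
      have "smooth_on (\<phi> ` U) (coord c)"
        unfolding smooth_on_def by (intro allI Ck_on_bounded_linear bounded_linear_coord)
      then have "smooth_on (\<phi> ` U) ((\<lambda>q. coord c (\<phi> q)) \<circ> inv_into U \<phi>)"
        by (rule smooth_on_eq[OF _ chart(2)[OF U(1)]]) (simp add: f_inv_into_f)
      then show ?thesis by (rule smooth_atI'[OF U(1) q])
    qed
    from Cinf_cutoff[OF *(1,6,7) _ is_open_chart[OF U(1)] this] show ?thesis
      using * by (simp add: F_def[abs_def])
  qed
  \<comment> \<open>\<open>F\<close> and \<open>D\<close> are fixed for all of \<open>W\<close>;
    only the Hadamard coefficients, taken around \<open>q\<close>, depend on q and f.\<close>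
  have "v f = (\<Sum>c\<in>obasis. v (F c) * D c q f)" if q: "q \<in> W" and v: "v \<in> tangent A q" and f: "f \<in> Cinf A" for q v f
  proof -
    have qU: "q \<in> U" and qA: "q \<in> carrier A" using q * chart(3)[OF U(1)] by auto
    have sm: "smooth_on (\<phi> ` U) (f \<circ> inv_into U \<phi>)"
      using f U chart(3)[OF U(1)] by (fastforce simp: Cinf_def smooth_fun_on_def Int_absorb2)
    obtain r where r: "r > 0" "ball (\<phi> q) r \<subseteq> \<phi> ` (U \<inter> W)"
      using open_contains_ball[of "\<phi> ` (U \<inter> W)"] is_open_image[OF *(2) U(1)] qU q by blast
    have "smooth_on (ball (\<phi> q) r) (f \<circ> inv_into U \<phi>)" by (rule smooth_on_subset[OF sm]) (use r in auto)
    from hadamard[OF finite_dim this r(1)] obtain G where G: "\<And>c. smooth_on (ball (\<phi> q) r) (G c)"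
      "\<And>c. G c (\<phi> q) = frechet_derivative (f \<circ> inv_into U \<phi>) (at (\<phi> q)) c"
      "\<And>y. y \<in> ball (\<phi> q) r \<Longrightarrow> (f \<circ> inv_into U \<phi>) y = (f \<circ> inv_into U \<phi>) (\<phi> q) + (\<Sum>c\<in>obasis. coord c (y - \<phi> q) * G c y)"
      by blast
    define O' where "O' = {x\<in>U. \<phi> x \<in> ball (\<phi> q) r}"
    have O: "is_open O'" "q \<in> O'" "O' \<subseteq> W"
      unfolding O'_def using is_open_preimage[OF U(1) open_ball] qU r inj by (auto dest!: subsetD simp: inj_on_eq_iff)
    obtain \<eta> O'' K' where e: "\<eta> \<in> Cinf A" "is_open O''" "q \<in> O''" "O'' \<subseteq> O'" "\<forall>q\<in>O''. \<eta> q = 1"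
      "closedin (atlas_topology A) K'" "K' \<subseteq> O'" "\<forall>q. q \<notin> K' \<longrightarrow> \<eta> q = 0"
      using bump_function[OF O(1,2)] by blast
    define H where "H c x = \<eta> x * G c (\<phi> x)" for c x
    have H: "H c \<in> Cinf A" for c
    proof -
      have "smooth_at (\<lambda>x. G c (\<phi> x)) x" if x: "x \<in> O'" for x
      proof -
        have b: "ball (\<phi> q) r \<subseteq> \<phi> ` U" using r by auto
        have "smooth_on (ball (\<phi> q) r) ((\<lambda>x. G c (\<phi> x)) \<circ> inv_into U \<phi>)"
        proof (rule smooth_on_eq[OF G(1)[of c] open_ball])
          fix y assume "y \<in> ball (\<phi> q) r"
          then have "y \<in> \<phi> ` U" using b by blast
          then show "G c y = ((\<lambda>x. G c (\<phi> x)) \<circ> inv_into U \<phi>) y" by (simp add: f_inv_into_f)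
        qed
        from smooth_atI[OF U(1) _ open_ball _ b this] show ?thesis using x by (auto simp: O'_def)
      qed
      from Cinf_cutoff[OF e(1,6,7) _ O(1) this] show ?thesis
        using e by (simp add: H_def[abs_def])
    qed
    \<comment> \<open>The first factor vanishes at q, so the product rule turns
      \<open>v (?T c)\<close> into \<open>v (F c)\<close> times the value of \<open>H c\<close> at
      q, which is a partial derivative of f.\<close>
    let ?T = "\<lambda>c. (F c - F c q *\<^sub>R unit) * H c"
    have T: "?T c \<in> Cinf A" for c by (intro Cinf_mult Cinf_diff Cinf_scale F H Cinf_unit)
    have "v f = v (f q *\<^sub>R unit + (\<Sum>c\<in>obasis. ?T c))"
    proof (rule tangent_local[OF v f _ e(2,3)])
      show "f q *\<^sub>R unit + (\<Sum>c\<in>obasis. ?T c) \<in> Cinf A" by (intro Cinf_add Cinf_scale Cinf_unit Cinf_sum T)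
      fix x assume x: "x \<in> O''"
      then have xO: "x \<in> O'" using e(4) by auto
      then have xW: "x \<in> W" using O(3) by auto
      then have xU: "x \<in> U" using *(4) by auto
      then have xA: "x \<in> carrier A" using chart(3)[OF U(1)] by auto
      have "(\<Sum>c\<in>obasis. ?T c) x = (\<Sum>c\<in>obasis. ?T c x)"
        by (rule sum_apply)
      also have "\<dots> = (\<Sum>c\<in>obasis. coord c (\<phi> x - \<phi> q) * G c (\<phi> x))"
        using xW q xA x e(5) *(5) by (intro sum.cong)
          (auto simp: F_def H_def unit_def scaleR_fun_def coord_def inner_diff_left diff_divide_distrib)
      finally show "f x = (f q *\<^sub>R unit + (\<Sum>c\<in>obasis. ?T c)) x"
        using G(3)[of "\<phi> x"] xO xU qU inj xA by (simp add: O'_def unit_def scaleR_fun_def)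
    qed
    also have "\<dots> = f q * v unit + (\<Sum>c\<in>obasis. v (?T c))"
      using tangentD(1)[OF v Cinf_scale[OF Cinf_unit, of "f q"] Cinf_sum[of obasis ?T, OF T]]
        tangentD(2)[OF v Cinf_unit Cinf_unit, of "f q"] tangent_sum[OF v, of obasis ?T, OF T] by simp
    also have "\<dots> = (\<Sum>c\<in>obasis. v (F c) * D c q f)"
    proof -
      have "v (?T c) = v (F c) * D c q f" for c
        using tangentD(3)[OF v Cinf_diff[OF F Cinf_scale[OF Cinf_unit]] H, of c "F c q" c]
          tangentD(5)[OF v F Cinf_scale[OF Cinf_unit], of c "F c q"] tangentD(2)[OF v Cinf_unit Cinf_unit]
          tangent_const[OF v qA] qA q * e G(2) f
        by (simp add: unit_def[of q] H_def[of c q] D_def)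
      then show ?thesis using tangent_const[OF v qA] by simp
    qed
    finally show ?thesis .
  qed
  then show ?thesis using *(2,3) D F obasis(1)[OF finite_dim]
    by (intro exI[of _ W] exI[of _ obasis] exI[of _ F] exI[of _ D]) blast
qed

end

section \<open>One-forms\<close>

text \<open>Polymorphic in the values, so that one product serves vector fields, forms and sections;
  \<open>fmult\<close> is its instance for covector-valued functions.\<close>

definition fmul :: "('a \<Rightarrow> real) \<Rightarrow> ('a \<Rightarrow> 'v::real_vector) \<Rightarrow> 'a \<Rightarrow> 'v" (infixr "\<odot>" 75) where
  "fmul f X = (\<lambda>q. f q *\<^sub>R X q)"

lemma fmul_apply [simp]: "(f \<odot> X) q = f q *\<^sub>R X q"
  by (simp add: fmul_def)

lemma fmul_distrib: "f \<odot> (X + Y) = f \<odot> X + f \<odot> Y" "(f + g) \<odot> X = f \<odot> X + g \<odot> X"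
  "f \<odot> (X - Y) = f \<odot> X - f \<odot> Y" "f \<odot> g \<odot> X = (f * g) \<odot> X"
  by (auto simp: fun_eq_iff scaleR_add_right scaleR_add_left scaleR_diff_right)

context manifold_on begin

lemma Cinf_pointwise:
  "f \<in> Cinf A \<Longrightarrow> g \<in> Cinf A \<Longrightarrow> (\<lambda>p. f p + g p) \<in> Cinf A"
  "f \<in> Cinf A \<Longrightarrow> g \<in> Cinf A \<Longrightarrow> (\<lambda>p. f p * g p) \<in> Cinf A"
  "f \<in> Cinf A \<Longrightarrow> (\<lambda>p. c * f p) \<in> Cinf A" "(\<lambda>p. 0) \<in> Cinf A"
  using Cinf_add[of f g] Cinf_mult[of f g] Cinf_scale[of f c] Cinf_0
  by (simp_all add: plus_fun_def times_fun_def scaleR_fun_def zero_fun_def)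

lemma tangent_scale: "v \<in> tangent A p \<Longrightarrow> f \<in> Cinf A \<Longrightarrow> v (c *\<^sub>R f) = c * v f"
  using tangentD(2) by metis

lemma cotangentD:
  assumes "a \<in> cotangent A p" "v \<in> tangent A p" "w \<in> tangent A p"
  shows "a (v + w) = a v + a w" "a (c *\<^sub>R v) = c * a v" "a (v - w) = a v - a w" "a (- v) = - a v" "a 0 = 0"
proof -
  have add: "a (v + w) = a v + a w" if "v \<in> tangent A p" "w \<in> tangent A p" for v w
    using assms(1) that by (auto simp: cotangent_def)
  have sc: "a (c *\<^sub>R v) = c * a v" if "v \<in> tangent A p" for c v using assms(1) that by (auto simp: cotangent_def)
  show "a (v + w) = a v + a w" "a (c *\<^sub>R v) = c * a v" using add sc assms by auto
  show m: "a (- v) = - a v" using sc[OF assms(2), of "-1"] by simp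
  show "a (v - w) = a v - a w"
    using add[OF assms(2) tangent_subspace(2)[OF assms(3), of "-1"]] sc[OF assms(3), of "-1"] by simp
  show "a 0 = 0" using sc[OF assms(2), of 0] by simp
qed

lemma cotangent_scale: "a \<in> cotangent A p \<Longrightarrow> v \<in> tangent A p \<Longrightarrow> a (c *\<^sub>R v) = c * a v"
  using cotangentD(2) by metis

lemma cotangent_zero: "a \<in> cotangent A p \<Longrightarrow> a 0 = 0"
  using cotangentD(5) tangent_subspace(3) by metis

lemma tangent_subspace_sum: "(\<And>i. i \<in> I \<Longrightarrow> v i \<in> tangent A p) \<Longrightarrow> sum v I \<in> tangent A p"
  by (induction I rule: infinite_finite_induct) (simp_all add: tangent_subspace)

lemma cotangent_sum:
  assumes "a \<in> cotangent A p" "\<And>i. i \<in> I \<Longrightarrow> v i \<in> tangent A p"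
  shows "a (sum v I) = (\<Sum>i\<in>I. a (v i))"
  using assms(2)
  by (induction I rule: infinite_finite_induct)
    (simp_all add: cotangent_zero[OF assms(1)] cotangentD(1)[OF assms(1)] tangent_subspace_sum)

lemma cotangent_outside: "a \<in> cotangent A p \<Longrightarrow> v \<notin> tangent A p \<Longrightarrow> a v = 0"
  by (simp add: cotangent_def)

lemma cotangent_subspace:
  "a \<in> cotangent A p \<Longrightarrow> b \<in> cotangent A p \<Longrightarrow> a + b \<in> cotangent A p"
  "a \<in> cotangent A p \<Longrightarrow> c *\<^sub>R a \<in> cotangent A p" "0 \<in> cotangent A p"
  by (auto simp: cotangent_def algebra_simps)

lemma cotangent_subspace_sum: "(\<And>i. i \<in> I \<Longrightarrow> v i \<in> cotangent A p) \<Longrightarrow> sum v I \<in> cotangent A p"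
  by (induction I rule: infinite_finite_induct) (simp_all add: cotangent_subspace)

lemma cotangent_eqI:
  "a \<in> cotangent A p \<Longrightarrow> b \<in> cotangent A p \<Longrightarrow> (\<And>v. v \<in> tangent A p \<Longrightarrow> a v = b v) \<Longrightarrow> a = b"
  unfolding fun_eq_iff using cotangent_outside by metis

lemma dif_apply: "p \<in> carrier A \<Longrightarrow> v \<in> tangent A p \<Longrightarrow> dif A f p v = v f"
  by (simp add: dif_def)

lemma dif_outside: "p \<notin> carrier A \<Longrightarrow> dif A f p = 0"
  by (simp add: dif_def fun_eq_iff)

lemma dif_cotangent: "dif A f p \<in> cotangent A p"
proof (cases "p \<in> carrier A")
  case False then show ?thesis using dif_outside cotangent_subspace(3) by simp
next
  case True
  then show ?thesis by (auto simp: cotangent_def dif_apply tangent_subspace dif_def)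
qed

lemma dif_add: "f \<in> Cinf A \<Longrightarrow> g \<in> Cinf A \<Longrightarrow> dif A (f + g) = dif A f + dif A g"
  by (auto simp: fun_eq_iff dif_def tangentD(1))

lemma dif_minus: "f \<in> Cinf A \<Longrightarrow> dif A (- f) = - dif A f"
  by (auto simp: fun_eq_iff dif_def tangentD(4))

lemma dif_scale: "f \<in> Cinf A \<Longrightarrow> dif A (c *\<^sub>R f) = c *\<^sub>R dif A f"
  by (auto simp: fun_eq_iff dif_def tangentD(2))

lemma dif_mult: "f \<in> Cinf A \<Longrightarrow> g \<in> Cinf A \<Longrightarrow> dif A (f * g) = f \<odot> dif A g + g \<odot> dif A f"
  by (auto simp: fun_eq_iff dif_def tangentD(3))

lemma dif_local:
  "f \<in> Cinf A \<Longrightarrow> g \<in> Cinf A \<Longrightarrow> is_open W \<Longrightarrow> p \<in> W \<Longrightarrow> (\<And>q. q \<in> W \<Longrightarrow> f q = g q) \<Longrightarrow> dif A f p = dif A g p"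
  using tangent_local[of _ p f g W] by (auto simp: fun_eq_iff dif_def)

lemma vector_fields_add: "X \<in> vector_fields A \<Longrightarrow> Y \<in> vector_fields A \<Longrightarrow> X + Y \<in> vector_fields A"
  by (auto simp: vector_fields_def tangent_subspace Cinf_pointwise)

lemma vector_fields_scale: "X \<in> vector_fields A \<Longrightarrow> c *\<^sub>R X \<in> vector_fields A"
  by (auto simp: vector_fields_def tangent_subspace Cinf_pointwise)

lemma vector_fields_zero: "0 \<in> vector_fields A"
  by (auto simp: vector_fields_def tangent_subspace Cinf_pointwise)

lemma vector_fields_sum: "(\<And>i. i \<in> I \<Longrightarrow> X i \<in> vector_fields A) \<Longrightarrow> sum X I \<in> vector_fields A"
  by (induction I rule: infinite_finite_induct) (simp_all add: vector_fields_add vector_fields_zero)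

lemma one_formD:
  assumes "\<alpha> \<in> one_forms A"
  shows "\<alpha> p \<in> cotangent A p" "p \<notin> carrier A \<Longrightarrow> \<alpha> p = 0" "X \<in> vector_fields A \<Longrightarrow> (\<lambda>p. \<alpha> p (X p)) \<in> Cinf A"
  using assms cotangent_subspace(3) by (auto simp: one_forms_def) (cases "p \<in> carrier A"; simp)?

lemma one_forms_add: "\<alpha> \<in> one_forms A \<Longrightarrow> \<beta> \<in> one_forms A \<Longrightarrow> \<alpha> + \<beta> \<in> one_forms A"
  by (auto simp: one_forms_def cotangent_subspace Cinf_pointwise)

lemma one_forms_fmul: "f \<in> Cinf A \<Longrightarrow> \<alpha> \<in> one_forms A \<Longrightarrow> f \<odot> \<alpha> \<in> one_forms A"
  by (auto simp: one_forms_def cotangent_subspace Cinf_pointwise)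

lemma one_forms_scale: "\<alpha> \<in> one_forms A \<Longrightarrow> c *\<^sub>R \<alpha> \<in> one_forms A"
  by (auto simp: one_forms_def cotangent_subspace Cinf_pointwise)

lemma one_forms_zero: "0 \<in> one_forms A"
  by (auto simp: one_forms_def cotangent_subspace Cinf_pointwise)

lemma one_forms_minus: "\<alpha> \<in> one_forms A \<Longrightarrow> - \<alpha> \<in> one_forms A"
  using one_forms_scale[of \<alpha> "-1"] by simp

lemma one_forms_diff: "\<alpha> \<in> one_forms A \<Longrightarrow> \<beta> \<in> one_forms A \<Longrightarrow> \<alpha> - \<beta> \<in> one_forms A"
  using one_forms_add[of \<alpha> "- \<beta>"] one_forms_minus by simp

lemma one_forms_sum: "(\<And>i. i \<in> I \<Longrightarrow> \<alpha> i \<in> one_forms A) \<Longrightarrow> sum \<alpha> I \<in> one_forms A"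
  by (induction I rule: infinite_finite_induct) (simp_all add: one_forms_add one_forms_zero)

lemma dif_one_form: "f \<in> Cinf A \<Longrightarrow> dif A f \<in> one_forms A"
proof -
  assume f: "f \<in> Cinf A"
  have "(\<lambda>p. dif A f p (X p)) = (\<lambda>p. X p f)" if "X \<in> vector_fields A" for X
    using that f by (auto simp: fun_eq_iff dif_def vector_fields_def)
  then show ?thesis using f
    by (auto simp: one_forms_def dif_cotangent dif_outside vector_field_Cinf)
qed

section \<open>Coframes, and reduction of statements on 1-forms to forms a dF\<close>

lemma local_coframe:
  assumes p: "p \<in> carrier A"
  obtains W I F D where "is_open W" "p \<in> W" "finite (I :: 'e set)" "\<And>c. c \<in> I \<Longrightarrow> F c \<in> Cinf A"
    "\<And>c. c \<in> I \<Longrightarrow> D c \<in> vector_fields A"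
    "\<And>q v. q \<in> W \<Longrightarrow> v \<in> tangent A q \<Longrightarrow> v = (\<Sum>c\<in>I. v (F c) *\<^sub>R D c q)"
    "\<And>q a. q \<in> W \<Longrightarrow> a \<in> cotangent A q \<Longrightarrow> a = (\<Sum>c\<in>I. a (D c q) *\<^sub>R dif A (F c) q)"
proof -
  obtain W I F D where *: "is_open W" "p \<in> W" "finite (I :: 'e set)" "\<forall>c\<in>I. F c \<in> Cinf A"
    "\<forall>c\<in>I. D c \<in> vector_fields A"
    and e: "\<forall>q\<in>W. \<forall>v\<in>tangent A q. \<forall>f\<in>Cinf A. v f = (\<Sum>c\<in>I. v (F c) * D c q f)"
    using local_frame[OF p] by blast
  have W: "q \<in> carrier A" if "q \<in> W" for q using is_open_subset[OF *(1)] that by auto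
  have D: "D c q \<in> tangent A q" if "c \<in> I" "q \<in> W" for c q
    using vector_field_tangent[of "D c" q] *(5) that W by auto
  have 1: "v = (\<Sum>c\<in>I. v (F c) *\<^sub>R D c q)" if "q \<in> W" "v \<in> tangent A q" for q v
  proof
    fix f show "v f = (\<Sum>c\<in>I. v (F c) *\<^sub>R D c q) f"
    proof (cases "f \<in> Cinf A")
      case True then show ?thesis using e that by (simp add: sum_apply)
    next
      case False
      then show ?thesis using tangent_outside[OF that(2)] tangent_outside[OF D[OF _ that(1)]] by (simp add: sum_apply)
    qed
  qed
  have 2: "a = (\<Sum>c\<in>I. a (D c q) *\<^sub>R dif A (F c) q)" if q: "q \<in> W" and a: "a \<in> cotangent A q" for q a
  proof (rule cotangent_eqI[OF a])
    show "(\<Sum>c\<in>I. a (D c q) *\<^sub>R dif A (F c) q) \<in> cotangent A q"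
      by (intro cotangent_subspace_sum cotangent_subspace dif_cotangent)
    fix v assume v: "v \<in> tangent A q"
    have "a v = a (\<Sum>c\<in>I. v (F c) *\<^sub>R D c q)" using 1[OF q v] by (rule arg_cong)
    also have "\<dots> = (\<Sum>c\<in>I. v (F c) * a (D c q))"
      using D[OF _ q] by (simp add: cotangent_sum[OF a] tangent_subspace cotangent_scale[OF a])
    finally show "a v = (\<Sum>c\<in>I. a (D c q) *\<^sub>R dif A (F c) q) v"
      using W[OF q] v by (simp add: sum_apply dif_apply mult.commute)
  qed
  show ?thesis by (rule that[of W I F D]) (use * in \<open>simp_all add: 1[symmetric] 2[symmetric]\<close>)
qed

text \<open>Guarantees that the \<open>Y\<close> chosen in the definition of \<open>lie_form\<close>
  really extends the tangent vector.\<close>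

lemma exists_field:
  assumes p: "p \<in> carrier A" and v: "v \<in> tangent A p"
  shows "\<exists>Y. Y \<in> vector_fields A \<and> Y p = v"
proof -
  obtain W I F D where *: "is_open W" "p \<in> W" "finite (I :: 'e set)" "\<And>c. c \<in> I \<Longrightarrow> F c \<in> Cinf A"
    "\<And>c. c \<in> I \<Longrightarrow> D c \<in> vector_fields A"
    "\<And>q v. q \<in> W \<Longrightarrow> v \<in> tangent A q \<Longrightarrow> v = (\<Sum>c\<in>I. v (F c) *\<^sub>R D c q)"
    "\<And>q a. q \<in> W \<Longrightarrow> a \<in> cotangent A q \<Longrightarrow> a = (\<Sum>c\<in>I. a (D c q) *\<^sub>R dif A (F c) q)"
    by (rule local_coframe[OF p], rule that)
  have "(\<Sum>c\<in>I. v (F c) *\<^sub>R D c) \<in> vector_fields A"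
    by (intro vector_fields_sum vector_fields_scale *(5))
  moreover have "(\<Sum>c\<in>I. v (F c) *\<^sub>R D c) p = v" using *(6)[OF *(2) v] by (simp add: sum_apply)
  ultimately show ?thesis by blast
qed

lemma exists_dif:
  assumes p: "p \<in> carrier A" and a: "a \<in> cotangent A p"
  shows "\<exists>f. f \<in> Cinf A \<and> dif A f p = a"
proof -
  obtain W I F D where *: "is_open W" "p \<in> W" "finite (I :: 'e set)" "\<And>c. c \<in> I \<Longrightarrow> F c \<in> Cinf A"
    "\<And>c. c \<in> I \<Longrightarrow> D c \<in> vector_fields A"
    "\<And>q v. q \<in> W \<Longrightarrow> v \<in> tangent A q \<Longrightarrow> v = (\<Sum>c\<in>I. v (F c) *\<^sub>R D c q)"
    "\<And>q a. q \<in> W \<Longrightarrow> a \<in> cotangent A q \<Longrightarrow> a = (\<Sum>c\<in>I. a (D c q) *\<^sub>R dif A (F c) q)"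
    by (rule local_coframe[OF p], rule that)
  let ?f = "\<Sum>c\<in>I. a (D c p) *\<^sub>R F c"
  have f: "?f \<in> Cinf A" by (intro Cinf_sum Cinf_scale *(4))
  have "dif A ?f p = (\<Sum>c\<in>I. a (D c p) *\<^sub>R dif A (F c) p)"
  proof (rule cotangent_eqI[OF dif_cotangent])
    show "(\<Sum>c\<in>I. a (D c p) *\<^sub>R dif A (F c) p) \<in> cotangent A p"
      by (intro cotangent_subspace_sum cotangent_subspace dif_cotangent)
    fix v assume v: "v \<in> tangent A p"
    show "dif A ?f p v = (\<Sum>c\<in>I. a (D c p) *\<^sub>R dif A (F c) p) v"
      using v p *(4) by (simp add: dif_apply sum_apply tangent_sum[OF v] Cinf_scale tangent_scale[OF v])
  qed
  then show ?thesis using f *(7)[OF *(2) a] by (intro exI[of _ ?f]) simp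
qed

text \<open>By the coframe, a 1-form agrees near \<open>p\<close> with a finite sum of forms a dF. A
  property that is additive and depends only on the germ at p therefore needs to be checked on a dF
  only.\<close>

lemma one_form_induct [consumes 2, case_names simple add local]:
  assumes \<alpha>: "\<alpha> \<in> one_forms A" and p: "p \<in> carrier A"
    and simple: "\<And>a F. a \<in> Cinf A \<Longrightarrow> F \<in> Cinf A \<Longrightarrow> P (a \<odot> dif A F)"
    and add: "\<And>\<alpha> \<beta>. \<alpha> \<in> one_forms A \<Longrightarrow> \<beta> \<in> one_forms A \<Longrightarrow> P \<alpha> \<Longrightarrow> P \<beta> \<Longrightarrow> P (\<alpha> + \<beta>)"
    and local: "\<And>\<alpha> \<beta> W. \<alpha> \<in> one_forms A \<Longrightarrow> \<beta> \<in> one_forms A \<Longrightarrow> is_open W \<Longrightarrow> p \<in> W \<Longrightarrow>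
      (\<And>q. q \<in> W \<Longrightarrow> \<alpha> q = \<beta> q) \<Longrightarrow> P \<alpha> \<Longrightarrow> P \<beta>"
  shows "P \<alpha>"
proof -
  obtain W I F D where *: "is_open W" "p \<in> W" "finite (I :: 'e set)" "\<And>c. c \<in> I \<Longrightarrow> F c \<in> Cinf A"
    "\<And>c. c \<in> I \<Longrightarrow> D c \<in> vector_fields A"
    "\<And>q v. q \<in> W \<Longrightarrow> v \<in> tangent A q \<Longrightarrow> v = (\<Sum>c\<in>I. v (F c) *\<^sub>R D c q)"
    "\<And>q a. q \<in> W \<Longrightarrow> a \<in> cotangent A q \<Longrightarrow> a = (\<Sum>c\<in>I. a (D c q) *\<^sub>R dif A (F c) q)"
    by (rule local_coframe[OF p], rule that)
  let ?\<beta> = "\<lambda>J. \<Sum>c\<in>J. (\<lambda>q. \<alpha> q (D c q)) \<odot> dif A (F c)"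
  have s: "(\<lambda>q. \<alpha> q (D c q)) \<odot> dif A (F c) \<in> one_forms A" if "c \<in> I" for c
    using that * by (intro one_forms_fmul one_formD(3)[OF \<alpha>] dif_one_form) auto
  have "P (?\<beta> J)" if "J \<subseteq> I" for J
    using finite_subset[OF that *(3)] that
  proof (induction J)
    case empty
    have "P ((0 :: 'a \<Rightarrow> real) \<odot> dif A 0)" by (rule simple[OF Cinf_0 Cinf_0])
    moreover have "(0 :: 'a \<Rightarrow> real) \<odot> dif A 0 = 0" by (simp add: fun_eq_iff)
    ultimately have "P (?\<beta> {})" by (simp only: sum.empty)
    then show ?case .
  next
    case (insert c J)
    have IH: "P (?\<beta> J)" by (rule insert.IH) (use insert.prems in simp)
    have c: "c \<in> I" "J \<subseteq> I" using insert.prems by auto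
    have "P ((\<lambda>q. \<alpha> q (D c q)) \<odot> dif A (F c) + ?\<beta> J)"
      by (rule add[OF s[OF c(1)] one_forms_sum[OF s] simple[OF one_formD(3)[OF \<alpha> *(5)[OF c(1)]] *(4)[OF c(1)]] IH])
        (use c in auto)
    then have "P (?\<beta> (insert c J))" using insert.hyps by (simp only: sum.insert if_False simp_thms)
    then show ?case .
  qed
  then have "P (?\<beta> I)" by simp
  then show ?thesis
    using *(7)[OF _ one_formD(1)[OF \<alpha>]] s
    by (intro local[OF _ \<alpha> *(1,2), of "?\<beta> I"] one_forms_sum) (auto simp: sum_apply)
qed

lemma vector_field_outside: "X \<in> vector_fields A \<Longrightarrow> f \<notin> Cinf A \<Longrightarrow> X q f = 0"
  using tangent_outside[OF vector_field_tangent] vector_field_zero[of X q] by (cases "q \<in> carrier A") auto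

section \<open>Lie brackets, Lie derivatives of 1-forms and the exterior derivative\<close>

lemma lie_bracket_tangent:
  assumes X: "X \<in> vector_fields A" and Y: "Y \<in> vector_fields A" and p: "p \<in> carrier A"
  shows "lie_bracket X Y p \<in> tangent A p"
proof -
  note Xp = vector_field_tangent[OF X p] and Yp = vector_field_tangent[OF Y p]
  have T: "(\<lambda>q. X q (f + g)) = (\<lambda>q. X q f) + (\<lambda>q. X q g)" "(\<lambda>q. X q (c *\<^sub>R f)) = c *\<^sub>R (\<lambda>q. X q f)"
    "(\<lambda>q. X q (f * g)) = f * (\<lambda>q. X q g) + g * (\<lambda>q. X q f)"
    if X: "X \<in> vector_fields A" and "f \<in> Cinf A" "g \<in> Cinf A" for X f g c
  proof -
    have "X q (f + g) = X q f + X q g \<and> X q (c *\<^sub>R f) = c * X q f \<and> X q (f * g) = f q * X q g + g q * X q f" for q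
      using tangentD(1-3)[OF vector_field_tangent[OF X] that(2,3)] vector_field_zero[OF X, of q]
      by (cases "q \<in> carrier A") auto
    then show "(\<lambda>q. X q (f + g)) = (\<lambda>q. X q f) + (\<lambda>q. X q g)" "(\<lambda>q. X q (c *\<^sub>R f)) = c *\<^sub>R (\<lambda>q. X q f)"
      "(\<lambda>q. X q (f * g)) = f * (\<lambda>q. X q g) + g * (\<lambda>q. X q f)" by auto
  qed
  note C = vector_field_Cinf[OF X] vector_field_Cinf[OF Y] Cinf_mult
  have "lie_bracket X Y p f = 0" if "f \<notin> Cinf A" for f
  proof -
    have "(\<lambda>q. X q f) = 0" "(\<lambda>q. Y q f) = 0"
      by (simp_all add: fun_eq_iff vector_field_outside[OF _ that] X Y)
    then show ?thesis using tangentD(6)[OF Xp Cinf_0 Cinf_0] tangentD(6)[OF Yp Cinf_0 Cinf_0] by (simp add: lie_bracket_def)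
  qed
  then show ?thesis
    unfolding tangent_def lie_bracket_def
    by (simp add: T[OF X] T[OF Y] C tangentD(1-3)[OF Xp] tangentD(1-3)[OF Yp] algebra_simps)
qed

text \<open>The chosen extension depends only on p and v, so a single \<open>Y\<close> serves all
  \<open>X\<close> and \<beta>; additivity in either of them can then be read off.\<close>

lemma lie_form_apply:
  assumes p: "p \<in> carrier A" and v: "v \<in> tangent A p"
  obtains Y where "Y \<in> vector_fields A" "Y p = v"
    "\<And>X \<beta>. lie_form A X \<beta> p v = X p (\<lambda>q. \<beta> q (Y q)) - \<beta> p (lie_bracket X Y p)"
proof -
  let ?Y = "SOME Y. Y \<in> vector_fields A \<and> Y p = v"
  have "?Y \<in> vector_fields A \<and> ?Y p = v" by (rule someI_ex[OF exists_field[OF p v]])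
  then show ?thesis by (intro that[of ?Y]) (auto simp: lie_form_def p v Let_def)
qed

lemma lie_form_outside: "p \<notin> carrier A \<or> v \<notin> tangent A p \<Longrightarrow> lie_form A X \<beta> p v = 0"
  by (auto simp: lie_form_def)

lemma lie_form_add:
  assumes X: "X \<in> vector_fields A" and "\<alpha> \<in> one_forms A" "\<beta> \<in> one_forms A"
  shows "lie_form A X (\<alpha> + \<beta>) = lie_form A X \<alpha> + lie_form A X \<beta>"
proof (intro ext)
  fix p v
  show "lie_form A X (\<alpha> + \<beta>) p v = (lie_form A X \<alpha> + lie_form A X \<beta>) p v"
  proof (cases "p \<in> carrier A \<and> v \<in> tangent A p")
    case False then show ?thesis by (simp add: lie_form_outside)
  next
    case True
    then have p: "p \<in> carrier A" and v: "v \<in> tangent A p" by auto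
    obtain Y where Y: "Y \<in> vector_fields A" "Y p = v"
      "\<And>X \<beta>. lie_form A X \<beta> p v = X p (\<lambda>q. \<beta> q (Y q)) - \<beta> p (lie_bracket X Y p)"
      by (rule lie_form_apply[OF p v], rule that)
    have "X p ((\<lambda>q. \<alpha> q (Y q)) + (\<lambda>q. \<beta> q (Y q))) = X p (\<lambda>q. \<alpha> q (Y q)) + X p (\<lambda>q. \<beta> q (Y q))"
      by (rule tangentD(1)[OF vector_field_tangent[OF X p] one_formD(3)[OF assms(2) Y(1)] one_formD(3)[OF assms(3) Y(1)]])
    then show ?thesis by (simp add: Y(3) plus_fun_def)
  qed
qed

text \<open>The term a X(Y F) cancels, so on these forms the value does not depend on the chosen
  extension \<open>Y\<close>.\<close>

lemma lie_form_simple: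
  assumes X: "X \<in> vector_fields A" and a: "a \<in> Cinf A" and F: "F \<in> Cinf A"
  shows "lie_form A X (a \<odot> dif A F) = (\<lambda>q. X q a) \<odot> dif A F + a \<odot> dif A (\<lambda>q. X q F)"
proof (intro ext)
  fix p v
  show "lie_form A X (a \<odot> dif A F) p v = ((\<lambda>q. X q a) \<odot> dif A F + a \<odot> dif A (\<lambda>q. X q F)) p v"
  proof (cases "p \<in> carrier A \<and> v \<in> tangent A p")
    case False then show ?thesis by (auto simp: lie_form_outside dif_def)
  next
    case True
    then have p: "p \<in> carrier A" and v: "v \<in> tangent A p" by auto
    obtain Y where Y: "Y \<in> vector_fields A" "Y p = v"
      "\<And>X \<beta>. lie_form A X \<beta> p v = X p (\<lambda>q. \<beta> q (Y q)) - \<beta> p (lie_bracket X Y p)"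
      by (rule lie_form_apply[OF p v], rule that)
    have YF: "(\<lambda>q. Y q F) \<in> Cinf A" by (rule vector_field_Cinf[OF Y(1) F])
    have "dif A F q (Y q) = Y q F" for q
      using vector_field_tangent[OF Y(1)] vector_field_zero[OF Y(1)] by (cases "q \<in> carrier A") (auto simp: dif_def)
    then have "(\<lambda>q. (a \<odot> dif A F) q (Y q)) = a * (\<lambda>q. Y q F)" by (simp add: fun_eq_iff)
    then have "X p (\<lambda>q. (a \<odot> dif A F) q (Y q)) = a p * X p (\<lambda>q. Y q F) + v F * X p a"
      using tangentD(3)[OF vector_field_tangent[OF X p] a YF] Y(2) by simp
    moreover have "(a \<odot> dif A F) p (lie_bracket X Y p) = a p * (X p (\<lambda>q. Y q F) - v (\<lambda>q. X q F))"
      using dif_apply[OF p lie_bracket_tangent[OF X Y(1) p]] Y(2) by (simp add: lie_bracket_def)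
    ultimately show ?thesis unfolding Y(3) by (simp add: dif_apply[OF p v] algebra_simps)
  qed
qed

lemma lie_form_local:
  assumes X: "X \<in> vector_fields A" and \<alpha>: "\<alpha> \<in> one_forms A" and \<beta>: "\<beta> \<in> one_forms A"
    and W: "is_open W" "p \<in> W" "\<And>q. q \<in> W \<Longrightarrow> \<alpha> q = \<beta> q"
  shows "lie_form A X \<alpha> p = lie_form A X \<beta> p"
proof
  fix v
  have p: "p \<in> carrier A" using W is_open_subset by auto
  show "lie_form A X \<alpha> p v = lie_form A X \<beta> p v"
  proof (cases "v \<in> tangent A p")
    case False then show ?thesis by (simp add: lie_form_outside)
  next
    case v: True
    obtain Y where Y: "Y \<in> vector_fields A" "Y p = v"
      "\<And>X \<beta>. lie_form A X \<beta> p v = X p (\<lambda>q. \<beta> q (Y q)) - \<beta> p (lie_bracket X Y p)"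
      by (rule lie_form_apply[OF p v], rule that)
    have "X p (\<lambda>q. \<alpha> q (Y q)) = X p (\<lambda>q. \<beta> q (Y q))"
      by (rule tangent_local[OF vector_field_tangent[OF X p] one_formD(3)[OF \<alpha> Y(1)] one_formD(3)[OF \<beta> Y(1)] W(1,2)])
        (use W in auto)
    then show ?thesis using W by (simp add: Y(3))
  qed
qed

text \<open>Linearity in v is not visible from the definition, where an extension is chosen for each
  v separately; it comes from the explicit formula on forms a dF.\<close>

lemma lie_form_cotangent:
  assumes X: "X \<in> vector_fields A" and \<alpha>: "\<alpha> \<in> one_forms A" shows "lie_form A X \<alpha> p \<in> cotangent A p"
proof (cases "p \<in> carrier A")
  case False
  then have "lie_form A X \<alpha> p = 0" by (simp add: fun_eq_iff lie_form_outside)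
  then show ?thesis by (simp add: cotangent_subspace)
next
  case True
  from \<alpha> True show ?thesis
  proof (induction rule: one_form_induct)
    case (simple a F)
    then have "lie_form A X (a \<odot> dif A F) p \<in> cotangent A p"
      unfolding lie_form_simple[OF X simple] by (simp add: cotangent_subspace dif_cotangent)
    then show ?case .
  next
      case (add \<alpha> \<beta>)
    then have "lie_form A X (\<alpha> + \<beta>) p \<in> cotangent A p"
      unfolding lie_form_add[OF X add(1,2)] by (simp add: cotangent_subspace)
    then show ?case .
  next
    case (local \<alpha> \<beta> W) then show ?case using lie_form_local[OF X local(1-5)] by simp
  qed
qed

definition ext_deriv :: "('a \<Rightarrow> 'a cvec) \<Rightarrow> ('a \<Rightarrow> 'a tvec) \<Rightarrow> ('a \<Rightarrow> 'a tvec) \<Rightarrow> 'a \<Rightarrow> real" where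
  "ext_deriv \<alpha> X Y p = X p (\<lambda>q. \<alpha> q (Y q)) - Y p (\<lambda>q. \<alpha> q (X q)) - \<alpha> p (lie_bracket X Y p)"

lemma ext_deriv_add:
  assumes X: "X \<in> vector_fields A" and Y: "Y \<in> vector_fields A" and p: "p \<in> carrier A"
    and \<alpha>: "\<alpha> \<in> one_forms A" and \<beta>: "\<beta> \<in> one_forms A"
  shows "ext_deriv (\<alpha> + \<beta>) X Y p = ext_deriv \<alpha> X Y p + ext_deriv \<beta> X Y p"
  using tangentD(1)[OF vector_field_tangent[OF X p] one_formD(3)[OF \<alpha> Y] one_formD(3)[OF \<beta> Y]]
    tangentD(1)[OF vector_field_tangent[OF Y p] one_formD(3)[OF \<alpha> X] one_formD(3)[OF \<beta> X]]
  by (simp add: ext_deriv_def plus_fun_def)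

text \<open>On a dF the value is X(a) Y(F) - Y(a) X(F), which involves only the vectors at p.
  Arbitrary fields can thus be replaced by Hamiltonian ones with the same values.\<close>

lemma ext_deriv_pointwise:
  assumes \<alpha>: "\<alpha> \<in> one_forms A" and p: "p \<in> carrier A"
    and X: "X \<in> vector_fields A" "X' \<in> vector_fields A" "X p = X' p"
    and Y: "Y \<in> vector_fields A" "Y' \<in> vector_fields A" "Y p = Y' p"
  shows "ext_deriv \<alpha> X Y p = ext_deriv \<alpha> X' Y' p"
  using \<alpha> p
proof (induction rule: one_form_induct)
  case (simple a F)
  have "ext_deriv (a \<odot> dif A F) X Y p = X p a * Y p F - Y p a * X p F"
    if X: "X \<in> vector_fields A" and Y: "Y \<in> vector_fields A" for X Y
  proof -
    have e: "(\<lambda>q. (a \<odot> dif A F) q (X q)) = a * (\<lambda>q. X q F)" if X: "X \<in> vector_fields A" for X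
    proof
      fix q show "(a \<odot> dif A F) q (X q) = (a * (\<lambda>q. X q F)) q"
        using vector_field_tangent[OF X] vector_field_zero[OF X] by (cases "q \<in> carrier A") (auto simp: dif_def)
    qed
    show ?thesis unfolding ext_deriv_def e[OF X] e[OF Y]
      using tangentD(3)[OF vector_field_tangent[OF X p] simple(1) vector_field_Cinf[OF Y simple(2)]]
        tangentD(3)[OF vector_field_tangent[OF Y p] simple(1) vector_field_Cinf[OF X simple(2)]]
      by (simp add: dif_apply[OF p lie_bracket_tangent[OF X Y p]] lie_bracket_def algebra_simps)
  qed
  from this[OF X(1) Y(1)] this[OF X(2) Y(2)]
  have "ext_deriv (a \<odot> dif A F) X Y p = ext_deriv (a \<odot> dif A F) X' Y' p" using X(3) Y(3) by simp
  then show ?case .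
next
  case (add \<alpha> \<beta>)
  then have "ext_deriv (\<alpha> + \<beta>) X Y p = ext_deriv (\<alpha> + \<beta>) X' Y' p"
    unfolding ext_deriv_add[OF X(1) Y(1) p add(1,2)] ext_deriv_add[OF X(2) Y(2) p add(1,2)] by (simp only:)
  then show ?case .
next
  case (local \<alpha> \<beta> W)
  have "ext_deriv \<alpha> X Y p = ext_deriv \<beta> X Y p" if X: "X \<in> vector_fields A" and Y: "Y \<in> vector_fields A" for X Y
    using tangent_local[OF vector_field_tangent[OF X p] one_formD(3)[OF local(1) Y] one_formD(3)[OF local(2) Y] local(3,4)]
      tangent_local[OF vector_field_tangent[OF Y p] one_formD(3)[OF local(1) X] one_formD(3)[OF local(2) X] local(3,4)]
      local(4,5) by (simp add: ext_deriv_def)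
  then show ?case using local(6) X Y by simp
qed

lemma closed_forms_iff:
  "\<alpha> \<in> closed_forms A \<longleftrightarrow> \<alpha> \<in> one_forms A \<and>
    (\<forall>X\<in>vector_fields A. \<forall>Y\<in>vector_fields A. \<forall>p\<in>carrier A. ext_deriv \<alpha> X Y p = 0)"
  by (auto simp: closed_forms_def ext_deriv_def)

end

section \<open>Poisson manifolds\<close>

locale poisson_manifold = manifold_on A for A :: "('a, 'e::real_inner) atlas" +
  fixes \<pi> :: "'a bivector"
  assumes poisson: "poisson A \<pi>"
begin

abbreviation pb :: "('a \<Rightarrow> real) \<Rightarrow> ('a \<Rightarrow> real) \<Rightarrow> 'a \<Rightarrow> real" where
  "pb \<equiv> poisson_bracket A \<pi>"

lemma bivector:
  assumes "p \<in> carrier A" "a \<in> cotangent A p" "b \<in> cotangent A p" "c \<in> cotangent A p"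
  shows "\<pi> p (a + b) c = \<pi> p a c + \<pi> p b c" "\<pi> p (r *\<^sub>R a) c = r * \<pi> p a c" "\<pi> p a b = - \<pi> p b a"
    "\<pi> p c (a + b) = \<pi> p c a + \<pi> p c b" "\<pi> p c (r *\<^sub>R a) = r * \<pi> p c a"
proof -
  have *: "\<pi> p (a + b) c = \<pi> p a c + \<pi> p b c \<and> \<pi> p (r *\<^sub>R a) c = r * \<pi> p a c \<and> \<pi> p a b = - \<pi> p b a"
    if "a \<in> cotangent A p" "b \<in> cotangent A p" "c \<in> cotangent A p" for a b c r
    using conjunct1[OF poisson[unfolded poisson_def]] assms(1) that by blast
  show "\<pi> p (a + b) c = \<pi> p a c + \<pi> p b c" "\<pi> p (r *\<^sub>R a) c = r * \<pi> p a c" "\<pi> p a b = - \<pi> p b a"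
    using *[OF assms(2-4)] by auto
  show "\<pi> p c (a + b) = \<pi> p c a + \<pi> p c b"
    using *[of c "a + b" a] *[of c a a] *[of c b a] *[of a b c] assms by (simp add: cotangent_subspace)
  show "\<pi> p c (r *\<^sub>R a) = r * \<pi> p c a"
    using *[of c "r *\<^sub>R a" a] *[of c a a] *[of a a c r] assms by (simp add: cotangent_subspace)
qed

lemma bivector_antisym:
  "p \<in> carrier A \<Longrightarrow> a \<in> cotangent A p \<Longrightarrow> b \<in> cotangent A p \<Longrightarrow> \<pi> p a b = - \<pi> p b a"
  using bivector(3)[of p a b a] by simp

lemma bivector_pair_Cinf: "\<alpha> \<in> one_forms A \<Longrightarrow> \<beta> \<in> one_forms A \<Longrightarrow> bivector_pair A \<pi> \<alpha> \<beta> \<in> Cinf A"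
  using conjunct2[OF poisson[unfolded poisson_def]] by blast

lemma pb_apply: "p \<in> carrier A \<Longrightarrow> pb f g p = \<pi> p (dif A f p) (dif A g p)"
  by (simp add: poisson_bracket_def bivector_pair_def)

lemma pb_outside: "p \<notin> carrier A \<Longrightarrow> pb f g p = 0"
  by (simp add: poisson_bracket_def bivector_pair_def)

lemma pb_Cinf: "f \<in> Cinf A \<Longrightarrow> g \<in> Cinf A \<Longrightarrow> pb f g \<in> Cinf A"
  unfolding poisson_bracket_def by (intro bivector_pair_Cinf dif_one_form)

lemma pb_antisym: "pb g f = - pb f g"
proof
  fix p show "pb g f p = (- pb f g) p"
    using bivector_antisym[OF _ dif_cotangent dif_cotangent, of p g f]
    by (cases "p \<in> carrier A") (simp_all add: pb_apply pb_outside)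
qed

lemma pb_antisym_apply: "pb g f p = - pb f g p"
  using pb_antisym[of g f] by simp

lemma pb_add_right: "g \<in> Cinf A \<Longrightarrow> h \<in> Cinf A \<Longrightarrow> pb f (g + h) = pb f g + pb f h"
proof
  fix p assume "g \<in> Cinf A" "h \<in> Cinf A"
  then show "pb f (g + h) p = (pb f g + pb f h) p"
    using bivector(4)[of p "dif A g p" "dif A h p" "dif A f p"] dif_cotangent[of _ p]
    by (cases "p \<in> carrier A") (simp_all add: pb_apply pb_outside dif_add)
qed

lemma pb_scale_right: "g \<in> Cinf A \<Longrightarrow> pb f (c *\<^sub>R g) = c *\<^sub>R pb f g"
proof
  fix p assume "g \<in> Cinf A"
  then show "pb f (c *\<^sub>R g) p = (c *\<^sub>R pb f g) p"
    using bivector(5)[of p "dif A g p" "dif A g p" "dif A f p" c] dif_cotangent[of _ p]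
    by (cases "p \<in> carrier A") (simp_all add: pb_apply pb_outside dif_scale)
qed

lemma pb_mult_right: "g \<in> Cinf A \<Longrightarrow> h \<in> Cinf A \<Longrightarrow> pb f (g * h) = g * pb f h + h * pb f g"
proof
  fix p assume "g \<in> Cinf A" "h \<in> Cinf A"
  then show "pb f (g * h) p = (g * pb f h + h * pb f g) p"
    using bivector(4)[of p "g p *\<^sub>R dif A h p" "h p *\<^sub>R dif A g p" "dif A f p"]
      bivector(5)[of p "dif A g p" "dif A g p" "dif A f p" "h p"]
      bivector(5)[of p "dif A h p" "dif A h p" "dif A f p" "g p"] dif_cotangent[of _ p]
    by (cases "p \<in> carrier A") (simp_all add: pb_apply pb_outside dif_mult cotangent_subspace)
qed

lemma pb_add_left: "g \<in> Cinf A \<Longrightarrow> h \<in> Cinf A \<Longrightarrow> pb (g + h) f = pb g f + pb h f"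
  using pb_add_right[of g h f] pb_antisym[of "g + h" f] pb_antisym[of g f] pb_antisym[of h f] by simp

lemma pb_scale_left: "g \<in> Cinf A \<Longrightarrow> pb (c *\<^sub>R g) f = c *\<^sub>R pb g f"
  using pb_scale_right[of g f c] pb_antisym[of "c *\<^sub>R g" f] pb_antisym[of g f] by simp

lemma pb_jacobi:
  "f \<in> Cinf A \<Longrightarrow> g \<in> Cinf A \<Longrightarrow> h \<in> Cinf A \<Longrightarrow> pb f (pb g h) + pb g (pb h f) + pb h (pb f g) = 0"
  using conjunct2[OF poisson[unfolded poisson_def]] by blast

lemma pb_jacobi_apply:
  "f \<in> Cinf A \<Longrightarrow> g \<in> Cinf A \<Longrightarrow> h \<in> Cinf A \<Longrightarrow> pb (pb f g) h p = pb f (pb g h) p - pb g (pb f h) p"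
  using fun_cong[OF pb_jacobi[of f g h], of p] pb_antisym_apply[of "pb f g" h p]
    pb_scale_right[of "pb f h" g "-1"] pb_antisym[of h f] pb_Cinf[of f h] by simp

lemma pb_local:
  assumes "g \<in> Cinf A" "h \<in> Cinf A" "is_open W" "p \<in> W" "\<And>q. q \<in> W \<Longrightarrow> g q = h q"
  shows "pb f g p = pb f h p" "pb g f p = pb h f p"
proof -
  have "p \<in> carrier A" using assms is_open_subset by auto
  then show "pb f g p = pb f h p" "pb g f p = pb h f p"
    using dif_local[OF assms] by (simp_all add: pb_apply)
qed

lemma sharp_at_apply: "p \<in> carrier A \<Longrightarrow> f \<in> Cinf A \<Longrightarrow> sharp_at A \<pi> p a f = \<pi> p a (dif A f p)"
  by (simp add: sharp_at_def)

lemma sharp_at_tangent: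
  assumes p: "p \<in> carrier A" and a: "a \<in> cotangent A p" shows "sharp_at A \<pi> p a \<in> tangent A p"
  using bivector(4)[OF p _ _ a] bivector(5)[OF p dif_cotangent dif_cotangent a] p dif_cotangent[of _ p]
  by (auto simp: tangent_def sharp_at_def dif_add dif_scale dif_mult Cinf_add Cinf_mult Cinf_scale cotangent_subspace)

lemma pair_sharp:
  assumes p: "p \<in> carrier A" and a: "a \<in> cotangent A p" and b: "b \<in> cotangent A p"
  shows "b (sharp_at A \<pi> p a) = \<pi> p a b"
proof -
  obtain f where f: "f \<in> Cinf A" "dif A f p = b" using exists_dif[OF p b] by auto
  then show ?thesis using dif_apply[OF p sharp_at_tangent[OF p a], of f] sharp_at_apply[OF p f(1)] by simp
qed

lemma sharp_at_linear:
  assumes p: "p \<in> carrier A" and a: "a \<in> cotangent A p" and b: "b \<in> cotangent A p"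
  shows "sharp_at A \<pi> p (a + b) = sharp_at A \<pi> p a + sharp_at A \<pi> p b"
    "sharp_at A \<pi> p (c *\<^sub>R a) = c *\<^sub>R sharp_at A \<pi> p a"
  using bivector(1)[OF p a b dif_cotangent] bivector(2)[OF p a b dif_cotangent]
  by (auto simp: fun_eq_iff sharp_at_def)

lemma sharp_apply: "sharp A \<pi> \<alpha> p f = (if f \<in> Cinf A then bivector_pair A \<pi> \<alpha> (dif A f) p else 0)"
  by (simp add: sharp_def sharp_at_def bivector_pair_def)

lemma sharp_dif: "f \<in> Cinf A \<Longrightarrow> sharp A \<pi> (dif A F) p f = pb F f p"
  by (simp add: sharp_apply poisson_bracket_def)

lemma sharp_vector_field: "\<alpha> \<in> one_forms A \<Longrightarrow> sharp A \<pi> \<alpha> \<in> vector_fields A"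
proof -
  assume \<alpha>: "\<alpha> \<in> one_forms A"
  have "sharp A \<pi> \<alpha> p = 0" if "p \<notin> carrier A" for p
    using that by (simp add: fun_eq_iff sharp_apply bivector_pair_def)
  moreover have "(\<lambda>p. sharp A \<pi> \<alpha> p f) \<in> Cinf A" if "f \<in> Cinf A" for f
    using bivector_pair_Cinf[OF \<alpha> dif_one_form[OF that]] that by (simp add: sharp_apply)
  ultimately show ?thesis
    using sharp_at_tangent one_formD(1)[OF \<alpha>] by (auto simp: vector_fields_def sharp_def)
qed

lemma sharp_add:
  "\<alpha> \<in> one_forms A \<Longrightarrow> \<beta> \<in> one_forms A \<Longrightarrow> sharp A \<pi> (\<alpha> + \<beta>) = sharp A \<pi> \<alpha> + sharp A \<pi> \<beta>"
proof (intro ext)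
  fix p f assume "\<alpha> \<in> one_forms A" "\<beta> \<in> one_forms A"
  then show "sharp A \<pi> (\<alpha> + \<beta>) p f = (sharp A \<pi> \<alpha> + sharp A \<pi> \<beta>) p f"
    using bivector(1)[OF _ one_formD(1) one_formD(1) dif_cotangent]
    by (auto simp: sharp_apply bivector_pair_def)
qed

lemma sharp_fmul: "\<alpha> \<in> one_forms A \<Longrightarrow> sharp A \<pi> (a \<odot> \<alpha>) = a \<odot> sharp A \<pi> \<alpha>"
proof (intro ext)
  fix p f assume "\<alpha> \<in> one_forms A"
  then show "sharp A \<pi> (a \<odot> \<alpha>) p f = (a \<odot> sharp A \<pi> \<alpha>) p f"
    using bivector(2)[OF _ one_formD(1) one_formD(1) dif_cotangent, of p \<alpha> \<alpha> "a p" f]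
    by (auto simp: sharp_apply bivector_pair_def)
qed

lemma sharp_scale: "\<alpha> \<in> one_forms A \<Longrightarrow> sharp A \<pi> (c *\<^sub>R \<alpha>) = c *\<^sub>R sharp A \<pi> \<alpha>"
proof (intro ext)
  fix p f assume "\<alpha> \<in> one_forms A"
  then show "sharp A \<pi> (c *\<^sub>R \<alpha>) p f = (c *\<^sub>R sharp A \<pi> \<alpha>) p f"
    using bivector(2)[OF _ one_formD(1) one_formD(1) dif_cotangent, of p \<alpha> \<alpha> c f]
    by (auto simp: sharp_apply bivector_pair_def)
qed

lemma bivector_pair_linear:
  assumes "\<alpha> \<in> one_forms A" "\<beta> \<in> one_forms A" "\<gamma> \<in> one_forms A"
  shows "bivector_pair A \<pi> (\<alpha> + \<beta>) \<gamma> = bivector_pair A \<pi> \<alpha> \<gamma> + bivector_pair A \<pi> \<beta> \<gamma>"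
    "bivector_pair A \<pi> \<gamma> (\<alpha> + \<beta>) = bivector_pair A \<pi> \<gamma> \<alpha> + bivector_pair A \<pi> \<gamma> \<beta>"
    "bivector_pair A \<pi> (f \<odot> \<alpha>) \<gamma> = f * bivector_pair A \<pi> \<alpha> \<gamma>"
    "bivector_pair A \<pi> \<gamma> (f \<odot> \<alpha>) = f * bivector_pair A \<pi> \<gamma> \<alpha>"
    "bivector_pair A \<pi> \<alpha> \<beta> = - bivector_pair A \<pi> \<beta> \<alpha>"
proof -
  have "bivector_pair A \<pi> (\<alpha> + \<beta>) \<gamma> p = bivector_pair A \<pi> \<alpha> \<gamma> p + bivector_pair A \<pi> \<beta> \<gamma> p \<and>
    bivector_pair A \<pi> \<gamma> (\<alpha> + \<beta>) p = bivector_pair A \<pi> \<gamma> \<alpha> p + bivector_pair A \<pi> \<gamma> \<beta> p \<and>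
    bivector_pair A \<pi> (f \<odot> \<alpha>) \<gamma> p = f p * bivector_pair A \<pi> \<alpha> \<gamma> p \<and>
    bivector_pair A \<pi> \<gamma> (f \<odot> \<alpha>) p = f p * bivector_pair A \<pi> \<gamma> \<alpha> p \<and>
    bivector_pair A \<pi> \<alpha> \<beta> p = - bivector_pair A \<pi> \<beta> \<alpha> p" for p
    using bivector[OF _ one_formD(1)[OF assms(1)] one_formD(1)[OF assms(2)] one_formD(1)[OF assms(3)], of p]
    by (simp add: bivector_pair_def)
  then show "bivector_pair A \<pi> (\<alpha> + \<beta>) \<gamma> = bivector_pair A \<pi> \<alpha> \<gamma> + bivector_pair A \<pi> \<beta> \<gamma>"
    "bivector_pair A \<pi> \<gamma> (\<alpha> + \<beta>) = bivector_pair A \<pi> \<gamma> \<alpha> + bivector_pair A \<pi> \<gamma> \<beta>"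
    "bivector_pair A \<pi> (f \<odot> \<alpha>) \<gamma> = f * bivector_pair A \<pi> \<alpha> \<gamma>"
    "bivector_pair A \<pi> \<gamma> (f \<odot> \<alpha>) = f * bivector_pair A \<pi> \<gamma> \<alpha>"
    "bivector_pair A \<pi> \<alpha> \<beta> = - bivector_pair A \<pi> \<beta> \<alpha>" by (simp_all add: fun_eq_iff)
qed

subsection \<open>The bracket of one-forms\<close>

abbreviation fb :: "('a \<Rightarrow> 'a cvec) \<Rightarrow> ('a \<Rightarrow> 'a cvec) \<Rightarrow> 'a \<Rightarrow> 'a cvec" where
  "fb \<equiv> form_bracket A \<pi>"

lemma fb_antisym:
  assumes "\<alpha> \<in> one_forms A" "\<beta> \<in> one_forms A" shows "fb \<beta> \<alpha> = - fb \<alpha> \<beta>"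
  unfolding form_bracket_def bivector_pair_linear(5)[OF assms(2,1,1)]
    dif_minus[OF bivector_pair_Cinf[OF assms]] by simp

lemma lie_form_add_field:
  assumes X: "X \<in> vector_fields A" and Y: "Y \<in> vector_fields A" and \<alpha>: "\<alpha> \<in> one_forms A"
  shows "lie_form A (X + Y) \<alpha> = lie_form A X \<alpha> + lie_form A Y \<alpha>"
proof (intro ext)
  fix p v
  show "lie_form A (X + Y) \<alpha> p v = (lie_form A X \<alpha> + lie_form A Y \<alpha>) p v"
  proof (cases "p \<in> carrier A \<and> v \<in> tangent A p")
    case False then show ?thesis by (simp add: lie_form_outside)
  next
    case True
    then have p: "p \<in> carrier A" and v: "v \<in> tangent A p" by auto
    obtain Z where Z: "Z \<in> vector_fields A" "Z p = v"
      "\<And>X \<beta>. lie_form A X \<beta> p v = X p (\<lambda>q. \<beta> q (Z q)) - \<beta> p (lie_bracket X Z p)"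
      by (rule lie_form_apply[OF p v], rule that)
    have "lie_bracket (X + Y) Z p = lie_bracket X Z p + lie_bracket Y Z p"
    proof
      fix f
      show "lie_bracket (X + Y) Z p f = (lie_bracket X Z p + lie_bracket Y Z p) f"
      proof (cases "f \<in> Cinf A")
        case True
        then show ?thesis
          using tangentD(1)[OF vector_field_tangent[OF Z(1) p] vector_field_Cinf[OF X True] vector_field_Cinf[OF Y True]]
          by (simp add: lie_bracket_def plus_fun_def)
      next
        case False
        then show ?thesis
          using tangent_outside[OF lie_bracket_tangent[OF _ Z(1) p] False] X Y vector_fields_add[OF X Y] by simp
      qed
    qed
    then show ?thesis
      using cotangentD(1)[OF one_formD(1)[OF \<alpha>] lie_bracket_tangent[OF X Z(1) p] lie_bracket_tangent[OF Y Z(1) p]]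
      by (simp add: Z(3))
  qed
qed

lemma fb_add_right:
  assumes \<alpha>: "\<alpha> \<in> one_forms A" and \<beta>: "\<beta> \<in> one_forms A" and \<gamma>: "\<gamma> \<in> one_forms A"
  shows "fb \<alpha> (\<beta> + \<gamma>) = fb \<alpha> \<beta> + fb \<alpha> \<gamma>"
  unfolding form_bracket_def sharp_add[OF \<beta> \<gamma>] bivector_pair_linear(2)[OF \<beta> \<gamma> \<alpha>]
    lie_form_add[OF sharp_vector_field[OF \<alpha>] \<beta> \<gamma>]
    lie_form_add_field[OF sharp_vector_field[OF \<beta>] sharp_vector_field[OF \<gamma>] \<alpha>]
    dif_add[OF bivector_pair_Cinf[OF \<alpha> \<beta>] bivector_pair_Cinf[OF \<alpha> \<gamma>]] by simp

lemma fb_add_left: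
  assumes \<alpha>: "\<alpha> \<in> one_forms A" and \<beta>: "\<beta> \<in> one_forms A" and \<gamma>: "\<gamma> \<in> one_forms A"
  shows "fb (\<beta> + \<gamma>) \<alpha> = fb \<beta> \<alpha> + fb \<gamma> \<alpha>"
  using fb_add_right[OF assms] fb_antisym[OF \<alpha>] \<beta> \<gamma> one_forms_add[OF \<beta> \<gamma>] by simp

lemma fb_local:
  assumes \<alpha>: "\<alpha> \<in> one_forms A" and \<beta>: "\<beta> \<in> one_forms A" and \<gamma>: "\<gamma> \<in> one_forms A"
    and W: "is_open W" "p \<in> W" "\<And>q. q \<in> W \<Longrightarrow> \<beta> q = \<gamma> q"
  shows "fb \<alpha> \<beta> p = fb \<alpha> \<gamma> p" "fb \<beta> \<alpha> p = fb \<gamma> \<alpha> p"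
proof -
  have p: "p \<in> carrier A" using W is_open_subset by auto
  have sh: "sharp A \<pi> \<beta> q = sharp A \<pi> \<gamma> q" if "q \<in> W" for q using W(3)[OF that] by (simp add: sharp_def)
  note sb = sharp_vector_field[OF \<beta>] and sg = sharp_vector_field[OF \<gamma>]
  have "lie_form A (sharp A \<pi> \<beta>) \<alpha> p v = lie_form A (sharp A \<pi> \<gamma>) \<alpha> p v" for v
  proof (cases "v \<in> tangent A p")
    case False then show ?thesis by (simp add: lie_form_outside)
  next
    case v: True
    obtain Y where Y: "Y \<in> vector_fields A" "Y p = v"
      "\<And>X \<beta>. lie_form A X \<beta> p v = X p (\<lambda>q. \<beta> q (Y q)) - \<beta> p (lie_bracket X Y p)"
      by (rule lie_form_apply[OF p v], rule that)
    have "lie_bracket (sharp A \<pi> \<beta>) Y p = lie_bracket (sharp A \<pi> \<gamma>) Y p"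
    proof
      fix f
      show "lie_bracket (sharp A \<pi> \<beta>) Y p f = lie_bracket (sharp A \<pi> \<gamma>) Y p f"
      proof (cases "f \<in> Cinf A")
        case True
        have "Y p (\<lambda>q. sharp A \<pi> \<beta> q f) = Y p (\<lambda>q. sharp A \<pi> \<gamma> q f)"
          by (rule tangent_local[OF vector_field_tangent[OF Y(1) p] vector_field_Cinf[OF sb True] vector_field_Cinf[OF sg True] W(1,2)])
            (simp add: sh)
        then show ?thesis using sh[OF W(2)] by (simp add: lie_bracket_def)
      next
        case False
        then show ?thesis
          using tangent_outside[OF lie_bracket_tangent[OF _ Y(1) p] False] sb sg by simp
      qed
    qed
    then show ?thesis using sh[OF W(2)] by (simp add: Y(3))
  qed
  then have 1: "lie_form A (sharp A \<pi> \<beta>) \<alpha> p = lie_form A (sharp A \<pi> \<gamma>) \<alpha> p" by (rule ext)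
  have "dif A (bivector_pair A \<pi> \<alpha> \<beta>) p = dif A (bivector_pair A \<pi> \<alpha> \<gamma>) p"
    by (rule dif_local[OF bivector_pair_Cinf[OF \<alpha> \<beta>] bivector_pair_Cinf[OF \<alpha> \<gamma>] W(1,2)])
      (simp add: bivector_pair_def W(3))
  then show r: "fb \<alpha> \<beta> p = fb \<alpha> \<gamma> p"
    using 1 lie_form_local[OF sharp_vector_field[OF \<alpha>] \<beta> \<gamma> W] by (simp add: form_bracket_def)
  show "fb \<beta> \<alpha> p = fb \<gamma> \<alpha> p" using fb_antisym[OF \<alpha> \<beta>] fb_antisym[OF \<alpha> \<gamma>] r by simp
qed

text \<open>The terms with da and db produced by the two Lie derivatives cancel against those of d(a
  b {F, G}), while d{F, G} occurs twice and is subtracted once.\<close>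

lemma fb_simple:
  assumes a: "a \<in> Cinf A" and F: "F \<in> Cinf A" and b: "b \<in> Cinf A" and G: "G \<in> Cinf A"
  shows "fb (a \<odot> dif A F) (b \<odot> dif A G) =
    (a * b) \<odot> dif A (pb F G) + (a * pb F b) \<odot> dif A G - (b * pb G a) \<odot> dif A F"
proof -
  have X: "sharp A \<pi> (a \<odot> dif A F) \<in> vector_fields A" "(\<lambda>q. sharp A \<pi> (a \<odot> dif A F) q f) = a * pb F f"
    if "f \<in> Cinf A" "a \<in> Cinf A" "F \<in> Cinf A" for f F a
    using that sharp_vector_field[OF one_forms_fmul[OF _ dif_one_form]]
    by (auto simp: fun_eq_iff sharp_fmul[OF dif_one_form] sharp_dif)
  have p: "bivector_pair A \<pi> (a \<odot> dif A F) (b \<odot> dif A G) = (a * b) * pb F G"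
    unfolding bivector_pair_linear(3)[OF dif_one_form[OF F] dif_one_form[OF F] one_forms_fmul[OF b dif_one_form[OF G]]]
      bivector_pair_linear(4)[OF dif_one_form[OF G] dif_one_form[OF F] dif_one_form[OF F]]
    by (simp add: poisson_bracket_def mult_ac)
  have "dif A (a * b * pb F G) = (a * b) \<odot> dif A (pb F G) + (pb F G * a) \<odot> dif A b + (pb F G * b) \<odot> dif A a"
    using a b F G by (simp add: dif_mult Cinf_mult pb_Cinf fmul_distrib)
  moreover have "lie_form A (sharp A \<pi> (a \<odot> dif A F)) (b \<odot> dif A G) =
      (a * pb F b) \<odot> dif A G + (b * a) \<odot> dif A (pb F G) + (b * pb F G) \<odot> dif A a"
    using a b F G by (simp add: lie_form_simple X dif_mult pb_Cinf fmul_distrib)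
  moreover have "lie_form A (sharp A \<pi> (b \<odot> dif A G)) (a \<odot> dif A F) =
      (b * pb G a) \<odot> dif A F - (a * b) \<odot> dif A (pb F G) - (a * pb F G) \<odot> dif A b"
    using a b F G pb_antisym[of G F] dif_minus[OF pb_Cinf[OF F G], folded pb_antisym[of G F]]
    by (simp add: lie_form_simple X dif_mult dif_minus Cinf_minus pb_Cinf fmul_distrib fun_eq_iff algebra_simps)
  ultimately show ?thesis unfolding form_bracket_def p by (simp add: fun_eq_iff algebra_simps)
qed

text \<open>Every dF equals unit dF, and the bracket of any function with the unit is 0, so this is
  a special case of \<open>fb_simple\<close>.\<close>

lemma fb_dif: "F \<in> Cinf A \<Longrightarrow> G \<in> Cinf A \<Longrightarrow> fb (dif A F) (dif A G) = dif A (pb F G)"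
proof -
  assume F: "F \<in> Cinf A" and G: "G \<in> Cinf A"
  have u: "dif A F = unit \<odot> dif A F" for F by (auto simp: fun_eq_iff unit_def dif_outside)
  have z: "pb F unit = 0" for F
  proof
    fix p show "pb F unit p = 0 p"
    proof (cases "p \<in> carrier A")
      case True
      have "dif A unit p = 0" using tangent_const[of _ p] True by (auto simp: fun_eq_iff dif_def)
      then show ?thesis using True bivector(2)[OF True cotangent_subspace(3) cotangent_subspace(3) dif_cotangent, of 0]
          pb_antisym_apply[of F unit p] by (simp add: pb_apply)
    qed (simp add: pb_outside)
  qed
  have uu: "unit * unit = unit" by (simp add: unit_def fun_eq_iff)
  have "fb (unit \<odot> dif A F) (unit \<odot> dif A G) = unit \<odot> dif A (pb F G)"
    unfolding fb_simple[OF Cinf_unit F Cinf_unit G] z uu by (simp add: fun_eq_iff)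
  then show ?thesis using u[of F] u[of G] u[of "pb F G"] by simp
qed

subsection \<open>Poisson vector fields\<close>

definition pb_derivation :: "('a \<Rightarrow> 'a tvec) \<Rightarrow> bool" where
  "pb_derivation v \<longleftrightarrow> (\<forall>f\<in>Cinf A. \<forall>g\<in>Cinf A. \<forall>p\<in>carrier A.
     v p (pb f g) = pb (\<lambda>q. v q f) g p + pb f (\<lambda>q. v q g) p)"

lemma lie_form_dif: "X \<in> vector_fields A \<Longrightarrow> F \<in> Cinf A \<Longrightarrow> lie_form A X (dif A F) = dif A (\<lambda>q. X q F)"
proof -
  assume X: "X \<in> vector_fields A" and F: "F \<in> Cinf A"
  have u: "dif A F = unit \<odot> dif A F" for F by (auto simp: fun_eq_iff unit_def dif_outside)
  have "(\<lambda>q. X q unit) = 0"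
    using tangent_const[OF vector_field_tangent[OF X]] vector_field_zero[OF X]
    by (metis ext zero_fun_apply)
  then show ?thesis
    using lie_form_simple[OF X Cinf_unit F] u[of F] u[of "\<lambda>q. X q F"] by (simp add: fun_eq_iff)
qed

text \<open>\<open>N \<alpha> \<beta>\<close> is the Lie derivative of \<pi> along v, antisymmetric
  and tensorial in the forms; on df and dg it is the defect of v from being a derivation of the
  bracket. So it suffices that it vanishes on differentials.\<close>

lemma poisson_fields_iff:
  "v \<in> poisson_fields A \<pi> \<longleftrightarrow> v \<in> vector_fields A \<and> pb_derivation v"
proof (cases "v \<in> vector_fields A")
  case False then show ?thesis by (simp add: poisson_fields_def)
next
  case v: True
  define N where "N \<alpha> \<beta> p = v p (bivector_pair A \<pi> \<alpha> \<beta>) - bivector_pair A \<pi> (lie_form A v \<alpha>) \<beta> p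
      - bivector_pair A \<pi> \<alpha> (lie_form A v \<beta>) p" for \<alpha> \<beta> p
  have P: "v \<in> poisson_fields A \<pi> \<longleftrightarrow> (\<forall>\<alpha>\<in>one_forms A. \<forall>\<beta>\<in>one_forms A. \<forall>p\<in>carrier A. N \<alpha> \<beta> p = 0)"
    using v by (simp add: poisson_fields_def N_def)
  have Nsym: "N \<alpha> \<beta> p = - N \<beta> \<alpha> p" if "\<alpha> \<in> one_forms A" "\<beta> \<in> one_forms A" "p \<in> carrier A" for \<alpha> \<beta> p
  proof -
    have "\<pi> p (lie_form A v \<alpha> p) (\<beta> p) = - \<pi> p (\<beta> p) (lie_form A v \<alpha> p)"
      "\<pi> p (\<alpha> p) (lie_form A v \<beta> p) = - \<pi> p (lie_form A v \<beta> p) (\<alpha> p)"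
      by (intro bivector_antisym[OF that(3)] lie_form_cotangent[OF v] one_formD(1) that)+
    then show ?thesis
      using bivector_pair_linear(5)[OF that(1,2,1)] that(3)
        tangentD(4)[OF vector_field_tangent[OF v that(3)] bivector_pair_Cinf[OF that(2,1)] Cinf_0]
      by (simp add: N_def bivector_pair_def[of A \<pi> _ _ p])
  qed
  have Nadd: "N (\<alpha> + \<beta>) \<gamma> p = N \<alpha> \<gamma> p + N \<beta> \<gamma> p"
    if "\<alpha> \<in> one_forms A" "\<beta> \<in> one_forms A" "\<gamma> \<in> one_forms A" "p \<in> carrier A" for \<alpha> \<beta> \<gamma> p
    using bivector(1)[OF that(4) lie_form_cotangent[OF v that(1)] lie_form_cotangent[OF v that(2)] one_formD(1)[OF that(3)]]
      bivector(1)[OF that(4) one_formD(1)[OF that(1)] one_formD(1)[OF that(2)] lie_form_cotangent[OF v that(3)]]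
      tangentD(1)[OF vector_field_tangent[OF v that(4)] bivector_pair_Cinf[OF that(1,3)] bivector_pair_Cinf[OF that(2,3)]]
    by (simp add: N_def bivector_pair_linear(1)[OF that(1-3)] lie_form_add[OF v that(1,2)])
      (simp add: bivector_pair_def that(4))
  have Nloc: "N \<alpha> \<gamma> p = N \<beta> \<gamma> p"
    if "\<alpha> \<in> one_forms A" "\<beta> \<in> one_forms A" "is_open W" "p \<in> W" "\<And>q. q \<in> W \<Longrightarrow> \<alpha> q = \<beta> q" "\<gamma> \<in> one_forms A"
    for \<alpha> \<beta> \<gamma> p W
  proof -
    have p: "p \<in> carrier A" using that is_open_subset by auto
    have "v p (bivector_pair A \<pi> \<alpha> \<gamma>) = v p (bivector_pair A \<pi> \<beta> \<gamma>)"
      by (rule tangent_local[OF vector_field_tangent[OF v p] bivector_pair_Cinf[OF that(1,6)] bivector_pair_Cinf[OF that(2,6)] that(3,4)])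
        (simp add: bivector_pair_def that(5))
    then show ?thesis
      using lie_form_local[OF v that(1-5)] that(5)[OF that(4)] by (simp add: N_def bivector_pair_def[of A \<pi> _ _ p])
  qed
  have Nd: "N (dif A f) (dif A g) p = v p (pb f g) - pb (\<lambda>q. v q f) g p - pb f (\<lambda>q. v q g) p"
    if "f \<in> Cinf A" "g \<in> Cinf A" for f g p
    using that by (simp add: N_def lie_form_dif[OF v] poisson_bracket_def)
  have Nf: "N (a \<odot> \<alpha>) \<gamma> p = a p * N \<alpha> \<gamma> p"
    if "a \<in> Cinf A" "f \<in> Cinf A" "\<alpha> = dif A f" "\<gamma> \<in> one_forms A" "p \<in> carrier A" for a f \<alpha> \<gamma> p
  proof -
    have \<alpha>: "\<alpha> \<in> one_forms A" using that dif_one_form by simp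
    have L: "lie_form A v (a \<odot> \<alpha>) p = v p a *\<^sub>R \<alpha> p + a p *\<^sub>R lie_form A v \<alpha> p"
      unfolding that(3) lie_form_simple[OF v that(1,2)] lie_form_dif[OF v that(2)] by simp
    have "bivector_pair A \<pi> (lie_form A v (a \<odot> \<alpha>)) \<gamma> p =
        v p a * bivector_pair A \<pi> \<alpha> \<gamma> p + a p * bivector_pair A \<pi> (lie_form A v \<alpha>) \<gamma> p"
      unfolding bivector_pair_def L using that(5)
        bivector(1)[OF that(5) cotangent_subspace(2)[OF one_formD(1)[OF \<alpha>]]
          cotangent_subspace(2)[OF lie_form_cotangent[OF v \<alpha>]] one_formD(1)[OF that(4)]]
        bivector(2)[OF that(5) one_formD(1)[OF \<alpha>] one_formD(1)[OF \<alpha>] one_formD(1)[OF that(4)]]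
        bivector(2)[OF that(5) lie_form_cotangent[OF v \<alpha>] one_formD(1)[OF \<alpha>] one_formD(1)[OF that(4)]]
      by simp
    moreover have "bivector_pair A \<pi> (a \<odot> \<alpha>) (lie_form A v \<gamma>) p = a p * bivector_pair A \<pi> \<alpha> (lie_form A v \<gamma>) p"
      unfolding bivector_pair_def using that(5)
        bivector(2)[OF that(5) one_formD(1)[OF \<alpha>] one_formD(1)[OF \<alpha>] lie_form_cotangent[OF v that(4)]]
      by simp
    ultimately show ?thesis
      using tangentD(3)[OF vector_field_tangent[OF v that(5)] that(1) bivector_pair_Cinf[OF \<alpha> that(4)]]
      by (simp add: N_def bivector_pair_linear(3)[OF \<alpha> \<alpha> that(4)] algebra_simps)
  qed
  \<comment> \<open>Reduces the first argument to differentials; antisymmetry lets the same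
    statement treat the second one.\<close>
  have main: "N \<alpha> \<gamma> p = 0"
    if "\<alpha> \<in> one_forms A" "\<gamma> \<in> one_forms A" "p \<in> carrier A" "\<And>f. f \<in> Cinf A \<Longrightarrow> N (dif A f) \<gamma> p = 0" for \<alpha> \<gamma> p
    using that(1,3)
  proof (induction rule: one_form_induct)
    case (simple a F)
    have "N (a \<odot> dif A F) \<gamma> p = 0" using Nf[OF simple refl that(2,3)] that(4)[OF simple(2)] by simp
    then show ?case .
  next
    case (add \<alpha> \<beta>)
    have "N (\<alpha> + \<beta>) \<gamma> p = 0" using Nadd[OF add(1,2) that(2,3)] add(3,4) by simp
    then show ?case .
  next
    case (local \<alpha> \<beta> W) then show ?case using Nloc[OF local(1-5) that(2)] by simp
  qed
  show ?thesis
  proof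
    assume L: "v \<in> poisson_fields A \<pi>"
    have "v p (pb f g) = pb (\<lambda>q. v q f) g p + pb f (\<lambda>q. v q g) p" if "f \<in> Cinf A" "g \<in> Cinf A" "p \<in> carrier A" for f g p
      using Nd[OF that(1,2), of p] L that dif_one_form unfolding P by simp
    then show "v \<in> vector_fields A \<and> pb_derivation v" using v by (auto simp: pb_derivation_def)
  next
    assume "v \<in> vector_fields A \<and> pb_derivation v"
    then have d: "N (dif A f) (dif A g) p = 0" if "f \<in> Cinf A" "g \<in> Cinf A" "p \<in> carrier A" for f g p
      using that Nd[OF that(1,2), of p] by (simp add: pb_derivation_def)
    have "N \<alpha> \<beta> p = 0" if "\<alpha> \<in> one_forms A" "\<beta> \<in> one_forms A" "p \<in> carrier A" for \<alpha> \<beta> p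
    proof (rule main[OF that])
      fix f assume f: "f \<in> Cinf A"
      have "N \<beta> (dif A f) p = 0" by (rule main[OF that(2) dif_one_form[OF f] that(3)]) (rule d[OF _ f that(3)])
      then show "N (dif A f) \<beta> p = 0" using Nsym[OF dif_one_form[OF f] that(2,3)] by simp
    qed
    then show "v \<in> poisson_fields A \<pi>" unfolding P by blast
  qed
qed

text \<open>Write X_f for the Hamiltonian field of f. Then \<alpha>(X_g) = - u(g), and [X_f, X_g] is
  the Hamiltonian field of {f, g} by the Jacobi identity. The formula links closedness of \<alpha>
  with the Poisson property of u.\<close>

lemma ext_deriv_hamiltonian:
  assumes \<alpha>: "\<alpha> \<in> one_forms A" and f: "f \<in> Cinf A" and g: "g \<in> Cinf A" and p: "p \<in> carrier A"
  defines "u \<equiv> sharp A \<pi> \<alpha>"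
  shows "ext_deriv \<alpha> (sharp A \<pi> (dif A f)) (sharp A \<pi> (dif A g)) p =
    u p (pb f g) - pb (\<lambda>q. u q f) g p - pb f (\<lambda>q. u q g) p"
proof -
  have u: "u \<in> vector_fields A" unfolding u_def by (rule sharp_vector_field[OF \<alpha>])
  have e: "\<alpha> q (sharp A \<pi> (dif A g) q) = - u q g" if g: "g \<in> Cinf A" and q: "q \<in> carrier A" for g q
    unfolding sharp_def pair_sharp[OF q dif_cotangent one_formD(1)[OF \<alpha>]]
    using bivector_antisym[OF q dif_cotangent one_formD(1)[OF \<alpha>], of g] q g
    by (simp add: u_def sharp_def sharp_at_def)
  have e': "(\<lambda>q. \<alpha> q (sharp A \<pi> (dif A g) q)) = - (\<lambda>q. u q g)" if g: "g \<in> Cinf A" for g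
  proof
    fix q show "\<alpha> q (sharp A \<pi> (dif A g) q) = (- (\<lambda>q. u q g)) q"
      using e[OF g, of q] one_formD(2)[OF \<alpha>, of q] vector_field_zero[OF u, of q] by (cases "q \<in> carrier A") auto
  qed
  have c: "(\<lambda>q. u q g) \<in> Cinf A" if g: "g \<in> Cinf A" for g by (rule vector_field_Cinf[OF u g])
  have s: "sharp A \<pi> (dif A f) p (- (\<lambda>q. u q g)) = - pb f (\<lambda>q. u q g) p" if g: "g \<in> Cinf A" for f g
    using sharp_dif[OF Cinf_minus[OF c[OF g]], of f p] pb_scale_right[OF c[OF g], of f "-1"] by simp
  have "lie_bracket (sharp A \<pi> (dif A f)) (sharp A \<pi> (dif A g)) p = sharp A \<pi> (dif A (pb f g)) p"
  proof
    fix k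
    show "lie_bracket (sharp A \<pi> (dif A f)) (sharp A \<pi> (dif A g)) p k = sharp A \<pi> (dif A (pb f g)) p k"
    proof (cases "k \<in> Cinf A")
      case True
      have "(\<lambda>q. sharp A \<pi> (dif A g) q k) = pb g k" for g using True by (simp add: sharp_dif fun_eq_iff)
      then show ?thesis
        using pb_jacobi_apply[OF f g True, of p] True f g by (simp add: lie_bracket_def sharp_dif pb_Cinf)
    next
      case False
      then show ?thesis
        using tangent_outside[OF lie_bracket_tangent[OF sharp_vector_field[OF dif_one_form[OF f]] sharp_vector_field[OF dif_one_form[OF g]] p] False]
        by (simp add: sharp_apply)
    qed
  qed
  then show ?thesis
    unfolding ext_deriv_def e'[OF f] e'[OF g] s[OF f] s[OF g]
    using e[OF pb_Cinf[OF f g] p] pb_antisym_apply[of "\<lambda>q. u q f" g p] by simp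
qed

end

section \<open>Inverting a nondegenerate Poisson tensor\<close>

text \<open>Nakayama's lemma over the germs of functions at \<open>p\<close>: modulo
  \<open>N\<close> the matrix 1 - k annihilates the vector of all \<open>D c\<close>, and it is the
  identity at p, hence invertible nearby. Instead of inverting the matrix, the generators are
  eliminated one by one.\<close>

lemma (in manifold_on) nakayama:
  fixes N :: "('a \<Rightarrow> 'v::real_vector) set" and D :: "'i \<Rightarrow> 'a \<Rightarrow> 'v"
  assumes p: "p \<in> carrier A"
    and add: "\<And>X Y. X \<in> N \<Longrightarrow> Y \<in> N \<Longrightarrow> X + Y \<in> N"
    and mult: "\<And>f X. f \<in> Cinf A \<Longrightarrow> X \<in> N \<Longrightarrow> f \<odot> X \<in> N"
    and local: "\<And>X Y W. X \<in> N \<Longrightarrow> is_open W \<Longrightarrow> p \<in> W \<Longrightarrow> (\<And>q. q \<in> W \<Longrightarrow> X q = Y q) \<Longrightarrow> Y \<in> N"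
    and "finite J" and "\<And>c c'. c \<in> J \<Longrightarrow> c' \<in> J \<Longrightarrow> k c c' \<in> Cinf A \<and> k c c' p = 0"
    and "\<And>c. c \<in> J \<Longrightarrow> D c - (\<Sum>c'\<in>J. k c c' \<odot> D c') \<in> N"
  shows "\<forall>c\<in>J. D c \<in> N"
  using assms(5-7)
proof (induction J arbitrary: k)
  case empty then show ?case by simp
next
  case (insert b J)
  have k: "k c c' \<in> Cinf A" "k c c' p = 0" if "c \<in> insert b J" "c' \<in> insert b J" for c c'
    using insert.prems(1)[OF that] by auto
  have D: "D c - (\<Sum>c'\<in>insert b J. k c c' \<odot> D c') \<in> N" if "c \<in> insert b J" for c
    by (rule insert.prems(2)[OF that])
  have "(unit - k b b) p \<noteq> 0" using k(2)[of b b] p by (simp add: unit_def)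
  from Cinf_local_inverse[OF Cinf_diff[OF Cinf_unit k(1)] p this] obtain m W
    where m: "m \<in> Cinf A" "is_open W" "p \<in> W" "\<forall>q\<in>W. m q * (unit - k b b) q = 1" by auto
  \<comment> \<open>The relation for \<open>b\<close>, divided by 1 - k b b, which is invertible
    near p, expresses \<open>D b\<close> modulo \<open>N\<close> by the remaining
    generators.\<close>
  define E where "E = D b - (\<Sum>c\<in>J. (m * k b c) \<odot> D c)"
  have E: "E \<in> N"
  proof (rule local[OF mult[OF m(1) D[of b]] m(2,3)])
    fix q assume q: "q \<in> W"
    then have q1: "m q - m q * k b b q = 1"
      using m(4) is_open_subset[OF m(2)] by (auto simp: unit_def algebra_simps subset_iff)
    have "(m \<odot> (D b - (\<Sum>c\<in>insert b J. k b c \<odot> D c))) q =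
        (m q - m q * k b b q) *\<^sub>R D b q - (\<Sum>c\<in>J. (m q * k b c q) *\<^sub>R D c q)"
      using insert.hyps by (simp add: sum_apply scaleR_diff_right scaleR_add_right scaleR_diff_left scaleR_sum_right)
    then show "(m \<odot> (D b - (\<Sum>c\<in>insert b J. k b c \<odot> D c))) q = E q"
      by (simp add: E_def q1 sum_apply)
  qed simp
  \<comment> \<open>The new coefficients arise by substituting the expression for \<open>D b\<close>
    in the other relations; they vanish at p because those of \<open>k\<close> do.\<close>
  have J: "\<forall>c\<in>J. D c \<in> N"
  proof (rule insert.IH[of "\<lambda>c c'. k c c' + k c b * (m * k b c')"])
    show "k c c' + k c b * (m * k b c') \<in> Cinf A \<and> (k c c' + k c b * (m * k b c')) p = 0" if "c \<in> J" "c' \<in> J" for c c'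
      using k[of c c'] k[of c b] k[of b c'] m(1) that by (auto intro!: Cinf_add Cinf_mult)
    fix c assume c: "c \<in> J"
    have "D c - (\<Sum>c'\<in>J. (k c c' + k c b * (m * k b c')) \<odot> D c') =
        (D c - (\<Sum>c'\<in>insert b J. k c c' \<odot> D c')) + k c b \<odot> E"
      using insert.hyps
      by (simp add: fun_eq_iff E_def sum_apply scaleR_diff_right scaleR_add_left scaleR_sum_right sum.distrib)
    then show "D c - (\<Sum>c'\<in>J. (k c c' + k c b * (m * k b c')) \<odot> D c') \<in> N"
      using add[OF D[of c] mult[OF k(1) E, of c b]] c by (simp only: insert_iff simp_thms)
  qed
  have "E + (\<Sum>c\<in>J'. (m * k b c) \<odot> D c) \<in> N" if "J' \<subseteq> J" for J'
    using finite_subset[OF that insert.hyps(1)] that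
  proof (induction J')
    case empty then show ?case using E by simp
  next
    case (insert c J')
    have "(m * k b c) \<odot> D c \<in> N" using J insert.prems m(1) k(1)[of b c] by (intro mult Cinf_mult) auto
    moreover have "E + (\<Sum>c\<in>J'. (m * k b c) \<odot> D c) \<in> N" by (rule insert.IH) (use insert.prems in simp)
    ultimately have "(m * k b c) \<odot> D c + (E + (\<Sum>c\<in>J'. (m * k b c) \<odot> D c)) \<in> N" by (rule add)
    then have "E + (\<Sum>c\<in>insert c J'. (m * k b c) \<odot> D c) \<in> N"
      by (simp only: sum.insert[OF insert.hyps] add.left_commute)
    then show ?case .
  qed
  from this[of J] have "D b \<in> N" by (simp add: E_def)
  then show ?case using J by simp
qed

text \<open>Nondegeneracy is stated as surjectivity of the sharp map at each point, the form in
  which a leaf provides it; injectivity follows in \<open>sharp_at_inj\<close>.\<close>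

locale symplectic_manifold = poisson_manifold +
  assumes nondegenerate: "p \<in> carrier A \<Longrightarrow> v \<in> tangent A p \<Longrightarrow> \<exists>a\<in>cotangent A p. v = sharp_at A \<pi> p a"
begin

text \<open>By antisymmetry, \<pi>(a, d) = \<pi>(b, d) says that a and b agree on the sharp of d,
  and such vectors exhaust the tangent space.\<close>

lemma sharp_at_inj:
  assumes p: "p \<in> carrier A" and a: "a \<in> cotangent A p" and b: "b \<in> cotangent A p"
    and eq: "sharp_at A \<pi> p a = sharp_at A \<pi> p b"
  shows "a = b"
proof (rule cotangent_eqI[OF a b])
  fix v assume "v \<in> tangent A p"
  then obtain d where d: "d \<in> cotangent A p" "v = sharp_at A \<pi> p d" using nondegenerate[OF p] by auto
  have "\<pi> p a d = \<pi> p b d" using pair_sharp[OF p a d(1)] pair_sharp[OF p b d(1)] eq by simp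
  then show "a v = b v"
    using pair_sharp[OF p d(1) a] pair_sharp[OF p d(1) b] bivector_antisym[OF p d(1) a] bivector_antisym[OF p d(1) b] d(2)
    by simp
qed

lemma sharp_at_sum:
  assumes p: "p \<in> carrier A" and "\<And>i. i \<in> J \<Longrightarrow> a i \<in> cotangent A p"
  shows "sharp_at A \<pi> p (\<Sum>i\<in>J. a i) = (\<Sum>i\<in>J. sharp_at A \<pi> p (a i))"
proof -
  have z: "sharp_at A \<pi> p 0 = 0"
    using sharp_at_linear(2)[OF p cotangent_subspace(3) cotangent_subspace(3), of 0] by (simp only: scaleR_zero_left)
  show ?thesis using assms(2)
    by (induction J rule: infinite_finite_induct)
      (simp_all add: z sharp_at_linear(1)[OF p] cotangent_subspace_sum)
qed

text \<open>At \<open>p\<close> itself the Hamiltonian fields of the coordinate functions span by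
  nondegeneracy, but smooth coefficients nearby are not automatic. They come from
  \<open>nakayama\<close>, applied to the module of all fields with such an expansion near
  p.\<close>

lemma local_hamiltonian_frame:
  assumes p: "p \<in> carrier A" and Y: "Y \<in> vector_fields A"
  shows "\<exists>W I F g. is_open W \<and> p \<in> W \<and> finite (I :: 'b set) \<and> (\<forall>c\<in>I. F c \<in> Cinf A \<and> g c \<in> Cinf A) \<and>
    (\<forall>q\<in>W. Y q = (\<Sum>c\<in>I. g c q *\<^sub>R sharp A \<pi> (dif A (F c)) q))"
proof -
  obtain W I F D where *: "is_open W" "p \<in> W" "finite (I :: 'b set)" "\<And>c. c \<in> I \<Longrightarrow> F c \<in> Cinf A"
    "\<And>c. c \<in> I \<Longrightarrow> D c \<in> vector_fields A"
    "\<And>q v. q \<in> W \<Longrightarrow> v \<in> tangent A q \<Longrightarrow> v = (\<Sum>c\<in>I. v (F c) *\<^sub>R D c q)"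
    "\<And>q a. q \<in> W \<Longrightarrow> a \<in> cotangent A q \<Longrightarrow> a = (\<Sum>c\<in>I. a (D c q) *\<^sub>R dif A (F c) q)"
    by (rule local_coframe[OF p], rule that)
  define X where "X c = sharp A \<pi> (dif A (F c))" for c
  have X: "X c \<in> vector_fields A" if "c \<in> I" for c
    unfolding X_def by (intro sharp_vector_field dif_one_form *(4) that)
  define N where "N = {Y. \<exists>W g. is_open W \<and> p \<in> W \<and> (\<forall>c\<in>I. g c \<in> Cinf A) \<and> (\<forall>q\<in>W. Y q = (\<Sum>c\<in>I. g c q *\<^sub>R X c q))}"
  have NI: "Y \<in> N" if "is_open W" "p \<in> W" "\<And>c. c \<in> I \<Longrightarrow> g c \<in> Cinf A" "\<And>q. q \<in> W \<Longrightarrow> Y q = (\<Sum>c\<in>I. g c q *\<^sub>R X c q)"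
    for Y W g unfolding N_def using that by auto
  have Nadd: "Y + Z \<in> N" if Y: "Y \<in> N" and Z: "Z \<in> N" for Y Z
  proof -
    obtain W g where 1: "is_open W" "p \<in> W" "\<forall>c\<in>I. g c \<in> Cinf A" "\<forall>q\<in>W. Y q = (\<Sum>c\<in>I. g c q *\<^sub>R X c q)"
      using Y unfolding N_def by auto
    obtain W' g' where 2: "is_open W'" "p \<in> W'" "\<forall>c\<in>I. g' c \<in> Cinf A" "\<forall>q\<in>W'. Z q = (\<Sum>c\<in>I. g' c q *\<^sub>R X c q)"
      using Z unfolding N_def by auto
    show ?thesis
      by (rule NI[OF openin_Int[OF 1(1) 2(1)], of "\<lambda>c. g c + g' c"])
        (use 1 2 in \<open>auto simp: scaleR_add_left sum.distrib Cinf_add\<close>)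
  qed
  have Nmult: "f \<odot> Y \<in> N" if f: "f \<in> Cinf A" and Y: "Y \<in> N" for f Y
  proof -
    obtain W g where 1: "is_open W" "p \<in> W" "\<forall>c\<in>I. g c \<in> Cinf A" "\<forall>q\<in>W. Y q = (\<Sum>c\<in>I. g c q *\<^sub>R X c q)"
      using Y unfolding N_def by auto
    show ?thesis
      by (rule NI[OF 1(1), of "\<lambda>c. f * g c"]) (use 1 f in \<open>auto simp: scaleR_sum_right Cinf_mult\<close>)
  qed
  have Nloc: "Z \<in> N" if Y: "Y \<in> N" and W': "is_open W'" "p \<in> W'" "\<And>q. q \<in> W' \<Longrightarrow> Y q = Z q" for Y Z W'
  proof -
    obtain W g where 1: "is_open W" "p \<in> W" "\<forall>c\<in>I. g c \<in> Cinf A" "\<forall>q\<in>W. Y q = (\<Sum>c\<in>I. g c q *\<^sub>R X c q)"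
      using Y unfolding N_def by auto
    show ?thesis
      by (rule NI[OF openin_Int[OF 1(1) W'(1)], of g]) (use 1 W' in auto)
  qed
  have "\<exists>r. D c p = (\<Sum>i\<in>I. r i *\<^sub>R X i p)" if c: "c \<in> I" for c
  proof -
    obtain a where a: "a \<in> cotangent A p" "D c p = sharp_at A \<pi> p a"
      using nondegenerate[OF p vector_field_tangent[OF *(5)[OF c] p]] by auto
    have "sharp_at A \<pi> p (\<Sum>i\<in>I. r i *\<^sub>R dif A (F i) p) = (\<Sum>i\<in>I. r i *\<^sub>R X i p)" for r :: "'b \<Rightarrow> real"
      by (simp add: sharp_at_sum[OF p cotangent_subspace(2)[OF dif_cotangent]]
        sharp_at_linear(2)[OF p dif_cotangent dif_cotangent] X_def sharp_def)
    from this[of "\<lambda>i. a (D i p)"] show ?thesis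
      using *(7)[OF *(2) a(1)] a(2) by (intro exI[of _ "\<lambda>i. a (D i p)"]) simp
  qed
  then obtain r where r: "\<And>c. c \<in> I \<Longrightarrow> D c p = (\<Sum>i\<in>I. r c i *\<^sub>R X i p)" by metis
  \<comment> \<open>\<open>D c\<close> minus its expansion at p, taken with constant coefficients.
    In the frame \<open>D\<close> the field \<open>Z c\<close> has the coefficients Z c (F c'),
    which vanish at p as \<open>nakayama\<close> requires.\<close>
  define Z where "Z c = D c - (\<Sum>i\<in>I. r c i *\<^sub>R X i)" for c
  have Z: "Z c \<in> vector_fields A" "Z c p = 0" if "c \<in> I" for c
  proof -
    have "D c + (\<Sum>i\<in>I. (- r c i) *\<^sub>R X i) \<in> vector_fields A"
      by (intro vector_fields_add vector_fields_sum vector_fields_scale X *(5) that)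
    then show "Z c \<in> vector_fields A" by (simp add: Z_def sum_negf)
    show "Z c p = 0" using r[OF that] by (simp add: Z_def sum_apply)
  qed
  have "\<forall>c\<in>I. D c \<in> N"
  proof (rule nakayama[OF p Nadd Nmult Nloc *(3), where k = "\<lambda>c c'. (\<lambda>q. Z c q (F c'))"])
    show "(\<lambda>q. Z c q (F c')) \<in> Cinf A \<and> Z c p (F c') = 0" if "c \<in> I" "c' \<in> I" for c c'
      using Z[OF that(1)] vector_field_Cinf[OF Z(1)[OF that(1)] *(4)[OF that(2)]] by simp
    fix c assume c: "c \<in> I"
    show "D c - (\<Sum>c'\<in>I. (\<lambda>q. Z c q (F c')) \<odot> D c') \<in> N"
    proof (rule NI[OF *(1,2), of "\<lambda>i. r c i *\<^sub>R unit"])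
      show "r c i *\<^sub>R unit \<in> Cinf A" for i by (intro Cinf_scale Cinf_unit)
      fix q assume q: "q \<in> W"
      then have qA: "q \<in> carrier A" using is_open_subset[OF *(1)] by auto
      have "Z c q = (\<Sum>c'\<in>I. Z c q (F c') *\<^sub>R D c' q)" by (rule *(6)[OF q vector_field_tangent[OF Z(1)[OF c] qA]])
      moreover have "D c q - Z c q = (\<Sum>i\<in>I. r c i *\<^sub>R X i q)" by (simp add: Z_def sum_apply)
      ultimately show "(D c - (\<Sum>c'\<in>I. (\<lambda>q. Z c q (F c')) \<odot> D c')) q = (\<Sum>i\<in>I. (r c i *\<^sub>R unit) q *\<^sub>R X i q)"
        using qA by (simp add: sum_apply unit_def)
    qed
  qed
  then have D: "D c \<in> N" if "c \<in> I" for c using that by simp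
  have Yf: "(\<lambda>q. Y q (F c)) \<in> Cinf A" if "c \<in> I" for c by (rule vector_field_Cinf[OF Y *(4)[OF that]])
  have N0: "0 \<in> N" by (rule NI[OF *(1,2), of "\<lambda>i. 0"]) (simp_all add: Cinf_0)
  have "(\<Sum>c\<in>J. (\<lambda>q. Y q (F c)) \<odot> D c) \<in> N" if "J \<subseteq> I" for J
    using finite_subset[OF that *(3)] that
    by (induction J) (simp_all add: N0 Nadd Nmult D Yf)
  from this[OF order_refl] have "Y \<in> N"
  proof (rule Nloc[OF _ *(1,2)])
    fix q assume q: "q \<in> W"
    then show "(\<Sum>c\<in>I. (\<lambda>q. Y q (F c)) \<odot> D c) q = Y q"
      using *(6)[OF q vector_field_tangent[OF Y]] is_open_subset[OF *(1)] by (auto simp: sum_apply)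
  qed
  then show ?thesis using *(3,4) unfolding N_def X_def by blast
qed

text \<open>The form exists pointwise by nondegeneracy. For smoothness, \<alpha> takes the value -
  v(F) on the Hamiltonian field of F, so on a local smooth combination of Hamiltonian fields its
  value is a smooth function.\<close>

lemma exists_flat:
  assumes v: "v \<in> vector_fields A"
  shows "\<exists>\<alpha>. \<alpha> \<in> one_forms A \<and> sharp A \<pi> \<alpha> = v"
proof -
  have "\<exists>a. (p \<in> carrier A \<longrightarrow> a \<in> cotangent A p \<and> v p = sharp_at A \<pi> p a) \<and> (p \<notin> carrier A \<longrightarrow> a = 0)" for p
    using nondegenerate[OF _ vector_field_tangent[OF v]] by (cases "p \<in> carrier A") auto
  then obtain \<alpha> where \<alpha>: "\<And>p. p \<in> carrier A \<Longrightarrow> \<alpha> p \<in> cotangent A p"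
    "\<And>p. p \<in> carrier A \<Longrightarrow> v p = sharp_at A \<pi> p (\<alpha> p)" "\<And>p. p \<notin> carrier A \<Longrightarrow> \<alpha> p = 0" by metis
  have "(\<lambda>p. \<alpha> p (Y p)) \<in> Cinf A" if Y: "Y \<in> vector_fields A" for Y
  proof (rule Cinf_local)
    fix p assume p: "p \<in> carrier A"
    obtain W I F g where *: "is_open W" "p \<in> W" "finite (I :: 'b set)" "\<forall>c\<in>I. F c \<in> Cinf A \<and> g c \<in> Cinf A"
      "\<forall>q\<in>W. Y q = (\<Sum>c\<in>I. g c q *\<^sub>R sharp A \<pi> (dif A (F c)) q)"
      using local_hamiltonian_frame[OF p Y] by blast
    let ?h = "\<Sum>c\<in>I. g c * (- (\<lambda>q. v q (F c)))"
    have "?h \<in> Cinf A"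
      by (intro Cinf_sum Cinf_mult Cinf_minus vector_field_Cinf[OF v]) (use *(4) in auto)
    moreover have "\<alpha> q (Y q) = ?h q" if q: "q \<in> W" for q
    proof -
      have qA: "q \<in> carrier A" using is_open_subset[OF *(1)] q by auto
      have s: "\<alpha> q (sharp A \<pi> (dif A (F c)) q) = - v q (F c)" if "c \<in> I" for c
        using pair_sharp[OF qA dif_cotangent \<alpha>(1)[OF qA], of "F c"] bivector_antisym[OF qA dif_cotangent \<alpha>(1)[OF qA], of "F c"]
          \<alpha>(2)[OF qA] sharp_at_apply[OF qA, of "F c" "\<alpha> q"] *(4) that by (simp add: sharp_def)
      have t: "sharp A \<pi> (dif A (F c)) q \<in> tangent A q" for c
        unfolding sharp_def by (rule sharp_at_tangent[OF qA dif_cotangent])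
      have "\<alpha> q (Y q) = (\<Sum>c\<in>I. g c q * \<alpha> q (sharp A \<pi> (dif A (F c)) q))"
        using *(5) q by (simp add: cotangent_sum[OF \<alpha>(1)[OF qA]] tangent_subspace t cotangent_scale[OF \<alpha>(1)[OF qA]])
      also have "\<dots> = ?h q" using s by (simp add: sum_apply)
      finally show ?thesis .
    qed
    ultimately show "\<exists>W g. is_open W \<and> p \<in> W \<and> g \<in> Cinf A \<and> (\<forall>q\<in>W. \<alpha> q (Y q) = g q)"
      using *(1,2) by (intro exI[of _ W] exI[of _ ?h]) auto
  qed (simp add: \<alpha>(3))
  then have "\<alpha> \<in> one_forms A" using \<alpha> by (simp add: one_forms_def)
  moreover have "sharp A \<pi> \<alpha> = v"
  proof (intro ext)
    fix p f show "sharp A \<pi> \<alpha> p f = v p f"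
      using \<alpha>(2)[of p] vector_field_zero[OF v, of p] by (cases "p \<in> carrier A") (auto simp: sharp_def sharp_at_def)
  qed
  ultimately show ?thesis by blast
qed

lemma sharp_inj:
  assumes "\<alpha> \<in> one_forms A" "\<beta> \<in> one_forms A" "sharp A \<pi> \<alpha> = sharp A \<pi> \<beta>" shows "\<alpha> = \<beta>"
proof
  fix p show "\<alpha> p = \<beta> p"
    using sharp_at_inj[OF _ one_formD(1)[OF assms(1)] one_formD(1)[OF assms(2)], of p]
      fun_cong[OF assms(3), of p] one_formD(2)[OF assms(1)] one_formD(2)[OF assms(2)]
    by (cases "p \<in> carrier A") (simp_all add: sharp_def)
qed

text \<open>Each tangent vector is the value of a Hamiltonian field, and the exterior derivative
  depends only on values, so closedness may be tested on Hamiltonian fields.\<close>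

lemma closed_iff_derivation:
  assumes \<alpha>: "\<alpha> \<in> one_forms A"
  shows "\<alpha> \<in> closed_forms A \<longleftrightarrow> pb_derivation (sharp A \<pi> \<alpha>)"
proof
  assume "\<alpha> \<in> closed_forms A"
  then have "ext_deriv \<alpha> (sharp A \<pi> (dif A f)) (sharp A \<pi> (dif A g)) p = 0"
    if "f \<in> Cinf A" "g \<in> Cinf A" "p \<in> carrier A" for f g p
    using that sharp_vector_field[OF dif_one_form] by (simp add: closed_forms_iff)
  then show "pb_derivation (sharp A \<pi> \<alpha>)"
    unfolding pb_derivation_def using ext_deriv_hamiltonian[OF \<alpha>] by (simp add: algebra_simps)
next
  assume d: "pb_derivation (sharp A \<pi> \<alpha>)"
  have ham: "\<exists>f. f \<in> Cinf A \<and> X p = sharp A \<pi> (dif A f) p" if X: "X \<in> vector_fields A" and p: "p \<in> carrier A" for X p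
  proof -
    obtain a where "a \<in> cotangent A p" "X p = sharp_at A \<pi> p a"
      using nondegenerate[OF p vector_field_tangent[OF X p]] by auto
    then show ?thesis using exists_dif[OF p, of a] by (auto simp: sharp_def)
  qed
  have "ext_deriv \<alpha> X Y p = 0" if X: "X \<in> vector_fields A" and Y: "Y \<in> vector_fields A" and p: "p \<in> carrier A" for X Y p
  proof -
    obtain f g where f: "f \<in> Cinf A" "X p = sharp A \<pi> (dif A f) p" and g: "g \<in> Cinf A" "Y p = sharp A \<pi> (dif A g) p"
      using ham[OF X p] ham[OF Y p] by auto
    have "ext_deriv \<alpha> X Y p = ext_deriv \<alpha> (sharp A \<pi> (dif A f)) (sharp A \<pi> (dif A g)) p"
      by (rule ext_deriv_pointwise[OF \<alpha> p X sharp_vector_field[OF dif_one_form[OF f(1)]] f(2) Y sharp_vector_field[OF dif_one_form[OF g(1)]] g(2)])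
    then show ?thesis using ext_deriv_hamiltonian[OF \<alpha> f(1) g(1) p] d f(1) g(1) p by (simp add: pb_derivation_def)
  qed
  then show "\<alpha> \<in> closed_forms A" using \<alpha> by (simp add: closed_forms_iff)
qed

end

section \<open>Quotients of real vector spaces\<close>

lemma coset_eq_iff:
  assumes W: "subspace W" shows "coset W x = coset W y \<longleftrightarrow> x - y \<in> W"
proof
  assume "coset W x = coset W y"
  moreover have "x \<in> coset W x" using subspace_0[OF W] by (force simp: coset_def)
  ultimately obtain w where "w \<in> W" "x = y + w" by (auto simp: coset_def)
  then show "x - y \<in> W" by simp
next
  assume d: "x - y \<in> W"
  have "coset W x \<subseteq> coset W y" if "x - y \<in> W" for x y
  proof
    fix z assume "z \<in> coset W x"
    then obtain w where "w \<in> W" "z = x + w" by (auto simp: coset_def)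
    then have "z = y + ((x - y) + w)" "(x - y) + w \<in> W" using subspace_add[OF W that] by auto
    then show "z \<in> coset W y" unfolding coset_def by blast
  qed
  from this[OF d] this[of y x] show "coset W x = coset W y"
    using d subspace_neg[OF W, of "x - y"] by auto
qed

lemma quotient_rspace_simps:
  assumes W: "subspace W"
  shows "rcarrier (quotient_rspace V W) = coset W ` V"
    "radd (quotient_rspace V W) (coset W x) (coset W y) = coset W (x + y)"
    "rscale (quotient_rspace V W) c (coset W x) = coset W (c *\<^sub>R x)"
proof -
  show "rcarrier (quotient_rspace V W) = coset W ` V" by (simp add: quotient_rspace_def)
  have "{a + b | a b. a \<in> coset W x \<and> b \<in> coset W y} = coset W (x + y)"
  proof safe
    fix a b assume "a \<in> coset W x" "b \<in> coset W y"
    then obtain u w where "u \<in> W" "w \<in> W" "a = x + u" "b = y + w" by (auto simp: coset_def)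
    then have "a + b = x + y + (u + w)" "u + w \<in> W" using subspace_add[OF W] by auto
    then show "a + b \<in> coset W (x + y)" unfolding coset_def by blast
  next
    fix z assume "z \<in> coset W (x + y)"
    then obtain w where "w \<in> W" "z = x + y + w" by (auto simp: coset_def)
    then have "z = (x + 0) + (y + w)" "x + 0 \<in> coset W x" "y + w \<in> coset W y"
      using subspace_0[OF W] unfolding coset_def by (simp add: add_ac, blast, blast)
    then show "\<exists>a b. z = a + b \<and> a \<in> coset W x \<and> b \<in> coset W y" by blast
  qed
  then show "radd (quotient_rspace V W) (coset W x) (coset W y) = coset W (x + y)"
    by (simp add: quotient_rspace_def)
  have "{c *\<^sub>R a + w | a w. a \<in> coset W x \<and> w \<in> W} = coset W (c *\<^sub>R x)"
  proof safe
    fix a w assume "a \<in> coset W x" and w: "w \<in> W"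
    then obtain u where "u \<in> W" "a = x + u" by (auto simp: coset_def)
    then have "c *\<^sub>R a + w = c *\<^sub>R x + (c *\<^sub>R u + w)" "c *\<^sub>R u + w \<in> W"
      using subspace_add[OF W subspace_scale[OF W] w] by (auto simp: scaleR_add_right)
    then show "c *\<^sub>R a + w \<in> coset W (c *\<^sub>R x)" unfolding coset_def by blast
  next
    fix z assume "z \<in> coset W (c *\<^sub>R x)"
    then obtain w where "w \<in> W" "z = c *\<^sub>R x + w" by (auto simp: coset_def)
    moreover have "x \<in> coset W x" using subspace_0[OF W] by (force simp: coset_def)
    ultimately show "\<exists>a w. z = c *\<^sub>R a + w \<and> a \<in> coset W x \<and> w \<in> W" by blast
  qed
  then show "rscale (quotient_rspace V W) c (coset W x) = coset W (c *\<^sub>R x)"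
    by (simp add: quotient_rspace_def)
qed

text \<open>The joint map (T1, T2, T3) is onto by \<open>onto\<close>, and by \<open>ker\<close> the
  preimage of W1 x W2 x W3 is \<open>W\<close>, so it descends to an isomorphism. Linearity is asked
  on \<open>V\<close> only, because the maps of the application are known to be linear only on
  Poisson derivations.\<close>

lemma quotient_isomorphic_direct_sum:
  assumes V: "subspace V" and W: "subspace W" "subspace W1" "subspace W2" "subspace W3"
    and add: "\<And>x y. x \<in> V \<Longrightarrow> y \<in> V \<Longrightarrow> T1 (x + y) = T1 x + T1 y \<and> T2 (x + y) = T2 x + T2 y \<and> T3 (x + y) = T3 x + T3 y"
    and scale: "\<And>c x. x \<in> V \<Longrightarrow> T1 (c *\<^sub>R x) = c *\<^sub>R T1 x \<and> T2 (c *\<^sub>R x) = c *\<^sub>R T2 x \<and> T3 (c *\<^sub>R x) = c *\<^sub>R T3 x"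
    and into: "\<And>x. x \<in> V \<Longrightarrow> T1 x \<in> V1 \<and> T2 x \<in> V2 \<and> T3 x \<in> V3"
    and onto: "\<And>a b c. a \<in> V1 \<Longrightarrow> b \<in> V2 \<Longrightarrow> c \<in> V3 \<Longrightarrow> \<exists>x\<in>V. T1 x = a \<and> T2 x = b \<and> T3 x = c"
    and ker: "\<And>x. x \<in> V \<Longrightarrow> x \<in> W \<longleftrightarrow> T1 x \<in> W1 \<and> T2 x \<in> W2 \<and> T3 x \<in> W3"
  shows "rspace_isomorphic (quotient_rspace V W)
    (direct_sum (quotient_rspace V1 W1) (direct_sum (quotient_rspace V2 W2) (quotient_rspace V3 W3)))"
    (is "rspace_isomorphic ?Q ?R")
proof -
  define G where "G x = (coset W1 (T1 x), coset W2 (T2 x), coset W3 (T3 x))" for x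
  define F where "F A = G (SOME x. x \<in> V \<and> coset W x = A)" for A
  note qs = quotient_rspace_simps[OF W(1)] quotient_rspace_simps[OF W(2)] quotient_rspace_simps[OF W(3)]
    quotient_rspace_simps[OF W(4)]
  have T: "T1 (x - y) = T1 x - T1 y \<and> T2 (x - y) = T2 x - T2 y \<and> T3 (x - y) = T3 x - T3 y" if "x \<in> V" "y \<in> V" for x y
    using add[OF that(1) subspace_scale[OF V that(2), of "-1"]] scale[OF that(2), of "-1"] by simp
  have GG: "G x = G y \<longleftrightarrow> coset W x = coset W y" if "x \<in> V" "y \<in> V" for x y
    using ker[OF subspace_diff[OF V that]] T[OF that]
    by (simp add: G_def coset_eq_iff[OF W(1)] coset_eq_iff[OF W(2)] coset_eq_iff[OF W(3)] coset_eq_iff[OF W(4)])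
  have F: "F (coset W x) = G x" if x: "x \<in> V" for x
  proof -
    have "\<exists>y. y \<in> V \<and> coset W y = coset W x" using x by blast
    from someI_ex[OF this] show ?thesis unfolding F_def using GG x by blast
  qed
  show ?thesis
    unfolding rspace_isomorphic_def
  proof (intro exI[of _ F] conjI)
    show "bij_betw F (rcarrier ?Q) (rcarrier ?R)"
      unfolding bij_betw_def
    proof
      show "inj_on F (rcarrier ?Q)" using F GG by (auto simp: qs inj_on_def)
      show "F ` rcarrier ?Q = rcarrier ?R"
      proof
        show "F ` rcarrier ?Q \<subseteq> rcarrier ?R" using F into by (auto simp: qs direct_sum_def G_def)
        show "rcarrier ?R \<subseteq> F ` rcarrier ?Q"
        proof
          fix z assume "z \<in> rcarrier ?R"
          then obtain a b c where "a \<in> V1" "b \<in> V2" "c \<in> V3" "z = (coset W1 a, coset W2 b, coset W3 c)"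
            by (auto simp: qs direct_sum_def)
          moreover from onto[OF this(1-3)] obtain x where "x \<in> V" "T1 x = a" "T2 x = b" "T3 x = c" by auto
          ultimately have "z = F (coset W x)" "coset W x \<in> rcarrier ?Q" using F by (auto simp: G_def qs)
          then show "z \<in> F ` rcarrier ?Q" by blast
        qed
      qed
    qed
    show "\<forall>x\<in>rcarrier ?Q. \<forall>y\<in>rcarrier ?Q. F (radd ?Q x y) = radd ?R (F x) (F y)"
      using F add subspace_add[OF V] by (auto simp: qs G_def direct_sum_def)
    show "\<forall>c. \<forall>x\<in>rcarrier ?Q. F (rscale ?Q c x) = rscale ?R c (F x)"
      using F scale subspace_scale[OF V] by (auto simp: qs G_def direct_sum_def)
  qed
qed

text \<open>Lift a Hamel basis of the small subspace first and then extend it.\<close>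

lemma linear_section:
  fixes pr :: "'v::real_vector \<Rightarrow> 'u::real_vector"
  assumes pr: "linear pr" and V: "subspace V" and W: "subspace W" "W \<subseteq> V"
    and U: "subspace U" "U \<subseteq> pr ` V" and I: "subspace I" "I \<subseteq> U" "I \<subseteq> pr ` W"
  shows "\<exists>\<sigma>. linear \<sigma> \<and> (\<forall>u\<in>U. \<sigma> u \<in> V \<and> pr (\<sigma> u) = u) \<and> (\<forall>u\<in>I. \<sigma> u \<in> W)"
proof -
  obtain B where B: "B \<subseteq> I" "independent B" "I \<subseteq> span B"
    using maximal_independent_subset by blast
  obtain C where C: "B \<subseteq> C" "C \<subseteq> U" "independent C" "U \<subseteq> span C"
    using maximal_independent_subset_extend[of B U] B I(2) by blast
  \<comment> \<open>For u in \<open>I\<close> one preimage must serve both purposes; it exists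
    because \<open>I\<close> lies in the image of \<open>W\<close> and \<open>W\<close> lies in
    \<open>V\<close>.\<close>
  have "\<exists>c. (u \<in> U \<longrightarrow> c \<in> V \<and> pr c = u) \<and> (u \<in> I \<longrightarrow> c \<in> W)" for u
    using U(2) I W(2) by (cases "u \<in> I") blast+
  then obtain c where c: "\<And>u. u \<in> U \<Longrightarrow> c u \<in> V \<and> pr (c u) = u" "\<And>u. u \<in> I \<Longrightarrow> c u \<in> W" by metis
  obtain \<sigma> where \<sigma>: "linear \<sigma>" "\<And>u. u \<in> C \<Longrightarrow> \<sigma> u = c u"
    using linear_independent_extend[OF C(3), of c] by blast
  have "\<sigma> u \<in> V \<and> pr (\<sigma> u) = u" if "u \<in> U" for u
  proof -
    have "u \<in> span C" using C(4) that by blast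
    then show ?thesis
    proof (induction rule: span_induct_alt)
      case base show ?case using linear_0[OF \<sigma>(1)] linear_0[OF pr] subspace_0[OF V] by simp
    next
      case (step r x y)
      then show ?case
        using \<sigma>(2)[of x] c(1)[of x] C(2) subspace_add[OF V subspace_scale[OF V]]
        by (auto simp: linear_add[OF \<sigma>(1)] linear_scale[OF \<sigma>(1)] linear_add[OF pr] linear_scale[OF pr])
    qed
  qed
  moreover have "\<sigma> u \<in> W" if "u \<in> I" for u
  proof -
    have "u \<in> span B" using B(3) that by blast
    then show ?thesis
    proof (induction rule: span_induct_alt)
      case base show ?case using linear_0[OF \<sigma>(1)] subspace_0[OF W(1)] by simp
    next
      case (step r x y)
      then have "x \<in> C" "x \<in> I" using C(1) B(1) by auto
      then show ?case
        using step \<sigma>(2)[of x] c(2)[of x] subspace_add[OF W(1) subspace_scale[OF W(1)]]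
        by (auto simp: linear_add[OF \<sigma>(1)] linear_scale[OF \<sigma>(1)])
    qed
  qed
  ultimately show ?thesis using \<sigma>(1) by blast
qed

section \<open>The restricted cotangent Lie algebroid\<close>

lemma (in manifold_on) one_forms_local:
  assumes "\<And>p. p \<notin> carrier A \<Longrightarrow> \<alpha> p = 0"
    and loc: "\<And>p. p \<in> carrier A \<Longrightarrow> \<exists>\<beta> W. \<beta> \<in> one_forms A \<and> is_open W \<and> p \<in> W \<and> (\<forall>q\<in>W. \<alpha> q = \<beta> q)"
  shows "\<alpha> \<in> one_forms A"
proof -
  have "\<alpha> p \<in> cotangent A p" if "p \<in> carrier A" for p
    using loc[OF that] one_formD(1) by fastforce
  moreover have "(\<lambda>p. \<alpha> p (X p)) \<in> Cinf A" if X: "X \<in> vector_fields A" for X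
  proof (rule Cinf_local)
    fix p assume "p \<in> carrier A"
    then obtain \<beta> W where "\<beta> \<in> one_forms A" "is_open W" "p \<in> W" "\<forall>q\<in>W. \<alpha> q = \<beta> q" using loc by blast
    then show "\<exists>W g. is_open W \<and> p \<in> W \<and> g \<in> Cinf A \<and> (\<forall>q\<in>W. \<alpha> q (X q) = g q)"
      using one_formD(3)[OF _ X] by (intro exI[of _ W] exI[of _ "\<lambda>q. \<beta> q (X q)"]) auto
  qed (simp add: assms(1))
  ultimately show ?thesis using assms(1) by (simp add: one_forms_def)
qed

text \<open>Collects what the inclusion of \<open>S\<close> provides: restriction of functions and
  of open sets, and \<open>pull_bivector\<close>, which says that the inclusion is a Poisson
  map.\<close>

locale poisson_submanifold = M: poisson_manifold M \<pi> + S: poisson_manifold S \<psi>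
  for M :: "('a, 'e::real_inner) atlas" and \<pi> :: "'a bivector"
    and S :: "('a, 'd::real_inner) atlas" and \<psi> :: "'a bivector" +
  assumes carrier_subset: "carrier S \<subseteq> carrier M"
    and restr_Cinf: "F \<in> Cinf M \<Longrightarrow> restr S F \<in> Cinf S"
    and open_restr: "M.is_open W \<Longrightarrow> S.is_open (W \<inter> carrier S)"
    and pull_bivector: "s \<in> carrier S \<Longrightarrow> a \<in> cotangent M s \<Longrightarrow> b \<in> cotangent M s \<Longrightarrow>
      \<psi> s (pull M S s a) (pull M S s b) = \<pi> s a b"
begin

lemma in_M: "s \<in> carrier S \<Longrightarrow> s \<in> carrier M"
  using carrier_subset by auto

lemma restr_simps: "restr S (F + G) = restr S F + restr S G" "restr S (F * G) = restr S F * restr S G"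
  "restr S (c *\<^sub>R F) = c *\<^sub>R restr S F" for F G :: "'a \<Rightarrow> real"
  by (auto simp: restr_def)

lemma push_apply: "F \<in> Cinf M \<Longrightarrow> push M S v F = v (restr S F)"
  by (simp add: push_def)

lemma push_tangent:
  assumes s: "s \<in> carrier S" and v: "v \<in> tangent S s" shows "push M S v \<in> tangent M s"
proof -
  have r: "restr S F s = F s" for F :: "'a \<Rightarrow> real" using s by (simp add: restr_def)
  show ?thesis
    by (auto simp: tangent_def[of M] push_def M.Cinf_add M.Cinf_mult M.Cinf_scale restr_simps
      S.tangentD(1-3)[OF v] restr_Cinf S.tangent_scale[OF v] r)
qed

lemma push_linear: "push M S (v + w) = push M S v + push M S w" "push M S (c *\<^sub>R v) = c *\<^sub>R push M S v"
  "push M S 0 = 0"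
  by (auto simp: push_def fun_eq_iff)

lemma pull_apply: "v \<in> tangent S s \<Longrightarrow> pull M S s a v = a (push M S v)"
  by (simp add: pull_def)

lemma pull_linear: "pull M S s (a + b) = pull M S s a + pull M S s b" "pull M S s (c *\<^sub>R a) = c *\<^sub>R pull M S s a"
  "pull M S s 0 = 0"
  by (auto simp: pull_def fun_eq_iff)

lemma pull_cotangent:
  assumes s: "s \<in> carrier S" and a: "a \<in> cotangent M s" shows "pull M S s a \<in> cotangent S s"
  using push_tangent[OF s] M.cotangentD(1)[OF a] M.cotangent_scale[OF a]
  by (auto simp: cotangent_def[of S] pull_def S.tangent_subspace push_linear)

lemma pull_dif: "s \<in> carrier S \<Longrightarrow> F \<in> Cinf M \<Longrightarrow> pull M S s (dif M F s) = dif S (restr S F) s"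
  using push_tangent[of s] in_M[of s] by (auto simp: fun_eq_iff pull_def dif_def push_apply)

lemma restr_pb:
  assumes F: "F \<in> Cinf M" and G: "G \<in> Cinf M"
  shows "restr S (M.pb F G) = S.pb (restr S F) (restr S G)"
proof
  fix s show "restr S (M.pb F G) s = S.pb (restr S F) (restr S G) s"
    using pull_bivector[OF _ M.dif_cotangent M.dif_cotangent, of s F G] in_M[of s]
    by (cases "s \<in> carrier S") (simp_all add: restr_def[of S "M.pb F G"] S.pb_outside S.pb_apply M.pb_apply pull_dif F G)
qed

end

text \<open>The last assumption provides extensions that are constant along the fibres of the tubular
  neighbourhood.\<close>

locale leaf_geometry = leaf_data M \<pi> S \<psi> e + poisson_submanifold M \<pi> S \<psi> + S: symplectic_manifold S \<psi>
  for M :: "('a, 'e::real_inner) atlas" and \<pi> :: "'a bivector"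
    and S :: "('a, 'd::real_inner) atlas" and \<psi> :: "'a bivector"
    and e :: "'a \<times> 'a tvec set \<Rightarrow> 'a" +
  assumes vertical: "s \<in> carrier S \<Longrightarrow> w \<in> rcarrier (normal_space M S s) \<Longrightarrow> vertical_differential M S e s w \<in> w"
    and extension: "f \<in> Cinf S \<Longrightarrow> s \<in> carrier S \<Longrightarrow> \<exists>F W. F \<in> Cinf M \<and> S.is_open W \<and> s \<in> W \<and>
      (\<forall>x\<in>W. F x = f x \<and> (\<forall>w\<in>rcarrier (normal_space M S x). vertical_differential M S e x w F = 0))"
begin

abbreviation L :: "('a \<Rightarrow> 'a cvec) set" where "L \<equiv> cotangent_sections M S"

lemma LD:
  assumes "a \<in> L"
  shows "a s \<in> cotangent M s" "s \<notin> carrier S \<Longrightarrow> a s = 0" "X \<in> vector_fields M \<Longrightarrow> (\<lambda>s. a s (X s)) \<in> Cinf S"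
proof -
  show 0: "a s = 0" if "s \<notin> carrier S" for s using assms that by (simp add: cotangent_sections_def)
  show "a s \<in> cotangent M s"
    using assms 0[of s] M.cotangent_subspace(3) by (cases "s \<in> carrier S") (simp_all add: cotangent_sections_def)
  show "(\<lambda>s. a s (X s)) \<in> Cinf S" if "X \<in> vector_fields M" using assms that by (simp add: cotangent_sections_def)
qed

lemma L_add: "a \<in> L \<Longrightarrow> b \<in> L \<Longrightarrow> a + b \<in> L"
  by (auto simp: cotangent_sections_def M.cotangent_subspace S.Cinf_pointwise)

lemma L_fmul: "f \<in> Cinf S \<Longrightarrow> a \<in> L \<Longrightarrow> f \<odot> a \<in> L"
  by (auto simp: cotangent_sections_def M.cotangent_subspace S.Cinf_pointwise)

lemma L_scale: "a \<in> L \<Longrightarrow> c *\<^sub>R a \<in> L"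
  by (auto simp: cotangent_sections_def M.cotangent_subspace S.Cinf_pointwise)

lemma L_zero: "0 \<in> L"
  by (auto simp: cotangent_sections_def M.cotangent_subspace S.Cinf_pointwise)

lemma L_minus: "a \<in> L \<Longrightarrow> - a \<in> L"
  using L_scale[of a "-1"] by simp

lemma L_diff: "a \<in> L \<Longrightarrow> b \<in> L \<Longrightarrow> a - b \<in> L"
  using L_add[of a "- b"] L_minus by simp

lemma L_sum: "(\<And>i. i \<in> I \<Longrightarrow> a i \<in> L) \<Longrightarrow> sum a I \<in> L"
  by (induction I rule: infinite_finite_induct) (simp_all add: L_add L_zero)

lemma L_simple:
  assumes a: "a \<in> Cinf S" and F: "F \<in> Cinf M" shows "a \<odot> dif M F \<in> L"
proof -
  have "(\<lambda>s. (a \<odot> dif M F) s (X s)) = a * restr S (\<lambda>p. X p F)" if X: "X \<in> vector_fields M" for X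
  proof
    fix s show "(a \<odot> dif M F) s (X s) = (a * restr S (\<lambda>p. X p F)) s"
      using S.Cinf_outside[OF a, of s] M.dif_apply[OF in_M M.vector_field_tangent[OF X in_M], of s F]
      by (cases "s \<in> carrier S") (simp_all add: restr_def)
  qed
  then have "(\<lambda>s. (a \<odot> dif M F) s (X s)) \<in> Cinf S" if "X \<in> vector_fields M" for X
    using S.Cinf_mult[OF a restr_Cinf[OF M.vector_field_Cinf[OF that F]]] that by simp
  then show ?thesis
    using S.Cinf_outside[OF a] by (simp add: cotangent_sections_def M.cotangent_subspace M.dif_cotangent fun_eq_iff)
qed

lemma L_local:
  assumes "\<And>s. s \<notin> carrier S \<Longrightarrow> a s = 0"
    and loc: "\<And>s. s \<in> carrier S \<Longrightarrow> \<exists>b W. b \<in> L \<and> S.is_open W \<and> s \<in> W \<and> (\<forall>x\<in>W. a x = b x)"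
  shows "a \<in> L"
proof -
  have "a s \<in> cotangent M s" if "s \<in> carrier S" for s
    using loc[OF that] LD(1) by fastforce
  moreover have "(\<lambda>s. a s (X s)) \<in> Cinf S" if X: "X \<in> vector_fields M" for X
  proof (rule S.Cinf_local)
    fix s assume "s \<in> carrier S"
    then obtain b W where "b \<in> L" "S.is_open W" "s \<in> W" "\<forall>x\<in>W. a x = b x" using loc by blast
    then show "\<exists>W g. S.is_open W \<and> s \<in> W \<and> g \<in> Cinf S \<and> (\<forall>x\<in>W. a x (X x) = g x)"
      using LD(3)[OF _ X] by (intro exI[of _ W] exI[of _ "\<lambda>x. b x (X x)"]) auto
  qed (simp add: assms(1))
  ultimately show ?thesis using assms(1) by (simp add: cotangent_sections_def)
qed

text \<open>Analogue of \<open>one_form_induct\<close> for sections over \<open>S\<close>: the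
  coframe is that of \<open>M\<close>, while the coefficients are functions on \<open>S\<close>
  only.\<close>

lemma L_induct [consumes 2, case_names simple add local]:
  assumes a: "a \<in> L" and s: "s \<in> carrier S"
    and simple: "\<And>a F. a \<in> Cinf S \<Longrightarrow> F \<in> Cinf M \<Longrightarrow> P (a \<odot> dif M F)"
    and add: "\<And>a b. a \<in> L \<Longrightarrow> b \<in> L \<Longrightarrow> P a \<Longrightarrow> P b \<Longrightarrow> P (a + b)"
    and local: "\<And>a b W. a \<in> L \<Longrightarrow> b \<in> L \<Longrightarrow> S.is_open W \<Longrightarrow> s \<in> W \<Longrightarrow>
      (\<And>x. x \<in> W \<Longrightarrow> a x = b x) \<Longrightarrow> P a \<Longrightarrow> P b"
  shows "P a"
proof -
  obtain W I F D where *: "M.is_open W" "s \<in> W" "finite (I :: 'e set)" "\<And>c. c \<in> I \<Longrightarrow> F c \<in> Cinf M"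
    "\<And>c. c \<in> I \<Longrightarrow> D c \<in> vector_fields M"
    "\<And>q v. q \<in> W \<Longrightarrow> v \<in> tangent M q \<Longrightarrow> v = (\<Sum>c\<in>I. v (F c) *\<^sub>R D c q)"
    "\<And>q a. q \<in> W \<Longrightarrow> a \<in> cotangent M q \<Longrightarrow> a = (\<Sum>c\<in>I. a (D c q) *\<^sub>R dif M (F c) q)"
    by (rule M.local_coframe[OF in_M[OF s]], rule that)
  let ?b = "\<lambda>J. \<Sum>c\<in>J. (\<lambda>q. a q (D c q)) \<odot> dif M (F c)"
  have s1: "(\<lambda>q. a q (D c q)) \<odot> dif M (F c) \<in> L" if "c \<in> I" for c
    by (rule L_simple[OF LD(3)[OF a *(5)[OF that]] *(4)[OF that]])
  have "P (?b J)" if "J \<subseteq> I" for J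
    using finite_subset[OF that *(3)] that
  proof (induction J)
    case empty
    have "P ((0 :: 'a \<Rightarrow> real) \<odot> dif M 0)" by (rule simple[OF S.Cinf_0 M.Cinf_0])
    moreover have "(0 :: 'a \<Rightarrow> real) \<odot> dif M 0 = 0" by (simp add: fun_eq_iff)
    ultimately have "P (?b {})" by (simp only: sum.empty)
    then show ?case .
  next
    case (insert c J)
    have IH: "P (?b J)" by (rule insert.IH) (use insert.prems in simp)
    have c: "c \<in> I" "J \<subseteq> I" using insert.prems by auto
    have "P ((\<lambda>q. a q (D c q)) \<odot> dif M (F c) + ?b J)"
      by (rule add[OF s1[OF c(1)] L_sum[OF s1] simple[OF LD(3)[OF a *(5)[OF c(1)]] *(4)[OF c(1)]] IH])
        (use c in auto)
    then have "P (?b (insert c J))" using insert.hyps by (simp only: sum.insert if_False simp_thms)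
    then show ?case .
  qed
  then have "P (?b I)" by simp
  then show ?thesis
    using *(2) s *(7)[OF _ LD(1)[OF a]] s1
    by (intro local[OF _ a open_restr[OF *(1)], of "?b I"] L_sum) (auto simp: sum_apply)
qed

text \<open>Coefficients extend locally by \<open>extension\<close>, and the differentials dF live
  on \<open>M\<close> already. This provides the forms demanded by the definition of
  \<open>br\<close>.\<close>

lemma extend_section:
  assumes "a \<in> L" "s \<in> carrier S"
  shows "\<exists>\<alpha> W. \<alpha> \<in> one_forms M \<and> S.is_open W \<and> s \<in> W \<and> (\<forall>x\<in>W. \<alpha> x = a x)"
  using assms
proof (induction rule: L_induct)
  case (simple a F)
  obtain A W where "A \<in> Cinf M" "S.is_open W" "s \<in> W" "\<forall>x\<in>W. A x = a x"
    using extension[OF simple(1) assms(2)] by blast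
  then have "\<exists>\<alpha> W. \<alpha> \<in> one_forms M \<and> S.is_open W \<and> s \<in> W \<and> (\<forall>x\<in>W. \<alpha> x = (a \<odot> dif M F) x)"
    using M.one_forms_fmul[OF _ M.dif_one_form[OF simple(2)], of A]
    by (intro exI[of _ "A \<odot> dif M F"] exI[of _ W]) simp
  then show ?case .
next
  case (add a b)
  obtain \<alpha> W \<beta> W' where "\<alpha> \<in> one_forms M" "S.is_open W" "s \<in> W" "\<forall>x\<in>W. \<alpha> x = a x"
    "\<beta> \<in> one_forms M" "S.is_open W'" "s \<in> W'" "\<forall>x\<in>W'. \<beta> x = b x" using add(3,4) by blast
  then have "\<exists>\<alpha> W. \<alpha> \<in> one_forms M \<and> S.is_open W \<and> s \<in> W \<and> (\<forall>x\<in>W. \<alpha> x = (a + b) x)"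
    using M.one_forms_add[of \<alpha> \<beta>] by (intro exI[of _ "\<alpha> + \<beta>"] exI[of _ "W \<inter> W'"]) auto
  then show ?case .
next
  case (local a b W)
  obtain \<alpha> W' where "\<alpha> \<in> one_forms M" "S.is_open W'" "s \<in> W'" "\<forall>x\<in>W'. \<alpha> x = a x" using local(6) by blast
  then show ?case using local(3-5) by (intro exI[of _ \<alpha>] exI[of _ "W' \<inter> W"]) auto
qed

section \<open>The bracket of sections over the leaf is well defined\<close>

lemma pb_zero: "S.pb f 0 = 0"
  using S.pb_scale_right[OF S.Cinf_0, of f 0] by (simp only: scaleR_zero_left)

text \<open>Near s the form \<gamma> is a sum of terms g dF with g zero on \<open>W\<close>. In the
  bracket of such a term with b dG the only summand without a factor g is b {G, g} dF, and {G, g} at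
  s is computed on \<open>S\<close>, where g vanishes near s, because S is a Poisson
  submanifold.\<close>

lemma fb_vanishing:
  assumes \<gamma>: "\<gamma> \<in> one_forms M" and \<beta>: "\<beta> \<in> one_forms M" and W: "S.is_open W" "s \<in> W" "\<And>x. x \<in> W \<Longrightarrow> \<gamma> x = 0"
  shows "M.fb \<gamma> \<beta> s = 0"
proof -
  have s: "s \<in> carrier S" using W S.is_open_subset by auto
  note sM = in_M[OF s]
  have simple: "M.fb (g \<odot> dif M F) \<beta> s = 0"
    if g: "g \<in> Cinf M" "\<And>x. x \<in> W \<Longrightarrow> g x = 0" and F: "F \<in> Cinf M" for g F
    using \<beta> sM
  proof (induction rule: M.one_form_induct)
    case (simple b G)
    have "S.pb (restr S G) (restr S g) s = S.pb (restr S G) 0 s"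
      by (rule S.pb_local(1)[OF restr_Cinf[OF g(1)] S.Cinf_0 W(1,2)]) (simp add: restr_def g(2))
    then have "M.pb G g s = 0"
      using fun_cong[OF restr_pb[OF simple(2) g(1)], of s] s by (simp add: restr_def[of S "M.pb G g"] pb_zero)
    then have "M.fb (g \<odot> dif M F) (b \<odot> dif M G) s = 0"
      unfolding M.fb_simple[OF g(1) F simple] using g(2)[OF W(2)] by simp
    then show ?case .
  next
    case (add \<alpha> \<beta>)
    have "M.fb (g \<odot> dif M F) \<alpha> s = 0" "M.fb (g \<odot> dif M F) \<beta> s = 0" by (rule add)+
    then have "M.fb (g \<odot> dif M F) (\<alpha> + \<beta>) s = 0"
      unfolding M.fb_add_right[OF M.one_forms_fmul[OF g(1) M.dif_one_form[OF F]] add(1,2)] by simp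
    then show ?case .
  next
    case (local \<alpha> \<beta> W)
    have "M.fb (g \<odot> dif M F) \<alpha> s = 0" by (rule local)
    then have "M.fb (g \<odot> dif M F) \<beta> s = 0"
      using M.fb_local(1)[OF M.one_forms_fmul[OF g(1) M.dif_one_form[OF F]] local(1-5)] by simp
    then show ?case .
  qed
  obtain V I F D where *: "M.is_open V" "s \<in> V" "finite (I :: 'e set)" "\<And>c. c \<in> I \<Longrightarrow> F c \<in> Cinf M"
    "\<And>c. c \<in> I \<Longrightarrow> D c \<in> vector_fields M"
    "\<And>q v. q \<in> V \<Longrightarrow> v \<in> tangent M q \<Longrightarrow> v = (\<Sum>c\<in>I. v (F c) *\<^sub>R D c q)"
    "\<And>q a. q \<in> V \<Longrightarrow> a \<in> cotangent M q \<Longrightarrow> a = (\<Sum>c\<in>I. a (D c q) *\<^sub>R dif M (F c) q)"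
    by (rule M.local_coframe[OF sM], rule that)
  have g: "(\<lambda>q. \<gamma> q (D c q)) \<in> Cinf M" if "c \<in> I" for c by (rule M.one_formD(3)[OF \<gamma> *(5)[OF that]])
  have o: "(\<lambda>q. \<gamma> q (D c q)) \<odot> dif M (F c) \<in> one_forms M" if "c \<in> I" for c
    by (intro M.one_forms_fmul g that M.dif_one_form *(4))
  have add0: "M.fb (\<alpha> + \<alpha>') \<beta> s = 0" if "\<alpha> \<in> one_forms M" "\<alpha>' \<in> one_forms M" "M.fb \<alpha> \<beta> s = 0" "M.fb \<alpha>' \<beta> s = 0" for \<alpha> \<alpha>'
    unfolding M.fb_add_left[OF \<beta> that(1,2)] using that(3,4) by simp
  have zero: "M.fb 0 \<beta> s = 0"
    using fun_cong[OF M.fb_add_left[OF \<beta> M.one_forms_zero M.one_forms_zero], of s] by simp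
  have sum: "M.fb (sum \<alpha> J) \<beta> s = 0"
    if "\<And>c. c \<in> J \<Longrightarrow> \<alpha> c \<in> one_forms M \<and> M.fb (\<alpha> c) \<beta> s = 0" for \<alpha> and J :: "'e set"
    using that by (induction J rule: infinite_finite_induct) (simp_all add: zero add0 M.one_forms_sum)
  have "M.fb (\<Sum>c\<in>I. (\<lambda>q. \<gamma> q (D c q)) \<odot> dif M (F c)) \<beta> s = 0"
    by (rule sum) (use simple[OF g _ *(4)] W(3) o in auto)
  moreover have "M.fb \<gamma> \<beta> s = M.fb (\<Sum>c\<in>I. (\<lambda>q. \<gamma> q (D c q)) \<odot> dif M (F c)) \<beta> s"
    by (rule M.fb_local(2)[OF \<beta> \<gamma> M.one_forms_sum[OF o] *(1,2)])
      (use *(7)[OF _ M.one_formD(1)[OF \<gamma>]] in \<open>auto simp: sum_apply\<close>)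
  ultimately show ?thesis by simp
qed

lemma fb_restriction:
  assumes \<alpha>: "\<alpha> \<in> one_forms M" "\<alpha>' \<in> one_forms M" and \<beta>: "\<beta> \<in> one_forms M" "\<beta>' \<in> one_forms M"
    and W: "S.is_open W" "s \<in> W" "\<And>x. x \<in> W \<Longrightarrow> \<alpha> x = \<alpha>' x \<and> \<beta> x = \<beta>' x"
  shows "M.fb \<alpha> \<beta> s = M.fb \<alpha>' \<beta>' s"
proof -
  have left: "M.fb \<alpha> \<beta> s = M.fb \<alpha>' \<beta> s"
    if "\<alpha> \<in> one_forms M" "\<alpha>' \<in> one_forms M" "\<beta> \<in> one_forms M" "\<And>x. x \<in> W \<Longrightarrow> \<alpha> x = \<alpha>' x" for \<alpha> \<alpha>' \<beta>
  proof -
    have "M.fb (\<alpha> - \<alpha>') \<beta> s = 0"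
      by (rule fb_vanishing[OF M.one_forms_diff[OF that(1,2)] that(3) W(1,2)]) (use that(4) in auto)
    then show ?thesis using M.fb_add_left[OF that(3) M.one_forms_diff[OF that(1,2)] that(2)] by simp
  qed
  have "M.fb \<alpha> \<beta> s = M.fb \<alpha>' \<beta> s" by (rule left[OF \<alpha> \<beta>(1)]) (use W in auto)
  also have "\<dots> = M.fb \<alpha>' \<beta>' s"
    using left[OF \<beta> \<alpha>(2)] W M.fb_antisym[OF \<alpha>(2) \<beta>(1)] M.fb_antisym[OF \<alpha>(2) \<beta>(2)] by simp
  finally show ?thesis .
qed

text \<open>All extensions give the same value by \<open>fb_restriction\<close>, so the choice in
  the definition of \<open>br\<close> is immaterial and any convenient extension may be
  used.\<close>

lemma br_eq:
  assumes \<alpha>: "\<alpha> \<in> one_forms M" and \<beta>: "\<beta> \<in> one_forms M"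
    and W: "S.is_open W" "s \<in> W" "\<And>x. x \<in> W \<Longrightarrow> \<alpha> x = a x \<and> \<beta> x = b x"
  shows "br a b s = M.fb \<alpha> \<beta> s"
proof -
  have s: "s \<in> carrier S" using W S.is_open_subset by auto
  let ?P = "\<lambda>c. \<exists>\<alpha>\<in>one_forms M. \<exists>\<beta>\<in>one_forms M. \<exists>W. S.is_open W \<and> s \<in> W \<and>
       (\<forall>x\<in>W. \<alpha> x = a x \<and> \<beta> x = b x) \<and> c = M.fb \<alpha> \<beta> s"
  have "(SOME c. ?P c) = M.fb \<alpha> \<beta> s"
  proof (rule some_equality)
    show "?P (M.fb \<alpha> \<beta> s)" using assms by blast
    fix c assume "?P c"
    then obtain \<alpha>' \<beta>' W' where *: "\<alpha>' \<in> one_forms M" "\<beta>' \<in> one_forms M" "S.is_open W'" "s \<in> W'"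
      "\<forall>x\<in>W'. \<alpha>' x = a x \<and> \<beta>' x = b x" "c = M.fb \<alpha>' \<beta>' s" by blast
    show "c = M.fb \<alpha> \<beta> s"
      unfolding *(6)
      by (rule fb_restriction[OF *(1) \<alpha> *(2) \<beta> openin_Int[OF *(3) W(1)]]) (use *(4,5) W in auto)
  qed
  then show ?thesis using s by (simp add: br_def)
qed

lemma br_outside: "s \<notin> carrier S \<Longrightarrow> br a b s = 0"
  by (simp add: br_def)

lemma extend_sections:
  assumes "a \<in> L" "b \<in> L" "s \<in> carrier S"
  obtains \<alpha> \<beta> W where "\<alpha> \<in> one_forms M" "\<beta> \<in> one_forms M" "S.is_open W" "s \<in> W"
    "\<And>x. x \<in> W \<Longrightarrow> \<alpha> x = a x \<and> \<beta> x = b x"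
proof -
  obtain \<alpha> W where 1: "\<alpha> \<in> one_forms M" "S.is_open W" "s \<in> W" "\<forall>x\<in>W. \<alpha> x = a x"
    using extend_section[OF assms(1,3)] by blast
  obtain \<beta> W' where 2: "\<beta> \<in> one_forms M" "S.is_open W'" "s \<in> W'" "\<forall>x\<in>W'. \<beta> x = b x"
    using extend_section[OF assms(2,3)] by blast
  show ?thesis by (rule that[OF 1(1) 2(1) openin_Int[OF 1(2) 2(2)]]) (use 1 2 in auto)
qed

lemma br_antisym:
  assumes a: "a \<in> L" and b: "b \<in> L" shows "br b a = - br a b"
proof
  fix s show "br b a s = (- br a b) s"
  proof (cases "s \<in> carrier S")
    case True
    obtain \<alpha> \<beta> W where *: "\<alpha> \<in> one_forms M" "\<beta> \<in> one_forms M" "S.is_open W" "s \<in> W"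
      "\<And>x. x \<in> W \<Longrightarrow> \<alpha> x = a x \<and> \<beta> x = b x" by (rule extend_sections[OF a b True], rule that)
    have "br a b s = M.fb \<alpha> \<beta> s" by (rule br_eq[OF *])
    moreover have "br b a s = M.fb \<beta> \<alpha> s" by (rule br_eq[OF *(2,1,3,4)]) (use *(5) in auto)
    ultimately show ?thesis using M.fb_antisym[OF *(1,2)] by simp
  qed (simp add: br_outside)
qed

lemma br_add_right:
  assumes a: "a \<in> L" and b: "b \<in> L" and c: "c \<in> L" shows "br a (b + c) = br a b + br a c"
proof
  fix s show "br a (b + c) s = (br a b + br a c) s"
  proof (cases "s \<in> carrier S")
    case True
    obtain \<alpha> \<beta> W where 1: "\<alpha> \<in> one_forms M" "\<beta> \<in> one_forms M" "S.is_open W" "s \<in> W"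
      "\<And>x. x \<in> W \<Longrightarrow> \<alpha> x = a x \<and> \<beta> x = b x" by (rule extend_sections[OF a b True], rule that)
    obtain \<gamma> W' where 2: "\<gamma> \<in> one_forms M" "S.is_open W'" "s \<in> W'" "\<forall>x\<in>W'. \<gamma> x = c x"
      using extend_section[OF c True] by blast
    have "br a b s = M.fb \<alpha> \<beta> s" by (rule br_eq[OF 1])
    moreover have "br a c s = M.fb \<alpha> \<gamma> s"
      by (rule br_eq[OF 1(1) 2(1) openin_Int[OF 1(3) 2(2)]]) (use 1 2 in auto)
    moreover have "br a (b + c) s = M.fb \<alpha> (\<beta> + \<gamma>) s"
      by (rule br_eq[OF 1(1) M.one_forms_add[OF 1(2) 2(1)] openin_Int[OF 1(3) 2(2)]]) (use 1 2 in auto)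
    ultimately show ?thesis using M.fb_add_right[OF 1(1,2) 2(1)] by simp
  qed (simp add: br_outside)
qed

lemma br_add_left:
  assumes "a \<in> L" "b \<in> L" "c \<in> L" shows "br (b + c) a = br b a + br c a"
  using br_add_right[OF assms] br_antisym[OF assms(1,2)] br_antisym[OF assms(1,3)]
    br_antisym[OF assms(1) L_add[OF assms(2,3)]] by simp

lemma br_local:
  assumes W: "S.is_open W" "s \<in> W" "\<And>x. x \<in> W \<Longrightarrow> a x = a' x \<and> b x = b' x" and "a \<in> L" "b \<in> L"
  shows "br a b s = br a' b' s"
proof -
  have s: "s \<in> carrier S" using W S.is_open_subset by auto
  obtain \<alpha> \<beta> W' where *: "\<alpha> \<in> one_forms M" "\<beta> \<in> one_forms M" "S.is_open W'" "s \<in> W'"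
    "\<And>x. x \<in> W' \<Longrightarrow> \<alpha> x = a x \<and> \<beta> x = b x" by (rule extend_sections[OF assms(4,5) s], rule that)
  have "br a b s = M.fb \<alpha> \<beta> s" by (rule br_eq[OF *])
  moreover have "br a' b' s = M.fb \<alpha> \<beta> s"
    by (rule br_eq[OF *(1,2) openin_Int[OF *(3) W(1)]]) (use * W in auto)
  ultimately show ?thesis by simp
qed

text \<open>The shape of \<open>fb_simple\<close>, but the coefficients are differentiated by the
  bracket of \<open>S\<close>, which makes sense for functions given on \<open>S\<close>
  only.\<close>

lemma br_simple:
  assumes a: "a \<in> Cinf S" and F: "F \<in> Cinf M" and b: "b \<in> Cinf S" and G: "G \<in> Cinf M"
  shows "br (a \<odot> dif M F) (b \<odot> dif M G) = (a * b) \<odot> dif M (M.pb F G) +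
    (a * S.pb (restr S F) b) \<odot> dif M G - (b * S.pb (restr S G) a) \<odot> dif M F"
    (is "_ = ?R")
proof
  fix s show "br (a \<odot> dif M F) (b \<odot> dif M G) s = ?R s"
  proof (cases "s \<in> carrier S")
    case False
    then show ?thesis using S.Cinf_outside[OF a False] S.Cinf_outside[OF b False] by (simp add: br_outside)
  next
    case s: True
    obtain A W where A: "A \<in> Cinf M" "S.is_open W" "s \<in> W" "\<forall>x\<in>W. A x = a x"
      using extension[OF a s] by blast
    obtain B W' where B: "B \<in> Cinf M" "S.is_open W'" "s \<in> W'" "\<forall>x\<in>W'. B x = b x"
      using extension[OF b s] by blast
    have pb: "M.pb H X s = S.pb (restr S H) x s"
      if "H \<in> Cinf M" "X \<in> Cinf M" "x \<in> Cinf S" "S.is_open W" "s \<in> W" "\<forall>y\<in>W. X y = x y" for H X x W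
    proof -
      have "S.pb (restr S H) (restr S X) s = S.pb (restr S H) x s"
        by (rule S.pb_local(1)[OF restr_Cinf[OF that(2)] that(3-5)])
          (use that(4,6) S.is_open_subset in \<open>auto simp: restr_def\<close>)
      then show ?thesis
        using fun_cong[OF restr_pb[OF that(1,2)], of s] s by (simp add: restr_def[of S "M.pb H X"])
    qed
    have "br (a \<odot> dif M F) (b \<odot> dif M G) s = M.fb (A \<odot> dif M F) (B \<odot> dif M G) s"
      by (rule br_eq[OF _ _ openin_Int[OF A(2) B(2)]])
        (use A B in \<open>auto intro!: M.one_forms_fmul M.dif_one_form F G\<close>)
    also have "\<dots> = ?R s"
      unfolding M.fb_simple[OF A(1) F B(1) G] using pb[OF F B(1) b B(2-4)] pb[OF G A(1) a A(2-4)] A B by simp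
    finally show ?thesis .
  qed
qed

lemma L_induct2 [consumes 3, case_names simple add_left add_right local]:
  assumes a: "a \<in> L" and b: "b \<in> L" and s: "s \<in> carrier S"
    and simple: "\<And>a F b G. a \<in> Cinf S \<Longrightarrow> F \<in> Cinf M \<Longrightarrow> b \<in> Cinf S \<Longrightarrow> G \<in> Cinf M \<Longrightarrow> P (a \<odot> dif M F) (b \<odot> dif M G)"
    and add_left: "\<And>a a' b. a \<in> L \<Longrightarrow> a' \<in> L \<Longrightarrow> b \<in> L \<Longrightarrow> P a b \<Longrightarrow> P a' b \<Longrightarrow> P (a + a') b"
    and add_right: "\<And>a b b'. a \<in> L \<Longrightarrow> b \<in> L \<Longrightarrow> b' \<in> L \<Longrightarrow> P a b \<Longrightarrow> P a b' \<Longrightarrow> P a (b + b')"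
    and local: "\<And>a a' b b' W. a \<in> L \<Longrightarrow> a' \<in> L \<Longrightarrow> b \<in> L \<Longrightarrow> b' \<in> L \<Longrightarrow> S.is_open W \<Longrightarrow> s \<in> W \<Longrightarrow>
      (\<And>x. x \<in> W \<Longrightarrow> a x = a' x \<and> b x = b' x) \<Longrightarrow> P a b \<Longrightarrow> P a' b'"
  shows "P a b"
  using b s
proof (rule L_induct)
  show "P a (b \<odot> dif M G)" if b: "b \<in> Cinf S" and G: "G \<in> Cinf M" for b G
    using a s
  proof (rule L_induct)
    note bG = L_simple[OF b G]
    show "P (a \<odot> dif M F) (b \<odot> dif M G)" if "a \<in> Cinf S" "F \<in> Cinf M" for a F by (rule simple[OF that b G])
    show "P (a + a') (b \<odot> dif M G)" if "a \<in> L" "a' \<in> L" "P a (b \<odot> dif M G)" "P a' (b \<odot> dif M G)" for a a'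
      by (rule add_left[OF that(1,2) bG that(3,4)])
    show "P a' (b \<odot> dif M G)" if "a \<in> L" "a' \<in> L" "S.is_open W" "s \<in> W" "\<And>x. x \<in> W \<Longrightarrow> a x = a' x" "P a (b \<odot> dif M G)" for a a' W
      by (rule local[OF that(1,2) bG bG that(3,4) _ that(6)]) (simp add: that(5))
  qed
  show "P a (b + b')" if "b \<in> L" "b' \<in> L" "P a b" "P a b'" for b b' by (rule add_right[OF a that])
  show "P a b'" if "b \<in> L" "b' \<in> L" "S.is_open W" "s \<in> W" "\<And>x. x \<in> W \<Longrightarrow> b x = b' x" "P a b" for b b' W
    by (rule local[OF a a that(1-4) _ that(6)]) (simp add: that(5))
qed

lemma br_L: "a \<in> L \<Longrightarrow> b \<in> L \<Longrightarrow> br a b \<in> L"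
proof (rule L_local[OF br_outside])
  fix s assume ab: "a \<in> L" "b \<in> L" and s: "s \<in> carrier S"
  let ?P = "\<lambda>a b. \<exists>c W. c \<in> L \<and> S.is_open W \<and> s \<in> W \<and> (\<forall>x\<in>W. br a b x = c x)"
  have add: "?P x y" if "?P x1 y1" "?P x2 y2" "br x y = br x1 y1 + br x2 y2" for x y x1 y1 x2 y2
  proof -
    obtain c W c' W' where "c \<in> L" "S.is_open W" "s \<in> W" "\<forall>x\<in>W. br x1 y1 x = c x"
      "c' \<in> L" "S.is_open W'" "s \<in> W'" "\<forall>x\<in>W'. br x2 y2 x = c' x" using \<open>?P x1 y1\<close> \<open>?P x2 y2\<close> by metis
    then show ?thesis using that(3) by (intro exI[of _ "c + c'"] exI[of _ "W \<inter> W'"]) (auto simp: L_add)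
  qed
  from ab s show "?P a b"
  proof (induction rule: L_induct2)
    case (simple a F b G)
    have "br (a \<odot> dif M F) (b \<odot> dif M G) \<in> L"
      unfolding br_simple[OF simple] using simple
      by (intro L_diff L_add L_simple S.Cinf_mult M.pb_Cinf S.pb_Cinf restr_Cinf)
    then show ?case using S.is_open_carrier s by blast
  next
    case (add_left a a' b) then show ?case by (intro add[OF add_left(4,5)] br_add_left)
  next
    case (add_right a b b') then show ?case by (intro add[OF add_right(4,5)] br_add_right)
  next
    case (local a a' b b' W)
    obtain c W' where *: "c \<in> L" "S.is_open W'" "s \<in> W'" "\<forall>x\<in>W'. br a b x = c x" using local(8) by blast
    have "br a' b' x = c x" if "x \<in> W \<inter> W'" for x
      using br_local[OF local(5) _ local(7) local(1,3), of x] * that by auto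
    then show ?case using * local(5,6) by (intro exI[of _ c] exI[of _ "W \<inter> W'"]) auto
  qed
qed

section \<open>Restriction to the cotangent bundle of the leaf, anchor, Leibniz rule and Jacobi
  identity\<close>

definition res :: "('a \<Rightarrow> 'a cvec) \<Rightarrow> 'a \<Rightarrow> 'a cvec" where
  "res a s = pull M S s (a s)"

lemma res_linear: "res (a + b) = res a + res b" "res (f \<odot> a) = f \<odot> res a" "res 0 = 0"
  by (auto simp: res_def fun_eq_iff pull_linear)

lemma res_diff: "res (a - b) = res a - res b"
proof -
  have "res (a - b) + res b = res a" using res_linear(1)[of "a - b" b] by simp
  then show ?thesis by (simp add: algebra_simps)
qed

lemma res_simple:
  assumes a: "a \<in> Cinf S" and F: "F \<in> Cinf M" shows "res (a \<odot> dif M F) = a \<odot> dif S (restr S F)"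
proof
  fix s show "res (a \<odot> dif M F) s = (a \<odot> dif S (restr S F)) s"
    using S.Cinf_outside[OF a, of s] pull_dif[OF _ F, of s]
    by (cases "s \<in> carrier S") (simp_all add: res_def pull_linear)
qed

lemma res_one_form: "a \<in> L \<Longrightarrow> res a \<in> one_forms S"
proof (rule S.one_forms_local)
  assume a: "a \<in> L"
  show "res a s = 0" if "s \<notin> carrier S" for s using LD(2)[OF a that] by (simp add: res_def pull_linear)
  fix s assume s: "s \<in> carrier S"
  from a s show "\<exists>\<beta> W. \<beta> \<in> one_forms S \<and> S.is_open W \<and> s \<in> W \<and> (\<forall>q\<in>W. res a q = \<beta> q)"
  proof (induction rule: L_induct)
    case (simple a F)
    have "res (a \<odot> dif M F) \<in> one_forms S"
      unfolding res_simple[OF simple] using simple by (intro S.one_forms_fmul S.dif_one_form restr_Cinf)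
    then show ?case using S.is_open_carrier s by blast
  next
    case (add a b)
    obtain \<alpha> W \<beta> W' where "\<alpha> \<in> one_forms S" "S.is_open W" "s \<in> W" "\<forall>x\<in>W. res a x = \<alpha> x"
      "\<beta> \<in> one_forms S" "S.is_open W'" "s \<in> W'" "\<forall>x\<in>W'. res b x = \<beta> x" using add(3,4) by blast
    then have "\<exists>\<beta> W. \<beta> \<in> one_forms S \<and> S.is_open W \<and> s \<in> W \<and> (\<forall>q\<in>W. res (a + b) q = \<beta> q)"
      unfolding res_linear using S.one_forms_add[of \<alpha> \<beta>]
      by (intro exI[of _ "\<alpha> + \<beta>"] exI[of _ "W \<inter> W'"]) auto
    then show ?case .
  next
    case (local a b W)
    obtain \<alpha> W' where "\<alpha> \<in> one_forms S" "S.is_open W'" "s \<in> W'" "\<forall>x\<in>W'. res a x = \<alpha> x" using local(6) by blast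
    then show ?case using local(3-5) by (intro exI[of _ \<alpha>] exI[of _ "W' \<inter> W"]) (auto simp: res_def)
  qed
qed

text \<open>On generators this says that restriction of functions from \<open>M\<close> to
  \<open>S\<close> preserves Poisson brackets.\<close>

lemma res_br: assumes "a \<in> L" "b \<in> L" shows "res (br a b) = S.fb (res a) (res b)"
proof
  fix s show "res (br a b) s = S.fb (res a) (res b) s"
  proof (cases "s \<in> carrier S")
    case False
    then show ?thesis by (auto simp: res_def br_outside pull_linear form_bracket_def fun_eq_iff S.lie_form_outside S.dif_outside)
  next
    case True
    from assms True show ?thesis
    proof (induction rule: L_induct2)
      case (simple a F b G)
      note C = restr_Cinf[OF simple(2)] restr_Cinf[OF simple(4)]
      have "res (br (a \<odot> dif M F) (b \<odot> dif M G)) = S.fb (res (a \<odot> dif M F)) (res (b \<odot> dif M G))"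
        unfolding br_simple[OF simple] res_simple[OF simple(1,2)] res_simple[OF simple(3,4)] S.fb_simple[OF simple(1) C(1) simple(3) C(2)]
        using simple by (simp add: res_diff res_linear(1) res_simple S.Cinf_mult S.pb_Cinf M.pb_Cinf C restr_pb)
      from fun_cong[OF this, of s] show ?case .
    next
      case (add_left a a' b)
      have "res (br (a + a') b) s = S.fb (res (a + a')) (res b) s"
        unfolding br_add_left[OF add_left(3,1,2)] res_linear
          S.fb_add_left[OF res_one_form[OF add_left(3)] res_one_form[OF add_left(1)] res_one_form[OF add_left(2)]]
        using add_left by simp
      then show ?case .
    next
      case (add_right a b b')
      have "res (br a (b + b')) s = S.fb (res a) (res (b + b')) s"
        unfolding br_add_right[OF add_right(1-3)] res_linear
          S.fb_add_right[OF res_one_form[OF add_right(1)] res_one_form[OF add_right(2)] res_one_form[OF add_right(3)]]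
        using add_right by simp
      then show ?case .
    next
      case (local a a' b b' W)
      have r: "res a x = res a' x" "res b x = res b' x" if "x \<in> W" for x using local(7)[OF that] by (simp_all add: res_def)
      have "res (br a b) s = res (br a' b') s" using br_local[OF local(5-7,1,3)] by (simp add: res_def)
      moreover have "S.fb (res a) (res b) s = S.fb (res a') (res b') s"
        using S.fb_local(2)[OF res_one_form[OF local(3)] res_one_form[OF local(1)] res_one_form[OF local(2)] local(5,6) r(1)]
          S.fb_local(1)[OF res_one_form[OF local(2)] res_one_form[OF local(3)] res_one_form[OF local(4)] local(5,6) r(2)] by simp
      ultimately show ?case using local(8) by simp
    qed
  qed
qed

text \<open>The anchor of the restricted cotangent algebroid, written on \<open>S\<close>: the
  vector \<pi>(a, .) is the push-forward of \<psi>(res a, .) because the inclusion is a Poisson map,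
  so it acts on functions on \<open>S\<close>.\<close>

definition anchor :: "('a \<Rightarrow> 'a cvec) \<Rightarrow> ('a \<Rightarrow> real) \<Rightarrow> 'a \<Rightarrow> real" where
  "anchor a f s = sharp S \<psi> (res a) s f"

lemma anchor_add: "a \<in> L \<Longrightarrow> b \<in> L \<Longrightarrow> anchor (a + b) f = anchor a f + anchor b f"
  by (simp add: fun_eq_iff anchor_def res_linear S.sharp_add res_one_form)

lemma anchor_simple: "a \<in> Cinf S \<Longrightarrow> F \<in> Cinf M \<Longrightarrow> f \<in> Cinf S \<Longrightarrow> anchor (a \<odot> dif M F) f = a * S.pb (restr S F) f"
  by (simp add: fun_eq_iff anchor_def res_simple S.sharp_fmul S.dif_one_form restr_Cinf S.sharp_dif)

lemma anchor_Cinf: "a \<in> L \<Longrightarrow> f \<in> Cinf S \<Longrightarrow> anchor a f \<in> Cinf S"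
  unfolding anchor_def[abs_def] by (rule S.vector_field_Cinf[OF S.sharp_vector_field[OF res_one_form]])

lemma br_leibniz:
  assumes "a \<in> L" "b \<in> L" and f: "f \<in> Cinf S"
  shows "br a (f \<odot> b) = f \<odot> br a b + anchor a f \<odot> b"
proof
  fix s show "br a (f \<odot> b) s = (f \<odot> br a b + anchor a f \<odot> b) s"
  proof (cases "s \<in> carrier S")
    case False
    then show ?thesis by (simp add: br_outside LD(2)[OF assms(2)])
  next
    case True
    from assms(1,2) True show ?thesis
    proof (induction rule: L_induct2)
      case (simple a F b G)
      have "br (a \<odot> dif M F) (f \<odot> b \<odot> dif M G) = f \<odot> br (a \<odot> dif M F) (b \<odot> dif M G) + anchor (a \<odot> dif M F) f \<odot> b \<odot> dif M G"
        unfolding fmul_distrib(4) br_simple[OF simple] br_simple[OF simple(1,2) S.Cinf_mult[OF f simple(3)] simple(4)]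
          anchor_simple[OF simple(1,2) f] S.pb_mult_right[OF f simple(3)]
        by (simp add: fun_eq_iff algebra_simps)
      from fun_cong[OF this, of s] show ?case .
    next
      case (add_left a a' b)
      have i: "br a (f \<odot> b) s = (f \<odot> br a b + anchor a f \<odot> b) s"
        "br a' (f \<odot> b) s = (f \<odot> br a' b + anchor a' f \<odot> b) s" by (rule add_left)+
      have "br (a + a') (f \<odot> b) s = (f \<odot> br (a + a') b + anchor (a + a') f \<odot> b) s"
        unfolding br_add_left[OF add_left(3,1,2)] br_add_left[OF L_fmul[OF f add_left(3)] add_left(1,2)] anchor_add[OF add_left(1,2)]
        using i by (simp add: algebra_simps)
      then show ?case .
    next
      case (add_right a b b')
      have i: "br a (f \<odot> b) s = (f \<odot> br a b + anchor a f \<odot> b) s"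
        "br a (f \<odot> b') s = (f \<odot> br a b' + anchor a f \<odot> b') s" by (rule add_right)+
      have "br a (f \<odot> (b + b')) s = (f \<odot> br a (b + b') + anchor a f \<odot> (b + b')) s"
        unfolding br_add_right[OF add_right(1-3)] fmul_distrib(1) br_add_right[OF add_right(1) L_fmul[OF f add_right(2)] L_fmul[OF f add_right(3)]]
        using i by (simp add: algebra_simps)
      then show ?case .
    next
      case (local a a' b b' W)
      have "br a (f \<odot> b) s = (f \<odot> br a b + anchor a f \<odot> b) s" by (rule local)
      moreover
      have "br a (f \<odot> b) s = br a' (f \<odot> b') s"
        by (rule br_local[OF local(5,6) _ local(1) L_fmul[OF f local(3)]]) (use local(7) in auto)
      moreover have "anchor a f s = anchor a' f s" using local(6,7) by (simp add: anchor_def res_def sharp_def)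
      ultimately have "br a' (f \<odot> b') s = (f \<odot> br a' b' + anchor a' f \<odot> b') s"
        using br_local[OF local(5-7,1,3)] local(6,7) by simp
      then show ?case .
    qed
  qed
qed

text \<open>The Jacobiator is additive and local in each argument, so generators suffice; there it
  reduces to the Jacobi identities on \<open>M\<close> and on \<open>S\<close> and to the product
  rule.\<close>

lemma br_jacobi:
  assumes a: "a \<in> L" and b: "b \<in> L" and c: "c \<in> L"
  shows "br a (br b c) + br b (br c a) + br c (br a b) = 0"
proof -
  define J where "J a b c s = br a (br b c) s + br b (br c a) s + br c (br a b) s" for a b c s
  \<comment> \<open>Cyclic symmetry lets statements on the first argument serve all three.\<close>
  have cyc: "J a b c s = J b c a s" for a b c s by (simp add: J_def)
  have Jadd: "J (a + a') b c s = J a b c s + J a' b c s" if "a \<in> L" "a' \<in> L" "b \<in> L" "c \<in> L" for a a' b c s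
    unfolding J_def br_add_left[OF br_L[OF that(3,4)] that(1,2)] br_add_right[OF that(4,1,2)] br_add_left[OF that(3,1,2)]
      br_add_right[OF that(3) br_L[OF that(4,1)] br_L[OF that(4,2)]]
      br_add_right[OF that(4) br_L[OF that(1,3)] br_L[OF that(2,3)]] by simp
  have Jloc: "J a b c s = J a' b c s"
    if "a \<in> L" "a' \<in> L" "b \<in> L" "c \<in> L" "S.is_open W" "s \<in> W" "\<And>x. x \<in> W \<Longrightarrow> a x = a' x" for a a' b c W s
  proof -
    have 1: "br c a x = br c a' x" "br a b x = br a' b x" if "x \<in> W" for x
      using \<open>x \<in> W\<close> that(1) by (auto intro!: br_local[OF \<open>S.is_open W\<close>] simp: \<open>a \<in> L\<close> \<open>b \<in> L\<close> \<open>c \<in> L\<close> \<open>\<And>x. x \<in> W \<Longrightarrow> a x = a' x\<close>)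
    have "br a (br b c) s = br a' (br b c) s"
      by (rule br_local[OF that(5,6) _ that(1) br_L[OF that(3,4)]]) (simp add: that(7))
    moreover have "br b (br c a) s = br b (br c a') s"
      by (rule br_local[OF that(5,6) _ that(3) br_L[OF that(4,1)]]) (simp add: 1)
    moreover have "br c (br a b) s = br c (br a' b) s"
      by (rule br_local[OF that(5,6) _ that(4) br_L[OF that(1,3)]]) (simp add: 1)
    ultimately show ?thesis by (simp add: J_def)
  qed
  have red: "J a b c s = 0"
    if "a \<in> L" "b \<in> L" "c \<in> L" "s \<in> carrier S" "\<And>f F. f \<in> Cinf S \<Longrightarrow> F \<in> Cinf M \<Longrightarrow> J (f \<odot> dif M F) b c s = 0" for a b c s
    using that(1,4)
  proof (rule L_induct)
    show "J (f \<odot> dif M F) b c s = 0" if "f \<in> Cinf S" "F \<in> Cinf M" for f F by (rule \<open>\<And>f F. f \<in> Cinf S \<Longrightarrow> F \<in> Cinf M \<Longrightarrow> J (f \<odot> dif M F) b c s = 0\<close>[OF that])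
    show "J (a + a') b c s = 0" if "a \<in> L" "a' \<in> L" "J a b c s = 0" "J a' b c s = 0" for a a'
      using Jadd[OF that(1,2) \<open>b \<in> L\<close> \<open>c \<in> L\<close>] that(3,4) by simp
    show "J a' b c s = 0" if "a \<in> L" "a' \<in> L" "S.is_open W" "s \<in> W" "\<And>x. x \<in> W \<Longrightarrow> a x = a' x" "J a b c s = 0" for a a' W
      using Jloc[OF that(1,2) \<open>b \<in> L\<close> \<open>c \<in> L\<close> that(3-5)] that(6) by simp
  qed
  have simple: "J (f \<odot> dif M F) (g \<odot> dif M G) (k \<odot> dif M H) s = 0"
    if f: "f \<in> Cinf S" and F: "F \<in> Cinf M" and g: "g \<in> Cinf S" and G: "G \<in> Cinf M" and k: "k \<in> Cinf S" and H: "H \<in> Cinf M"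
    for f F g G k H s
  proof -
    note CM = F G H M.pb_Cinf
    note rC = restr_Cinf[OF F] restr_Cinf[OF G] restr_Cinf[OF H]
    note CS = f g k rC S.pb_Cinf S.Cinf_mult
    \<comment> \<open>Expands the inner bracket, so that every bracket that remains is again one of
      generators.\<close>
    have three: "br (f \<odot> dif M F) (br (g \<odot> dif M G) (k \<odot> dif M H)) =
        br (f \<odot> dif M F) ((g * k) \<odot> dif M (M.pb G H)) + br (f \<odot> dif M F) ((g * S.pb (restr S G) k) \<odot> dif M H)
        - br (f \<odot> dif M F) ((k * S.pb (restr S H) g) \<odot> dif M G)"
      if f: "f \<in> Cinf S" and F: "F \<in> Cinf M" and g: "g \<in> Cinf S" and G: "G \<in> Cinf M" and k: "k \<in> Cinf S" and H: "H \<in> Cinf M"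
      for f F g G k H
    proof -
      let ?a = "f \<odot> dif M F" and ?x = "(g * k) \<odot> dif M (M.pb G H)" and ?y = "(g * S.pb (restr S G) k) \<odot> dif M H"
        and ?z = "(k * S.pb (restr S H) g) \<odot> dif M G"
      have a: "?a \<in> L" and x: "?x \<in> L" and y: "?y \<in> L" and z: "?z \<in> L"
        using that by (auto intro!: L_simple S.Cinf_mult S.pb_Cinf M.pb_Cinf restr_Cinf)
      have "br ?a ((?x + ?y - ?z) + ?z) = br ?a (?x + ?y - ?z) + br ?a ?z"
        by (rule br_add_right[OF a L_diff[OF L_add[OF x y] z] z])
      then have "br ?a (?x + ?y - ?z) = br ?a (?x + ?y) - br ?a ?z" by (simp add: algebra_simps)
      then show ?thesis unfolding br_simple[OF g G k H] br_add_right[OF a x y] .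
    qed
    have jM: "dif M (M.pb F (M.pb G H)) s v + dif M (M.pb G (M.pb H F)) s v + dif M (M.pb H (M.pb F G)) s v = 0" for v
    proof -
      have "dif M (M.pb F (M.pb G H) + M.pb G (M.pb H F) + M.pb H (M.pb F G)) s v = dif M 0 s v"
        by (simp only: M.pb_jacobi[OF F G H])
      moreover have "dif M 0 s v = 0" using M.dif_scale[OF M.Cinf_0, of 0] by (simp add: fun_eq_iff)
      ultimately show ?thesis by (simp add: M.dif_add CM M.Cinf_add)
    qed
    have jS: "S.pb (S.pb x y) z s = S.pb x (S.pb y z) s - S.pb y (S.pb x z) s" if "x \<in> Cinf S" "y \<in> Cinf S" "z \<in> Cinf S" for x y z
      by (rule S.pb_jacobi_apply[OF that])
    note anti = M.pb_antisym[of H F] M.pb_antisym[of G F] M.pb_antisym[of H G]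
    have "J (f \<odot> dif M F) (g \<odot> dif M G) (k \<odot> dif M H) s v = 0" for v
      unfolding J_def three[OF f F g G k H] three[OF g G k H f F] three[OF k H f F g G]
      using jM[of v]
      by (simp add: br_simple CM CS restr_pb S.pb_mult_right jS, simp add: M.dif_minus anti CM algebra_simps, algebra)
    then show ?thesis by (simp add: fun_eq_iff)
  qed
  have "J a b c s = 0" for s
  proof (cases "s \<in> carrier S")
    case False then show ?thesis by (simp add: J_def br_outside)
  next
    case s: True
    show ?thesis
    proof (rule red[OF a b c s])
      fix f F assume f: "f \<in> Cinf S" "F \<in> Cinf M"
      have "J b c (f \<odot> dif M F) s = 0"
      proof (rule red[OF b c L_simple[OF f] s])
        fix g G assume g: "g \<in> Cinf S" "G \<in> Cinf M"
        have "J c (f \<odot> dif M F) (g \<odot> dif M G) s = 0"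
          by (rule red[OF c L_simple[OF f] L_simple[OF g] s]) (rule simple[OF _ _ f g])
        then show "J (g \<odot> dif M G) c (f \<odot> dif M F) s = 0" by (simp only: cyc)
      qed
      then show "J (f \<odot> dif M F) b c s = 0" by (simp only: cyc)
    qed
  qed
  then show ?thesis by (simp add: J_def fun_eq_iff)
qed

end

text \<open>Let u = \<pi>(\<alpha>, df). Closedness turns the Lie derivative of \<alpha> along the
  Hamiltonian field of f into - du, so the bracket is du + du - du.\<close>

lemma (in poisson_manifold) fb_closed:
  assumes \<alpha>: "\<alpha> \<in> closed_forms A" and f: "f \<in> Cinf A"
  shows "fb \<alpha> (dif A f) = dif A (\<lambda>p. sharp A \<pi> \<alpha> p f)"
proof -
  have \<alpha>1: "\<alpha> \<in> one_forms A" using \<alpha> by (simp add: closed_forms_iff)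
  note X = sharp_vector_field[OF \<alpha>1] and Z = sharp_vector_field[OF dif_one_form[OF f]]
  let ?u = "\<lambda>p. sharp A \<pi> \<alpha> p f"
  have u: "?u \<in> Cinf A" by (rule vector_field_Cinf[OF X f])
  have pair: "bivector_pair A \<pi> \<alpha> (dif A f) = ?u" using f by (simp add: sharp_apply)
  have \<alpha>Z: "(\<lambda>q. \<alpha> q (sharp A \<pi> (dif A f) q)) = - ?u"
  proof
    fix q show "\<alpha> q (sharp A \<pi> (dif A f) q) = (- ?u) q"
    proof (cases "q \<in> carrier A")
      case True
      then show ?thesis
        unfolding sharp_def pair_sharp[OF True dif_cotangent one_formD(1)[OF \<alpha>1]]
        using bivector_antisym[OF True dif_cotangent one_formD(1)[OF \<alpha>1], of f] f by (simp add: sharp_at_def)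
    qed (simp add: one_formD(2)[OF \<alpha>1] vector_field_zero[OF X])
  qed
  have "lie_form A (sharp A \<pi> (dif A f)) \<alpha> p v = - dif A ?u p v" for p v
  proof (cases "p \<in> carrier A \<and> v \<in> tangent A p")
    case False then show ?thesis by (auto simp: lie_form_outside dif_def)
  next
    case True
    then have p: "p \<in> carrier A" and v: "v \<in> tangent A p" by auto
    obtain Y where Y: "Y \<in> vector_fields A" "Y p = v"
      "\<And>X \<beta>. lie_form A X \<beta> p v = X p (\<lambda>q. \<beta> q (Y q)) - \<beta> p (lie_bracket X Y p)"
      by (rule lie_form_apply[OF p v], rule that)
    have "ext_deriv \<alpha> (sharp A \<pi> (dif A f)) Y p = 0" using \<alpha> Y Z p by (simp add: closed_forms_iff)
    then show ?thesis
      using tangentD(4)[OF v u u] Y(2) by (simp add: Y(3) ext_deriv_def \<alpha>Z dif_apply[OF p v])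
  qed
  then have "lie_form A (sharp A \<pi> (dif A f)) \<alpha> = - dif A ?u" by (simp add: fun_eq_iff)
  then show ?thesis unfolding form_bracket_def lie_form_dif[OF X f] pair by simp
qed

text \<open>By the Jacobi identity Hamiltonian fields are derivations of the bracket, and
  \<open>closed_iff_derivation\<close> translates this back to forms.\<close>

lemma (in symplectic_manifold) dif_closed: "f \<in> Cinf A \<Longrightarrow> dif A f \<in> closed_forms A"
proof -
  assume f: "f \<in> Cinf A"
  have e: "(\<lambda>q. sharp A \<pi> (dif A f) q g) = pb f g" if "g \<in> Cinf A" for g using that by (simp add: sharp_dif)
  have "pb_derivation (sharp A \<pi> (dif A f))"
    unfolding pb_derivation_def
  proof (intro ballI)
    fix g k p assume g: "g \<in> Cinf A" and k: "k \<in> Cinf A"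
    show "sharp A \<pi> (dif A f) p (pb g k) = pb (\<lambda>q. sharp A \<pi> (dif A f) q g) k p + pb g (\<lambda>q. sharp A \<pi> (dif A f) q k) p"
      unfolding e[OF g] e[OF k] sharp_dif[OF pb_Cinf[OF g k]] using pb_jacobi_apply[OF f g k, of p] by simp
  qed
  then show ?thesis using closed_iff_derivation[OF dif_one_form[OF f]] by simp
qed

lemma (in manifold_on) dif_zero: "dif A 0 = 0"
  using dif_scale[OF Cinf_0, of 0] by (simp only: scaleR_zero_left)

section \<open>The splitting and the infinitesimal Poisson algebra\<close>

context leaf_geometry begin

definition proj :: "'a \<Rightarrow> 'a tvec \<Rightarrow> 'a tvec" where
  "proj s v = (THE u. u \<in> tangent S s \<and>
     (\<exists>w\<in>rcarrier (normal_space M S s). v = push M S u + vertical_differential M S e s w))"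

text \<open>The vertical differential of the class of v lies in that class, so it differs from v by
  a vector tangent to \<open>S\<close>.\<close>

lemma splitting_exists:
  assumes s: "s \<in> carrier S" and v: "v \<in> tangent M s"
  shows "\<exists>u. u \<in> tangent S s \<and> (\<exists>w\<in>rcarrier (normal_space M S s). v = push M S u + vertical_differential M S e s w)"
proof -
  let ?w = "coset (push M S ` tangent S s) v"
  have w: "?w \<in> rcarrier (normal_space M S s)" using v by (simp add: normal_space_def quotient_rspace_def)
  obtain t where t: "t \<in> tangent S s" "vertical_differential M S e s ?w = v + push M S t"
    using vertical[OF s w] by (auto simp: coset_def)
  have "v = push M S ((-1) *\<^sub>R t) + vertical_differential M S e s ?w" using t(2) by (simp only: push_linear(2)) simp
  then show ?thesis using w S.tangent_subspace(2)[OF t(1), of "-1"] by blast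
qed

text \<open>A local extension F of f whose vertical derivatives vanish sees only the component of v
  tangent to \<open>S\<close>. This gives uniqueness of the splitting, and later the smoothness of
  \<open>h\<close>.\<close>

lemma splitting_apply:
  assumes F: "F \<in> Cinf M" and f: "f \<in> Cinf S" and W: "S.is_open W" "x \<in> W"
    and ext: "\<forall>x\<in>W. F x = f x \<and> (\<forall>w\<in>rcarrier (normal_space M S x). vertical_differential M S e x w F = 0)"
    and u: "u \<in> tangent S x" "w \<in> rcarrier (normal_space M S x)" "v = push M S u + vertical_differential M S e x w"
  shows "u f = v F"
proof -
  have "v F = u (restr S F)" using u W(2) ext by (simp add: push_apply[OF F])
  also have "\<dots> = u f"
    by (rule S.tangent_local[OF u(1) restr_Cinf[OF F] f W]) (use ext S.is_open_subset[OF W(1)] in \<open>auto simp: restr_def\<close>)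
  finally show ?thesis by simp
qed

lemma proj:
  assumes s: "s \<in> carrier S" and v: "v \<in> tangent M s"
  shows "proj s v \<in> tangent S s"
    "\<exists>w\<in>rcarrier (normal_space M S s). v = push M S (proj s v) + vertical_differential M S e s w"
    "\<And>u w. u \<in> tangent S s \<Longrightarrow> w \<in> rcarrier (normal_space M S s) \<Longrightarrow>
      v = push M S u + vertical_differential M S e s w \<Longrightarrow> proj s v = u"
proof -
  let ?P = "\<lambda>u. u \<in> tangent S s \<and> (\<exists>w\<in>rcarrier (normal_space M S s). v = push M S u + vertical_differential M S e s w)"
  obtain u where u: "?P u" using splitting_exists[OF s v] by blast
  have uniq: "u' = u" if "?P u'" for u'
  proof
    fix f show "u' f = u f"
    proof (cases "f \<in> Cinf S")
      case True
      obtain F W where *: "F \<in> Cinf M" "S.is_open W" "s \<in> W"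
        "\<forall>x\<in>W. F x = f x \<and> (\<forall>w\<in>rcarrier (normal_space M S x). vertical_differential M S e x w F = 0)"
        using extension[OF True s] by blast
      show ?thesis using splitting_apply[OF *(1) True *(2-4)] u that by metis
    next
      case False then show ?thesis using u that S.tangent_outside by metis
    qed
  qed
  have pu: "proj s v = u" unfolding proj_def by (rule the_equality) (use u uniq in blast)+
  then show "proj s v \<in> tangent S s"
    "\<exists>w\<in>rcarrier (normal_space M S s). v = push M S (proj s v) + vertical_differential M S e s w" using u by auto
  show "proj s v = u" if "u \<in> tangent S s" "w \<in> rcarrier (normal_space M S s)"
    "v = push M S u + vertical_differential M S e s w" for u w
    unfolding pu using uniq[of u] that by auto
qed

lemma proj_apply:
  assumes F: "F \<in> Cinf M" and f: "f \<in> Cinf S" and W: "S.is_open W" "x \<in> W"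
    and ext: "\<forall>x\<in>W. F x = f x \<and> (\<forall>w\<in>rcarrier (normal_space M S x). vertical_differential M S e x w F = 0)"
    and v: "v \<in> tangent M x"
  shows "proj x v f = v F"
proof -
  have x: "x \<in> carrier S" using W S.is_open_subset by auto
  obtain w where "w \<in> rcarrier (normal_space M S x)" "v = push M S (proj x v) + vertical_differential M S e x w"
    using proj(2)[OF x v] by auto
  then show ?thesis by (rule splitting_apply[OF assms(1-5) proj(1)[OF x v]])
qed

lemma proj_eqI:
  assumes s: "s \<in> carrier S" and v: "v \<in> tangent M s" and u: "u \<in> tangent S s"
    and e: "\<And>F f W. F \<in> Cinf M \<Longrightarrow> f \<in> Cinf S \<Longrightarrow> S.is_open W \<Longrightarrow> s \<in> W \<Longrightarrow>
      \<forall>x\<in>W. F x = f x \<and> (\<forall>w\<in>rcarrier (normal_space M S x). vertical_differential M S e x w F = 0) \<Longrightarrow> v F = u f"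
  shows "proj s v = u"
proof
  fix f show "proj s v f = u f"
  proof (cases "f \<in> Cinf S")
    case True
    obtain F W where *: "F \<in> Cinf M" "S.is_open W" "s \<in> W"
      "\<forall>x\<in>W. F x = f x \<and> (\<forall>w\<in>rcarrier (normal_space M S x). vertical_differential M S e x w F = 0)"
      using extension[OF True s] by blast
    show ?thesis using proj_apply[OF *(1) True *(2-4) v] assms(4)[OF *(1) True *(2-4)] by simp
  next
    case False then show ?thesis using S.tangent_outside[OF u] S.tangent_outside[OF proj(1)[OF s v]] by simp
  qed
qed

lemma proj_push:
  assumes s: "s \<in> carrier S" and u: "u \<in> tangent S s" shows "proj s (push M S u) = u"
proof (rule proj_eqI[OF s push_tangent[OF s u] u])
  fix F f W assume *: "F \<in> Cinf M" "f \<in> Cinf S" "S.is_open W" "s \<in> W"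
    "\<forall>x\<in>W. F x = f x \<and> (\<forall>w\<in>rcarrier (normal_space M S x). vertical_differential M S e x w F = 0)"
  show "push M S u F = u f"
    unfolding push_apply[OF *(1)]
    by (rule S.tangent_local[OF u restr_Cinf[OF *(1)] *(2-4)]) (use *(5) S.is_open_subset[OF *(3)] in \<open>auto simp: restr_def\<close>)
qed

lemma h_apply: "h \<alpha> s v = (if s \<in> carrier S \<and> v \<in> tangent M s then \<alpha> s (proj s v) else 0)"
  by (simp add: h_def proj_def)

lemma h_linear: "h (\<alpha> + \<beta>) = h \<alpha> + h \<beta>" "h (f \<odot> \<alpha>) = f \<odot> h \<alpha>" "h (c *\<^sub>R \<alpha>) = c *\<^sub>R h \<alpha>" "h 0 = 0"
  by (auto simp: fun_eq_iff h_apply)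

lemma h_outside: "s \<notin> carrier S \<Longrightarrow> h \<alpha> s = 0"
  by (simp add: fun_eq_iff h_apply)

text \<open>If F is a local extension of f with vanishing vertical derivatives along
  \<open>S\<close>, then \<open>h (a \<odot> dif S f)\<close> is a dF near s, which is visibly
  smooth.\<close>

lemma h_L: "\<alpha> \<in> one_forms S \<Longrightarrow> h \<alpha> \<in> L"
proof (rule L_local[OF h_outside])
  fix s assume \<alpha>: "\<alpha> \<in> one_forms S" and s: "s \<in> carrier S"
  let ?P = "\<lambda>\<alpha>. \<exists>b W. b \<in> L \<and> S.is_open W \<and> s \<in> W \<and> (\<forall>x\<in>W. h \<alpha> x = b x)"
  from \<alpha> s show "?P \<alpha>"
  proof (rule S.one_form_induct)
    fix a f assume a: "a \<in> Cinf S" and f: "f \<in> Cinf S"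
    obtain F W where *: "F \<in> Cinf M" "S.is_open W" "s \<in> W"
      "\<forall>x\<in>W. F x = f x \<and> (\<forall>w\<in>rcarrier (normal_space M S x). vertical_differential M S e x w F = 0)"
      using extension[OF f s] by blast
    have "h (a \<odot> dif S f) x = (a \<odot> dif M F) x" if x: "x \<in> W" for x
    proof
      fix v
      have xS: "x \<in> carrier S" using x S.is_open_subset[OF *(2)] by auto
      show "h (a \<odot> dif S f) x v = (a \<odot> dif M F) x v"
        using proj_apply[OF *(1) f *(2) x *(4)] S.dif_apply[OF xS proj(1)[OF xS]] in_M[OF xS]
        by (auto simp: h_apply xS dif_def[of M])
    qed
    then show "?P (a \<odot> dif S f)" using L_simple[OF a *(1)] *(2,3) by (intro exI[of _ "a \<odot> dif M F"] exI[of _ W]) simp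
  next
    fix \<alpha> \<beta> assume "?P \<alpha>" "?P \<beta>"
    then obtain b W b' W' where "b \<in> L" "S.is_open W" "s \<in> W" "\<forall>x\<in>W. h \<alpha> x = b x"
      "b' \<in> L" "S.is_open W'" "s \<in> W'" "\<forall>x\<in>W'. h \<beta> x = b' x" by metis
    then show "?P (\<alpha> + \<beta>)"
      unfolding h_linear using L_add[of b b'] by (intro exI[of _ "b + b'"] exI[of _ "W \<inter> W'"]) auto
  next
    fix \<alpha> \<beta> W assume W: "S.is_open W" "s \<in> W" "\<And>q. q \<in> W \<Longrightarrow> \<alpha> q = \<beta> q" and "?P \<alpha>"
    then obtain b W' where b: "b \<in> L" "S.is_open W'" "s \<in> W'" "\<forall>x\<in>W'. h \<alpha> x = b x" by metis
    have "h \<beta> x = h \<alpha> x" if "x \<in> W" for x using W(3)[OF that] by (simp add: fun_eq_iff h_apply)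
    then show "?P \<beta>" using b W by (intro exI[of _ b] exI[of _ "W \<inter> W'"]) auto
  qed
qed

lemma res_h: "\<alpha> \<in> one_forms S \<Longrightarrow> res (h \<alpha>) = \<alpha>"
proof (intro ext)
  fix s v assume \<alpha>: "\<alpha> \<in> one_forms S"
  show "res (h \<alpha>) s v = \<alpha> s v"
  proof (cases "s \<in> carrier S \<and> v \<in> tangent S s")
    case True
    then show ?thesis using push_tangent proj_push by (simp add: res_def pull_apply h_apply)
  next
    case False
    then show ?thesis using S.one_formD(2)[OF \<alpha>] S.cotangent_outside[OF S.one_formD(1)[OF \<alpha>]]
      by (cases "s \<in> carrier S") (auto simp: res_def pull_def h_apply)
  qed
qed

lemma GE_iff: "\<eta> \<in> \<Gamma>E \<longleftrightarrow> \<eta> \<in> L \<and> res \<eta> = 0"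
proof -
  have "\<eta> \<in> L \<Longrightarrow> res \<eta> = 0 \<longleftrightarrow> (\<forall>s\<in>carrier S. \<eta> s \<in> conormal_space M S s)"
    using LD(1,2)[of \<eta>] by (auto simp: res_def fun_eq_iff pull_def conormal_space_def)
  then show ?thesis by (auto simp: conormal_sections_def)
qed

lemma GE_L: "\<eta> \<in> \<Gamma>E \<Longrightarrow> \<eta> \<in> L" and res_GE: "\<eta> \<in> \<Gamma>E \<Longrightarrow> res \<eta> = 0"
  by (auto simp: GE_iff)

lemma res_scale: "res (c *\<^sub>R a) = c *\<^sub>R res a"
  by (auto simp: res_def fun_eq_iff pull_linear)

lemma GE_linear: "\<eta> \<in> \<Gamma>E \<Longrightarrow> \<xi> \<in> \<Gamma>E \<Longrightarrow> \<eta> + \<xi> \<in> \<Gamma>E" "f \<in> Cinf S \<Longrightarrow> \<eta> \<in> \<Gamma>E \<Longrightarrow> f \<odot> \<eta> \<in> \<Gamma>E"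
  "\<eta> \<in> \<Gamma>E \<Longrightarrow> c *\<^sub>R \<eta> \<in> \<Gamma>E" "0 \<in> \<Gamma>E" "\<eta> \<in> \<Gamma>E \<Longrightarrow> \<xi> \<in> \<Gamma>E \<Longrightarrow> \<eta> - \<xi> \<in> \<Gamma>E" "\<eta> \<in> \<Gamma>E \<Longrightarrow> - \<eta> \<in> \<Gamma>E"
proof -
  show "\<eta> + \<xi> \<in> \<Gamma>E" "\<eta> - \<xi> \<in> \<Gamma>E" if "\<eta> \<in> \<Gamma>E" "\<xi> \<in> \<Gamma>E"
    using that by (simp_all add: GE_iff L_add L_diff res_linear(1) res_diff)
  show "f \<odot> \<eta> \<in> \<Gamma>E" if "f \<in> Cinf S" "\<eta> \<in> \<Gamma>E"
    using that L_fmul[of f \<eta>] res_linear(2)[of f \<eta>] by (simp add: GE_iff fun_eq_iff)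
  show sc: "c *\<^sub>R \<eta> \<in> \<Gamma>E" if "\<eta> \<in> \<Gamma>E" for c using that L_scale[of \<eta> c] res_scale[of c \<eta>] by (simp add: GE_iff)
  show "0 \<in> \<Gamma>E" using L_zero res_linear(3) by (simp add: GE_iff)
  show "- \<eta> \<in> \<Gamma>E" if "\<eta> \<in> \<Gamma>E" using sc[OF that, of "-1"] by simp
qed

lemma fmult_eq: "fmult f \<xi> = f \<odot> \<xi>"
  by (simp add: fun_eq_iff fmult_def)

lemma br_linear:
  assumes "a \<in> L" "b \<in> L" "c \<in> L"
  shows "br a (b - c) = br a b - br a c" "br (b - c) a = br b a - br c a" "br a (r *\<^sub>R b) = r *\<^sub>R br a b"
    "br (r *\<^sub>R b) a = r *\<^sub>R br b a" "br a 0 = 0" "br 0 a = 0" "br a (- b) = - br a b" "br (- b) a = - br b a"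
proof -
  show d: "br a (b - c) = br a b - br a c"
    using br_add_right[OF assms(1) L_diff[OF assms(2,3)] assms(3)] by simp
  show "br (b - c) a = br b a - br c a"
    using br_add_left[OF assms(1) L_diff[OF assms(2,3)] assms(3)] by simp
  show r0: "br a 0 = 0" using br_add_right[OF assms(1) L_zero L_zero] by simp
  show "br 0 a = 0" using br_add_left[OF assms(1) L_zero L_zero] by simp
  \<comment> \<open>Homogeneity over the reals is the Leibniz rule for the constant function r, on
    which the anchor vanishes.\<close>
  have sc: "br a (r *\<^sub>R b) = r *\<^sub>R br a b" for r
  proof -
    have z: "anchor a (r *\<^sub>R S.unit) = 0"
    proof
      fix s
      have "sharp S \<psi> (res a) s (r *\<^sub>R S.unit) = 0" if "s \<in> carrier S"
      proof -
        note t = S.vector_field_tangent[OF S.sharp_vector_field[OF res_one_form[OF assms(1)]] that]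
        show ?thesis using S.tangent_scale[OF t S.Cinf_unit, of r] S.tangent_const[OF t that] by simp
      qed
      moreover have "sharp S \<psi> (res a) s (r *\<^sub>R S.unit) = 0" if "s \<notin> carrier S"
        using S.vector_field_zero[OF S.sharp_vector_field[OF res_one_form[OF assms(1)]] that] by simp
      ultimately show "anchor a (r *\<^sub>R S.unit) s = 0 s" by (cases "s \<in> carrier S") (simp_all add: anchor_def)
    qed
    have e: "(r *\<^sub>R S.unit) \<odot> x = r *\<^sub>R x" if "x \<in> L" for x :: "'a \<Rightarrow> 'a cvec"
    proof
      fix s show "((r *\<^sub>R S.unit) \<odot> x) s = (r *\<^sub>R x) s"
        using LD(2)[OF that, of s] by (simp add: S.unit_def)
    qed
    then show ?thesis
      using br_leibniz[OF assms(1,2) S.Cinf_scale[OF S.Cinf_unit], of r]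
      unfolding e[OF assms(2)] e[OF br_L[OF assms(1,2)]] z by (simp add: fun_eq_iff)
  qed
  show "br a (r *\<^sub>R b) = r *\<^sub>R br a b" by (rule sc)
  show sc2: "br (r *\<^sub>R b) a = r *\<^sub>R br b a" for r
    using br_antisym[OF assms(1) L_scale[OF assms(2)], of r] br_antisym[OF assms(1,2)] sc[of r] by simp
  show "br a (- b) = - br a b" using sc[of "-1"] by simp
  show "br (- b) a = - br b a" using sc2[of "-1"] by simp
qed

text \<open>The embedding of \<open>\<P>\<close> into the sections of the restricted cotangent bundle under which the
  bracket of \<open>\<P>\<close> becomes the bracket of the Lie algebroid.\<close>

definition lift :: "('a \<Rightarrow> real) \<times> ('a \<Rightarrow> 'a cvec) \<Rightarrow> 'a \<Rightarrow> 'a cvec" where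
  "lift p = h (d (fst p)) + snd p"

lemma aff_iff: "p \<in> aff \<longleftrightarrow> fst p \<in> Cinf S \<and> snd p \<in> \<Gamma>E"
  by (cases p) (simp add: aff_def)

lemma aff_linear: "p \<in> aff \<Longrightarrow> q \<in> aff \<Longrightarrow> p + q \<in> aff" "p \<in> aff \<Longrightarrow> c *\<^sub>R p \<in> aff" "0 \<in> aff"
  "p \<in> aff \<Longrightarrow> q \<in> aff \<Longrightarrow> p - q \<in> aff"
  by (auto simp: aff_iff S.Cinf_add S.Cinf_scale S.Cinf_0 S.Cinf_diff GE_linear)

lemma hd_L: "f \<in> Cinf S \<Longrightarrow> h (d f) \<in> L"
  by (rule h_L[OF S.dif_one_form])

lemma lift_L: "p \<in> aff \<Longrightarrow> lift p \<in> L"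
  by (simp add: aff_iff lift_def L_add hd_L GE_L)

lemma res_lift: "p \<in> aff \<Longrightarrow> res (lift p) = d (fst p)"
  by (auto simp: aff_iff lift_def res_linear(1) res_h S.dif_one_form res_GE)

lemma lift_linear: "p \<in> aff \<Longrightarrow> q \<in> aff \<Longrightarrow> lift (p + q) = lift p + lift q" "p \<in> aff \<Longrightarrow> lift (c *\<^sub>R p) = c *\<^sub>R lift p"
  by (auto simp: aff_iff lift_def S.dif_add S.dif_scale h_linear scaleR_add_right)

lemma lift_simps: "lift (f, 0) = h (d f)" "lift (0, \<eta>) = \<eta>" "lift 0 = 0"
  by (simp_all add: lift_def S.dif_zero h_linear)

text \<open>\<open>lift\<close> forgets locally constant functions, hence the function parts are
  compared separately.\<close>

lemma lift_inj: "fst p = fst q \<Longrightarrow> lift p = lift q \<Longrightarrow> p = q"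
  by (simp add: lift_def prod_eq_iff)

text \<open>The curvature contributes - h(d{f, g}), because the bracket of df and dg is d{f, g}; the
  other terms are the expansion of the bracket of the two lifts.\<close>

lemma aff_bracket_eq:
  assumes "p \<in> aff" "q \<in> aff"
  shows "aff_bracket p q = (S.pb (fst p) (fst q), br (lift p) (lift q) - h (d (S.pb (fst p) (fst q))))"
proof -
  obtain f \<eta> g \<xi> where p: "p = (f, \<eta>)" and q: "q = (g, \<xi>)" by (cases p, cases q)
  have f: "f \<in> Cinf S" and \<eta>: "\<eta> \<in> L" and g: "g \<in> Cinf S" and \<xi>: "\<xi> \<in> L"
    using assms p q GE_L by (auto simp: aff_iff)
  note hf = hd_L[OF f] and hg = hd_L[OF g]
  have "br (h (d f) + \<eta>) (h (d g) + \<xi>) = br (h (d f)) (h (d g)) + br (h (d f)) \<xi> - br (h (d g)) \<eta> + br \<eta> \<xi>"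
    using br_antisym[OF hg \<eta>]
    by (simp add: br_add_left[OF L_add[OF hg \<xi>] hf \<eta>] br_add_right[OF hf hg \<xi>] br_add_right[OF \<eta> hg \<xi>])
  then show ?thesis by (simp add: p q lift_def \<D>_def \<K>_def S.fb_dif[OF f g])
qed

lemma aff_bracket_fst: "fst (aff_bracket p q) = S.pb (fst p) (fst q)"
  by (cases p; cases q) simp

lemma lift_bracket: "p \<in> aff \<Longrightarrow> q \<in> aff \<Longrightarrow> lift (aff_bracket p q) = br (lift p) (lift q)"
  by (simp add: aff_bracket_eq lift_def)

lemma aff_bracket_aff:
  assumes p: "p \<in> aff" and q: "q \<in> aff" shows "aff_bracket p q \<in> aff"
proof -
  have f: "fst p \<in> Cinf S" "fst q \<in> Cinf S" using assms by (auto simp: aff_iff)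
  note pbC = S.pb_Cinf[OF f]
  have "res (br (lift p) (lift q) - h (d (S.pb (fst p) (fst q)))) = 0"
    by (simp add: res_diff res_br[OF lift_L[OF p] lift_L[OF q]] res_lift p q S.fb_dif[OF f] res_h[OF S.dif_one_form[OF pbC]])
  then show ?thesis
    using L_diff[OF br_L[OF lift_L[OF p] lift_L[OF q]] hd_L[OF pbC]] pbC
    by (simp add: aff_bracket_eq[OF p q] aff_iff GE_iff)
qed

lemma aff_mult_fst: "fst (aff_mult p q) = fst p * fst q"
  by (cases p; cases q) simp

lemma lift_mult: "p \<in> aff \<Longrightarrow> q \<in> aff \<Longrightarrow> lift (aff_mult p q) = fst p \<odot> lift q + fst q \<odot> lift p"
  by (cases p; cases q)
    (simp add: lift_def aff_iff fmult_eq S.dif_mult h_linear fmul_distrib add_ac)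

lemma aff_mult_aff: "p \<in> aff \<Longrightarrow> q \<in> aff \<Longrightarrow> aff_mult p q \<in> aff"
  by (cases p; cases q) (auto simp: aff_iff fmult_eq intro!: S.Cinf_mult GE_linear)

text \<open>Determined by two requirements: the function part is differentiated by the anchor, and
  \<open>lift\<close> intertwines \<open>ad a\<close> with the bracket by \<open>a\<close>, as in
  \<open>lift_ad\<close>.\<close>

definition ad :: "('a \<Rightarrow> 'a cvec) \<Rightarrow> ('a \<Rightarrow> real) \<times> ('a \<Rightarrow> 'a cvec) \<Rightarrow> ('a \<Rightarrow> real) \<times> ('a \<Rightarrow> 'a cvec)" where
  "ad a p = (if p \<in> aff then (anchor a (fst p), br a (lift p) - h (d (anchor a (fst p)))) else 0)"

definition closed_sections :: "('a \<Rightarrow> 'a cvec) set" where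
  "closed_sections = {a\<in>L. res a \<in> closed_forms S}"

lemma closed_sectionsD: "a \<in> closed_sections \<Longrightarrow> a \<in> L" "a \<in> closed_sections \<Longrightarrow> res a \<in> closed_forms S"
  by (auto simp: closed_sections_def)

lemma ad_fst: "p \<in> aff \<Longrightarrow> fst (ad a p) = anchor a (fst p)"
  by (simp add: ad_def)

lemma lift_ad: "p \<in> aff \<Longrightarrow> lift (ad a p) = br a (lift p)"
  by (simp add: ad_def lift_def)

text \<open>The point where closedness enters: by \<open>fb_closed\<close> the bracket restricts to
  an exact form with the primitive \<open>anchor a (fst p)\<close>, so subtracting \<open>h\<close>
  of its differential leaves a conormal section.\<close>

lemma res_br_closed:
  assumes a: "a \<in> closed_sections" and p: "p \<in> aff"
  shows "res (br a (lift p)) = d (anchor a (fst p))"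
proof -
  have f: "fst p \<in> Cinf S" using p by (simp add: aff_iff)
  show ?thesis
    unfolding res_br[OF closed_sectionsD(1)[OF a] lift_L[OF p]] res_lift[OF p] S.fb_closed[OF closed_sectionsD(2)[OF a] f]
    by (simp add: anchor_def[abs_def])
qed

lemma ad_aff:
  assumes a: "a \<in> closed_sections" and p: "p \<in> aff" shows "ad a p \<in> aff"
proof -
  note aL = closed_sectionsD(1)[OF a]
  have f: "fst p \<in> Cinf S" using p by (simp add: aff_iff)
  note C = anchor_Cinf[OF aL f]
  have "res (br a (lift p) - h (d (anchor a (fst p)))) = 0"
    by (simp add: res_diff res_br_closed[OF a p] res_h[OF S.dif_one_form[OF C]])
  then show ?thesis
    using L_diff[OF br_L[OF aL lift_L[OF p]] hd_L[OF C]] C p by (simp add: ad_def aff_iff GE_iff)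
qed

lemma anchor_linear:
  assumes "a \<in> L" "f \<in> Cinf S" "g \<in> Cinf S"
  shows "anchor a (f + g) = anchor a f + anchor a g" "anchor a (c *\<^sub>R f) = c *\<^sub>R anchor a f"
    "anchor a (f * g) = f * anchor a g + g * anchor a f"
proof -
  note V = S.sharp_vector_field[OF res_one_form[OF assms(1)]]
  have "anchor a (f + g) s = anchor a f s + anchor a g s \<and> anchor a (c *\<^sub>R f) s = c * anchor a f s \<and>
      anchor a (f * g) s = f s * anchor a g s + g s * anchor a f s" for s
    using S.tangentD(1-3)[OF S.vector_field_tangent[OF V] assms(2,3)] S.vector_field_zero[OF V, of s]
    by (cases "s \<in> carrier S") (simp_all add: anchor_def)
  then show "anchor a (f + g) = anchor a f + anchor a g" "anchor a (c *\<^sub>R f) = c *\<^sub>R anchor a f"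
    "anchor a (f * g) = f * anchor a g + g * anchor a f" by (simp_all add: fun_eq_iff)
qed

lemma PoissI:
  assumes "\<And>p. p \<in> aff \<Longrightarrow> X p \<in> aff" "\<And>p. p \<notin> aff \<Longrightarrow> X p = 0"
    "\<And>p q. p \<in> aff \<Longrightarrow> q \<in> aff \<Longrightarrow> X (p + q) = X p + X q"
    "\<And>c p. p \<in> aff \<Longrightarrow> X (c *\<^sub>R p) = c *\<^sub>R X p"
    "\<And>p q. p \<in> aff \<Longrightarrow> q \<in> aff \<Longrightarrow> X (aff_mult p q) = aff_mult (X p) q + aff_mult p (X q)"
    "\<And>p q. p \<in> aff \<Longrightarrow> q \<in> aff \<Longrightarrow> X (aff_bracket p q) = aff_bracket (X p) q + aff_bracket p (X q)"
  shows "X \<in> Poiss"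
  unfolding Poiss_def using assms by (simp add: image_subset_iff)

lemma PoissD:
  assumes "X \<in> Poiss"
  shows "p \<in> aff \<Longrightarrow> X p \<in> aff" "p \<notin> aff \<Longrightarrow> X p = 0"
    "p \<in> aff \<Longrightarrow> q \<in> aff \<Longrightarrow> X (p + q) = X p + X q" "p \<in> aff \<Longrightarrow> X (c *\<^sub>R p) = c *\<^sub>R X p"
    "p \<in> aff \<Longrightarrow> q \<in> aff \<Longrightarrow> X (aff_mult p q) = aff_mult (X p) q + aff_mult p (X q)"
    "p \<in> aff \<Longrightarrow> q \<in> aff \<Longrightarrow> X (aff_bracket p q) = aff_bracket (X p) q + aff_bracket p (X q)"
  using assms unfolding Poiss_def by (blast | simp)+

lemma anchor_derivation:
  assumes a: "a \<in> closed_sections" and "f \<in> Cinf S" "g \<in> Cinf S"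
  shows "anchor a (S.pb f g) = S.pb (anchor a f) g + S.pb f (anchor a g)"
proof
  fix s
  have "S.pb_derivation (sharp S \<psi> (res a))"
    using S.closed_iff_derivation[OF res_one_form[OF closed_sectionsD(1)[OF a]]] closed_sectionsD(2)[OF a] by simp
  then show "anchor a (S.pb f g) s = (S.pb (anchor a f) g + S.pb f (anchor a g)) s"
    using assms(2,3) S.vector_field_zero[OF S.sharp_vector_field[OF res_one_form[OF closed_sectionsD(1)[OF a]]], of s]
    by (cases "s \<in> carrier S") (simp_all add: S.pb_derivation_def anchor_def[abs_def] S.pb_outside)
qed

text \<open>Each identity is tested on the function part and under \<open>lift\<close>. There the
  product rule becomes the Leibniz rule of the algebroid, and the bracket rule becomes its Jacobi
  identity together with \<open>anchor_derivation\<close>.\<close>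

lemma ad_Poiss: assumes a: "a \<in> closed_sections" shows "ad a \<in> Poiss"
proof (rule PoissI)
  note aL = closed_sectionsD(1)[OF a]
  show "ad a p \<in> aff" if "p \<in> aff" for p by (rule ad_aff[OF a that])
  show "ad a p = 0" if "p \<notin> aff" for p using that by (simp add: ad_def)
  fix p q assume p: "p \<in> aff"
  have f: "fst p \<in> Cinf S" using p by (simp add: aff_iff)
  show "ad a (c *\<^sub>R p) = c *\<^sub>R ad a p" for c
    by (rule lift_inj) (simp_all add: ad_fst lift_ad aff_linear p ad_aff[OF a] lift_linear anchor_linear(2)[OF aL f f]
      br_linear(3)[OF aL lift_L[OF p] lift_L[OF p]])
  assume q: "q \<in> aff"
  have g: "fst q \<in> Cinf S" using q by (simp add: aff_iff)
  note ap = ad_aff[OF a p] and aq = ad_aff[OF a q]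
  show "ad a (p + q) = ad a p + ad a q"
    by (rule lift_inj) (simp_all add: ad_fst lift_ad aff_linear p q ap aq lift_linear anchor_linear(1)[OF aL f g]
      br_add_right[OF aL lift_L[OF p] lift_L[OF q]])
  show "ad a (aff_mult p q) = aff_mult (ad a p) q + aff_mult p (ad a q)"
  proof (rule lift_inj)
    show "fst (ad a (aff_mult p q)) = fst (aff_mult (ad a p) q + aff_mult p (ad a q))"
      by (simp add: ad_fst aff_mult_aff p q aff_mult_fst anchor_linear(3)[OF aL f g] algebra_simps)
    have "br a (fst p \<odot> lift q + fst q \<odot> lift p) =
        fst p \<odot> br a (lift q) + anchor a (fst p) \<odot> lift q + (fst q \<odot> br a (lift p) + anchor a (fst q) \<odot> lift p)"
      unfolding br_add_right[OF aL L_fmul[OF f lift_L[OF q]] L_fmul[OF g lift_L[OF p]]]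
        br_leibniz[OF aL lift_L[OF q] f] br_leibniz[OF aL lift_L[OF p] g] ..
    then show "lift (ad a (aff_mult p q)) = lift (aff_mult (ad a p) q + aff_mult p (ad a q))"
      by (simp only: lift_ad aff_mult_aff lift_mult p q ap aq lift_linear(1) ad_fst)
        (simp add: add_ac)
  qed
  show "ad a (aff_bracket p q) = aff_bracket (ad a p) q + aff_bracket p (ad a q)"
  proof (rule lift_inj)
    show "fst (ad a (aff_bracket p q)) = fst (aff_bracket (ad a p) q + aff_bracket p (ad a q))"
      by (simp add: ad_fst aff_bracket_aff p q aff_bracket_fst anchor_derivation[OF a f g])
    note P = lift_L[OF p] and Q = lift_L[OF q]
    have "br a (br (lift p) (lift q)) = br (br a (lift p)) (lift q) + br (lift p) (br a (lift q))"
      using br_jacobi[OF aL P Q] br_antisym[OF br_L[OF aL P] Q] br_antisym[OF aL Q] br_linear(7)[OF P br_L[OF aL Q] aL]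
      by (simp add: eq_neg_iff_add_eq_0 algebra_simps)
    then show "lift (ad a (aff_bracket p q)) = lift (aff_bracket (ad a p) q + aff_bracket p (ad a q))"
      by (simp only: lift_ad aff_bracket_aff lift_bracket p q ap aq lift_linear(1))
  qed
qed

lemma ad_linear:
  assumes "a \<in> L" "b \<in> L"
  shows "ad (a + b) = ad a + ad b" "ad (c *\<^sub>R a) = c *\<^sub>R ad a"
proof -
  have "ad (a + b) p = ad a p + ad b p \<and> ad (c *\<^sub>R a) p = c *\<^sub>R ad a p" for p
  proof (cases "p \<in> aff")
    case p: True
    then have f: "fst p \<in> Cinf S" by (simp add: aff_iff)
    have sc: "anchor (c *\<^sub>R a) (fst p) = c *\<^sub>R anchor a (fst p)"
      by (simp add: fun_eq_iff anchor_def res_scale S.sharp_scale[OF res_one_form[OF assms(1)]])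
    show ?thesis
      using S.dif_add[OF anchor_Cinf[OF assms(1) f] anchor_Cinf[OF assms(2) f]] S.dif_scale[OF anchor_Cinf[OF assms(1) f], of c]
        br_linear(4)[OF lift_L[OF p] assms(1) assms(1), of c]
      by (simp add: ad_def p anchor_add[OF assms] sc br_add_left[OF lift_L[OF p] assms] h_linear scaleR_diff_right)
  qed (simp add: ad_def)
  then show "ad (a + b) = ad a + ad b" "ad (c *\<^sub>R a) = c *\<^sub>R ad a" by (simp_all add: fun_eq_iff)
qed

lemma lift_closed: "p \<in> aff \<Longrightarrow> lift p \<in> closed_sections"
  by (simp add: closed_sections_def lift_L res_lift S.dif_closed aff_iff)

lemma anchor_lift: "p \<in> aff \<Longrightarrow> f \<in> Cinf S \<Longrightarrow> anchor (lift p) f = S.pb (fst p) f"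
  by (simp add: fun_eq_iff anchor_def res_lift S.sharp_dif)

lemma ad_lift: "p \<in> aff \<Longrightarrow> ad (lift p) = (\<lambda>q. if q \<in> aff then aff_bracket p q else 0)"
  by (rule ext) (simp add: ad_def aff_bracket_eq anchor_lift aff_iff)

lemma Ham_eq: "Ham = (\<lambda>p. ad (lift p)) ` aff"
  unfolding Ham_def by (rule image_cong[OF refl]) (simp add: ad_lift)

lemma GE_closed: "\<eta> \<in> \<Gamma>E \<Longrightarrow> \<eta> \<in> closed_sections"
  using lift_closed[of "(0, \<eta>)"] by (simp add: aff_iff S.Cinf_0 lift_simps)

lemma h_closed: "\<alpha> \<in> closed_forms S \<Longrightarrow> h \<alpha> \<in> closed_sections"
  by (simp add: closed_sections_def h_L res_h S.closed_forms_iff)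

end

section \<open>Poisson derivations of the infinitesimal Poisson algebra\<close>

context leaf_geometry begin

lemma ad_zero: "ad 0 = 0"
  using ad_linear(2)[OF L_zero L_zero, of 0] by (simp only: scaleR_zero_left)

lemma subspace_Poiss: "subspace Poiss"
proof (rule subspaceI)
  show "0 \<in> Poiss" using ad_Poiss[OF GE_closed[OF GE_linear(4)]] by (simp only: ad_zero)
next
  fix X Y assume X: "X \<in> Poiss" and Y: "Y \<in> Poiss"
  note XD = PoissD[OF X] and YD = PoissD[OF Y]
  have M: "aff_mult (x + y) q = aff_mult x q + aff_mult y q" "aff_mult q (x + y) = aff_mult q x + aff_mult q y" for x y q
    by (cases x; cases y; cases q; simp add: fmult_eq fmul_distrib algebra_simps)+
  have B: "aff_bracket (x + y) q = aff_bracket x q + aff_bracket y q" "aff_bracket q (x + y) = aff_bracket q x + aff_bracket q y"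
    if "x \<in> aff" "y \<in> aff" "q \<in> aff" for x y q
    by (rule lift_inj; simp add: aff_bracket_fst lift_bracket lift_linear aff_linear aff_bracket_aff that
      S.pb_add_left S.pb_add_right br_add_left br_add_right lift_L aff_iff[THEN iffD1])+
  show "X + Y \<in> Poiss"
    by (rule PoissI) (simp_all add: aff_linear XD YD aff_mult_aff aff_bracket_aff M B scaleR_add_right add_ac)
next
  fix X c assume X: "X \<in> Poiss"
  note XD = PoissD[OF X]
  have M: "aff_mult (c *\<^sub>R x) q = c *\<^sub>R aff_mult x q" "aff_mult q (c *\<^sub>R x) = c *\<^sub>R aff_mult q x" for x q
    by (cases x; cases q; simp add: fmult_eq fun_eq_iff scaleR_add_right algebra_simps)+
  have B: "aff_bracket (c *\<^sub>R x) q = c *\<^sub>R aff_bracket x q" "aff_bracket q (c *\<^sub>R x) = c *\<^sub>R aff_bracket q x"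
    if "x \<in> aff" "q \<in> aff" for x q
    using br_linear(3)[OF lift_L[OF that(2)] lift_L[OF that(1)] lift_L[OF that(1)], of c]
      br_linear(4)[OF lift_L[OF that(2)] lift_L[OF that(1)] lift_L[OF that(1)], of c]
    by (auto intro!: lift_inj simp: aff_bracket_fst lift_bracket lift_linear aff_linear aff_bracket_aff that
      S.pb_scale_left S.pb_scale_right aff_iff[THEN iffD1])
  show "c *\<^sub>R X \<in> Poiss"
    by (rule PoissI) (simp_all add: aff_linear XD aff_mult_aff aff_bracket_aff M B scaleR_add_right scaleR_left_commute)
qed

lemma subspace_ad_image:
  assumes "subspace V" "V \<subseteq> L" shows "subspace (ad ` V)"
proof (rule subspaceI)
  show "0 \<in> ad ` V" using subspace_0[OF assms(1)] ad_zero by (metis image_eqI)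
  show "x + y \<in> ad ` V" if xy: "x \<in> ad ` V" "y \<in> ad ` V" for x y
  proof -
    obtain a b where ab: "a \<in> V" "b \<in> V" "x = ad a" "y = ad b" using xy by auto
    have "a \<in> L" "b \<in> L" using ab assms(2) by auto
    then have "x + y = ad (a + b)" using ad_linear(1) ab by simp
    then show ?thesis using subspace_add[OF assms(1) ab(1,2)] by simp
  qed
  show "c *\<^sub>R x \<in> ad ` V" if x: "x \<in> ad ` V" for c x
  proof -
    obtain a where a: "a \<in> V" "x = ad a" using x by auto
    have "a \<in> L" using a assms(2) by auto
    then have "c *\<^sub>R x = ad (c *\<^sub>R a)" using ad_linear(2) a by simp
    then show ?thesis using subspace_scale[OF assms(1) a(1)] by simp
  qed
qed

lemma subspace_GE: "subspace \<Gamma>E"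
  by (rule subspaceI) (auto intro: GE_linear)

lemma subspace_Ham: "subspace Ham"
proof -
  have "subspace (lift ` aff)"
  proof (rule subspaceI)
    show "0 \<in> lift ` aff" using aff_linear(3) lift_simps(3) by (metis image_eqI)
    show "x + y \<in> lift ` aff" if xy: "x \<in> lift ` aff" "y \<in> lift ` aff" for x y
    proof -
      obtain p q where pq: "p \<in> aff" "q \<in> aff" "x = lift p" "y = lift q" using xy by blast
      have "x + y = lift (p + q)" by (simp add: pq lift_linear)
      then show ?thesis using aff_linear(1)[OF pq(1,2)] by simp
    qed
    show "c *\<^sub>R x \<in> lift ` aff" if x: "x \<in> lift ` aff" for c x
    proof -
      obtain p where p: "p \<in> aff" "x = lift p" using x by blast
      have "c *\<^sub>R x = lift (c *\<^sub>R p)" by (simp add: p lift_linear)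
      then show ?thesis using aff_linear(2)[OF p(1)] by simp
    qed
  qed
  from subspace_ad_image[OF this] show ?thesis unfolding Ham_eq image_image[symmetric, of ad lift] using lift_L by blast
qed

text \<open>With \<open>A\<close> the function part of \<open>X \<eta>\<close>, applying \<open>X\<close> to \<open>\<eta> \<cdot> \<eta> = 0\<close> gives \<open>A \<eta> = 0\<close>, and the
  function part of \<open>X (A \<eta>)\<close> is \<open>A\<^sup>2\<close>.\<close>

lemma nilpotent_part:
  assumes X: "X \<in> Poiss" and \<eta>: "\<eta> \<in> \<Gamma>E" shows "fst (X (0, \<eta>)) = 0"
proof -
  note XD = PoissD[OF X]
  have e: "(0, \<xi>) \<in> aff" if "\<xi> \<in> \<Gamma>E" for \<xi> using that by (simp add: aff_iff S.Cinf_0)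
  have fe: "(f, 0) \<in> aff" if "f \<in> Cinf S" for f using that by (simp add: aff_iff GE_linear)
  have lin: "fst (X (0, f \<odot> \<xi>)) = f * fst (X (0, \<xi>))" if f: "f \<in> Cinf S" and \<xi>: "\<xi> \<in> \<Gamma>E" for f \<xi>
  proof -
    have "aff_mult (f, 0) (0, \<xi>) = (0, f \<odot> \<xi>)" by (simp add: fmult_eq fun_eq_iff)
    then show ?thesis using XD(5)[OF fe[OF f] e[OF \<xi>]] by (simp add: aff_mult_fst)
  qed
  define A where "A = fst (X (0, \<eta>))"
  have A: "A \<in> Cinf S" using XD(1)[OF e[OF \<eta>]] by (simp add: aff_iff A_def)
  have X0: "X 0 = 0" using XD(4)[OF aff_linear(3), of 0] by simp
  have "aff_mult (0, \<eta>) (0, \<eta>) = 0" by (simp add: fmult_eq fun_eq_iff prod_eq_iff)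
  then have "0 = aff_mult (X (0, \<eta>)) (0, \<eta>) + aff_mult (0, \<eta>) (X (0, \<eta>))" using XD(5)[OF e[OF \<eta>] e[OF \<eta>]] X0 by simp
  then have "0 = snd (aff_mult (X (0, \<eta>)) (0, \<eta>)) + snd (aff_mult (0, \<eta>) (X (0, \<eta>)))"
    by (metis snd_add snd_zero)
  then have "A \<odot> \<eta> + A \<odot> \<eta> = 0"
    unfolding A_def by (cases "X (0, \<eta>)") (simp add: fmult_eq fun_eq_iff)
  then have "A \<odot> \<eta> = 0" by (simp add: fun_eq_iff)
  then have "A * A = fst (X (0, 0))" using lin[OF A \<eta>] by (simp only: A_def)
  also have "\<dots> = 0" using X0 by (simp add: zero_prod_def)
  finally show ?thesis by (simp add: A_def fun_eq_iff)
qed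

lemma derivation_fst:
  assumes X: "X \<in> Poiss" and p: "p \<in> aff" shows "fst (X p) = (\<lambda>s. induced_field X s (fst p))"
proof -
  have 1: "(fst p, 0) \<in> aff" "(0, snd p) \<in> aff" using p by (auto simp: aff_iff S.Cinf_0 GE_linear)
  have "p = (fst p, 0) + (0, snd p)" by (simp add: prod_eq_iff)
  then have "X p = X (fst p, 0) + X (0, snd p)" using PoissD(3)[OF X 1] by metis
  then show ?thesis using nilpotent_part[OF X, of "snd p"] p by (simp add: aff_iff induced_field_def)
qed

lemma induced_field_poisson:
  assumes X: "X \<in> Poiss" shows "induced_field X \<in> vector_fields S" "S.pb_derivation (induced_field X)"
proof -
  note XD = PoissD[OF X]
  have fe: "(f, 0) \<in> aff" if "f \<in> Cinf S" for f using that by (simp add: aff_iff GE_linear)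
  have C: "fst (X (f, 0)) \<in> Cinf S" if "f \<in> Cinf S" for f using XD(1)[OF fe[OF that]] by (simp add: aff_iff)
  have out: "induced_field X s f = 0" if "f \<notin> Cinf S" for s f
    using XD(2)[of "(f, 0)"] that by (simp add: induced_field_def aff_iff)
  have t: "induced_field X s \<in> tangent S s" for s
  proof -
    have "induced_field X s (f + g) = induced_field X s f + induced_field X s g"
      if "f \<in> Cinf S" "g \<in> Cinf S" for f g
      using XD(3)[OF fe[OF that(1)] fe[OF that(2)]] by (simp add: induced_field_def)
    moreover have "induced_field X s (c *\<^sub>R f) = c * induced_field X s f" if "f \<in> Cinf S" for c f
      using XD(4)[OF fe[OF that], of c] by (simp add: induced_field_def)
    moreover have "induced_field X s (f * g) = f s * induced_field X s g + g s * induced_field X s f"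
      if "f \<in> Cinf S" "g \<in> Cinf S" for f g
    proof -
      have "aff_mult (f, 0) (g, 0) = (f * g, 0)" by (simp add: fmult_eq fun_eq_iff)
      then show ?thesis using XD(5)[OF fe[OF that(1)] fe[OF that(2)]] by (simp add: induced_field_def aff_mult_fst)
    qed
    ultimately show ?thesis using out by (simp add: tangent_def)
  qed
  have "induced_field X s = 0" if "s \<notin> carrier S" for s
    using S.Cinf_outside[OF C that] out by (auto simp: fun_eq_iff induced_field_def)
  then show v: "induced_field X \<in> vector_fields S"
    using t C by (simp add: vector_fields_def induced_field_def)
  show "S.pb_derivation (induced_field X)"
    unfolding S.pb_derivation_def
  proof (intro ballI)
    fix f g s assume f: "f \<in> Cinf S" and g: "g \<in> Cinf S"
    have "fst (X (aff_bracket (f, 0) (g, 0))) = (\<lambda>s. induced_field X s (S.pb f g))"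
      using derivation_fst[OF X aff_bracket_aff[OF fe[OF f] fe[OF g]]] by simp
    moreover have "fst (X (aff_bracket (f, 0) (g, 0))) = S.pb (fst (X (f, 0))) g + S.pb f (fst (X (g, 0)))"
      unfolding XD(6)[OF fe[OF f] fe[OF g]] by (simp only: fst_add aff_bracket_fst fst_conv)
    ultimately show "induced_field X s (S.pb f g) =
        S.pb (\<lambda>q. induced_field X q f) g s + S.pb f (\<lambda>q. induced_field X q g) s"
      by (simp add: induced_field_def fun_eq_iff)
  qed
qed

lemma induced_field_linear: "induced_field (X + Y) = induced_field X + induced_field Y"
  "induced_field (c *\<^sub>R X) = c *\<^sub>R induced_field X" "induced_field (X - Y) = induced_field X - induced_field Y"
  by (simp_all add: fun_eq_iff induced_field_def)

lemma induced_field_ad: "a \<in> L \<Longrightarrow> induced_field (ad a) = sharp S \<psi> (res a)"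
proof (intro ext)
  fix s f assume "a \<in> L"
  show "induced_field (ad a) s f = sharp S \<psi> (res a) s f"
    by (cases "f \<in> Cinf S") (simp_all add: induced_field_def ad_def aff_iff GE_linear anchor_def sharp_def sharp_at_def)
qed

text \<open>On vector fields the choice has exactly one candidate, by \<open>S.exists_flat\<close>
  and \<open>S.sharp_inj\<close>; this is what makes it linear.\<close>

definition flat :: "('a \<Rightarrow> 'a tvec) \<Rightarrow> 'a \<Rightarrow> 'a cvec" where
  "flat v = (SOME \<alpha>. \<alpha> \<in> one_forms S \<and> sharp S \<psi> \<alpha> = v)"

lemma flat: "v \<in> vector_fields S \<Longrightarrow> flat v \<in> one_forms S \<and> sharp S \<psi> (flat v) = v"
  unfolding flat_def by (rule someI_ex[OF S.exists_flat])

lemma flat_sharp: "\<alpha> \<in> one_forms S \<Longrightarrow> flat (sharp S \<psi> \<alpha>) = \<alpha>"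
  using flat[OF S.sharp_vector_field] S.sharp_inj by metis

lemma flat_linear:
  assumes "v \<in> vector_fields S" "w \<in> vector_fields S"
  shows "flat (v + w) = flat v + flat w" "flat (c *\<^sub>R v) = c *\<^sub>R flat v"
proof -
  have "flat (sharp S \<psi> (flat v + flat w)) = flat v + flat w"
    by (rule flat_sharp) (use flat assms S.one_forms_add in blast)
  then show "flat (v + w) = flat v + flat w" using flat assms S.sharp_add by simp
  have "flat (sharp S \<psi> (c *\<^sub>R flat v)) = c *\<^sub>R flat v"
    by (rule flat_sharp) (use flat assms S.one_forms_scale in blast)
  then show "flat (c *\<^sub>R v) = c *\<^sub>R flat v" using flat assms S.sharp_scale by simp
qed

lemma flat_closed: "X \<in> Poiss \<Longrightarrow> flat (induced_field X) \<in> closed_forms S"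
  using S.closed_iff_derivation flat[OF induced_field_poisson(1)] induced_field_poisson(2) by simp

section \<open>Derivations that induce the zero field, as compatible pairs\<close>

definition Poiss0 :: "(('a \<Rightarrow> real) \<times> ('a \<Rightarrow> 'a cvec) \<Rightarrow> ('a \<Rightarrow> real) \<times> ('a \<Rightarrow> 'a cvec)) set" where
  "Poiss0 = {X\<in>Poiss. induced_field X = 0}"

lemma subspace_Poiss0: "subspace Poiss0"
  using subspace_Poiss
  by (auto simp: Poiss0_def subspace_def induced_field_linear) (simp add: fun_eq_iff induced_field_def)

definition gpart :: "(('a \<Rightarrow> real) \<times> ('a \<Rightarrow> 'a cvec) \<Rightarrow> ('a \<Rightarrow> real) \<times> ('a \<Rightarrow> 'a cvec)) \<Rightarrow>
    ('a \<Rightarrow> 'a cvec) \<Rightarrow> 'a \<Rightarrow> 'a cvec" where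
  "gpart X = (\<lambda>\<eta>. snd (X (0, \<eta>)))"

definition hpart :: "(('a \<Rightarrow> real) \<times> ('a \<Rightarrow> 'a cvec) \<Rightarrow> ('a \<Rightarrow> real) \<times> ('a \<Rightarrow> 'a cvec)) \<Rightarrow>
    ('a \<Rightarrow> real) \<Rightarrow> 'a \<Rightarrow> 'a cvec" where
  "hpart X = (\<lambda>f. snd (X (f, 0)))"

lemma linear_gpart: "linear gpart"
  by (rule linearI) (auto simp: gpart_def fun_eq_iff)

lemma hpart_linear: "hpart (X + Y) = hpart X + hpart Y" "hpart (c *\<^sub>R X) = c *\<^sub>R hpart X" "hpart (X - Y) = hpart X - hpart Y"
  by (auto simp: hpart_def fun_eq_iff)

text \<open>The conditions on a pair \<open>(Q, \<delta>)\<close> under which \<open>f \<oplus> \<eta> \<mapsto> 0 \<oplus> (Q f + \<delta> \<eta>)\<close> is a Poisson derivation.\<close>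

definition compatible :: "(('a \<Rightarrow> real) \<Rightarrow> 'a \<Rightarrow> 'a cvec) \<Rightarrow> (('a \<Rightarrow> 'a cvec) \<Rightarrow> 'a \<Rightarrow> 'a cvec) \<Rightarrow> bool" where
  "compatible Q \<delta> \<longleftrightarrow>
    (\<forall>f\<in>Cinf S. Q f \<in> \<Gamma>E) \<and> (\<forall>f\<in>Cinf S. \<forall>g\<in>Cinf S. Q (f + g) = Q f + Q g \<and> Q (f * g) = f \<odot> Q g + g \<odot> Q f) \<and>
    (\<forall>c. \<forall>f\<in>Cinf S. Q (c *\<^sub>R f) = c *\<^sub>R Q f) \<and>
    (\<forall>\<eta>\<in>\<Gamma>E. \<delta> \<eta> \<in> \<Gamma>E) \<and> (\<forall>\<eta>\<in>\<Gamma>E. \<forall>\<xi>\<in>\<Gamma>E. \<delta> (\<eta> + \<xi>) = \<delta> \<eta> + \<delta> \<xi> \<and> \<delta> (br \<eta> \<xi>) = br (\<delta> \<eta>) \<xi> + br \<eta> (\<delta> \<xi>)) \<and>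
    (\<forall>f\<in>Cinf S. \<forall>\<eta>\<in>\<Gamma>E. \<delta> (f \<odot> \<eta>) = f \<odot> \<delta> \<eta>) \<and>
    (\<forall>f\<in>Cinf S. \<forall>\<xi>\<in>\<Gamma>E. \<delta> (\<D> (d f) \<xi>) = br (Q f) \<xi> + \<D> (d f) (\<delta> \<xi>)) \<and>
    (\<forall>f\<in>Cinf S. \<forall>g\<in>Cinf S. Q (S.pb f g) + \<delta> (\<K> (d f) (d g)) = \<D> (d f) (Q g) - \<D> (d g) (Q f))"

lemma pair_aff: "f \<in> Cinf S \<Longrightarrow> (f, 0) \<in> aff" "\<eta> \<in> \<Gamma>E \<Longrightarrow> (0, \<eta>) \<in> aff"
  by (simp_all add: aff_iff GE_linear S.Cinf_0)

lemma pb_zero_left: "S.pb 0 f = 0"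
  using S.pb_antisym[of 0 f] pb_zero[of f] by simp

lemma d_zero: "d 0 = 0"
  by (rule S.dif_zero)

lemma \<D>_GE: "f \<in> Cinf S \<Longrightarrow> \<xi> \<in> \<Gamma>E \<Longrightarrow> \<D> (d f) \<xi> \<in> \<Gamma>E"
  and br_GE: "\<eta> \<in> \<Gamma>E \<Longrightarrow> \<xi> \<in> \<Gamma>E \<Longrightarrow> br \<eta> \<xi> \<in> \<Gamma>E"
  and \<K>_GE: "f \<in> Cinf S \<Longrightarrow> g \<in> Cinf S \<Longrightarrow> \<K> (d f) (d g) \<in> \<Gamma>E"
proof -
  have z: "br 0 0 = 0" "h (d 0) = 0" by (simp_all add: br_linear(5)[OF L_zero L_zero L_zero] d_zero h_linear)
  show "\<D> (d f) \<xi> \<in> \<Gamma>E" if "f \<in> Cinf S" "\<xi> \<in> \<Gamma>E"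
    using aff_bracket_aff[OF pair_aff(1)[OF that(1)] pair_aff(2)[OF that(2)]] that
    unfolding aff_bracket_eq[OF pair_aff(1)[OF that(1)] pair_aff(2)[OF that(2)]]
    by (simp add: lift_simps pb_zero z \<D>_def aff_iff)
  show "br \<eta> \<xi> \<in> \<Gamma>E" if "\<eta> \<in> \<Gamma>E" "\<xi> \<in> \<Gamma>E"
    using aff_bracket_aff[OF pair_aff(2)[OF that(1)] pair_aff(2)[OF that(2)]] that
    unfolding aff_bracket_eq[OF pair_aff(2)[OF that(1)] pair_aff(2)[OF that(2)]]
    by (simp add: lift_simps pb_zero z aff_iff)
  show "\<K> (d f) (d g) \<in> \<Gamma>E" if "f \<in> Cinf S" "g \<in> Cinf S"
    using aff_bracket_aff[OF pair_aff(1)[OF that(1)] pair_aff(1)[OF that(2)]]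
    unfolding aff_bracket_eq[OF pair_aff(1)[OF that(1)] pair_aff(1)[OF that(2)]]
    by (simp add: lift_simps \<K>_def S.fb_dif[OF that] aff_iff)
qed

lemma aff_bracket_pairs:
  assumes "f \<in> Cinf S" "g \<in> Cinf S" "\<eta> \<in> \<Gamma>E" "\<xi> \<in> \<Gamma>E"
  shows "aff_bracket (0, \<eta>) (0, \<xi>) = (0, br \<eta> \<xi>)" "aff_bracket (f, 0) (0, \<xi>) = (0, \<D> (d f) \<xi>)"
    "aff_bracket (f, 0) (g, 0) = (S.pb f g, \<K> (d f) (d g))" "aff_bracket (0, \<eta>) (g, 0) = (0, - \<D> (d g) \<eta>)"
    "aff_bracket (0, \<eta>) (g, \<xi>) = (0, br \<eta> \<xi> - \<D> (d g) \<eta>)" "aff_bracket (f, \<eta>) (0, \<xi>) = (0, \<D> (d f) \<xi> + br \<eta> \<xi>)"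
proof -
  note p = pair_aff(1)[OF assms(1)] pair_aff(1)[OF assms(2)] pair_aff(2)[OF assms(3)] pair_aff(2)[OF assms(4)]
  have gx: "(g, \<xi>) \<in> aff" "(f, \<eta>) \<in> aff" using assms by (simp_all add: aff_iff)
  note L' = GE_L[OF assms(3)] GE_L[OF assms(4)] hd_L[OF assms(1)] hd_L[OF assms(2)]
  have z: "h (d 0) = 0" by (simp add: d_zero h_linear)
  show "aff_bracket (0, \<eta>) (0, \<xi>) = (0, br \<eta> \<xi>)" "aff_bracket (f, 0) (0, \<xi>) = (0, \<D> (d f) \<xi>)"
    "aff_bracket (f, 0) (g, 0) = (S.pb f g, \<K> (d f) (d g))"
    by (simp_all only: aff_bracket_eq p) (simp_all add: lift_simps pb_zero z \<D>_def \<K>_def S.fb_dif assms)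
  show "aff_bracket (0, \<eta>) (g, 0) = (0, - \<D> (d g) \<eta>)"
    unfolding aff_bracket_eq[OF p(3,2)] using br_antisym[OF L'(4,1)] by (simp add: lift_simps pb_zero_left z \<D>_def)
  show "aff_bracket (0, \<eta>) (g, \<xi>) = (0, br \<eta> \<xi> - \<D> (d g) \<eta>)"
    unfolding aff_bracket_eq[OF p(3) gx(1)] using br_antisym[OF L'(4,1)] br_add_right[OF L'(1,4,2)]
    by (simp add: lift_def d_zero h_linear pb_zero_left z \<D>_def)
  show "aff_bracket (f, \<eta>) (0, \<xi>) = (0, \<D> (d f) \<xi> + br \<eta> \<xi>)"
    unfolding aff_bracket_eq[OF gx(2) p(4)] using br_add_left[OF L'(2,3,1)]
    by (simp add: lift_def d_zero h_linear pb_zero z \<D>_def)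
qed

lemma Poiss0_apply:
  assumes X: "X \<in> Poiss0" shows "X p = (if p \<in> aff then (0, hpart X (fst p) + gpart X (snd p)) else 0)"
proof (cases "p \<in> aff")
  case True
  have XP: "X \<in> Poiss" using X by (simp add: Poiss0_def)
  have 1: "(fst p, 0) \<in> aff" "(0, snd p) \<in> aff" using True by (auto simp: aff_iff S.Cinf_0 GE_linear)
  have "p = (fst p, 0) + (0, snd p)" by (simp add: prod_eq_iff)
  then have "X p = X (fst p, 0) + X (0, snd p)" using PoissD(3)[OF XP 1] by metis
  moreover have "fst (X p) = 0" using derivation_fst[OF XP True] X by (simp add: Poiss0_def fun_eq_iff)
  ultimately show ?thesis using True by (simp add: prod_eq_iff hpart_def gpart_def)
next
  case False then show ?thesis using X PoissD(2) by (simp add: Poiss0_def)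
qed

text \<open>The conditions are the derivation rules evaluated on pairs (f, 0) and (0, \<eta>); the
  brackets of (f, 0) with (0, \<xi>) and with (g, 0) yield the last two.\<close>

lemma Poiss0_compatible:
  assumes X: "X \<in> Poiss0" shows "compatible (hpart X) (gpart X)"
proof -
  let ?Q = "hpart X" and ?\<delta> = "gpart X"
  have XP: "X \<in> Poiss" using X by (simp add: Poiss0_def)
  note XD = PoissD[OF XP]
  have gz: "?\<delta> 0 = 0" using XD(4)[OF aff_linear(3), of 0] by (simp add: gpart_def zero_prod_def)
  have hz: "?Q 0 = 0" using XD(4)[OF aff_linear(3), of 0] by (simp add: hpart_def zero_prod_def)
  have Xf: "X (f, 0) = (0, ?Q f)" if "f \<in> Cinf S" for f
    using Poiss0_apply[OF X, of "(f, 0)"] pair_aff(1)[OF that] gz by simp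
  have Xe: "X (0, \<eta>) = (0, ?\<delta> \<eta>)" if "\<eta> \<in> \<Gamma>E" for \<eta>
    using Poiss0_apply[OF X, of "(0, \<eta>)"] pair_aff(2)[OF that] hz by simp
  have Q: "?Q f \<in> \<Gamma>E" if "f \<in> Cinf S" for f using XD(1)[OF pair_aff(1)[OF that]] by (simp add: hpart_def aff_iff)
  have \<delta>: "?\<delta> \<eta> \<in> \<Gamma>E" if "\<eta> \<in> \<Gamma>E" for \<eta> using XD(1)[OF pair_aff(2)[OF that]] by (simp add: gpart_def aff_iff)
  show ?thesis unfolding compatible_def
  proof (intro conjI ballI allI)
    fix f g assume f: "f \<in> Cinf S" and g: "g \<in> Cinf S"
    show "?Q f \<in> \<Gamma>E" by (rule Q[OF f])
    show "?Q (f + g) = ?Q f + ?Q g" using XD(3)[OF pair_aff(1)[OF f] pair_aff(1)[OF g]] by (simp add: hpart_def)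
    have e: "aff_mult (f, 0) (g, 0) = (f * g, 0)" by (simp add: fmult_eq fun_eq_iff)
    show "?Q (f * g) = f \<odot> ?Q g + g \<odot> ?Q f"
      using XD(5)[OF pair_aff(1)[OF f] pair_aff(1)[OF g]]
      unfolding e Xf[OF f] Xf[OF g] Xf[OF S.Cinf_mult[OF f g]] by (simp add: fmult_eq fun_eq_iff)
    show "?Q (c *\<^sub>R f) = c *\<^sub>R ?Q f" for c using XD(4)[OF pair_aff(1)[OF f], of c] by (simp add: hpart_def)
    have "X (aff_bracket (f, 0) (g, 0)) = (0, ?Q (S.pb f g) + ?\<delta> (\<K> (d f) (d g)))"
      using Poiss0_apply[OF X, of "(S.pb f g, \<K> (d f) (d g))"] \<K>_GE[OF f g] S.pb_Cinf[OF f g]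
      by (simp only: aff_bracket_pairs(3)[OF f g GE_linear(4) GE_linear(4)]) (simp add: aff_iff)
    then show "?Q (S.pb f g) + ?\<delta> (\<K> (d f) (d g)) = \<D> (d f) (?Q g) - \<D> (d g) (?Q f)"
      unfolding XD(6)[OF pair_aff(1)[OF f] pair_aff(1)[OF g]] Xf[OF f] Xf[OF g]
        aff_bracket_pairs(2)[OF f g Q[OF f] Q[OF g]] aff_bracket_pairs(4)[OF f g Q[OF f] Q[OF g]] by simp
  next
    fix \<eta> \<xi> assume \<eta>: "\<eta> \<in> \<Gamma>E" and \<xi>: "\<xi> \<in> \<Gamma>E"
    show "?\<delta> \<eta> \<in> \<Gamma>E" by (rule \<delta>[OF \<eta>])
    show "?\<delta> (\<eta> + \<xi>) = ?\<delta> \<eta> + ?\<delta> \<xi>" using XD(3)[OF pair_aff(2)[OF \<eta>] pair_aff(2)[OF \<xi>]] by (simp add: gpart_def)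
    show "?\<delta> (br \<eta> \<xi>) = br (?\<delta> \<eta>) \<xi> + br \<eta> (?\<delta> \<xi>)"
      using XD(6)[OF pair_aff(2)[OF \<eta>] pair_aff(2)[OF \<xi>]]
      unfolding Xe[OF \<eta>] Xe[OF \<xi>] aff_bracket_pairs(1)[OF S.Cinf_0 S.Cinf_0 \<eta> \<xi>]
        aff_bracket_pairs(1)[OF S.Cinf_0 S.Cinf_0 \<delta>[OF \<eta>] \<xi>] aff_bracket_pairs(1)[OF S.Cinf_0 S.Cinf_0 \<eta> \<delta>[OF \<xi>]]
        Xe[OF br_GE[OF \<eta> \<xi>]] by simp
  next
    fix f \<eta> assume f: "f \<in> Cinf S" and \<eta>: "\<eta> \<in> \<Gamma>E"
    have "aff_mult (f, 0) (0, \<eta>) = (0, f \<odot> \<eta>)" by (simp add: fmult_eq fun_eq_iff)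
    then show "?\<delta> (f \<odot> \<eta>) = f \<odot> ?\<delta> \<eta>"
      using XD(5)[OF pair_aff(1)[OF f] pair_aff(2)[OF \<eta>]] Xf[OF f] Xe[OF \<eta>] Xe[OF GE_linear(2)[OF f \<eta>]]
      by (simp add: fmult_eq) (simp add: fun_eq_iff)
    show "?\<delta> (\<D> (d f) \<eta>) = br (?Q f) \<eta> + \<D> (d f) (?\<delta> \<eta>)"
      using XD(6)[OF pair_aff(1)[OF f] pair_aff(2)[OF \<eta>]]
      unfolding Xf[OF f] Xe[OF \<eta>] aff_bracket_pairs(2)[OF f f \<eta> \<eta>] aff_bracket_pairs(1)[OF f f Q[OF f] \<eta>]
        aff_bracket_pairs(2)[OF f f \<eta> \<delta>[OF \<eta>]] Xe[OF \<D>_GE[OF f \<eta>]] by simp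
  qed
qed

definition mk_derivation :: "(('a \<Rightarrow> real) \<Rightarrow> 'a \<Rightarrow> 'a cvec) \<Rightarrow> (('a \<Rightarrow> 'a cvec) \<Rightarrow> 'a \<Rightarrow> 'a cvec) \<Rightarrow>
    ('a \<Rightarrow> real) \<times> ('a \<Rightarrow> 'a cvec) \<Rightarrow> ('a \<Rightarrow> real) \<times> ('a \<Rightarrow> 'a cvec)" where
  "mk_derivation Q \<delta> p = (if p \<in> aff then (0, Q (fst p) + \<delta> (snd p)) else 0)"

text \<open>A general pair splits as (f, 0) + (0, \<eta>), so the conditions on the two kinds of
  pairs suffice. Compatibility says nothing on \<open>Q\<close> and \<delta> off their domains,
  hence the last two equations are restricted to them.\<close>

lemma compatible_Poiss0:
  assumes c: "compatible Q \<delta>"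
  shows "mk_derivation Q \<delta> \<in> Poiss0" "f \<in> Cinf S \<Longrightarrow> hpart (mk_derivation Q \<delta>) f = Q f"
    "\<eta> \<in> \<Gamma>E \<Longrightarrow> gpart (mk_derivation Q \<delta>) \<eta> = \<delta> \<eta>"
proof -
  let ?X = "mk_derivation Q \<delta>"
  note cD = c[unfolded compatible_def]
  have c1: "\<forall>f\<in>Cinf S. Q f \<in> \<Gamma>E"
    and c2: "\<forall>f\<in>Cinf S. \<forall>g\<in>Cinf S. Q (f + g) = Q f + Q g \<and> Q (f * g) = f \<odot> Q g + g \<odot> Q f"
    and c3: "\<forall>r. \<forall>f\<in>Cinf S. Q (r *\<^sub>R f) = r *\<^sub>R Q f"
    and c4: "\<forall>\<eta>\<in>\<Gamma>E. \<delta> \<eta> \<in> \<Gamma>E"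
    and c5: "\<forall>\<eta>\<in>\<Gamma>E. \<forall>\<xi>\<in>\<Gamma>E. \<delta> (\<eta> + \<xi>) = \<delta> \<eta> + \<delta> \<xi> \<and> \<delta> (br \<eta> \<xi>) = br (\<delta> \<eta>) \<xi> + br \<eta> (\<delta> \<xi>)"
    and c6: "\<forall>f\<in>Cinf S. \<forall>\<eta>\<in>\<Gamma>E. \<delta> (f \<odot> \<eta>) = f \<odot> \<delta> \<eta>"
    and c7: "\<forall>f\<in>Cinf S. \<forall>\<xi>\<in>\<Gamma>E. \<delta> (\<D> (d f) \<xi>) = br (Q f) \<xi> + \<D> (d f) (\<delta> \<xi>)"
    and c8: "\<forall>f\<in>Cinf S. \<forall>g\<in>Cinf S. Q (S.pb f g) + \<delta> (\<K> (d f) (d g)) = \<D> (d f) (Q g) - \<D> (d g) (Q f)"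
    using cD by - (elim conjE, assumption)+
  have QD: "Q f \<in> \<Gamma>E" "Q (f + g) = Q f + Q g" "Q (f * g) = f \<odot> Q g + g \<odot> Q f" "Q (r *\<^sub>R f) = r *\<^sub>R Q f"
    "Q (S.pb f g) + \<delta> (\<K> (d f) (d g)) = \<D> (d f) (Q g) - \<D> (d g) (Q f)"
    if "f \<in> Cinf S" "g \<in> Cinf S" for f g r
    by (rule c1[rule_format, OF that(1)] conjunct1[OF c2[rule_format, OF that]] conjunct2[OF c2[rule_format, OF that]]
      c3[rule_format, OF that(1)] c8[rule_format, OF that])+
  have \<delta>D: "\<delta> \<eta> \<in> \<Gamma>E" "\<delta> (\<eta> + \<xi>) = \<delta> \<eta> + \<delta> \<xi>" "\<delta> (br \<eta> \<xi>) = br (\<delta> \<eta>) \<xi> + br \<eta> (\<delta> \<xi>)"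
    "\<delta> (f \<odot> \<eta>) = f \<odot> \<delta> \<eta>" "\<delta> (\<D> (d f) \<xi>) = br (Q f) \<xi> + \<D> (d f) (\<delta> \<xi>)"
    if "f \<in> Cinf S" "\<eta> \<in> \<Gamma>E" "\<xi> \<in> \<Gamma>E" for f \<eta> \<xi>
    by (rule c4[rule_format, OF that(2)] conjunct1[OF c5[rule_format, OF that(2,3)]] conjunct2[OF c5[rule_format, OF that(2,3)]]
      c6[rule_format, OF that(1,2)] c7[rule_format, OF that(1,3)])+
  have \<delta>0: "\<delta> 0 = 0" using \<delta>D(2)[OF S.Cinf_0 GE_linear(4) GE_linear(4)] by simp
  have \<delta>m: "\<delta> (\<eta> - \<xi>) = \<delta> \<eta> - \<delta> \<xi>" if "\<eta> \<in> \<Gamma>E" "\<xi> \<in> \<Gamma>E" for \<eta> \<xi>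
    using \<delta>D(2)[OF S.Cinf_0 GE_linear(5)[OF that] that(2)] by (simp add: algebra_simps)
  have Q0: "Q 0 = 0" using QD(4)[OF S.Cinf_0 S.Cinf_0, of 0] by (simp only: scaleR_zero_left)
  \<comment> \<open>Real homogeneity is linearity over functions, applied to a constant.\<close>
  have \<delta>s: "\<delta> (r *\<^sub>R \<eta>) = r *\<^sub>R \<delta> \<eta>" if "\<eta> \<in> \<Gamma>E" for r \<eta>
  proof -
    have e: "(r *\<^sub>R S.unit) \<odot> \<xi> = r *\<^sub>R \<xi>" if "\<xi> \<in> \<Gamma>E" for \<xi>
    proof
      fix s show "((r *\<^sub>R S.unit) \<odot> \<xi>) s = (r *\<^sub>R \<xi>) s" using LD(2)[OF GE_L[OF that], of s] by (simp add: S.unit_def)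
    qed
    have "\<delta> ((r *\<^sub>R S.unit) \<odot> \<eta>) = (r *\<^sub>R S.unit) \<odot> \<delta> \<eta>"
      by (rule \<delta>D(4)[OF S.Cinf_scale[OF S.Cinf_unit] that that])
    then show ?thesis unfolding e[OF that] e[OF \<delta>D(1)[OF S.Cinf_0 that that]] .
  qed
  have X: "?X p = (0, Q (fst p) + \<delta> (snd p))" if "p \<in> aff" for p using that by (simp add: mk_derivation_def)
  have D: "fst p \<in> Cinf S" "snd p \<in> \<Gamma>E" if "p \<in> aff" for p using that by (auto simp: aff_iff)
  have P: "?X \<in> Poiss"
  proof (rule PoissI)
    show Xa: "?X p \<in> aff" if p: "p \<in> aff" for p
      using D[OF p] QD(1)[OF D(1)[OF p] D(1)[OF p]] \<delta>D(1)[OF D(1)[OF p] D(2)[OF p] D(2)[OF p]]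
      by (simp add: X[OF p] aff_iff S.Cinf_0 GE_linear)
    show "?X p = 0" if "p \<notin> aff" for p using that by (simp add: mk_derivation_def)
    fix p assume p: "p \<in> aff"
    note p1 = D(1)[OF p] and p2 = D(2)[OF p]
    show "?X (r *\<^sub>R p) = r *\<^sub>R ?X p" for r
      unfolding X[OF aff_linear(2)[OF p]] X[OF p] by (simp add: QD(4)[OF p1 p1] \<delta>s[OF p2] scaleR_add_right)
    fix q assume q: "q \<in> aff"
    note q1 = D(1)[OF q] and q2 = D(2)[OF q]
    show "?X (p + q) = ?X p + ?X q"
      unfolding X[OF aff_linear(1)[OF p q]] X[OF p] X[OF q] by (simp add: QD(2)[OF p1 q1] \<delta>D(2)[OF p1 p2 q2])
    show "?X (aff_mult p q) = aff_mult (?X p) q + aff_mult p (?X q)"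
    proof -
      obtain f \<eta> g \<xi> where pq: "p = (f, \<eta>)" "q = (g, \<xi>)" by (cases p, cases q)
      have f: "f \<in> Cinf S" "\<eta> \<in> \<Gamma>E" "g \<in> Cinf S" "\<xi> \<in> \<Gamma>E" using p q pq by (auto simp: aff_iff)
      show ?thesis
        unfolding X[OF aff_mult_aff[OF p q]] X[OF p] X[OF q]
        using QD(3)[OF f(1,3)] \<delta>D(4)[OF f(1,4,4)] \<delta>D(4)[OF f(3,2,2)]
          \<delta>D(2)[OF f(1) GE_linear(2)[OF f(1,4)] GE_linear(2)[OF f(3,2)]]
        by (simp add: pq fmult_eq fmul_distrib) (simp add: fun_eq_iff)
    qed
    show "?X (aff_bracket p q) = aff_bracket (?X p) q + aff_bracket p (?X q)"
    proof -
      obtain f \<eta> g \<xi> where pq: "p = (f, \<eta>)" "q = (g, \<xi>)" by (cases p, cases q)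
      have f: "f \<in> Cinf S" "\<eta> \<in> \<Gamma>E" "g \<in> Cinf S" "\<xi> \<in> \<Gamma>E" using p q pq by (auto simp: aff_iff)
      note Qf = QD(1)[OF f(1,1)] and Qg = QD(1)[OF f(3,3)] and \<delta>\<eta> = \<delta>D(1)[OF f(1,2,2)] and \<delta>\<xi> = \<delta>D(1)[OF f(1,4,4)]
      note G = \<D>_GE[OF f(1,4)] \<D>_GE[OF f(3,2)] br_GE[OF f(2,4)] \<K>_GE[OF f(1,3)]
      \<comment> \<open>\<open>E1\<close> expands the left side of the bracket rule and
        \<open>E2\<close> the right side; \<open>E3\<close> is the condition that absorbs the
        curvature term.\<close>
      have E1: "\<delta> (\<D> (d f) \<xi> - \<D> (d g) \<eta> + br \<eta> \<xi> + \<K> (d f) (d g)) =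
          br (Q f) \<xi> + \<D> (d f) (\<delta> \<xi>) - (br (Q g) \<eta> + \<D> (d g) (\<delta> \<eta>)) + (br (\<delta> \<eta>) \<xi> + br \<eta> (\<delta> \<xi>)) + \<delta> (\<K> (d f) (d g))"
        by (simp only: \<delta>D(2)[OF f(1) GE_linear(1)[OF GE_linear(5)[OF G(1,2)] G(3)] G(4)]
          \<delta>D(2)[OF f(1) GE_linear(5)[OF G(1,2)] G(3)] \<delta>m[OF G(1,2)] \<delta>D(5)[OF f(1,4,4)] \<delta>D(5)[OF f(3,2,2)] \<delta>D(3)[OF f(1,2,4)])
      have E2: "br (Q f + \<delta> \<eta>) \<xi> = br (Q f) \<xi> + br (\<delta> \<eta>) \<xi>" "br \<eta> (Q g + \<delta> \<xi>) = br \<eta> (Q g) + br \<eta> (\<delta> \<xi>)"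
        "\<D> (d g) (Q f + \<delta> \<eta>) = \<D> (d g) (Q f) + \<D> (d g) (\<delta> \<eta>)" "\<D> (d f) (Q g + \<delta> \<xi>) = \<D> (d f) (Q g) + \<D> (d f) (\<delta> \<xi>)"
        "br \<eta> (Q g) = - br (Q g) \<eta>"
        unfolding \<D>_def
        by (rule br_add_left br_add_right br_antisym; intro GE_L hd_L f Qf Qg \<delta>\<eta> \<delta>\<xi>)+
      have E3: "Q (S.pb f g) = \<D> (d f) (Q g) - \<D> (d g) (Q f) - \<delta> (\<K> (d f) (d g))"
        using QD(5)[OF f(1,3)] by (simp add: eq_diff_eq)
      show ?thesis
        unfolding X[OF aff_bracket_aff[OF p q]] X[OF p] X[OF q] unfolding pq fst_conv snd_conv
          aff_bracket_pairs(5)[OF f(1,3) GE_linear(1)[OF Qf \<delta>\<eta>] f(4)] aff_bracket_pairs(6)[OF f(1,3,2) GE_linear(1)[OF Qg \<delta>\<xi>]]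
        by (simp only: aff_bracket.simps fst_conv snd_conv E1 E2 E3) (simp add: algebra_simps)
    qed
  qed
  have "induced_field ?X = 0"
    by (auto simp: fun_eq_iff induced_field_def mk_derivation_def)
  then show "?X \<in> Poiss0" using P by (simp add: Poiss0_def)
  show "hpart ?X f = Q f" if "f \<in> Cinf S" using X[OF pair_aff(1)[OF that]] by (simp add: hpart_def \<delta>0)
  show "gpart ?X \<eta> = \<delta> \<eta>" if "\<eta> \<in> \<Gamma>E" using X[OF pair_aff(2)[OF that]] by (simp add: gpart_def Q0)
qed

subsection \<open>Derivations as vector fields with values in the conormal bundle\<close>

text \<open>A derivation \<open>q\<close> of \<open>C\<^sup>\<infinity>(S)\<close> with values in \<open>\<Gamma>E\<^sup>*\<close>, as a bundle map \<open>T\<^sup>*S \<rightarrow> E\<^sup>*\<close>.\<close>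

definition mvec :: "(('a \<Rightarrow> real) \<Rightarrow> 'a \<Rightarrow> 'a cvec) \<Rightarrow> 'a \<Rightarrow> 'a cvec list \<Rightarrow> 'a cvec" where
  "mvec q s as = (if s \<in> carrier S \<and> length as = 1 \<and> set as \<subseteq> cotangent S s
     then q (SOME f. f \<in> Cinf S \<and> d f s = as ! 0) s else 0)"

definition derivation :: "(('a \<Rightarrow> real) \<Rightarrow> 'a \<Rightarrow> 'a cvec) \<Rightarrow> bool" where
  "derivation q \<longleftrightarrow> (\<forall>f\<in>Cinf S. q f \<in> \<Gamma>E) \<and>
    (\<forall>f\<in>Cinf S. \<forall>g\<in>Cinf S. q (f + g) = q f + q g \<and> q (f * g) = f \<odot> q g + g \<odot> q f) \<and>
    (\<forall>c. \<forall>f\<in>Cinf S. q (c *\<^sub>R f) = c *\<^sub>R q f)"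

lemma mvec_linear: "mvec (q + q') = mvec q + mvec q'" "mvec (c *\<^sub>R q) = c *\<^sub>R mvec q"
  by (auto simp: fun_eq_iff mvec_def)

text \<open>Evaluating q at \<open>s\<close> on a fixed vector w gives a tangent vector of
  \<open>S\<close> at s, so the value on f depends only on the differential of f at s.\<close>

lemma derivation_pointwise:
  assumes q: "derivation q" and f: "f \<in> Cinf S" and g: "g \<in> Cinf S" and s: "s \<in> carrier S" and eq: "d f s = d g s"
  shows "q f s = q g s"
proof (rule M.cotangent_eqI)
  have qL: "q f \<in> L" if "f \<in> Cinf S" for f using q that by (auto simp: derivation_def intro: GE_L)
  show "q f s \<in> cotangent M s" "q g s \<in> cotangent M s" using LD(1)[OF qL] f g by auto
  fix w assume "w \<in> tangent M s"
  define v where "v k = (if k \<in> Cinf S then q k s w else 0)" for k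
  have "v \<in> tangent S s"
    using q by (auto simp: tangent_def v_def derivation_def S.Cinf_add S.Cinf_scale S.Cinf_mult)
  then have "v f = v g" using eq S.dif_apply[OF s, of v] by metis
  then show "q f s w = q g s w" using f g by (simp add: v_def)
qed

lemma mvec_dif:
  assumes q: "derivation q" and f: "f \<in> Cinf S" and s: "s \<in> carrier S"
  shows "mvec q s [d f s] = q f s"
proof -
  let ?g = "SOME g. g \<in> Cinf S \<and> d g s = d f s"
  have "?g \<in> Cinf S \<and> d ?g s = d f s" by (rule someI[of _ f]) (simp add: f)
  then have "q ?g s = q f s" using derivation_pointwise[OF q _ f s] by blast
  then show ?thesis by (simp add: mvec_def s S.dif_cotangent)
qed

lemma apply_mvec:
  assumes q: "derivation q" and f: "f \<in> Cinf S" shows "apply_forms (mvec q) [d f] = q f"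
proof
  fix s show "apply_forms (mvec q) [d f] s = q f s"
  proof (cases "s \<in> carrier S")
    case True then show ?thesis using mvec_dif[OF q f True] by (simp add: apply_forms_def)
  next
    case False
    have "q f \<in> L" using q f by (auto simp: derivation_def intro: GE_L)
    then show ?thesis using False LD(2) by (simp add: apply_forms_def mvec_def)
  qed
qed

lemma mvec_add:
  assumes q: "derivation q" and s: "s \<in> carrier S" and a: "a \<in> cotangent S s" and b: "b \<in> cotangent S s"
  shows "mvec q s [a + b] = mvec q s [a] + mvec q s [b]" "mvec q s [c *\<^sub>R a] = c *\<^sub>R mvec q s [a]"
proof -
  obtain f g where f: "f \<in> Cinf S" "d f s = a" and g: "g \<in> Cinf S" "d g s = b"
    using S.exists_dif[OF s a] S.exists_dif[OF s b] by auto
  have "q (f + g) = q f + q g" "q (c *\<^sub>R f) = c *\<^sub>R q f" using q f g by (auto simp: derivation_def)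
  then show "mvec q s [a + b] = mvec q s [a] + mvec q s [b]" "mvec q s [c *\<^sub>R a] = c *\<^sub>R mvec q s [a]"
    using mvec_dif[OF q S.Cinf_add[OF f(1) g(1)] s] mvec_dif[OF q S.Cinf_scale[OF f(1)] s, of c]
      mvec_dif[OF q f(1) s] mvec_dif[OF q g(1) s] f g
    by (simp_all add: S.dif_add S.dif_scale)
qed

text \<open>Stated for any family \<open>N\<close> closed under sums, function multiples and gluing,
  so that it applies both to all conormal sections and to the central ones.\<close>

lemma apply_mvec_section:
  assumes q: "derivation q" and \<alpha>: "\<alpha> \<in> one_forms S"
    and N: "\<And>f. f \<in> Cinf S \<Longrightarrow> q f \<in> N"
    and N_add: "\<And>x y. x \<in> N \<Longrightarrow> y \<in> N \<Longrightarrow> x + y \<in> N" and N_mult: "\<And>f x. f \<in> Cinf S \<Longrightarrow> x \<in> N \<Longrightarrow> f \<odot> x \<in> N"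
    and N_local: "\<And>x. (\<And>s. s \<notin> carrier S \<Longrightarrow> x s = 0) \<Longrightarrow>
      (\<And>s. s \<in> carrier S \<Longrightarrow> \<exists>b W. b \<in> N \<and> S.is_open W \<and> s \<in> W \<and> (\<forall>t\<in>W. x t = b t)) \<Longrightarrow> x \<in> N"
  shows "apply_forms (mvec q) [\<alpha>] \<in> N"
proof (rule N_local)
  show "apply_forms (mvec q) [\<alpha>] s = 0" if "s \<notin> carrier S" for s using that by (simp add: apply_forms_def mvec_def fun_eq_iff)
  fix s assume s: "s \<in> carrier S"
  let ?P = "\<lambda>\<alpha>. \<exists>b W. b \<in> N \<and> S.is_open W \<and> s \<in> W \<and> (\<forall>t\<in>W. apply_forms (mvec q) [\<alpha>] t = b t)"
  from \<alpha> s show "?P \<alpha>"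
  proof (rule S.one_form_induct)
    fix a f assume a: "a \<in> Cinf S" and f: "f \<in> Cinf S"
    have "apply_forms (mvec q) [a \<odot> d f] t = (a \<odot> q f) t" if "t \<in> carrier S" for t
      using mvec_add(2)[OF q that S.dif_cotangent S.dif_cotangent] mvec_dif[OF q f that] by (simp add: apply_forms_def fun_eq_iff)
    then show "?P (a \<odot> d f)" using N_mult[OF a N[OF f]] S.is_open_carrier s by blast
  next
    fix \<alpha> \<beta> assume ab: "\<alpha> \<in> one_forms S" "\<beta> \<in> one_forms S" and "?P \<alpha>" "?P \<beta>"
    then obtain b W b' W' where b: "b \<in> N" "S.is_open W" "s \<in> W" "\<forall>t\<in>W. apply_forms (mvec q) [\<alpha>] t = b t"
      "b' \<in> N" "S.is_open W'" "s \<in> W'" "\<forall>t\<in>W'. apply_forms (mvec q) [\<beta>] t = b' t" by metis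
    have "apply_forms (mvec q) [\<alpha> + \<beta>] t = (b + b') t" if t: "t \<in> W \<inter> W'" for t
    proof -
      have "t \<in> carrier S" using t S.is_open_subset[OF b(2)] by auto
      from mvec_add(1)[OF q this S.one_formD(1)[OF ab(1)] S.one_formD(1)[OF ab(2)]]
      show ?thesis using b t by (simp add: apply_forms_def fun_eq_iff)
    qed
    then show "?P (\<alpha> + \<beta>)" using b N_add[OF b(1,5)] by (intro exI[of _ "b + b'"] exI[of _ "W \<inter> W'"]) auto
  next
    fix \<alpha> \<beta> W assume W: "S.is_open W" "s \<in> W" "\<And>q. q \<in> W \<Longrightarrow> \<alpha> q = \<beta> q" and "?P \<alpha>"
    then obtain b W' where b: "b \<in> N" "S.is_open W'" "s \<in> W'" "\<forall>t\<in>W'. apply_forms (mvec q) [\<alpha>] t = b t" by metis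
    then show "?P \<beta>" using W by (intro exI[of _ b] exI[of _ "W \<inter> W'"]) (auto simp: apply_forms_def)
  qed
qed

lemma GE_local:
  assumes "\<And>s. s \<notin> carrier S \<Longrightarrow> x s = 0"
    and loc: "\<And>s. s \<in> carrier S \<Longrightarrow> \<exists>b W. b \<in> \<Gamma>E \<and> S.is_open W \<and> s \<in> W \<and> (\<forall>t\<in>W. x t = b t)"
  shows "x \<in> \<Gamma>E"
proof -
  have "x \<in> L" by (rule L_local[OF assms(1)]) (use loc GE_L in blast)+
  moreover have "res x s = 0" for s
  proof (cases "s \<in> carrier S")
    case True
    then obtain b where "b \<in> \<Gamma>E" "x s = b s" using loc by blast
    then have "res x s = res b s" by (simp only: res_def)
    then show ?thesis using res_GE[OF \<open>b \<in> \<Gamma>E\<close>] by simp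
  qed (simp add: assms(1) res_def pull_linear)
  ultimately show ?thesis by (simp add: GE_iff fun_eq_iff)
qed

lemma length_1_cases: "length as = 1 \<and> set as \<subseteq> A \<longleftrightarrow> (\<exists>a\<in>A. as = [a])"
  by (auto simp: length_Suc_conv)

lemma mvec_multivectors:
  assumes q: "derivation q" shows "mvec q \<in> multivectors 1"
proof -
  have qE: "q f \<in> \<Gamma>E" if "f \<in> Cinf S" for f using q that by (simp add: derivation_def)
  have ap: "apply_forms (mvec q) [\<alpha>] \<in> \<Gamma>E" if "\<alpha> \<in> one_forms S" for \<alpha>
    by (rule apply_mvec_section[OF q that qE GE_linear(1,2) GE_local])
  have con: "mvec q s [a] \<in> conormal_space M S s" if s: "s \<in> carrier S" and a: "a \<in> cotangent S s" for s a
  proof -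
    obtain f where f: "f \<in> Cinf S" "d f s = a" using S.exists_dif[OF s a] by auto
    then show ?thesis using mvec_dif[OF q f(1) s] qE[OF f(1)] s by (simp add: conormal_sections_def)
  qed
  show ?thesis
    unfolding multivectors_def length_1_cases
  proof (intro CollectI conjI allI impI ballI)
    show "mvec q s as = 0" if "\<not> (s \<in> carrier S \<and> (\<exists>a\<in>cotangent S s. as = [a]))" for s as
      using that length_1_cases[of as "cotangent S s"] by (auto simp: mvec_def)
  qed (auto simp: con mvec_add[OF q] ap)
qed

text \<open>Together with \<open>apply_mvec\<close> and \<open>mvec_multivectors\<close> this
  identifies conormal-valued vector fields with derivations of the functions on
  \<open>S\<close>.\<close>

lemma multivector_derivation:
  assumes Q: "Q \<in> multivectors 1"
  shows "derivation (\<lambda>f. apply_forms Q [d f])" "mvec (\<lambda>f. apply_forms Q [d f]) = Q"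
proof -
  note QD = CollectD[OF Q[unfolded multivectors_def]]
  have out: "Q s as = 0" if "\<not> (s \<in> carrier S \<and> length as = 1 \<and> set as \<subseteq> cotangent S s)" for s as
    using conjunct1[OF QD] that by blast
  have lin: "Q s [a + b] = Q s [a] + Q s [b]" "Q s [c *\<^sub>R a] = c *\<^sub>R Q s [a]"
    if "s \<in> carrier S" "a \<in> cotangent S s" "b \<in> cotangent S s" for s a b c
  proof -
    from conjunct1[OF conjunct2[OF QD], rule_format, OF that(1), of "[a]"] that
    have "\<forall>i<1. \<forall>a'\<in>cotangent S s. \<forall>b\<in>cotangent S s. \<forall>c.
          Q s ([a][i := a' + b]) = Q s ([a][i := a']) + Q s ([a][i := b]) \<and>
          Q s ([a][i := c *\<^sub>R a']) = c *\<^sub>R Q s ([a][i := a'])" by simp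
    from this[rule_format, of 0 a b c] that
    show "Q s [a + b] = Q s [a] + Q s [b]" "Q s [c *\<^sub>R a] = c *\<^sub>R Q s [a]" by auto
  qed
  have ap: "apply_forms Q [\<alpha>] \<in> \<Gamma>E" if "\<alpha> \<in> one_forms S" for \<alpha>
  proof -
    show ?thesis using conjunct2[OF conjunct2[OF QD], rule_format, of "[\<alpha>]"] that by simp
  qed
  have "apply_forms Q [d (f + g)] s = apply_forms Q [d f] s + apply_forms Q [d g] s \<and>
      apply_forms Q [d (f * g)] s = f s *\<^sub>R apply_forms Q [d g] s + g s *\<^sub>R apply_forms Q [d f] s \<and>
      apply_forms Q [d (c *\<^sub>R f)] s = c *\<^sub>R apply_forms Q [d f] s" if "f \<in> Cinf S" "g \<in> Cinf S" for f g c s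
  proof (cases "s \<in> carrier S")
    case True
    note l = lin[OF True]
    show ?thesis
      using that True by (simp add: fun_eq_iff apply_forms_def S.dif_add S.dif_mult S.dif_scale l[OF S.dif_cotangent S.dif_cotangent]
        l(1)[OF S.cotangent_subspace(2)[OF S.dif_cotangent] S.cotangent_subspace(2)[OF S.dif_cotangent]])
  qed (simp add: apply_forms_def out fun_eq_iff)
  then show dq: "derivation (\<lambda>f. apply_forms Q [d f])"
    using ap S.dif_one_form by (simp add: derivation_def fun_eq_iff)
  show "mvec (\<lambda>f. apply_forms Q [d f]) = Q"
  proof (intro ext)
    fix s as x
    show "mvec (\<lambda>f. apply_forms Q [d f]) s as x = Q s as x"
    proof (cases "s \<in> carrier S \<and> length as = 1 \<and> set as \<subseteq> cotangent S s")
      case True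
      then obtain a where a: "a \<in> cotangent S s" "as = [a]" and s: "s \<in> carrier S"
        using length_1_cases[of as "cotangent S s"] by auto
      obtain f where f: "f \<in> Cinf S" "d f s = a" using S.exists_dif[OF s a(1)] by auto
      show ?thesis using mvec_dif[OF dq f(1) s] by (simp add: f(2) a(2) apply_forms_def)
    next
      case False show ?thesis unfolding mvec_def if_not_P[OF False] out[OF False] ..
    qed
  qed
qed

lemma d\<D>_1: "d\<D> Q [f] = \<D> (d f) (apply_forms Q [])"
  by (simp add: d\<D>_def omit_def)

lemma d\<D>_2: "d\<D> Q [f, g] = \<D> (d f) (apply_forms Q [d g]) - \<D> (d g) (apply_forms Q [d f]) - apply_forms Q [d (S.pb f g)]"
  by (simp add: d\<D>_def omit_def numeral_2_eq_2 lessThan_Suc)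

end

section \<open>The decomposition of the first cohomology\<close>

context leaf_geometry begin

lemma anchor_GE: "\<eta> \<in> \<Gamma>E \<Longrightarrow> f \<in> Cinf S \<Longrightarrow> anchor \<eta> f = 0"
  using anchor_lift[OF pair_aff(2), of \<eta> f] by (simp add: lift_simps pb_zero_left)

text \<open>The anchor is zero on conormal sections, so the Leibniz term vanishes and the center is
  a module over the functions on \<open>S\<close>.\<close>

lemma center_linear:
  "x \<in> center \<Longrightarrow> y \<in> center \<Longrightarrow> x + y \<in> center" "f \<in> Cinf S \<Longrightarrow> x \<in> center \<Longrightarrow> f \<odot> x \<in> center"
  "x \<in> center \<Longrightarrow> c *\<^sub>R x \<in> center" "0 \<in> center"
proof -
  show "x + y \<in> center" if "x \<in> center" "y \<in> center"
    using that by (auto simp: center_def GE_linear br_add_left GE_L)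
  show "c *\<^sub>R x \<in> center" if "x \<in> center"
    using that by (auto simp: center_def GE_linear br_linear(4)[OF _ GE_L GE_L] GE_L)
  show "0 \<in> center" by (auto simp: center_def GE_linear br_linear(6)[OF GE_L L_zero L_zero])
  show "f \<odot> x \<in> center" if f: "f \<in> Cinf S" and x: "x \<in> center"
  proof -
    have "br (f \<odot> x) \<eta> = 0" if \<eta>: "\<eta> \<in> \<Gamma>E" for \<eta>
    proof -
      have xE: "x \<in> \<Gamma>E" and "br x \<eta> = 0" using x \<eta> by (auto simp: center_def)
      then have "br \<eta> x = 0" using br_antisym[OF GE_L[OF xE] GE_L[OF \<eta>]] by simp
      then have "br \<eta> (f \<odot> x) = 0"
        using br_leibniz[OF GE_L[OF \<eta>] GE_L[OF xE] f] anchor_GE[OF \<eta> f] by (simp add: fun_eq_iff)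
      then show ?thesis using br_antisym[OF GE_L[OF \<eta>] L_fmul[OF f GE_L[OF xE]]] by simp
    qed
    then show ?thesis using f x by (simp add: center_def GE_linear)
  qed
qed

lemma center_local:
  assumes "\<And>s. s \<notin> carrier S \<Longrightarrow> x s = 0"
    and loc: "\<And>s. s \<in> carrier S \<Longrightarrow> \<exists>b W. b \<in> center \<and> S.is_open W \<and> s \<in> W \<and> (\<forall>t\<in>W. x t = b t)"
  shows "x \<in> center"
proof -
  have *: "\<exists>b W. b \<in> \<Gamma>E \<and> S.is_open W \<and> s \<in> W \<and> (\<forall>t\<in>W. x t = b t)" if "s \<in> carrier S" for s
    using loc[OF that] by (auto simp: center_def)
  have x: "x \<in> \<Gamma>E" by (rule GE_local[OF assms(1) *])
  have "br x \<eta> s = 0" if \<eta>: "\<eta> \<in> \<Gamma>E" for \<eta> s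
  proof (cases "s \<in> carrier S")
    case True
    obtain b W where b: "b \<in> center" "S.is_open W" "s \<in> W" "\<forall>t\<in>W. x t = b t" using loc[OF True] by blast
    have "br x \<eta> s = br b \<eta> s" by (rule br_local[OF b(2,3) _ GE_L[OF x] GE_L[OF \<eta>]]) (use b(4) in simp)
    then show ?thesis using b(1) \<eta> by (simp add: center_def)
  qed (simp add: br_outside)
  then show ?thesis using x by (simp add: center_def fun_eq_iff)
qed

lemma mvec_ZZ:
  assumes q: "derivation q" and c: "\<And>f. f \<in> Cinf S \<Longrightarrow> q f \<in> center" shows "mvec q \<in> \<ZZ> 1"
proof -
  have "apply_forms (mvec q) [\<alpha>] \<in> center" if "\<alpha> \<in> one_forms S" for \<alpha>
    by (rule apply_mvec_section[OF q that c center_linear(1,2) center_local])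
  then show ?thesis using mvec_multivectors[OF q] length_1_cases[of _ "one_forms S"] by (auto simp: \<ZZ>_def)
qed

lemma ZZ_1D:
  assumes "Q \<in> \<ZZ> 1" shows "Q \<in> multivectors 1" "\<alpha> \<in> one_forms S \<Longrightarrow> apply_forms Q [\<alpha>] \<in> center"
proof -
  have *: "Q \<in> multivectors 1 \<and> (\<forall>\<alpha>s. length \<alpha>s = 1 \<and> set \<alpha>s \<subseteq> one_forms S \<longrightarrow> apply_forms Q \<alpha>s \<in> center)"
    using assms unfolding \<ZZ>_def by (rule CollectD)
  show "Q \<in> multivectors 1" by (rule conjunct1[OF *])
  show "apply_forms Q [\<alpha>] \<in> center" if "\<alpha> \<in> one_forms S"
    using conjunct2[OF *, rule_format, of "[\<alpha>]"] that by simp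
qed

text \<open>In degree 0 the only argument list is the empty one, so the whole datum is a central
  section.\<close>

lemma ZZ_0_iff: "\<rho> \<in> center \<longleftrightarrow> (\<exists>R\<in>\<ZZ> 0. apply_forms R [] = \<rho>)"
proof
  assume \<rho>: "\<rho> \<in> center"
  define R :: "'a \<Rightarrow> 'a cvec list \<Rightarrow> 'a cvec" where "R s as = (if as = [] then \<rho> s else 0)" for s as
  have \<rho>E: "\<rho> \<in> \<Gamma>E" using \<rho> by (simp add: center_def)
  have "R \<in> multivectors 0"
    using \<rho>E LD(2)[OF GE_L[OF \<rho>E]]
    by (auto simp: multivectors_def R_def apply_forms_def[abs_def] conormal_sections_def)
  moreover have "apply_forms R [] = \<rho>" by (simp add: apply_forms_def[abs_def] R_def)
  ultimately show "\<exists>R\<in>\<ZZ> 0. apply_forms R [] = \<rho>" using \<rho> by (intro bexI[of _ R]) (simp_all add: \<ZZ>_def)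
qed (auto simp: \<ZZ>_def)

lemma mvec_cong: assumes "\<And>f. f \<in> Cinf S \<Longrightarrow> q f = q' f" shows "mvec q = mvec q'"
proof (intro ext)
  fix s as x
  show "mvec q s as x = mvec q' s as x"
  proof (cases "s \<in> carrier S \<and> length as = 1 \<and> set as \<subseteq> cotangent S s")
    case True
    then have s: "s \<in> carrier S" and "as ! 0 \<in> cotangent S s" by (auto simp: subset_iff)
    from someI_ex[OF S.exists_dif[OF this]] show ?thesis using assms by (simp add: mvec_def)
  next
    case False show ?thesis unfolding mvec_def if_not_P[OF False] ..
  qed
qed

lemma compatible_derivation: "compatible Q \<delta> \<Longrightarrow> derivation Q"
  by (simp add: compatible_def derivation_def)

text \<open>On conormal sections \<open>ad \<rho>\<close> is the inner derivation by \<rho>, and on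
  functions it is minus the covariant differential of \<rho>; the minus comes from antisymmetry of
  the bracket.\<close>

lemma ad_GE:
  assumes \<rho>: "\<rho> \<in> \<Gamma>E"
  shows "ad \<rho> \<in> Poiss0" "f \<in> Cinf S \<Longrightarrow> hpart (ad \<rho>) f = - \<D> (d f) \<rho>"
    "gpart (ad \<rho>) = (\<lambda>\<eta>. if \<eta> \<in> \<Gamma>E then br \<rho> \<eta> else 0)"
proof -
  note \<rho>L = GE_L[OF \<rho>]
  have "sharp S \<psi> 0 = 0" using S.sharp_scale[OF S.one_forms_zero, of 0] by (simp only: scaleR_zero_left)
  then show "ad \<rho> \<in> Poiss0"
    using ad_Poiss[OF GE_closed[OF \<rho>]] induced_field_ad[OF \<rho>L] res_GE[OF \<rho>] by (simp add: Poiss0_def)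
  show "hpart (ad \<rho>) f = - \<D> (d f) \<rho>" if f: "f \<in> Cinf S"
    using br_antisym[OF hd_L[OF f] \<rho>L]
    by (simp add: hpart_def ad_def pair_aff f anchor_GE[OF \<rho> f] lift_simps d_zero h_linear \<D>_def)
  show "gpart (ad \<rho>) = (\<lambda>\<eta>. if \<eta> \<in> \<Gamma>E then br \<rho> \<eta> else 0)"
  proof
    fix \<eta> show "gpart (ad \<rho>) \<eta> = (if \<eta> \<in> \<Gamma>E then br \<rho> \<eta> else 0)"
      by (simp add: gpart_def ad_def aff_iff S.Cinf_0 anchor_GE[OF \<rho> S.Cinf_0] lift_simps d_zero h_linear)
  qed
qed

lemma Inn_eq: "Inn = gpart ` ad ` \<Gamma>E"
  unfolding Inn_def image_image by (rule image_cong[OF refl]) (simp add: ad_GE(3))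

text \<open>The \<open>Q\<close> required in the definition of \<open>\<MM>0\<close> is the function
  part of a derivation, and the two equations there are the last two conditions of
  \<open>compatible\<close>.\<close>

lemma \<MM>0_eq: "\<MM>0 = gpart ` Poiss0"
proof
  show "gpart ` Poiss0 \<subseteq> \<MM>0"
  proof
    fix \<delta> assume "\<delta> \<in> gpart ` Poiss0"
    then obtain X where X: "X \<in> Poiss0" "\<delta> = gpart X" by auto
    note c = Poiss0_compatible[OF X(1), folded X(2)]
    note dq = compatible_derivation[OF c]
    have out: "\<delta> \<eta> = 0" if "\<eta> \<notin> \<Gamma>E" for \<eta>
      using Poiss0_apply[OF X(1), of "(0, \<eta>)"] that by (simp add: X(2) gpart_def aff_iff)
    have c7: "\<delta> (\<D> (d f) \<xi>) = br (hpart X f) \<xi> + \<D> (d f) (\<delta> \<xi>)" if "f \<in> Cinf S" "\<xi> \<in> \<Gamma>E" for f \<xi>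
      using c that unfolding compatible_def by blast
    have c8: "hpart X (S.pb f g) + \<delta> (\<K> (d f) (d g)) = \<D> (d f) (hpart X g) - \<D> (d g) (hpart X f)"
      if "f \<in> Cinf S" "g \<in> Cinf S" for f g using c that unfolding compatible_def by blast
    have "\<exists>Q\<in>multivectors 1. \<forall>f\<in>Cinf S. \<forall>g\<in>Cinf S.
       (\<forall>\<xi>\<in>\<Gamma>E. \<delta> (\<D> (d f) \<xi>) - \<D> (d f) (\<delta> \<xi>) = br (apply_forms Q [d f]) \<xi>) \<and>
       d\<D> Q [f, g] = \<delta> (\<K> (d f) (d g))"
      by (rule bexI[OF _ mvec_multivectors[OF dq]])
        (simp add: d\<D>_2 apply_mvec[OF dq] S.pb_Cinf c7 c8[symmetric])
    then show "\<delta> \<in> \<MM>0"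
      using c out unfolding \<MM>0_def compatible_def fmult_eq by (simp add: image_subset_iff)
  qed
  show "\<MM>0 \<subseteq> gpart ` Poiss0"
  proof
    fix \<delta> assume "\<delta> \<in> \<MM>0"
    note \<delta> = CollectD[OF this[unfolded \<MM>0_def]]
    obtain Q where Q: "Q \<in> multivectors 1"
      "\<And>f g \<xi>. f \<in> Cinf S \<Longrightarrow> g \<in> Cinf S \<Longrightarrow> \<xi> \<in> \<Gamma>E \<Longrightarrow> \<delta> (\<D> (d f) \<xi>) - \<D> (d f) (\<delta> \<xi>) = br (apply_forms Q [d f]) \<xi>"
      "\<And>f g. f \<in> Cinf S \<Longrightarrow> g \<in> Cinf S \<Longrightarrow> d\<D> Q [f, g] = \<delta> (\<K> (d f) (d g))"
      using \<delta> by (elim conjE bexE) metis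
    let ?q = "\<lambda>f. apply_forms Q [d f]"
    have "\<delta> (\<D> (d f) \<xi>) = br (?q f) \<xi> + \<D> (d f) (\<delta> \<xi>)" if "f \<in> Cinf S" "\<xi> \<in> \<Gamma>E" for f \<xi>
      using Q(2)[OF that(1,1,2)] by (simp add: diff_eq_eq)
    moreover have "?q (S.pb f g) + \<delta> (\<K> (d f) (d g)) = \<D> (d f) (?q g) - \<D> (d g) (?q f)"
      if "f \<in> Cinf S" "g \<in> Cinf S" for f g
      unfolding Q(3)[OF that, symmetric] d\<D>_2 by simp
    ultimately have c: "compatible ?q \<delta>"
      using multivector_derivation(1)[OF Q(1)] \<delta>
      unfolding compatible_def derivation_def fmult_eq by (simp add: image_subset_iff)
    have "\<forall>\<eta>. \<eta> \<notin> \<Gamma>E \<longrightarrow> \<delta> \<eta> = 0" using \<delta> by (elim conjE)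
    then have out: "\<delta> \<eta> = 0" if "\<eta> \<notin> \<Gamma>E" for \<eta> using that by simp
    have "gpart (mk_derivation ?q \<delta>) = \<delta>"
    proof
      fix \<eta> show "gpart (mk_derivation ?q \<delta>) \<eta> = \<delta> \<eta>"
        using compatible_Poiss0(3)[OF c, of \<eta>] out[of \<eta>]
        by (cases "\<eta> \<in> \<Gamma>E") (simp_all add: gpart_def mk_derivation_def aff_iff)
    qed
    from image_eqI[of \<delta> gpart, OF this[symmetric] compatible_Poiss0(1)[OF c]] show "\<delta> \<in> gpart ` Poiss0" .
  qed
qed

section \<open>Cocycles and coboundaries as parts of derivations\<close>

definition cocycles :: "('a \<Rightarrow> 'a cvec list \<Rightarrow> 'a cvec) set" where
  "cocycles = {Q\<in>\<ZZ> 1. \<forall>f\<in>Cinf S. \<forall>g\<in>Cinf S. d\<D> Q [f, g] = 0}"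

definition coboundaries :: "('a \<Rightarrow> 'a cvec list \<Rightarrow> 'a cvec) set" where
  "coboundaries = {Q\<in>\<ZZ> 1. \<exists>R\<in>\<ZZ> 0. \<forall>f\<in>Cinf S. apply_forms Q [d f] = d\<D> R [f]}"

text \<open>With \<delta> = 0 compatibility says that \<open>hpart X f\<close> commutes with every
  conormal section, hence is central, and that the differential of the resulting vector field
  vanishes.\<close>

lemma cocycle_hpart:
  assumes X: "X \<in> Poiss0" and g: "\<And>\<eta>. \<eta> \<in> \<Gamma>E \<Longrightarrow> gpart X \<eta> = 0"
  shows "mvec (hpart X) \<in> cocycles"
proof -
  note c = Poiss0_compatible[OF X]
  note dq = compatible_derivation[OF c]
  have c1: "hpart X f \<in> \<Gamma>E" if "f \<in> Cinf S" for f using dq that by (simp add: derivation_def)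
  have c7: "gpart X (\<D> (d f) \<xi>) = br (hpart X f) \<xi> + \<D> (d f) (gpart X \<xi>)" if "f \<in> Cinf S" "\<xi> \<in> \<Gamma>E" for f \<xi>
    using c that unfolding compatible_def by blast
  have c8: "hpart X (S.pb f g) + gpart X (\<K> (d f) (d g)) = \<D> (d f) (hpart X g) - \<D> (d g) (hpart X f)"
    if "f \<in> Cinf S" "g \<in> Cinf S" for f g using c that unfolding compatible_def by blast
  have D0: "\<D> (d f) 0 = 0" if "f \<in> Cinf S" for f
    unfolding \<D>_def by (rule br_linear(5)[OF hd_L[OF that] L_zero L_zero])
  have "hpart X f \<in> center" if f: "f \<in> Cinf S" for f
    using c7[OF f] g c1[OF f] \<D>_GE[OF f] D0[OF f] by (auto simp: center_def)
  then have "mvec (hpart X) \<in> \<ZZ> 1" by (rule mvec_ZZ[OF dq])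
  moreover have "d\<D> (mvec (hpart X)) [f, k] = 0" if "f \<in> Cinf S" "k \<in> Cinf S" for f k
    using c8[OF that] g[OF \<K>_GE[OF that]] that by (simp add: d\<D>_2 apply_mvec[OF dq] S.pb_Cinf)
  ultimately show ?thesis by (simp add: cocycles_def)
qed

lemma gpart_center: "\<rho> \<in> center \<Longrightarrow> gpart (ad \<rho>) = 0"
  using ad_GE(3)[of \<rho>] by (auto simp: center_def fun_eq_iff)

lemma coboundaries_eq: "coboundaries = (\<lambda>\<rho>. mvec (hpart (ad \<rho>))) ` center"
proof
  show "coboundaries \<subseteq> (\<lambda>\<rho>. mvec (hpart (ad \<rho>))) ` center"
  proof
    fix Q assume "Q \<in> coboundaries"
    then obtain R where Q: "Q \<in> \<ZZ> 1" and R: "R \<in> \<ZZ> 0" "\<forall>f\<in>Cinf S. apply_forms Q [d f] = \<D> (d f) (apply_forms R [])"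
      by (auto simp: coboundaries_def d\<D>_1)
    \<comment> \<open>The sign compensates the one in \<open>ad_GE\<close>.\<close>
    define \<rho> where "\<rho> = (-1) *\<^sub>R apply_forms R []"
    have c: "apply_forms R [] \<in> center" using R(1) ZZ_0_iff by blast
    have \<rho>: "\<rho> \<in> center" unfolding \<rho>_def by (rule center_linear(3)[OF c])
    have \<rho>E: "\<rho> \<in> \<Gamma>E" "apply_forms R [] \<in> \<Gamma>E" using \<rho> c by (simp_all add: center_def)
    have "apply_forms Q [d f] = hpart (ad \<rho>) f" if f: "f \<in> Cinf S" for f
      using br_linear(3)[OF hd_L[OF f] GE_L[OF \<rho>E(2)] L_zero, of "-1"] R(2) f
      by (simp add: ad_GE(2)[OF \<rho>E(1) f]) (simp add: \<rho>_def \<D>_def)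
    then have "mvec (\<lambda>f. apply_forms Q [d f]) = mvec (hpart (ad \<rho>))" by (rule mvec_cong)
    then show "Q \<in> (\<lambda>\<rho>. mvec (hpart (ad \<rho>))) ` center"
      using multivector_derivation(2)[OF ZZ_1D(1)[OF Q]] \<rho> by simp
  qed
  show "(\<lambda>\<rho>. mvec (hpart (ad \<rho>))) ` center \<subseteq> coboundaries"
  proof
    fix Q assume "Q \<in> (\<lambda>\<rho>. mvec (hpart (ad \<rho>))) ` center"
    then obtain \<rho> where \<rho>: "\<rho> \<in> center" "Q = mvec (hpart (ad \<rho>))" by auto
    have \<rho>E: "\<rho> \<in> \<Gamma>E" using \<rho> by (simp add: center_def)
    note X = ad_GE(1)[OF \<rho>E]
    have "Q \<in> \<ZZ> 1" using cocycle_hpart[OF X] gpart_center[OF \<rho>(1)] \<rho>(2) by (simp add: cocycles_def)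
    moreover obtain R where R: "R \<in> \<ZZ> 0" "apply_forms R [] = (-1) *\<^sub>R \<rho>"
      using ZZ_0_iff center_linear(3)[OF \<rho>(1), of "-1"] by blast
    moreover have "apply_forms Q [d f] = d\<D> R [f]" if f: "f \<in> Cinf S" for f
      unfolding \<rho>(2) apply_mvec[OF compatible_derivation[OF Poiss0_compatible[OF X]] f] ad_GE(2)[OF \<rho>E f] d\<D>_1 R(2)
      using br_linear(3)[OF hd_L[OF f] GE_L[OF \<rho>E] L_zero, of "-1"] by (simp add: \<D>_def)
    ultimately show "Q \<in> coboundaries" by (auto simp: coboundaries_def)
  qed
qed

lemma subspace_coboundaries: "subspace coboundaries"
proof (rule subspaceI)
  have cL: "\<rho> \<in> L" if "\<rho> \<in> center" for \<rho> using that by (simp add: center_def GE_L)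
  let ?T = "\<lambda>\<rho>. mvec (hpart (ad \<rho>))"
  have add: "?T (a + b) = ?T a + ?T b" and scale: "?T (c *\<^sub>R a) = c *\<^sub>R ?T a" if "a \<in> center" "b \<in> center" for a b c
    using that by (simp_all add: ad_linear[OF cL cL] hpart_linear mvec_linear)
  show "0 \<in> coboundaries"
    unfolding coboundaries_eq using scale[OF center_linear(4,4), of 0] center_linear(4)
    by (intro image_eqI[of _ _ 0]) simp_all
  show "x + y \<in> coboundaries" if xy: "x \<in> coboundaries" "y \<in> coboundaries" for x y
  proof -
    obtain a b where ab: "a \<in> center" "b \<in> center" "x = ?T a" "y = ?T b" using xy unfolding coboundaries_eq by auto
    then have "x + y = ?T (a + b)" using add by simp
    then show ?thesis unfolding coboundaries_eq using center_linear(1)[OF ab(1,2)] by blast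
  qed
  show "c *\<^sub>R x \<in> coboundaries" if x: "x \<in> coboundaries" for c x
  proof -
    obtain a where a: "a \<in> center" "x = ?T a" using x unfolding coboundaries_eq by auto
    then have "c *\<^sub>R x = ?T (c *\<^sub>R a)" using scale by simp
    then show ?thesis unfolding coboundaries_eq using center_linear(3)[OF a(1)] by blast
  qed
qed

lemma subspace_exact: "subspace (d ` Cinf S)"
proof (rule subspaceI)
  show "0 \<in> d ` Cinf S" using image_eqI[of 0 d 0, OF d_zero[symmetric] S.Cinf_0] .
  show "x + y \<in> d ` Cinf S" if xy: "x \<in> d ` Cinf S" "y \<in> d ` Cinf S" for x y
  proof -
    obtain f g where f: "f \<in> Cinf S" "g \<in> Cinf S" "x = d f" "y = d g" using xy by auto
    then have "x + y = d (f + g)" by (simp add: S.dif_add)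
    then show ?thesis by (rule image_eqI[OF _ S.Cinf_add[OF f(1,2)]])
  qed
  show "c *\<^sub>R x \<in> d ` Cinf S" if x: "x \<in> d ` Cinf S" for c x
  proof -
    obtain f where f: "f \<in> Cinf S" "x = d f" using x by auto
    then have "c *\<^sub>R x = d (c *\<^sub>R f)" by (simp add: S.dif_scale)
    then show ?thesis by (rule image_eqI[OF _ S.Cinf_scale[OF f(1)]])
  qed
qed

section \<open>The three components of a Poisson derivation\<close>

definition drift :: "(('a \<Rightarrow> real) \<times> ('a \<Rightarrow> 'a cvec) \<Rightarrow> ('a \<Rightarrow> real) \<times> ('a \<Rightarrow> 'a cvec)) \<Rightarrow> 'a \<Rightarrow> 'a cvec" where
  "drift X = flat (induced_field X)"

definition reduced :: "(('a \<Rightarrow> real) \<times> ('a \<Rightarrow> 'a cvec) \<Rightarrow> ('a \<Rightarrow> real) \<times> ('a \<Rightarrow> 'a cvec)) \<Rightarrow>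
    ('a \<Rightarrow> real) \<times> ('a \<Rightarrow> 'a cvec) \<Rightarrow> ('a \<Rightarrow> real) \<times> ('a \<Rightarrow> 'a cvec)" where
  "reduced X = X - ad (h (drift X))"

lemma drift_closed: "X \<in> Poiss \<Longrightarrow> drift X \<in> closed_forms S"
  by (simp add: drift_def flat_closed)

lemma drift_form: "X \<in> Poiss \<Longrightarrow> drift X \<in> one_forms S"
  using drift_closed S.closed_forms_iff by blast

lemma drift_linear: "X \<in> Poiss \<Longrightarrow> Y \<in> Poiss \<Longrightarrow> drift (X + Y) = drift X + drift Y"
  "X \<in> Poiss \<Longrightarrow> drift (c *\<^sub>R X) = c *\<^sub>R drift X"
  by (simp_all add: drift_def induced_field_linear flat_linear(1) induced_field_poisson(1)
    flat_linear(2)[OF induced_field_poisson(1) induced_field_poisson(1)[of X]])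

lemma drift_ad: "a \<in> L \<Longrightarrow> drift (ad a) = res a"
  by (simp add: drift_def induced_field_ad flat_sharp res_one_form)

lemma drift_Poiss0: "X \<in> Poiss0 \<Longrightarrow> drift X = 0"
proof -
  have "sharp S \<psi> 0 = 0" using S.sharp_scale[OF S.one_forms_zero, of 0] by (simp only: scaleR_zero_left)
  then have "flat 0 = 0" using flat_sharp[OF S.one_forms_zero] by simp
  then show "X \<in> Poiss0 \<Longrightarrow> drift X = 0" by (simp add: drift_def Poiss0_def)
qed

lemma ad_scale: "a \<in> L \<Longrightarrow> ad (c *\<^sub>R a) = c *\<^sub>R ad a"
  using ad_linear(2)[of a a c] by simp

lemma reduced_linear: "X \<in> Poiss \<Longrightarrow> Y \<in> Poiss \<Longrightarrow> reduced (X + Y) = reduced X + reduced Y"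
  "X \<in> Poiss \<Longrightarrow> reduced (c *\<^sub>R X) = c *\<^sub>R reduced X"
  by (simp_all add: reduced_def drift_linear h_linear ad_linear(1) ad_scale h_L drift_form scaleR_diff_right)

lemma reduced_Poiss0: "X \<in> Poiss \<Longrightarrow> reduced X \<in> Poiss0"
proof -
  assume X: "X \<in> Poiss"
  have "ad (h (drift X)) \<in> Poiss" by (rule ad_Poiss[OF h_closed[OF drift_closed[OF X]]])
  moreover have "induced_field (ad (h (drift X))) = induced_field X"
    using flat[OF induced_field_poisson(1)[OF X]]
    by (simp add: induced_field_ad h_L drift_form X res_h) (simp add: drift_def)
  ultimately show ?thesis
    using subspace_diff[OF subspace_Poiss X] by (simp add: Poiss0_def reduced_def induced_field_linear)
qed

lemma Poiss0_Poiss: "X \<in> Poiss0 \<Longrightarrow> X \<in> Poiss"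
  by (simp add: Poiss0_def)

text \<open>The three linear maps are \<open>drift\<close>, which gives a closed form, the function
  part of \<open>rest X\<close> below, which gives a cocycle, and the action of
  \<open>reduced X\<close> on conormal sections, which gives an element of
  \<open>\<MM>0\<close>.\<close>

lemma cohomology_decomposition:
  "rspace_isomorphic H1_P (direct_sum (H1_dR S) (direct_sum H1_del (quotient_rspace \<MM>0 Inn)))"
proof -
  have sub: "subspace (ad ` \<Gamma>E)" "ad ` \<Gamma>E \<subseteq> Poiss0"
    using subspace_ad_image[OF subspace_GE] GE_L ad_GE(1) by auto
  have sM: "subspace \<MM>0" unfolding \<MM>0_eq by (rule linear_subspace_image[OF linear_gpart subspace_Poiss0])
  have sI: "subspace Inn" unfolding Inn_eq by (rule linear_subspace_image[OF linear_gpart sub(1)])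
  have IM: "Inn \<subseteq> \<MM>0" unfolding Inn_eq \<MM>0_eq using sub(2) by (rule image_mono)
  \<comment> \<open>That \<sigma> maps \<open>Inn\<close> into \<open>ad\<close> of conormal
    sections makes the second component descend to the quotient: for a Hamiltonian derivation only a
    Hamiltonian one is then subtracted.\<close>
  have "\<exists>\<sigma>. linear \<sigma> \<and> (\<forall>u\<in>\<MM>0. \<sigma> u \<in> Poiss0 \<and> gpart (\<sigma> u) = u) \<and> (\<forall>u\<in>Inn. \<sigma> u \<in> ad ` \<Gamma>E)"
    by (rule linear_section[OF linear_gpart subspace_Poiss0 sub sM equalityD1[OF \<MM>0_eq] sI IM equalityD1[OF Inn_eq]])
  then obtain \<sigma> where \<sigma>1: "linear \<sigma>" and \<sigma>2: "\<forall>u\<in>\<MM>0. \<sigma> u \<in> Poiss0 \<and> gpart (\<sigma> u) = u"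
    and \<sigma>3: "\<forall>u\<in>Inn. \<sigma> u \<in> ad ` \<Gamma>E" by (elim exE conjE)
  note \<sigma> = \<sigma>1 \<sigma>2[rule_format] \<sigma>3[rule_format]
  \<comment> \<open>Subtracting the chosen lift of its own action leaves a derivation that is zero
    on conormal sections, hence a cocycle.\<close>
  define rest where "rest X = reduced X - \<sigma> (gpart (reduced X))" for X
  have g: "gpart (reduced X) \<in> \<MM>0" if "X \<in> Poiss" for X
    using reduced_Poiss0[OF that] by (auto simp: \<MM>0_eq)
  have rest0: "rest X \<in> Poiss0" and grest: "gpart (rest X) = 0" if "X \<in> Poiss" for X
    using subspace_diff[OF subspace_Poiss0 reduced_Poiss0[OF that]] \<sigma>(2)[OF g[OF that]] linear_diff[OF linear_gpart]
    by (simp_all add: rest_def)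
  have rest_linear: "rest (X + Y) = rest X + rest Y" "rest (c *\<^sub>R X) = c *\<^sub>R rest X" if "X \<in> Poiss" "Y \<in> Poiss" for X Y c
    using that by (simp_all add: rest_def reduced_linear linear_add[OF linear_gpart] linear_add[OF \<sigma>(1)]
      linear_scale[OF linear_gpart] linear_scale[OF \<sigma>(1)] scaleR_diff_right)
  have "rspace_isomorphic (quotient_rspace Poiss Ham) (direct_sum (quotient_rspace (closed_forms S) (d ` Cinf S))
      (direct_sum (quotient_rspace cocycles coboundaries) (quotient_rspace \<MM>0 Inn)))"
  proof (rule quotient_isomorphic_direct_sum[OF subspace_Poiss subspace_Ham subspace_exact subspace_coboundaries sI,
        where ?T1.0 = drift and ?T2.0 = "\<lambda>X. mvec (hpart (rest X))" and ?T3.0 = "\<lambda>X. gpart (reduced X)"])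
    fix X Y c assume X: "X \<in> Poiss"
    show "drift (c *\<^sub>R X) = c *\<^sub>R drift X \<and> mvec (hpart (rest (c *\<^sub>R X))) = c *\<^sub>R mvec (hpart (rest X)) \<and>
        gpart (reduced (c *\<^sub>R X)) = c *\<^sub>R gpart (reduced X)"
      by (simp add: X drift_linear rest_linear(2)[OF X X] reduced_linear hpart_linear mvec_linear linear_scale[OF linear_gpart])
    show "drift X \<in> closed_forms S \<and> mvec (hpart (rest X)) \<in> cocycles \<and> gpart (reduced X) \<in> \<MM>0"
      using drift_closed[OF X] cocycle_hpart[OF rest0[OF X]] grest[OF X] g[OF X] by simp
    assume Y: "Y \<in> Poiss"
    show "drift (X + Y) = drift X + drift Y \<and> mvec (hpart (rest (X + Y))) = mvec (hpart (rest X)) + mvec (hpart (rest Y)) \<and>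
        gpart (reduced (X + Y)) = gpart (reduced X) + gpart (reduced Y)"
      by (simp add: X Y drift_linear rest_linear(1) reduced_linear hpart_linear mvec_linear linear_add[OF linear_gpart])
  next
    fix \<alpha> Q \<delta> assume \<alpha>: "\<alpha> \<in> closed_forms S" and Q: "Q \<in> cocycles" and \<delta>: "\<delta> \<in> \<MM>0"
    have QZ: "Q \<in> \<ZZ> 1" and dQ: "\<And>f g. f \<in> Cinf S \<Longrightarrow> g \<in> Cinf S \<Longrightarrow> d\<D> Q [f, g] = 0" using Q by (auto simp: cocycles_def)
    let ?q = "\<lambda>f. apply_forms Q [d f]"
    note qd = multivector_derivation[OF ZZ_1D(1)[OF QZ]]
    have D0: "\<D> (d f) 0 = 0" if "f \<in> Cinf S" for f
      unfolding \<D>_def by (rule br_linear(5)[OF hd_L[OF that] L_zero L_zero])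
    have "?q (S.pb f k) = \<D> (d f) (?q k) - \<D> (d k) (?q f)" if "f \<in> Cinf S" "k \<in> Cinf S" for f k
      using dQ[OF that] by (simp add: d\<D>_2)
    moreover have "br (?q f) \<xi> = 0" if "f \<in> Cinf S" "\<xi> \<in> \<Gamma>E" for f \<xi>
      using ZZ_1D(2)[OF QZ S.dif_one_form[OF that(1)]] that(2) by (simp add: center_def)
    ultimately have "compatible ?q (\<lambda>_. 0)"
      using qd(1) D0 unfolding compatible_def derivation_def
      by (simp add: GE_linear br_linear(5,6)[OF GE_L L_zero L_zero]) (simp add: fun_eq_iff)
    note Y = compatible_Poiss0[OF this]
    define Y where "Y = mk_derivation ?q (\<lambda>_. 0)"
    have gY: "gpart Y = 0"
    proof
      fix \<eta> show "gpart Y \<eta> = 0 \<eta>"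
        using Y(3)[of \<eta>] by (cases "\<eta> \<in> \<Gamma>E") (simp_all add: Y_def gpart_def mk_derivation_def aff_iff)
    qed
    let ?a = "ad (h \<alpha>)"
    \<comment> \<open>The summands realize \<alpha>, Q and \<delta>. The last two induce the zero
      field, so they do not change the drift, and \<open>Y\<close> is zero on conormal sections, so
      it does not change \<delta>.\<close>
    define X where "X = ?a + (Y + \<sigma> \<delta>)"
    note \<sigma>\<delta> = \<sigma>(2)[OF \<delta>]
    have Y0: "Y \<in> Poiss0" unfolding Y_def by (rule Y(1))
    have YP: "Y + \<sigma> \<delta> \<in> Poiss0" using subspace_add[OF subspace_Poiss0 Y0] \<sigma>\<delta> by simp
    have aP: "?a \<in> Poiss" by (rule ad_Poiss[OF h_closed[OF \<alpha>]])
    have \<alpha>1: "\<alpha> \<in> one_forms S" using \<alpha> by (simp add: S.closed_forms_iff)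
    have XP: "X \<in> Poiss" unfolding X_def by (rule subspace_add[OF subspace_Poiss aP Poiss0_Poiss[OF YP]])
    have dX: "drift X = \<alpha>"
      unfolding X_def by (simp add: drift_linear(1)[OF aP Poiss0_Poiss[OF YP]] drift_Poiss0[OF YP] drift_ad h_L \<alpha>1 res_h)
    have rX: "reduced X = Y + \<sigma> \<delta>" by (simp add: reduced_def dX) (simp add: X_def)
    have gX: "gpart (reduced X) = \<delta>" using \<sigma>\<delta> gY by (simp add: rX linear_add[OF linear_gpart])
    have "hpart (rest X) f = ?q f" if "f \<in> Cinf S" for f
      using Y(2)[OF that] unfolding rest_def gX unfolding rX by (simp add: Y_def)
    then have "mvec (hpart (rest X)) = Q" using mvec_cong[of "hpart (rest X)" ?q] qd(2) by simp
    then show "\<exists>X\<in>Poiss. drift X = \<alpha> \<and> mvec (hpart (rest X)) = Q \<and> gpart (reduced X) = \<delta>"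
      using XP dX gX by blast
  next
    fix X assume X: "X \<in> Poiss"
    show "X \<in> Ham \<longleftrightarrow> drift X \<in> d ` Cinf S \<and> mvec (hpart (rest X)) \<in> coboundaries \<and> gpart (reduced X) \<in> Inn"
    proof
      assume "X \<in> Ham"
      then obtain p where p: "p \<in> aff" "X = ad (lift p)" unfolding Ham_eq by auto
      have f: "fst p \<in> Cinf S" and \<eta>: "snd p \<in> \<Gamma>E" using p(1) by (auto simp: aff_iff)
      have dX: "drift X = d (fst p)" by (simp add: p drift_ad lift_L res_lift)
      have rX: "reduced X = ad (snd p)"
        using ad_linear(1)[OF hd_L[OF f] GE_L[OF \<eta>]] by (simp add: reduced_def dX) (simp add: p lift_def)
      have I: "gpart (reduced X) \<in> Inn" unfolding rX Inn_eq using \<eta> by blast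
      obtain \<xi> where \<xi>: "\<xi> \<in> \<Gamma>E" "\<sigma> (gpart (reduced X)) = ad \<xi>" using \<sigma>(3)[OF I] by auto
      \<comment> \<open>\<open>reduced X\<close> and its \<sigma>-part are both \<open>ad\<close> of
        conormal sections. Their difference acts trivially on conormal sections by
        \<open>grest\<close>, which makes \<open>snd p - \<xi>\<close> central.\<close>
      have e: "rest X = ad (snd p - \<xi>)"
        using ad_linear(1)[OF GE_L[OF GE_linear(5)[OF \<eta> \<xi>(1)]] GE_L[OF \<xi>(1)]] unfolding rest_def \<xi>(2) unfolding rX by simp
      have d: "snd p - \<xi> \<in> \<Gamma>E" by (rule GE_linear(5)[OF \<eta> \<xi>(1)])
      have "br (snd p - \<xi>) \<theta> = 0" if "\<theta> \<in> \<Gamma>E" for \<theta>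
        using fun_cong[OF ad_GE(3)[OF d], of \<theta>] grest[OF X] that by (simp add: e)
      then have "snd p - \<xi> \<in> center" using d by (simp add: center_def)
      then have "mvec (hpart (rest X)) \<in> coboundaries" unfolding coboundaries_eq e by blast
      then show "drift X \<in> d ` Cinf S \<and> mvec (hpart (rest X)) \<in> coboundaries \<and> gpart (reduced X) \<in> Inn"
        using dX f I by blast
    next
      assume A: "drift X \<in> d ` Cinf S \<and> mvec (hpart (rest X)) \<in> coboundaries \<and> gpart (reduced X) \<in> Inn"
      then obtain f where f: "f \<in> Cinf S" "drift X = d f" by auto
      obtain \<rho> where \<rho>: "\<rho> \<in> center" "mvec (hpart (rest X)) = mvec (hpart (ad \<rho>))" using A unfolding coboundaries_eq by auto
      have \<rho>E: "\<rho> \<in> \<Gamma>E" using \<rho> by (simp add: center_def)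
      obtain \<xi> where \<xi>: "\<xi> \<in> \<Gamma>E" "\<sigma> (gpart (reduced X)) = ad \<xi>" using \<sigma>(3) A by blast
      have R: "rest X \<in> Poiss0" "ad \<rho> \<in> Poiss0" using rest0[OF X] ad_GE(1)[OF \<rho>E] by auto
      have "hpart (rest X) f = hpart (ad \<rho>) f" if "f \<in> Cinf S" for f
        using apply_mvec[OF compatible_derivation[OF Poiss0_compatible[OF R(1)]] that]
          apply_mvec[OF compatible_derivation[OF Poiss0_compatible[OF R(2)]] that] \<rho>(2) by simp
      then have "rest X p = ad \<rho> p" for p
        using Poiss0_apply[OF R(1), of p] Poiss0_apply[OF R(2), of p] grest[OF X] gpart_center[OF \<rho>(1)]
        by (simp add: aff_iff)
      then have "rest X = ad \<rho>" by (rule ext)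
      \<comment> \<open>Reassembles X from its drift, its \<sigma>-part and its rest, each of which
        is now an \<open>ad\<close>; the sum is \<open>ad\<close> of a single lift.\<close>
      then have "X = ad (h (d f)) + (ad \<xi> + ad \<rho>)"
        using \<xi>(2) f(2) by (simp add: rest_def reduced_def algebra_simps)
      also have "\<dots> = ad (lift (f, \<xi> + \<rho>))"
        using ad_linear(1)[OF GE_L[OF \<xi>(1)] GE_L[OF \<rho>E]] ad_linear(1)[OF hd_L[OF f(1)] L_add[OF GE_L[OF \<xi>(1)] GE_L[OF \<rho>E]]]
        by (simp add: lift_def)
      finally show "X \<in> Ham" unfolding Ham_eq using f(1) GE_linear(1)[OF \<xi>(1) \<rho>E] by (auto simp: aff_iff intro!: image_eqI)
    qed
  qed
  then show ?thesis by (simp add: H1_P_def H1_dR_def H1_del_def cocycles_def coboundaries_def)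
qed

lemma hamiltonian_fields_eq: "hamiltonian_fields S \<psi> = induced_field ` Ham"
proof -
  have "induced_field (ad (lift p)) = sharp S \<psi> (d (fst p))" if "p \<in> aff" for p
    using that by (simp add: induced_field_ad lift_L res_lift)
  then have "induced_field ` Ham = (\<lambda>p. sharp S \<psi> (d (fst p))) ` aff"
    unfolding Ham_eq image_image by (rule image_cong[OF refl])
  also have "\<dots> = (\<lambda>f. sharp S \<psi> (d f)) ` (fst ` aff)" by (simp add: image_image)
  also have "fst ` aff = Cinf S"
  proof
    show "Cinf S \<subseteq> fst ` aff" using pair_aff(1) by (intro subsetI image_eqI[of _ _ "(_, 0)"]) auto
  qed (auto simp: aff_iff)
  finally show ?thesis by (simp add: hamiltonian_fields_def)
qed

lemma subspace_hamiltonian_fields: "subspace (hamiltonian_fields S \<psi>)"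
  unfolding hamiltonian_fields_eq
  by (rule linear_subspace_image[OF _ subspace_Ham]) (rule linearI; rule induced_field_linear)

lemma zeta_surjective: "\<zeta> ` rcarrier H1_P = rcarrier (H1_poisson S \<psi>)"
proof -
  have z: "\<zeta> (coset Ham X) = coset (hamiltonian_fields S \<psi>) (induced_field X)" if X: "X \<in> Poiss" for X
  proof -
    \<comment> \<open>Hamiltonian derivations induce Hamiltonian fields, so the union in the
      definition of \<open>\<zeta>\<close> is one of equal cosets.\<close>
    have "coset (hamiltonian_fields S \<psi>) (induced_field Y) = coset (hamiltonian_fields S \<psi>) (induced_field X)"
      if Y: "Y \<in> coset Ham X" for Y
    proof -
      obtain H where "H \<in> Ham" "Y = X + H" using Y by (auto simp: coset_def)
      then show ?thesis
        unfolding coset_eq_iff[OF subspace_hamiltonian_fields] by (simp add: induced_field_linear hamiltonian_fields_eq)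
    qed
    moreover have "X \<in> coset Ham X" using subspace_0[OF subspace_Ham] by (force simp: coset_def)
    ultimately show ?thesis unfolding \<zeta>_def by blast
  qed
  have "induced_field ` Poiss = poisson_fields S \<psi>"
  proof
    show "induced_field ` Poiss \<subseteq> poisson_fields S \<psi>"
      using induced_field_poisson by (auto simp: S.poisson_fields_iff)
    show "poisson_fields S \<psi> \<subseteq> induced_field ` Poiss"
    proof
      fix v assume "v \<in> poisson_fields S \<psi>"
      then have v: "v \<in> vector_fields S" "S.pb_derivation v" by (auto simp: S.poisson_fields_iff)
      have \<alpha>: "flat v \<in> one_forms S" "sharp S \<psi> (flat v) = v" using flat[OF v(1)] by auto
      then have "flat v \<in> closed_forms S" using S.closed_iff_derivation v(2) by simp
      from ad_Poiss[OF h_closed[OF this]] show "v \<in> induced_field ` Poiss"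
        using induced_field_ad[OF h_L[OF \<alpha>(1)]] \<alpha> by (intro image_eqI[of _ _ "ad (h (flat v))"]) (simp_all add: res_h)
    qed
  qed
  then show ?thesis
    by (simp add: H1_P_def H1_poisson_def quotient_rspace_def image_image z cong: image_cong_simp)
      (simp add: image_image[symmetric, of "coset (hamiltonian_fields S \<psi>)" induced_field])
qed

end

section \<open>Smooth maps and the tubular neighbourhood\<close>

lemma open_submanifold_carrier:
  assumes "manifold A" shows "open_submanifold A (carrier A) = A"
proof -
  interpret A: manifold_on A by (rule manifold_on.intro[OF assms])
  have "(\<lambda>(U, \<phi>). (U \<inter> carrier A, \<phi>)) x = x" if "x \<in> A" for x
    using A.chart(3)[of "fst x" "snd x"] that by (auto simp: split_beta intro!: prod_eqI)
  then have "(\<lambda>(U, \<phi>). (U \<inter> carrier A, \<phi>)) ` A = (\<lambda>x. x) ` A" by (rule image_cong[OF refl])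
  then show ?thesis by (simp add: open_submanifold_def)
qed

text \<open>Smooth maps on an open domain \<open>D\<close>, so that the same facts serve the
  inclusion of \<open>S\<close>, the map \<open>e\<close>, and its inverse on the open
  image.\<close>

locale local_smooth_map = A: manifold_on A + B: manifold_on B
  for A :: "('a, 'e::real_inner) atlas" and B :: "('b, 'f::real_inner) atlas" +
  fixes D :: "'a set" and F :: "'a \<Rightarrow> 'b"
  assumes dom: "A.is_open D" and smooth: "smooth_map (open_submanifold A D) B F"
begin

lemma image: "p \<in> D \<Longrightarrow> F p \<in> carrier B"
proof -
  assume p: "p \<in> D"
  then obtain U \<phi> where U: "(U, \<phi>) \<in> A" "p \<in> U" using A.chart_at A.is_open_subset[OF dom] by blast
  have "p \<in> carrier (open_submanifold A D)"
    unfolding carrier_def open_submanifold_def using U p by force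
  then show ?thesis using smooth by (auto simp: smooth_map_def)
qed

lemma in_charts:
  assumes U: "(U, \<phi>) \<in> A" and V: "(V, \<theta>) \<in> B"
  shows "open (\<phi> ` (U \<inter> D \<inter> F -` V))" "smooth_on (\<phi> ` (U \<inter> D \<inter> F -` V)) (\<theta> \<circ> F \<circ> inv_into U \<phi>)"
proof -
  have "(U \<inter> D, \<phi>) \<in> open_submanifold A D" using U by (force simp: open_submanifold_def)
  then have *: "open (\<phi> ` (U \<inter> D \<inter> F -` V))" "smooth_on (\<phi> ` (U \<inter> D \<inter> F -` V)) (\<theta> \<circ> F \<circ> inv_into (U \<inter> D) \<phi>)"
    using smooth V unfolding smooth_map_def by fastforce+
  note inj = A.chart(1)[OF U]
  show "open (\<phi> ` (U \<inter> D \<inter> F -` V))" by (rule *(1))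
  show "smooth_on (\<phi> ` (U \<inter> D \<inter> F -` V)) (\<theta> \<circ> F \<circ> inv_into U \<phi>)"
  proof (rule smooth_on_eq[OF *(2,1)])
    fix y assume "y \<in> \<phi> ` (U \<inter> D \<inter> F -` V)"
    then obtain x where "x \<in> U" "x \<in> D" "y = \<phi> x" by auto
    then show "(\<theta> \<circ> F \<circ> inv_into (U \<inter> D) \<phi>) y = (\<theta> \<circ> F \<circ> inv_into U \<phi>) y"
      using inv_into_f_f[OF inj, of x] inv_into_f_f[OF inj_on_subset[OF inj], of "U \<inter> D" x] by simp
  qed
qed

lemma local_chart:
  assumes p: "p \<in> D" and f: "B.smooth_at f (F p)"
  shows "\<exists>U \<phi> N. (U, \<phi>) \<in> A \<and> p \<in> U \<and> open N \<and> \<phi> p \<in> N \<and> N \<subseteq> \<phi> ` U \<and> smooth_on N (f \<circ> F \<circ> inv_into U \<phi>)"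
proof -
  obtain U \<phi> where U: "(U, \<phi>) \<in> A" "p \<in> U" using A.chart_at A.is_open_subset[OF dom] p by blast
  obtain V \<theta> where V: "(V, \<theta>) \<in> B" "F p \<in> V" using B.chart_at image[OF p] by blast
  obtain N where N: "open N" "\<theta> (F p) \<in> N" "N \<subseteq> \<theta> ` V" "smooth_on N (f \<circ> inv_into V \<theta>)"
    using B.smooth_atD[OF f V] by blast
  note inj = A.chart(1)[OF U(1)] and injV = B.chart(1)[OF V(1)]
  note c = in_charts[OF U(1) V(1)]
  let ?G = "\<theta> \<circ> F \<circ> inv_into U \<phi>"
  define N' where "N' = {y \<in> \<phi> ` (U \<inter> D \<inter> F -` V). ?G y \<in> N}"
  have oN': "open N'" unfolding N'_def by (rule open_preimage_smooth[OF c(2,1) N(1)])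
  have "?G (\<phi> p) = \<theta> (F p)" using inv_into_f_f[OF inj U(2)] by simp
  then have pN': "\<phi> p \<in> N'" using U(2) V(2) p N(2) by (auto simp: N'_def)
  have "smooth_on N' ?G" by (rule smooth_on_subset[OF c(2)]) (auto simp: N'_def)
  then have s: "smooth_on N' (\<lambda>y. (f \<circ> inv_into V \<theta>) (?G y))"
    by (rule smooth_on_compose[OF B.finite_dim oN' N(1) _ N(4)]) (auto simp: N'_def)
  have "smooth_on N' (f \<circ> F \<circ> inv_into U \<phi>)"
  proof (rule smooth_on_eq[OF s oN'])
    fix y assume "y \<in> N'"
    then obtain x where x: "x \<in> U" "F x \<in> V" "y = \<phi> x" by (auto simp: N'_def)
    then show "(f \<circ> inv_into V \<theta>) (?G y) = (f \<circ> F \<circ> inv_into U \<phi>) y"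
      using inv_into_f_f[OF inj x(1)] inv_into_f_f[OF injV x(2)] by simp
  qed
  moreover have "N' \<subseteq> \<phi> ` U" by (auto simp: N'_def)
  ultimately show ?thesis using U oN' pN' by blast
qed

lemma smooth_at_compose:
  assumes "p \<in> D" "B.smooth_at f (F p)" shows "A.smooth_at (f \<circ> F) p"
  using local_chart[OF assms] unfolding A.smooth_at_def .

lemma is_open_vimage:
  assumes W: "B.is_open W" shows "A.is_open {p\<in>D. F p \<in> W}"
  unfolding A.is_open_iff
proof (intro conjI ballI, goal_cases)
  case 1
  then show ?case using A.is_open_subset[OF dom] by auto
next
  case (2 c)
  obtain U \<phi> where c: "c = (U, \<phi>)" by (cases c)
  with 2 have U: "(U, \<phi>) \<in> A" by simp
  note inj = A.chart(1)[OF U]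
  have "open (\<phi> ` (U \<inter> {p\<in>D. F p \<in> W}))"
  proof (rule Topological_Spaces.openI)
    fix y assume "y \<in> \<phi> ` (U \<inter> {p\<in>D. F p \<in> W})"
    then obtain p where p: "p \<in> U" "p \<in> D" "F p \<in> W" "y = \<phi> p" by auto
    obtain V \<theta> where V: "(V, \<theta>) \<in> B" "F p \<in> V" using B.chart_at image[OF p(2)] by blast
    note c = in_charts[OF U V(1)] and injV = B.chart(1)[OF V(1)]
    let ?G = "\<theta> \<circ> F \<circ> inv_into U \<phi>"
    let ?N = "{y \<in> \<phi> ` (U \<inter> D \<inter> F -` V). ?G y \<in> \<theta> ` (V \<inter> W)}"
    have "open ?N" by (rule open_preimage_smooth[OF c(2,1) B.is_open_image[OF W V(1)]])
    moreover have "y \<in> ?N" using p V(2) inv_into_f_f[OF inj p(1)] by auto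
    moreover have "?N \<subseteq> \<phi> ` (U \<inter> {p\<in>D. F p \<in> W})"
    proof
      fix z assume z: "z \<in> ?N"
      then obtain x where x: "x \<in> U" "x \<in> D" "F x \<in> V" "z = \<phi> x" by auto
      with z have "\<theta> (F x) \<in> \<theta> ` (V \<inter> W)" using inv_into_f_f[OF inj x(1)] by simp
      then have "F x \<in> W" using inj_onD[OF injV _ x(3)] by auto
      then show "z \<in> \<phi> ` (U \<inter> {p\<in>D. F p \<in> W})" using x by blast
    qed
    ultimately show "\<exists>T. open T \<and> y \<in> T \<and> T \<subseteq> \<phi> ` (U \<inter> {p\<in>D. F p \<in> W})" by blast
  qed
  then show ?case by (simp add: c)
qed

end

lemma local_smooth_map_total:
  assumes "manifold A" "manifold B" "smooth_map A B F"
  shows "local_smooth_map A B (carrier A) F"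
proof -
  interpret A: manifold_on A by (rule manifold_on.intro[OF assms(1)])
  interpret B: manifold_on B by (rule manifold_on.intro[OF assms(2)])
  show ?thesis
    by unfold_locales (simp_all add: A.is_open_carrier open_submanifold_carrier assms)
qed

section \<open>A leaf with a tubular neighbourhood satisfies the assumptions of
  \<open>leaf_geometry\<close>\<close>

lemma poisson_submanifold_embedded:
  assumes M: "manifold M" "poisson M \<pi>" and S: "embedded_poisson_submanifold M \<pi> S \<psi>"
  shows "poisson_submanifold M \<pi> S \<psi>"
proof -
  have S': "manifold S" "poisson S \<psi>" "smooth_map S M (\<lambda>x. x)"
    and pull: "\<And>s a b. s \<in> carrier S \<Longrightarrow> a \<in> cotangent M s \<Longrightarrow> b \<in> cotangent M s \<Longrightarrow>
      \<psi> s (pull M S s a) (pull M S s b) = \<pi> s a b"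
    using S by (auto simp: embedded_poisson_submanifold_def embedded_submanifold_def immersed_submanifold_def)
  interpret M: poisson_manifold M \<pi> by unfold_locales (rule M)+
  interpret S: poisson_manifold S \<psi> by unfold_locales (rule S')+
  interpret i: local_smooth_map S M "carrier S" "\<lambda>x. x"
    by (rule local_smooth_map_total[OF S'(1) M(1) S'(3)])
  show ?thesis
  proof unfold_locales
    show "carrier S \<subseteq> carrier M" using i.image by auto
    show "restr S F \<in> Cinf S" if F: "F \<in> Cinf M" for F
      unfolding S.Cinf_iff
    proof (intro conjI ballI allI impI)
      fix s assume s: "s \<in> carrier S"
      have "S.smooth_at (F \<circ> (\<lambda>x. x)) s"
        using F i.image[OF s] by (intro i.smooth_at_compose[OF s]) (simp add: M.Cinf_iff)
      then show "S.smooth_at (restr S F) s"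
        by (rule S.smooth_at_cong[OF _ S.is_open_carrier s]) (simp add: restr_def)
    qed (simp add: restr_def)
    show "S.is_open (W \<inter> carrier S)" if "M.is_open W" for W
    proof -
      have "{p \<in> carrier S. p \<in> W} = W \<inter> carrier S" by auto
      then show ?thesis using i.is_open_vimage[OF that] by simp
    qed
    show "\<psi> s (pull M S s a) (pull M S s b) = \<pi> s a b"
      if "s \<in> carrier S" "a \<in> cotangent M s" "b \<in> cotangent M s" for s a b using pull[OF that] .
  qed
qed

text \<open>If the push-forward of v is \<pi>(a, .), then v is \<psi>(a', .) with a' the pullback of
  a: both sides are compared on f through a local extension F, using
  \<open>pull_bivector\<close>.\<close>

lemma (in poisson_submanifold) nondegenerate_leaf:
  assumes s: "s \<in> carrier S" and v: "v \<in> tangent S s"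
    and char: "push M S v \<in> sharp_at M \<pi> s ` cotangent M s"
    and ext: "\<And>f. f \<in> Cinf S \<Longrightarrow> \<exists>F W. F \<in> Cinf M \<and> S.is_open W \<and> s \<in> W \<and> (\<forall>x\<in>W. F x = f x)"
  shows "\<exists>a\<in>cotangent S s. v = sharp_at S \<psi> s a"
proof -
  obtain a where a: "a \<in> cotangent M s" "push M S v = sharp_at M \<pi> s a" using char by auto
  have "v f = sharp_at S \<psi> s (pull M S s a) f" for f
  proof (cases "f \<in> Cinf S")
    case True
    then obtain F W where F: "F \<in> Cinf M" "S.is_open W" "s \<in> W" "\<forall>x\<in>W. F x = f x" using ext by blast
    have r: "restr S F x = f x" if "x \<in> W" for x
      using F(4) that S.is_open_subset[OF F(2)] by (auto simp: restr_def)
    have t: "w (restr S F) = w f" if "w \<in> tangent S s" for w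
      by (rule S.tangent_local[OF that restr_Cinf[OF F(1)] True F(2,3) r])
    have "dif S f s = dif S (restr S F) s" by (auto simp: dif_def fun_eq_iff t)
    then have "sharp_at S \<psi> s (pull M S s a) f = \<psi> s (pull M S s a) (pull M S s (dif M F s))"
      by (simp add: S.sharp_at_apply s True pull_dif F(1))
    also have "\<dots> = \<pi> s a (dif M F s)" by (rule pull_bivector[OF s a(1) M.dif_cotangent])
    also have "\<dots> = push M S v F" by (simp add: a(2) M.sharp_at_apply in_M s F(1))
    also have "\<dots> = v f" using t[OF v] by (simp add: push_apply F(1))
    finally show ?thesis ..
  next
    case False
    then show ?thesis using S.tangent_outside[OF v] by (simp add: sharp_at_def)
  qed
  then show ?thesis using pull_cotangent[OF s a(1)] by blast
qed

text \<open>For the scalar 0 the zero coset is recovered through the summand from the subspace; all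
  it takes is that \<open>w\<close> is not empty.\<close>

lemma normal_space_zero:
  assumes "w \<in> rcarrier (normal_space M S s)"
  shows "rscale (normal_space M S s) 0 w = push M S ` tangent S s"
proof -
  have "0 \<in> tangent S s" by (simp add: tangent_def)
  moreover obtain v where "w = coset (push M S ` tangent S s) v"
    using assms by (auto simp: normal_space_def quotient_rspace_def)
  ultimately have "\<exists>a. a \<in> w" by (auto simp: coset_def)
  then show ?thesis by (simp add: normal_space_def quotient_rspace_def)
qed

text \<open>F is f composed with the bundle projection and the inverse of \<open>e\<close>, cut off
  near s. Along t -> e(x, t w) it is constant for small t, so its vertical derivative
  vanishes.\<close>

lemma tubular_extension:
  fixes M :: "('a, 'e::real_inner) atlas" and S :: "('a, 'd::real_inner) atlas"
    and e :: "'a \<times> 'a tvec set \<Rightarrow> 'a"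
  assumes M: "manifold M" and S: "manifold S" "carrier S \<subseteq> carrier M"
    and open_restr: "\<forall>W. openin (atlas_topology M) W \<longrightarrow> openin (atlas_topology S) (W \<inter> carrier S)"
    and exponential: "exponential_map TYPE('f::real_inner) M S e"
    and f: "f \<in> Cinf S" and s: "s \<in> carrier S"
  shows "\<exists>F W. F \<in> Cinf M \<and> openin (atlas_topology S) W \<and> s \<in> W \<and>
      (\<forall>x\<in>W. F x = f x \<and> (\<forall>w\<in>rcarrier (normal_space M S x). vertical_differential M S e x w F = 0))"
proof -
  define E where "E = (normal_atlas M S :: ('a \<times> 'a tvec set, 'd \<times> 'f) atlas)"
  have E: "manifold E" "carrier E = normal_total M S" "smooth_map E M e" "inj_on e (carrier E)"
    "openin (atlas_topology M) (e ` carrier E)"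
    "smooth_map (open_submanifold M (e ` carrier E)) E (inv_into (carrier E) e)"
    and zero: "\<And>s. s \<in> carrier S \<Longrightarrow> e (s, push M S ` tangent S s) = s"
    using exponential by (auto simp: exponential_map_def Let_def E_def)
  interpret M: manifold_on M by (rule manifold_on.intro[OF M])
  interpret S: manifold_on S by (rule manifold_on.intro[OF S(1)])
  interpret e: local_smooth_map E M "carrier E" e by (rule local_smooth_map_total[OF E(1) M E(3)])
  interpret i: local_smooth_map M E "e ` carrier E" "inv_into (carrier E) e"
    by unfold_locales (rule E(5), rule E(6))
  have zeroE: "(x, push M S ` tangent S x) \<in> carrier E" if "x \<in> carrier S" for x
  proof -
    have "0 \<in> tangent M x" by (simp add: tangent_def)
    moreover have "coset (push M S ` tangent S x) 0 = push M S ` tangent S x" by (simp add: coset_def)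
    ultimately show ?thesis
      unfolding E(2) normal_total_def normal_space_def quotient_rspace_def using that by (force intro: image_eqI)
  qed
  have chart: thesis if p: "(x, w) \<in> carrier E" and
    hyp: "\<And>D U \<phi> W T. (D, \<lambda>(s, w). (\<phi> s, inv (T s) w)) \<in> E \<Longrightarrow> (U, \<phi>) \<in> S \<Longrightarrow> W \<subseteq> U \<Longrightarrow> x \<in> W \<Longrightarrow>
      normal_trivialization M S W T \<Longrightarrow> D = {(s, w). s \<in> W \<and> w \<in> rcarrier (normal_space M S s)} \<Longrightarrow> (x, w) \<in> D \<Longrightarrow> thesis"
    for x w thesis and T :: "'a \<Rightarrow> 'f \<Rightarrow> 'a tvec set"
  proof -
    obtain D \<kappa> where D: "(D, \<kappa>) \<in> E" "(x, w) \<in> D" using e.A.chart_at[OF p] by blast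
    then obtain U \<phi> W and T :: "'a \<Rightarrow> 'f \<Rightarrow> 'a tvec set" where *: "(U, \<phi>) \<in> S" "W \<subseteq> U" "normal_trivialization M S W T"
      "D = {(s, w). s \<in> W \<and> w \<in> rcarrier (normal_space M S s)}" "\<kappa> = (\<lambda>(s, w). (\<phi> s, inv (T s) w))"
      unfolding E_def normal_atlas_def by auto
    show thesis by (rule hyp[OF D(1)[unfolded *(5)] *(1,2) _ *(3,4) D(2)]) (use D(2) *(4) in auto)
  qed
  \<comment> \<open>In a chart of the total space the projection is the first coordinate, so the
    function becomes the coordinate expression of f composed with \<open>fst\<close>.\<close>
  have fst_smooth: "e.A.smooth_at (f \<circ> fst) z" if z: "z \<in> carrier E" for z
  proof -
    obtain x w where xw: "z = (x, w)" by (cases z)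
    show ?thesis
    proof (rule chart[OF z[unfolded xw]])
      fix D U W and \<phi> :: "'a \<Rightarrow> 'd" and T :: "'a \<Rightarrow> 'f \<Rightarrow> 'a tvec set"
      let ?\<kappa> = "\<lambda>(s, w). (\<phi> s, inv (T s) w)"
      assume D: "(D, ?\<kappa>) \<in> E" and U: "(U, \<phi>) \<in> S" "W \<subseteq> U"
        and De: "D = {(s, w). s \<in> W \<and> w \<in> rcarrier (normal_space M S s)}" and xwD: "(x, w) \<in> D"
      have fs: "smooth_on (\<phi> ` U) (f \<circ> inv_into U \<phi>)"
        using f U(1) S.chart(3)[OF U(1)] by (auto simp: Cinf_def smooth_fun_on_def inf_absorb1)
      have sf: "smooth_on (?\<kappa> ` D) (fst :: 'd \<times> 'f \<Rightarrow> 'd)"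
        unfolding smooth_on_def using Ck_on_bounded_linear[OF bounded_linear_fst] by blast
      have s1: "smooth_on (?\<kappa> ` D) (\<lambda>y. (f \<circ> inv_into U \<phi>) (fst y))"
        by (rule smooth_on_compose[OF S.finite_dim e.A.chart(2)[OF D] S.chart(2)[OF U(1)] sf fs])
          (use De U(2) in force)
      have "smooth_on (?\<kappa> ` D) ((f \<circ> fst) \<circ> inv_into D ?\<kappa>)"
      proof (rule smooth_on_eq[OF s1 e.A.chart(2)[OF D]])
        fix y assume "y \<in> ?\<kappa> ` D"
        then obtain q where q: "q \<in> D" "y = ?\<kappa> q" by auto
        have "inv_into D ?\<kappa> y = q" unfolding q(2) by (rule inv_into_f_f[OF e.A.chart(1)[OF D] q(1)])
        moreover have "fst y = \<phi> (fst q)" unfolding q(2) by (simp add: split_beta)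
        moreover have "fst q \<in> U" using q(1) De U(2) by auto
        ultimately show "(f \<circ> inv_into U \<phi>) (fst y) = ((f \<circ> fst) \<circ> inv_into D ?\<kappa>) y"
          using inv_into_f_f[OF S.chart(1)[OF U(1)]] by simp
      qed
      then show ?thesis unfolding xw by (rule e.A.smooth_atI'[OF D xwD])
    qed
  qed
  have sO: "s \<in> e ` carrier E" using imageI[OF zeroE[OF s], of e] unfolding zero[OF s] .
  have "M.smooth_at ((f \<circ> fst) \<circ> inv_into (carrier E) e) p" if p: "p \<in> e ` carrier E" for p
    by (rule i.smooth_at_compose[OF p fst_smooth[OF i.image[OF p]]])
  from M.Cinf_extension[OF E(5) sO this] obtain F O' where F: "F \<in> Cinf M" and O': "M.is_open O'" "s \<in> O'"
    and FO: "\<forall>q\<in>O'. F q = ((f \<circ> fst) \<circ> inv_into (carrier E) e) q" by blast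
  have Fe: "F (e (x, w)) = f x" if "(x, w) \<in> carrier E" "e (x, w) \<in> O'" for x w
    using FO that(2) inv_into_f_f[OF E(4) that(1)] by simp
  have "F x = f x \<and> (\<forall>w\<in>rcarrier (normal_space M S x). vertical_differential M S e x w F = 0)"
    if "x \<in> O' \<inter> carrier S" for x
  proof (intro conjI ballI)
    have x: "x \<in> O'" "x \<in> carrier S" using that by auto
    show "F x = f x" using Fe[OF zeroE[OF x(2)]] zero[OF x(2)] x(1) by simp
    fix w assume w: "w \<in> rcarrier (normal_space M S x)"
    then have p: "(x, w) \<in> carrier E" using x(2) by (simp add: E(2) normal_total_def)
    show "vertical_differential M S e x w F = 0"
    proof (rule chart[OF p])
      fix D U W and \<phi> :: "'a \<Rightarrow> 'd" and T :: "'a \<Rightarrow> 'f \<Rightarrow> 'a tvec set"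
      let ?\<kappa> = "\<lambda>(s, w). (\<phi> s, inv (T s) w)"
      assume D: "(D, ?\<kappa>) \<in> E" and U: "(U, \<phi>) \<in> S" "W \<subseteq> U" and xW: "x \<in> W" and T: "normal_trivialization M S W T"
        and De: "D = {(s, w). s \<in> W \<and> w \<in> rcarrier (normal_space M S s)}"
      have bT: "bij_betw (T x) UNIV (rcarrier (normal_space M S x))"
        and sT: "\<And>c y. T x (c *\<^sub>R y) = rscale (normal_space M S x) c (T x y)"
        using T xW by (auto simp: normal_trivialization_def)
      obtain y where y: "w = T x y" using bT w by (auto simp: bij_betw_def)
      have path: "rscale (normal_space M S x) t w = T x (t *\<^sub>R y)" for t by (simp add: y sT)
      have TD: "(x, T x z) \<in> D" for z using bT xW by (auto simp: De bij_betw_def)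
      have \<kappa>T: "?\<kappa> (x, T x z) = (\<phi> x, z)" for z using bT by (simp add: bij_betw_def)
      let ?V = "{z\<in>carrier E. e z \<in> O'}"
      have oV: "open (?\<kappa> ` (D \<inter> ?V))" by (rule e.A.is_open_image[OF e.is_open_vimage[OF O'(1)] D])
      have "T x (0 *\<^sub>R y) = push M S ` tangent S x" unfolding path[symmetric] by (rule normal_space_zero[OF w])
      then have "(x, T x (0 *\<^sub>R y)) \<in> D \<inter> ?V" using TD[of "0 *\<^sub>R y"] zeroE[OF x(2)] zero[OF x(2)] x(1) by simp
      then have "?\<kappa> (x, T x (0 *\<^sub>R y)) \<in> ?\<kappa> ` (D \<inter> ?V)" by (rule imageI)
      then have in0: "(\<phi> x, 0 *\<^sub>R y) \<in> ?\<kappa> ` (D \<inter> ?V)" unfolding \<kappa>T .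
      \<comment> \<open>In the chart the ray is (\<phi> x, t y), which is continuous at t = 0; for
        small t its image under \<open>e\<close> therefore stays in the open set where F is given by
        f and the projection.\<close>
      have "((\<lambda>t. (\<phi> x, t *\<^sub>R y)) \<longlongrightarrow> (\<phi> x, 0 *\<^sub>R y)) (nhds 0)"
        by (intro tendsto_intros filterlim_ident)
      from topological_tendstoD[OF this oV in0]
      have "\<forall>\<^sub>F t in nhds 0. F (e (x, rscale (normal_space M S x) t w)) = f x"
      proof (rule eventually_mono)
        fix t assume "(\<phi> x, t *\<^sub>R y) \<in> ?\<kappa> ` (D \<inter> ?V)"
        then have "?\<kappa> (x, T x (t *\<^sub>R y)) \<in> ?\<kappa> ` (D \<inter> ?V)" unfolding \<kappa>T .
        then have "(x, T x (t *\<^sub>R y)) \<in> ?V"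
          using inj_on_image_mem_iff[OF e.A.chart(1)[OF D] TD, of "D \<inter> ?V"] by blast
        then show "F (e (x, rscale (normal_space M S x) t w)) = f x" unfolding path using Fe by blast
      qed
      then have "deriv (\<lambda>t. F (e (x, rscale (normal_space M S x) t w))) 0 = deriv (\<lambda>t. f x) 0"
        by (intro deriv_cong_ev refl)
      then show ?thesis by (simp add: vertical_differential_def)
    qed
  qed
  then show ?thesis using F open_restr[rule_format, OF O'(1)] O'(2) s by blast
qed

text \<open>Nondegeneracy of \<psi> comes from the leaf condition, by which the vectors tangent to
  \<open>S\<close> are exactly the values of the sharp map of \<pi>.\<close>

lemma leaf_geometry_tubular:
  fixes M :: "('a, 'e::real_inner) atlas" and S :: "('a, 'd::real_inner) atlas"
  assumes M: "manifold M" "poisson M \<pi>"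
    and leaf: "symplectic_leaf M \<pi> S" and S: "embedded_poisson_submanifold M \<pi> S \<psi>"
    and exponential: "exponential_map TYPE('f::real_inner) M S e"
  shows "leaf_geometry M \<pi> S \<psi> e"
proof -
  interpret poisson_submanifold M \<pi> S \<psi> by (rule poisson_submanifold_embedded[OF M S])
  have "\<forall>W. M.is_open W \<longrightarrow> S.is_open (W \<inter> carrier S)" using open_restr by blast
  note ext = tubular_extension[OF M(1) S.manifold carrier_subset this exponential]
  have char: "push M S v \<in> sharp_at M \<pi> s ` cotangent M s" if "s \<in> carrier S" "v \<in> tangent S s" for s v
    using leaf that by (auto simp: symplectic_leaf_def connected_integral_submanifold_def)
  show ?thesis
  proof unfold_locales
    show "\<exists>a\<in>cotangent S s. v = sharp_at S \<psi> s a" if s: "s \<in> carrier S" and v: "v \<in> tangent S s" for s v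
    proof (rule nondegenerate_leaf[OF s v char[OF s v]])
      fix f assume "f \<in> Cinf S"
      from ext[OF this s] show "\<exists>F W. F \<in> Cinf M \<and> S.is_open W \<and> s \<in> W \<and> (\<forall>x\<in>W. F x = f x)" by blast
    qed
    show "vertical_differential M S e s w \<in> w" if "s \<in> carrier S" "w \<in> rcarrier (normal_space M S s)" for s w
      using exponential that by (auto simp: exponential_map_def Let_def normal_total_def)
  qed (rule ext)
qed

theorem theorem3p9:
  fixes M :: "('a, 'e::real_inner) atlas" and \<pi> :: "'a bivector"
    and S :: "('a, 'd::real_inner) atlas" and \<psi> :: "'a bivector"
    and e :: "'a \<times> 'a tvec set \<Rightarrow> 'a"
  assumes "manifold M" and "poisson M \<pi>"
    and "symplectic_leaf M \<pi> S" and "embedded_poisson_submanifold M \<pi> S \<psi>"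
    and "exponential_map TYPE('f::real_inner) M S e"
  shows "leaf_data.\<zeta> S \<psi> ` rcarrier (leaf_data.H1_P M \<pi> S \<psi> e) = rcarrier (H1_poisson S \<psi>) \<and>
    rspace_isomorphic (leaf_data.H1_P M \<pi> S \<psi> e)
           (direct_sum (H1_dR S)
             (direct_sum (leaf_data.H1_del M \<pi> S \<psi> e)
               (quotient_rspace (leaf_data.\<MM>0 M \<pi> S \<psi> e) (leaf_data.Inn M \<pi> S))))"
proof -
  interpret leaf_geometry M \<pi> S \<psi> e by (rule leaf_geometry_tubular[OF assms])
  show ?thesis using zeta_surjective cohomology_decomposition ..
qed

end
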